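(* Let $$\mathscr C_{\mathrm{pf}}=\{\mu\in\mathscr C(\Gamma):\mu(X_n\text{ is path-forest})=1\text{ for every }n\ge1\}.$$ This is a proper exposed face of $\mathscr C(\Gamma)$, with exposing functional $$\mathscr D(\mu_L)=\sum_{m\ge3}2^{-m}\delta_m(L),\qquad \delta_m(L)=L(F_{C_m})-L(F_{C_m}F_\tau).$$ The barycentre map $$\mathsf B:\mathcal P(\nabla_\infty)\longrightarrow\mathscr C_{\mathrm{pf}},\qquad \mathsf B(\rho)=\int_{\nabla_\infty}\mu^p\,\rho(dp),$$ is an affine homeomorphism, so the face is a Bauer simplex with extreme points $\mu^p$, $p\in\nabla_\infty$. These laws $\mu^p$ are also extreme in $\mathscr C(\Gamma)$.
   Context: Rooted trees are finite, unlabelled and non-plane (considered up to root-preserving isomorphism). $\mathcal T_n$ is the set of those with $n$ vertices, $\mathcal T=\bigsqcup_{n\ge1}\mathcal T_n$; $V(t)$ is the vertex set of (a representative of) $t$. $\bullet$ is the one-vertex tree, $C_m$ is the chain (path rooted at an end) with $m$ vertices, and $\tau=C_2$. The real Grossman--Larson algebra $\mathcal G$ has basis $(F_t)_{t\in\mathcal T}$ and product $F_sF_t=\sum_{f:\{1,\dots,k\}\to V(t)}F_{t\circ_f(s_1,\dots,s_k)}$, where $s_1,\dots,s_k$ are the root branches of $s$ (the trees left after deleting the root of $s$, rooted at the children of that root, treated as distinct occurrences) and $t\circ_f(s_1,\dots,s_k)$ is the tree, with the root of $t$ as root, obtained by joining the root of each $s_i$ by an edge to $f(i)$. It is associative with unit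 $F_\bullet$. A left Pieri state is a linear functional $L:\mathcal G\to\mathbb R$ with $L(F_\bullet)=1$, $L(F_t)\ge0$ for all $t\in\mathcal T$, and $L(F_\tau x)=L(x)$ for all $x\in\mathcal G$. A tree is path-forest if every non-root vertex has at most one child. For an integer partition $\lambda$, $P_\lambda$ is the path-forest tree whose root branches are chains with $\lambda_1,\lambda_2,\dots$ vertices. $\Lambda=\mathbb R[\mathsf p_1,\mathsf p_2,\dots]$ is the algebra of symmetric functions ($\mathsf p_k$ the power sums), $m_\lambda$ the monomial symmetric function, $\widetilde m_\lambda=\big(\prod_{j\ge1}r_j(\lambda)!\big)m_\lambda$ with $r_j(\lambda)$ the multiplicity of the part $j$. $\nabla_\infty=\{p_1\ge p_2\ge\cdots\ge0:\sum_ip_i\le1\}$ with the product topology; $\mathcal P(E)$ is the space of Borel probability measures on $E$ with the weak topology. For $p\in\nabla_\infty$, $\chi_p:\Lambda\to\mathbb R$ is the unital algebra homomorphism with $\chi_p(\mathsf p_1)=1$, $\chi_p(\mathsf p_k)=\sum_ip_i^k$ ($k\ge2$), and $\psi_p:\mathcal G\to\mathbb R$ is the linear functional with $\psi_p(F_{P_\lambda})=\chi_p(\widetilde m_\lambda)$ and $\psi_p(F_t)=0$ for $t$ not path-forest; it is a left Pieri state. For trees $s,t$, $n(s;t)$ is the number of $v\in V(s)$ such that attaching a new leaf at $v$ yields $t$. The Hoffman graph $\Gamma$ has vertex set $\mathcal T$ and $n(s;t)$ edge copies from $s$ to $t$; $u(t)$ is the number of paths of edge copies from $\bullet$ to $t$.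 $\mathcal X_\Gamma$ is the space of infinite paths $(e_n)_{n\ge1}$ of edge copies starting at $\bullet$ ($e_n$ going from $\mathcal T_n$ to $\mathcal T_{n+1}$), a closed subspace of a product of finite discrete sets; $X_n\in\mathcal T_n$ is the $n$-th vertex of the path; $C_\gamma$ is the cylinder of paths with finite prefix $\gamma$ starting at $\bullet$. A Borel probability measure $\mu$ on $\mathcal X_\Gamma$ is central if $\mu(C_\gamma)=\mu(X_n=t)/u(t)$ for every prefix $\gamma$ ending at $t\in\mathcal T_n$. $\mathscr C(\Gamma)$ is the compact convex set of central measures with the weak topology. The map $L\mapsto\mu_L$, $\mu_L(C_\gamma)=L(F_t)$ for $\gamma$ ending at $t$, is an affine homeomorphism from left Pieri states (with pointwise convergence on the tree basis) onto $\mathscr C(\Gamma)$. Put $\mu^p=\mu_{\psi_p}$. An exposed face of a compact convex set is the set of minimizers of a continuous affine functional (the exposing functional). A Bauer simplex is a compact convex set whose extreme points form a closed set and each of whose points is the barycentre of a unique probability measure on that set. *)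

theory Defs
  imports "HOL-Probability.Probability" "HOL-Analysis.Finite_Function_Topology"
begin

subsection \<open>Rooted trees\<close>

text \<open>A finite unlabelled non-plane rooted tree is the multiset of its root branches.\<close>

datatype rtree = Node (branches: "rtree multiset")

definition bullet :: rtree where
  "bullet = Node {#}"

text \<open>Only meant for \<open>m \<ge> 1\<close>.\<close>

definition chain :: "nat \<Rightarrow> rtree" where
  "chain m = ((\<lambda>t. Node {#t#}) ^^ (m - 1)) bullet"

definition tau :: rtree where
  "tau = chain 2"

text \<open>
  Vertices only exist in a representative of a tree. As representatives we use plane trees, whose
  vertices are addressed by the list of child positions along the path from the root (so the root
  is \<open>[]\<close>).
\<close>

datatype ptree = PNode "ptree list"

primrec shape :: "ptree \<Rightarrow> rtree" where
  "shape (PNode ts) = Node (mset (map shape ts))"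

lemma size_nth_less [termination_simp]: "i < length ts \<Longrightarrow> size (ts ! i) < Suc (size_list size ts)"
  by (metis less_Suc_eq_le nth_mem order_refl size_list_estimation')

fun pverts :: "ptree \<Rightarrow> nat list set" where
  "pverts (PNode ts) = insert [] (\<Union>i<length ts. (#) i ` pverts (ts ! i))"

definition plane :: "rtree \<Rightarrow> ptree" where
  "plane t = (SOME p. shape p = t)"

definition verts :: "rtree \<Rightarrow> nat list set" where
  "verts t = pverts (plane t)"

definition trees :: "nat \<Rightarrow> rtree set" where
  "trees n = {t. card (verts t) = n}"

text \<open>\<open>pgraft p g\<close> joins, for every vertex \<open>v\<close>, the roots of all trees in \<open>g v\<close> to \<open>v\<close>.\<close>

fun pgraft :: "ptree \<Rightarrow> (nat list \<Rightarrow> rtree multiset) \<Rightarrow> rtree" where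
  "pgraft (PNode ts) g =
     Node (mset (map (\<lambda>i. pgraft (ts ! i) (\<lambda>v. g (i # v))) [0..<length ts]) + g [])"

definition graft :: "rtree \<Rightarrow> (nat list \<Rightarrow> rtree multiset) \<Rightarrow> rtree" where
  "graft t g = pgraft (plane t) g"

text \<open>The tree \<open>t \<circ>\<^sub>f (s\<^sub>1, \<dots>, s\<^sub>k)\<close>, with the trees indexed from \<open>0\<close>.\<close>

definition graft_along :: "rtree \<Rightarrow> rtree list \<Rightarrow> (nat \<Rightarrow> nat list) \<Rightarrow> rtree" where
  "graft_along t ss f = graft t (\<lambda>v. mset (map ((!) ss) (filter (\<lambda>i. f i = v) [0..<length ss])))"

text \<open>The root branches as distinct occurrences, in some order.\<close>

definition branch_list :: "rtree \<Rightarrow> rtree list" where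
  "branch_list s = (SOME ss. mset ss = branches s)"

lemma ex_shape: "\<exists>p. shape p = t"
proof (induction t)
  case (Node M)
  obtain ts where ts: "mset ts = M" using ex_mset by blast
  have "\<exists>ps. map shape ps = ts"
    using Node ts by (metis ex_map_conv in_multiset_in_set)
  then obtain ps where "map shape ps = ts" by blast
  then have "shape (PNode ps) = Node M" using ts by simp
  then show ?case by blast
qed

lemma shape_plane [simp]: "shape (plane t) = t"
  unfolding plane_def using ex_shape by (rule someI_ex)

lemma mset_branch_list [simp]: "mset (branch_list s) = branches s"
  unfolding branch_list_def using ex_mset by (rule someI_ex)

lemma finite_verts [simp]: "finite (verts t)"
proof -
  have "finite (pverts p)" for p
    by (induction p) auto
  then show ?thesis by (simp add: verts_def)
qed

lemma Nil_in_verts [simp]: "[] \<in> verts t"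
  by (cases "plane t") (simp add: verts_def)

lemma graft_nothing: "graft t (\<lambda>_. {#}) = t"
proof -
  have "pgraft p (\<lambda>_. {#}) = shape p" for p
  proof (induction p)
    case (PNode ts)
    have "map (\<lambda>i. pgraft (ts ! i) (\<lambda>_. {#})) [0..<length ts] = map shape ts"
      using PNode by (intro nth_equalityI) auto
    then show ?case by (auto simp del: mset_map)
  qed
  then show ?thesis by (simp add: graft_def)
qed

definition path_forest :: "rtree \<Rightarrow> bool" where
  "path_forest t \<longleftrightarrow> (\<forall>v\<in>verts t. v \<noteq> [] \<longrightarrow> card {w \<in> verts t. \<exists>i. w = v @ [i]} \<le> 1)"

text \<open>Integer partitions are finite multisets of positive integers.\<close>

definition int_partition :: "nat multiset \<Rightarrow> bool" where
  "int_partition l \<longleftrightarrow> 0 \<notin># l"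

definition path_forest_tree :: "nat multiset \<Rightarrow> rtree" where
  "path_forest_tree l = Node (image_mset chain l)"


subsection \<open>The Grossman--Larson algebra and left Pieri states\<close>

text \<open>
  The underlying vector space consists of the finitely supported functions on trees. The ring
  multiplication of \<open>\<Rightarrow>\<^sub>0\<close> is not used.
\<close>

type_synonym gl = "rtree \<Rightarrow>\<^sub>0 real"

definition basis_F :: "rtree \<Rightarrow> gl" where
  "basis_F t = Poly_Mapping.single t 1"

definition gl_basis_mult :: "rtree \<Rightarrow> rtree \<Rightarrow> gl" where
  "gl_basis_mult s t =
     (\<Sum>f\<in>{..<length (branch_list s)} \<rightarrow>\<^sub>E verts t. basis_F (graft_along t (branch_list s) f))"

definition gl_mult :: "gl \<Rightarrow> gl \<Rightarrow> gl" (infixl \<open>\<star>\<close> 70) where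
  "x \<star> y = (\<Sum>s\<in>Poly_Mapping.keys x. \<Sum>t\<in>Poly_Mapping.keys y.
     (Poly_Mapping.lookup x s * Poly_Mapping.lookup y t) *\<^sub>R gl_basis_mult s t)"

definition left_pieri_state :: "(gl \<Rightarrow> real) \<Rightarrow> bool" where
  "left_pieri_state L \<longleftrightarrow>
     linear L \<and> L (basis_F bullet) = 1 \<and> (\<forall>t. 0 \<le> L (basis_F t)) \<and> (\<forall>x. L (basis_F tau \<star> x) = L x)"


subsection \<open>Symmetric functions\<close>

text \<open>
  A monomial \<open>\<Prod>\<^sub>i x\<^sub>i ^ a\<^sub>i\<close> in the variables \<open>x\<^sub>0, x\<^sub>1, \<dots>\<close> is encoded as the multiset in which \<open>i\<close>
  occurs \<open>a\<^sub>i\<close> times, and a formal power series as the function giving its coefficients. The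
  product of monomials is then the sum of multisets. \<open>Lambda\<close> is the algebra of symmetric series of
  bounded degree.
\<close>

type_synonym series = "nat multiset \<Rightarrow> real"

definition series_mult :: "series \<Rightarrow> series \<Rightarrow> series" where
  "series_mult f g = (\<lambda>M. \<Sum>A | A \<subseteq># M. f A * g (M - A))"

definition Lambda :: "series set" where
  "Lambda = {f. (\<forall>\<pi>. bij \<pi> \<longrightarrow> (\<forall>M. f (image_mset \<pi> M) = f M)) \<and>
                (\<exists>d. \<forall>M. f M \<noteq> 0 \<longrightarrow> size M \<le> d)}"

definition power_sum :: "nat \<Rightarrow> series" where
  "power_sum k = (\<lambda>M. of_bool (\<exists>i. M = replicate_mset k i))"

definition exponents :: "nat multiset \<Rightarrow> nat multiset" where
  "exponents M = image_mset (count M) (mset_set (set_mset M))"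

definition monomial_sf :: "nat multiset \<Rightarrow> series" where
  "monomial_sf l = (\<lambda>M. of_bool (exponents M = l))"

definition augmented_monomial_sf :: "nat multiset \<Rightarrow> series" where
  "augmented_monomial_sf l = (\<lambda>M. (\<Prod>j\<in>set_mset l. fact (count l j)) * monomial_sf l M)"

definition unital_algebra_hom :: "(series \<Rightarrow> real) \<Rightarrow> bool" where
  "unital_algebra_hom \<phi> \<longleftrightarrow>
     \<phi> (\<lambda>M. of_bool (M = {#})) = 1 \<and>
     (\<forall>f\<in>Lambda. \<forall>g\<in>Lambda. \<phi> (\<lambda>M. f M + g M) = \<phi> f + \<phi> g) \<and>
     (\<forall>c. \<forall>f\<in>Lambda. \<phi> (\<lambda>M. c * f M) = c * \<phi> f) \<and>
     (\<forall>f\<in>Lambda. \<forall>g\<in>Lambda. \<phi> (series_mult f g) = \<phi> f * \<phi> g)"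

text \<open>Sequences are indexed from \<open>0\<close>; the topology of \<open>nat \<Rightarrow> real\<close> is the product topology.\<close>

definition nabla :: "(nat \<Rightarrow> real) set" where
  "nabla = {p. (\<forall>i. p (Suc i) \<le> p i) \<and> (\<forall>i. 0 \<le> p i) \<and> summable p \<and> suminf p \<le> 1}"

definition chi :: "(nat \<Rightarrow> real) \<Rightarrow> series \<Rightarrow> real" where
  "chi p = (THE \<phi>. \<phi> \<in> extensional Lambda \<and> unital_algebra_hom \<phi> \<and>
     \<phi> (power_sum 1) = 1 \<and> (\<forall>k\<ge>2. \<phi> (power_sum k) = suminf (\<lambda>i. p i ^ k)))"

definition psi_basis :: "(nat \<Rightarrow> real) \<Rightarrow> rtree \<Rightarrow> real" where
  "psi_basis p t =
     (if path_forest t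
      then chi p (augmented_monomial_sf (THE l. int_partition l \<and> path_forest_tree l = t))
      else 0)"

definition psi :: "(nat \<Rightarrow> real) \<Rightarrow> gl \<Rightarrow> real" where
  "psi p x = (\<Sum>t\<in>Poly_Mapping.keys x. Poly_Mapping.lookup x t * psi_basis p t)"


subsection \<open>Spaces of probability measures\<close>

definition borel_on :: "'a topology \<Rightarrow> 'a measure" where
  "borel_on X = sigma (topspace X) {U. openin X U}"

definition prob_measures :: "'a topology \<Rightarrow> 'a measure set" where
  "prob_measures X = {\<mu>. prob_space \<mu> \<and> sets \<mu> = sets (borel_on X)}"

definition weak_topology :: "'a topology \<Rightarrow> 'a measure topology" where
  "weak_topology X = topology_generated_by
     {{\<mu> \<in> prob_measures X. (\<integral>x. f x \<partial>\<mu>) \<in> U} | f U.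
        continuous_map X euclideanreal f \<and> bounded (f ` topspace X) \<and> open U}"

text \<open>The convex combination \<open>a \<mu> + (1 - a) \<nu>\<close> of two measures on the same measurable space.\<close>

definition mix :: "real \<Rightarrow> 'a measure \<Rightarrow> 'a measure \<Rightarrow> 'a measure" where
  "mix a \<mu> \<nu> = measure_of (space \<mu>) (sets \<mu>)
     (\<lambda>A. ennreal a * emeasure \<mu> A + ennreal (1 - a) * emeasure \<nu> A)"

definition convex_measures :: "'a measure set \<Rightarrow> bool" where
  "convex_measures K \<longleftrightarrow> (\<forall>\<mu>\<in>K. \<forall>\<nu>\<in>K. \<forall>a\<in>{0..1}. mix a \<mu> \<nu> \<in> K)"

definition affine_functional :: "'a measure set \<Rightarrow> ('a measure \<Rightarrow> real) \<Rightarrow> bool" where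
  "affine_functional K \<Phi> \<longleftrightarrow>
     (\<forall>\<mu>\<in>K. \<forall>\<nu>\<in>K. \<forall>a\<in>{0..1}. \<Phi> (mix a \<mu> \<nu>) = a * \<Phi> \<mu> + (1 - a) * \<Phi> \<nu>)"

definition affine_map :: "'a measure set \<Rightarrow> ('a measure \<Rightarrow> 'b measure) \<Rightarrow> bool" where
  "affine_map K \<Phi> \<longleftrightarrow>
     (\<forall>\<mu>\<in>K. \<forall>\<nu>\<in>K. \<forall>a\<in>{0..1}. \<Phi> (mix a \<mu> \<nu>) = mix a (\<Phi> \<mu>) (\<Phi> \<nu>))"

definition extreme_points :: "'a measure set \<Rightarrow> 'a measure set" where
  "extreme_points K =
     {\<mu> \<in> K. \<forall>\<nu>\<in>K. \<forall>\<kappa>\<in>K. \<forall>a\<in>{0<..<1}. \<mu> = mix a \<nu> \<kappa> \<longrightarrow> \<nu> = \<mu> \<and> \<kappa> = \<mu>}"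

text \<open>
  In the following definitions \<open>T\<close> is a topology on a set of measures, and the convex set under
  consideration is its underlying set \<open>topspace T\<close>.
\<close>

definition compact_convex :: "'a measure topology \<Rightarrow> bool" where
  "compact_convex T \<longleftrightarrow> compact_space T \<and> convex_measures (topspace T)"

definition cont_affine :: "'a measure topology \<Rightarrow> ('a measure \<Rightarrow> real) \<Rightarrow> bool" where
  "cont_affine T \<Phi> \<longleftrightarrow> continuous_map T euclideanreal \<Phi> \<and> affine_functional (topspace T) \<Phi>"

definition exposed_face_by ::
  "'a measure topology \<Rightarrow> 'a measure set \<Rightarrow> ('a measure \<Rightarrow> real) \<Rightarrow> bool" where
  "exposed_face_by T G \<Phi> \<longleftrightarrow> compact_convex T \<and> cont_affine T \<Phi> \<and>
     G = {\<mu> \<in> topspace T. \<forall>\<nu>\<in>topspace T. \<Phi> \<mu> \<le> \<Phi> \<nu>}"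

definition barycentre_of :: "'a measure topology \<Rightarrow> 'a measure measure \<Rightarrow> 'a measure \<Rightarrow> bool" where
  "barycentre_of T m \<mu> \<longleftrightarrow> \<mu> \<in> topspace T \<and> (\<forall>\<Phi>. cont_affine T \<Phi> \<longrightarrow> \<Phi> \<mu> = (\<integral>\<nu>. \<Phi> \<nu> \<partial>m))"

definition bauer_simplex :: "'a measure topology \<Rightarrow> bool" where
  "bauer_simplex T \<longleftrightarrow> compact_convex T \<and> closedin T (extreme_points (topspace T)) \<and>
     (\<forall>\<mu>\<in>topspace T.
        \<exists>!m. m \<in> prob_measures (subtopology T (extreme_points (topspace T))) \<and> barycentre_of T m \<mu>)"


subsection \<open>The Hoffman graph and its central measures\<close>

definition leaf_mult :: "rtree \<Rightarrow> rtree \<Rightarrow> nat" where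
  "leaf_mult s t = card {v \<in> verts s. graft s (\<lambda>w. if w = v then {#bullet#} else {#}) = t}"

text \<open>\<open>(s, t, j)\<close> with \<open>j < leaf_mult s t\<close> is the \<open>j\<close>-th copy of the edge from \<open>s\<close> to \<open>t\<close>.\<close>

type_synonym edge = "rtree \<times> rtree \<times> nat"

definition edges :: "edge set" where
  "edges = {(s, t, j). j < leaf_mult s t}"

abbreviation source :: "edge \<Rightarrow> rtree" where
  "source e \<equiv> fst e"

abbreviation target :: "edge \<Rightarrow> rtree" where
  "target e \<equiv> fst (snd e)"

fun is_path :: "rtree \<Rightarrow> edge list \<Rightarrow> rtree \<Rightarrow> bool" where
  "is_path s [] t \<longleftrightarrow> s = t"
| "is_path s (e # \<gamma>) t \<longleftrightarrow> e \<in> edges \<and> source e = s \<and> is_path (target e) \<gamma> t"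

definition num_paths :: "rtree \<Rightarrow> nat" where
  "num_paths t = card {\<gamma>. is_path bullet \<gamma> t}"

text \<open>
  Paths are indexed from \<open>0\<close>: \<open>\<omega> n\<close> is the edge \<open>e\<^sub>n\<^sub>+\<^sub>1\<close>, which leads from \<open>trees (n + 1)\<close> to
  \<open>trees (n + 2)\<close>. The vertices \<open>vertex_at n \<omega>\<close> are indexed by \<open>n \<ge> 1\<close>.
\<close>

definition inf_paths :: "(nat \<Rightarrow> edge) set" where
  "inf_paths = {\<omega>. source (\<omega> 0) = bullet \<and>
     (\<forall>n. \<omega> n \<in> edges \<and> target (\<omega> n) = source (\<omega> (Suc n)))}"

definition path_top :: "(nat \<Rightarrow> edge) topology" where
  "path_top = subtopology
     (product_topology (\<lambda>n. discrete_topology {e \<in> edges. source e \<in> trees (n + 1)}) UNIV) inf_paths"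

definition vertex_at :: "nat \<Rightarrow> (nat \<Rightarrow> edge) \<Rightarrow> rtree" where
  "vertex_at n \<omega> = source (\<omega> (n - 1))"

definition cylinder :: "edge list \<Rightarrow> (nat \<Rightarrow> edge) set" where
  "cylinder \<gamma> = {\<omega> \<in> inf_paths. \<forall>i<length \<gamma>. \<omega> i = \<gamma> ! i}"

definition central_measures :: "(nat \<Rightarrow> edge) measure set" where
  "central_measures = {\<mu> \<in> prob_measures path_top.
     \<forall>n\<ge>1. \<forall>t\<in>trees n. \<forall>\<gamma>. is_path bullet \<gamma> t \<longrightarrow>
       measure \<mu> (cylinder \<gamma>) = measure \<mu> {\<omega> \<in> inf_paths. vertex_at n \<omega> = t} / real (num_paths t)}"

definition central_top :: "(nat \<Rightarrow> edge) measure topology" where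
  "central_top = subtopology (weak_topology path_top) central_measures"

definition measure_of_state :: "(gl \<Rightarrow> real) \<Rightarrow> (nat \<Rightarrow> edge) measure" where
  "measure_of_state L = (THE \<mu>. \<mu> \<in> prob_measures path_top \<and>
     (\<forall>\<gamma> t. is_path bullet \<gamma> t \<longrightarrow> measure \<mu> (cylinder \<gamma>) = L (basis_F t)))"

text \<open>The inverse of the bijection \<open>L \<mapsto> \<mu>\<^sub>L\<close> from left Pieri states onto central measures.\<close>

definition state_of_measure :: "(nat \<Rightarrow> edge) measure \<Rightarrow> gl \<Rightarrow> real" where
  "state_of_measure = inv_into {L. left_pieri_state L} measure_of_state"

definition mu :: "(nat \<Rightarrow> real) \<Rightarrow> (nat \<Rightarrow> edge) measure" where
  "mu p = measure_of_state (psi p)"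


subsection \<open>The path-forest face\<close>

definition path_forest_measures :: "(nat \<Rightarrow> edge) measure set" where
  "path_forest_measures = {\<mu> \<in> central_measures.
     \<forall>n\<ge>1. measure \<mu> {\<omega> \<in> inf_paths. path_forest (vertex_at n \<omega>)} = 1}"

definition path_forest_top :: "(nat \<Rightarrow> edge) measure topology" where
  "path_forest_top = subtopology central_top path_forest_measures"

definition delta :: "nat \<Rightarrow> (gl \<Rightarrow> real) \<Rightarrow> real" where
  "delta m L = L (basis_F (chain m)) - L (basis_F (chain m) \<star> basis_F tau)"

definition face_functional :: "(nat \<Rightarrow> edge) measure \<Rightarrow> real" where
  "face_functional \<mu> = (\<Sum>\<^sub>\<infinity>m\<in>{3..}. (1 / 2 ^ m) * delta m (state_of_measure \<mu>))"

definition bary_map :: "(nat \<Rightarrow> real) measure \<Rightarrow> (nat \<Rightarrow> edge) measure" where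
  "bary_map \<rho> = \<rho> \<bind> mu"

end

theory Submission
  imports Defs
begin

text \<open>
  Left Pieri states correspond to harmonic functions on the Hoffman graph. The defect of the \<open>m\<close>-th
  chain is a sum of values of the state at one-branch trees that grow a chain of \<open>m - 1\<close> vertices
  non-linearly, hence nonnegative; every tree that is not a path forest is reached from such a tree, so
  all defects vanish iff the harmonic function is supported on path forests. On path forests
  harmonicity is Kingman's recursion for exchangeable partition functions. Such a function gives a
  probability weight on the words of length \<open>n\<close> over \<open>n\<close> letters; the letter frequencies are
  random points of \<open>nabla\<close>, and a weak limit of their laws represents the function. Uniqueness and
  bicontinuity come from the density of the functions \<open>p \<mapsto> chi p g\<close> in the continuous functions on the
  compact set \<open>nabla\<close> (Stone--Weierstrass). Extremality of the Dirac measures transfers through the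
  affine bijection \<open>bary_map\<close>, and from the face to all central measures by positivity.
\<close>

subsection \<open>Growing trees\<close>

text \<open>The defect compares two products: \<open>basis_F tau \<star> basis_F C\<close> grows a
  chain \<open>C\<close> with \<open>m\<close> vertices by a leaf anywhere,
  \<open>basis_F C \<star> basis_F tau\<close> only at its root or at its tip. For
  \<open>m = 2\<close> nothing else exists, so the defects start at 3; the weights
  \<open>1 / 2 ^ m\<close> secure uniform convergence. The obstacle on the simplex is dust: the
  coordinates may sum to less than 1 while \<open>chi p\<close> sends the first power sum to 1.
  Letter frequencies always sum to 1, and mass is lost only in the limit; power sums of degree at
  least 2 survive it because of \<open>p i \<le> 1 / (i + 1)\<close>. Words of length
  \<open>n\<close> use \<open>n\<close> letters, so that there are never more blocks than labels.
  The measures on paths and on the simplex come from one extension result for finite alphabets: a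
  point of the simplex is replaced by its roundings at all scales. Barycentres are tested against
  all continuous affine functionals, not only against values of states. This requires that such a
  functional on measures on the simplex integrates its values at point masses, which is shown for
  finite supports and then by rounding.\<close>

primrec grow :: "rtree \<Rightarrow> rtree multiset" where
  "grow (Node M) = add_mset (Node (add_mset bullet M))
     (\<Sum>\<^sub># (image_mset (\<lambda>c. image_mset (\<lambda>b. Node (add_mset b (M - {#c#}))) (grow c)) M))"

primrec nv :: "rtree \<Rightarrow> nat" where
  "nv (Node M) = Suc (\<Sum>\<^sub># (image_mset nv M))"

abbreviation leaf_at :: "nat list \<Rightarrow> nat list \<Rightarrow> rtree multiset" where
  "leaf_at v \<equiv> (\<lambda>w. if w = v then {#bullet#} else {#})"

lemma pgraft_nothing: "pgraft p (\<lambda>_. {#}) = shape p"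
proof (induction p)
  case (PNode ts)
  have "map (\<lambda>i. pgraft (ts ! i) (\<lambda>_. {#})) [0..<length ts] = map shape ts"
    using PNode by (intro nth_equalityI) auto
  then show ?case by (auto simp del: mset_map)
qed

lemma finite_pverts [simp]: "finite (pverts p)"
  by (induction p) auto

lemma mset_set_UN_disjoint:
  assumes "finite I" "\<And>i. i \<in> I \<Longrightarrow> finite (A i)" "\<And>i j. i \<in> I \<Longrightarrow> j \<in> I \<Longrightarrow> i \<noteq> j \<Longrightarrow> A i \<inter> A j = {}"
  shows "mset_set (\<Union>i\<in>I. A i) = (\<Sum>i\<in>I. mset_set (A i))"
  using assms
proof (induction I rule: finite_induct)
  case (insert i I)
  have "A i \<inter> (\<Union>j\<in>I. A j) = {}" using insert by (auto simp: disjoint_iff)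
  then show ?case using insert by (simp add: mset_set_Union)
qed auto

lemma sum_mset_mset_nth: "\<Sum>\<^sub># (image_mset f (mset xs)) = (\<Sum>i<length xs. f (xs ! i))"
  by (simp add: sum_mset_sum_list sum_list_sum_nth atLeast0LessThan flip: mset_map)

lemma image_mset_sum: "image_mset f (\<Sum>i\<in>I. A i) = (\<Sum>i\<in>I. image_mset f (A i))"
  by (induction I rule: infinite_finite_induct) auto

text \<open>A new leaf sits either at the root or inside one occurrence of a branch. This replaces
  vertex addresses in a chosen representative by a recursion on multisets of branches, with each
  tree counted as often as some vertex produces it.\<close>

lemma pgrow: "image_mset (\<lambda>v. pgraft p (leaf_at v)) (mset_set (pverts p)) = grow (shape p)"
proof (induction p)
  case (PNode ts)
  let ?S = "mset (map shape ts)"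
  let ?g = "\<lambda>v. pgraft (PNode ts) (leaf_at v)"
  have root: "?g [] = Node (add_mset bullet ?S)"
  proof -
    have "map (\<lambda>i. pgraft (ts ! i) (\<lambda>v. leaf_at [] (i # v))) [0..<length ts] = map shape ts"
      by (intro nth_equalityI) (auto simp: pgraft_nothing)
    then show ?thesis by (simp del: mset_map)
  qed
  have inner: "?g (i # v) = Node (add_mset (pgraft (ts ! i) (leaf_at v)) (?S - {#shape (ts ! i)#}))"
    if "i < length ts" for i v
  proof -
    have "map (\<lambda>j. pgraft (ts ! j) (\<lambda>w. leaf_at (i # v) (j # w))) [0..<length ts]
      = (map shape ts)[i := pgraft (ts ! i) (leaf_at v)]"
    proof (intro nth_equalityI)
      fix j assume "j < length (map (\<lambda>j. pgraft (ts ! j) (\<lambda>w. leaf_at (i # v) (j # w))) [0..<length ts])"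
      then show "map (\<lambda>j. pgraft (ts ! j) (\<lambda>w. leaf_at (i # v) (j # w))) [0..<length ts] ! j
          = (map shape ts)[i := pgraft (ts ! i) (leaf_at v)] ! j"
        by (cases "j = i") (auto simp: pgraft_nothing)
    qed simp
    then show ?thesis using that by (simp add: mset_update del: mset_map)
  qed
  have "mset_set (pverts (PNode ts)) = add_mset [] (\<Sum>i<length ts. mset_set ((#) i ` pverts (ts ! i)))"
    by (subst mset_set_UN_disjoint[symmetric]) (auto intro!: mset_set.insert)
  also have "\<dots> = add_mset [] (\<Sum>i<length ts. image_mset ((#) i) (mset_set (pverts (ts ! i))))"
    by (simp add: image_mset_mset_set inj_on_def)
  finally have V: "mset_set (pverts (PNode ts)) = add_mset [] (\<Sum>i<length ts. image_mset ((#) i) (mset_set (pverts (ts ! i))))" .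
  have "image_mset ?g (mset_set (pverts (PNode ts)))
    = add_mset (Node (add_mset bullet ?S)) (\<Sum>i<length ts. image_mset (\<lambda>v. ?g (i # v)) (mset_set (pverts (ts ! i))))"
    unfolding V image_mset_add_mset image_mset_sum root multiset.map_comp comp_def ..
  also have "(\<Sum>i<length ts. image_mset (\<lambda>v. ?g (i # v)) (mset_set (pverts (ts ! i))))
     = (\<Sum>i<length ts. image_mset (\<lambda>b. Node (add_mset b (?S - {#shape (ts ! i)#}))) (grow (shape (ts ! i))))"
  proof (intro sum.cong refl)
    fix i assume i: "i \<in> {..<length ts}"
    then have "grow (shape (ts ! i)) = image_mset (\<lambda>v. pgraft (ts ! i) (leaf_at v)) (mset_set (pverts (ts ! i)))"
      using PNode by simp
    then show "image_mset (\<lambda>v. ?g (i # v)) (mset_set (pverts (ts ! i)))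
      = image_mset (\<lambda>b. Node (add_mset b (?S - {#shape (ts ! i)#}))) (grow (shape (ts ! i)))"
      using i by (simp add: inner multiset.map_comp comp_def del: pgraft.simps)
  qed
  also have "\<dots> = \<Sum>\<^sub># (image_mset (\<lambda>c. image_mset (\<lambda>b. Node (add_mset b (?S - {#c#}))) (grow c)) ?S)"
    by (simp only: sum_mset_mset_nth) simp
  finally show ?case by simp
qed

lemma grow_verts: "grow t = image_mset (\<lambda>v. graft t (leaf_at v)) (mset_set (verts t))"
  using pgrow[of "plane t"] by (simp add: graft_def verts_def)

lemma sum_verts_grow: "(\<Sum>v\<in>verts t. h (graft t (leaf_at v))) = (\<Sum>b\<in>#grow t. h b)"
  by (simp add: grow_verts sum_unfold_sum_mset multiset.map_comp comp_def)

text \<open>Edge copies of the Hoffman graph become occurrences in \<open>grow s\<close>, so sums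
  over edges become multiset sums.\<close>

lemma leaf_mult_count: "leaf_mult s t = count (grow s) t"
proof -
  have "{v \<in> verts s. graft s (leaf_at v) = t} = (\<lambda>v. graft s (leaf_at v)) -` {t} \<inter> verts s"
    by auto
  moreover have "sum (count (mset_set (verts s))) A = card A" if "A \<subseteq> verts s" for A
    using sum.cong[of A A "count (mset_set (verts s))" "\<lambda>_. 1"] that by (auto simp: subset_iff)
  ultimately show ?thesis
    by (simp add: leaf_mult_def grow_verts count_image_mset)
qed

lemma card_pverts: "card (pverts p) = nv (shape p)"
proof (induction p)
  case (PNode ts)
  have "card (pverts (PNode ts)) = Suc (card (\<Union>i<length ts. (#) i ` pverts (ts ! i)))"
    by (simp, intro card_insert_disjoint) auto
  also have "card (\<Union>i<length ts. (#) i ` pverts (ts ! i)) = (\<Sum>i<length ts. card ((#) i ` pverts (ts ! i)))"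
    by (intro card_UN_disjoint) auto
  also have "\<dots> = (\<Sum>i<length ts. nv (shape (ts ! i)))"
    using PNode by (intro sum.cong) (auto simp: card_image inj_on_def)
  also have "\<dots> = \<Sum>\<^sub># (image_mset nv (mset (map shape ts)))"
    by (simp only: sum_mset_mset_nth) simp
  finally show ?case by simp
qed

lemma card_verts: "card (verts t) = nv t"
  by (simp add: verts_def card_pverts)

lemma trees_iff: "t \<in> trees n \<longleftrightarrow> nv t = n"
  by (simp add: trees_def card_verts)

lemma nv_bullet [simp]: "nv bullet = 1" by (simp add: bullet_def)

lemma nv_pos: "nv t \<ge> 1" by (cases t) simp

lemma size_grow: "size (grow t) = nv t"
  by (simp add: grow_verts card_verts)

lemma nv_grow: "b \<in># grow t \<Longrightarrow> nv b = Suc (nv t)"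
proof (induction t arbitrary: b)
  case (Node M)
  from Node.prems consider "b = Node (add_mset bullet M)"
    | c d where "c \<in># M" "d \<in># grow c" "b = Node (add_mset d (M - {#c#}))"
    by auto
  then show ?case
  proof cases
    case 2
    then have "nv d = Suc (nv c)" using Node.IH by blast
    moreover obtain M' where "M = add_mset c M'" using 2(1) by (metis multi_member_split)
    ultimately show ?thesis using 2 by simp
  qed simp
qed

definition reach :: "rtree \<Rightarrow> rtree \<Rightarrow> bool" where
  "reach = (\<lambda>s t. t \<in># grow s)\<^sup>*\<^sup>*"

lemma reach_refl [simp]: "reach t t" by (simp add: reach_def)

lemma reach_trans: "reach r s \<Longrightarrow> reach s t \<Longrightarrow> reach r t"
  unfolding reach_def by (rule rtranclp_trans)

lemma reach_step: "reach r s \<Longrightarrow> t \<in># grow s \<Longrightarrow> reach r t"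
  unfolding reach_def by (rule rtranclp.rtrancl_into_rtrancl)

lemma grow_branch: "d \<in># grow c \<Longrightarrow> Node (add_mset d N) \<in># grow (Node (add_mset c N))"
  by auto

lemma reach_branch: "reach c d \<Longrightarrow> reach (Node (add_mset c N)) (Node (add_mset d N))"
  unfolding reach_def
proof (induction rule: rtranclp_induct)
  case (step y z)
  then show ?case using grow_branch rtranclp.rtrancl_into_rtrancl by (metis (no_types, lifting))
qed auto

text \<open>Induction over the branches: a new leaf at the root is the seed of the next branch,
  which then grows in place by \<open>reach_branch\<close>.\<close>

lemma reach_bullet: "reach bullet t"
proof (induction t)
  case (Node M)
  then show ?case
  proof (induction M)
    case empty
    then show ?case by (simp add: bullet_def)
  next
    case (add c M)
    have "reach bullet (Node M)" using add by simp
    then have "reach bullet (Node (add_mset bullet M))" by (rule reach_step) simp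
    moreover have "reach (Node (add_mset bullet M)) (Node (add_mset c M))"
      using add.prems by (intro reach_branch) simp
    ultimately show ?case by (rule reach_trans)
  qed
qed

text \<open>Branches can be added without touching the present ones. With a single bad branch as
  \<open>N\<close>, every tree containing that branch is reached.\<close>

lemma reach_union: "reach (Node N) (Node (N + M))"
proof (induction M)
  case (add c M)
  have "reach (Node N) (Node (add_mset bullet (N + M)))" by (rule reach_step[OF add]) simp
  then show ?case using reach_trans reach_branch[OF reach_bullet] by fastforce
qed simp

subsection \<open>Chains and path forests\<close>

lemma chain_1 [simp]: "chain (Suc 0) = bullet" by (simp add: chain_def)

lemma chain_Suc_Suc: "chain (Suc (Suc m)) = Node {#chain (Suc m)#}"
  by (simp add: chain_def)

lemma tau_eq: "tau = Node {#bullet#}"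
  by (simp add: tau_def numeral_2_eq_2 chain_Suc_Suc)

text \<open>\<open>chain 0\<close> and \<open>chain 1\<close> are the same tree; the index
  \<open>Suc m\<close> gives each linear tree exactly one index.\<close>

definition linear_tree :: "rtree \<Rightarrow> bool" where
  "linear_tree b \<longleftrightarrow> (\<exists>m. b = chain (Suc m))"

lemma linear_tree_chain [simp]: "linear_tree (chain (Suc m))" by (auto simp: linear_tree_def)

lemma linear_tree_Node: "linear_tree (Node M) \<longleftrightarrow> M = {#} \<or> (\<exists>c. M = {#c#} \<and> linear_tree c)"
proof
  assume "linear_tree (Node M)"
  then obtain m where "Node M = chain (Suc m)" by (auto simp: linear_tree_def)
  then show "M = {#} \<or> (\<exists>c. M = {#c#} \<and> linear_tree c)"
    by (cases m) (auto simp: bullet_def chain_Suc_Suc)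
next
  assume "M = {#} \<or> (\<exists>c. M = {#c#} \<and> linear_tree c)"
  then show "linear_tree (Node M)"
    by (metis chain_1 bullet_def chain_Suc_Suc linear_tree_def)
qed

lemma nv_chain [simp]: "nv (chain (Suc m)) = Suc m"
  by (induction m) (auto simp: chain_Suc_Suc)

lemma children_pverts:
  "{w \<in> pverts (PNode ts). \<exists>j. w = [] @ [j]} = (\<lambda>i. [i]) ` {..<length ts}"
  "i < length ts \<Longrightarrow> {w \<in> pverts (PNode ts). \<exists>j. w = (i # v) @ [j]} = (#) i ` {w \<in> pverts (ts ! i). \<exists>j. w = v @ [j]}"
proof -
  have "[] \<in> pverts p" for p by (cases p) auto
  then show "{w \<in> pverts (PNode ts). \<exists>j. w = [] @ [j]} = (\<lambda>i. [i]) ` {..<length ts}"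
    by auto
qed auto

text \<open>The children of an address in branch \<open>i\<close> are the prefixed children inside
  that branch, so the condition splits into one at the root and one on each branch. Unlike in
  \<open>path_forest\<close>, the root is not exempt.\<close>

lemma linear_tree_shape:
  "linear_tree (shape p) \<longleftrightarrow> (\<forall>v\<in>pverts p. card {w \<in> pverts p. \<exists>i. w = v @ [i]} \<le> 1)"
proof (induction p)
  case (PNode ts)
  have "(\<forall>v\<in>pverts (PNode ts). card {w \<in> pverts (PNode ts). \<exists>i. w = v @ [i]} \<le> 1)
    \<longleftrightarrow> card {w \<in> pverts (PNode ts). \<exists>i. w = [] @ [i]} \<le> 1 \<and>
      (\<forall>i<length ts. \<forall>v\<in>pverts (ts ! i). card {w \<in> pverts (PNode ts). \<exists>j. w = (i # v) @ [j]} \<le> 1)"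
    by (simp del: append.simps) auto
  also have "\<dots> \<longleftrightarrow> length ts \<le> 1 \<and> (\<forall>i<length ts. linear_tree (shape (ts ! i)))"
    using PNode[OF nth_mem] by (simp add: children_pverts card_image inj_on_def del: pverts.simps append.simps)
  also have "\<dots> \<longleftrightarrow> linear_tree (shape (PNode ts))"
  proof (cases ts)
    case (Cons a us)
    then show ?thesis by (cases us) (auto simp: linear_tree_Node nth_Cons')
  qed (auto simp: linear_tree_Node)
  finally show ?case by (rule sym)
qed

text \<open>Dropping the condition at the root from the criterion for linear trees leaves linearity
  of each root branch.\<close>

lemma path_forest_iff: "path_forest t \<longleftrightarrow> (\<forall>b\<in>#branches t. linear_tree b)"
proof -
  obtain ts where ts: "plane t = PNode ts" by (cases "plane t")
  then have t: "branches t = mset (map shape ts)" by (metis shape.simps shape_plane rtree.sel)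
  have "path_forest t \<longleftrightarrow> (\<forall>i<length ts. \<forall>v\<in>pverts (ts ! i). card {w \<in> pverts (PNode ts). \<exists>j. w = (i # v) @ [j]} \<le> 1)"
    unfolding path_forest_def verts_def ts by (simp del: append.simps) auto
  also have "\<dots> \<longleftrightarrow> (\<forall>i<length ts. linear_tree (shape (ts ! i)))"
    by (simp add: linear_tree_shape children_pverts card_image inj_on_def del: pverts.simps append.simps)
  also have "\<dots> \<longleftrightarrow> (\<forall>b\<in>#branches t. linear_tree b)"
    by (auto simp: t all_set_conv_all_nth)
  finally show ?thesis .
qed

text \<open>The vertex counts of the branches recover the partition. Hence
  \<open>path_forest_tree\<close> is injective and the definite description in
  \<open>psi_basis\<close> is meaningful.\<close>

lemma nv_image_chain: "int_partition l \<Longrightarrow> image_mset nv (image_mset chain l) = l"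
proof (induction l)
  case (add j l)
  then obtain i where "j = Suc i" by (cases j) (auto simp: int_partition_def)
  with add show ?case by (auto simp: int_partition_def)
qed simp

lemma path_forest_tree_inj:
  "int_partition l \<Longrightarrow> int_partition l' \<Longrightarrow> path_forest_tree l = path_forest_tree l' \<Longrightarrow> l = l'"
  by (metis nv_image_chain path_forest_tree_def rtree.inject)

lemma the_partition: "int_partition l \<Longrightarrow> (THE l'. int_partition l' \<and> path_forest_tree l' = path_forest_tree l) = l"
  by (intro the_equality) (auto intro: path_forest_tree_inj)

lemma path_forest_path_forest_tree: "int_partition l \<Longrightarrow> path_forest (path_forest_tree l)"
  unfolding path_forest_iff path_forest_tree_def int_partition_def
  by (auto simp: linear_tree_def gr0_conv_Suc) (metis not0_implies_Suc)

lemma path_forest_obtain: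
  assumes "path_forest t" obtains l where "int_partition l" "t = path_forest_tree l"
proof
  show "int_partition (image_mset nv (branches t))"
    by (auto simp: int_partition_def) (metis nv_pos not_one_le_zero)
  have "image_mset chain (image_mset nv (branches t)) = branches t"
    using assms unfolding path_forest_iff multiset.map_comp
    by (intro trans[OF image_mset_cong multiset.map_ident]) (auto simp: linear_tree_def)
  then show "t = path_forest_tree (image_mset nv (branches t))"
    by (metis path_forest_tree_def rtree.collapse)
qed

lemma grow_Node1: "grow (Node {#c#}) = add_mset (Node {#bullet, c#}) (image_mset (\<lambda>b. Node {#b#}) (grow c))"
  by simp

text \<open>Only a leaf at the deepest vertex prolongs the chain; at any other vertex it creates a
  second child. The remainder \<open>R\<close> of non-linear trees is what the defects
  measure.\<close>

lemma grow_chain: "\<exists>R. grow (chain (Suc m)) = add_mset (chain (Suc (Suc m))) R \<and> (\<forall>b\<in>#R. \<not> linear_tree b)"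
proof (induction m)
  case 0
  show ?case by (simp add: bullet_def chain_Suc_Suc)
next
  case (Suc m)
  then obtain R where "grow (chain (Suc m)) = add_mset (chain (Suc (Suc m))) R" "\<forall>b\<in>#R. \<not> linear_tree b" by blast
  then show ?case
    by (intro exI[of _ "add_mset (Node {#bullet, chain (Suc m)#}) (image_mset (\<lambda>b. Node {#b#}) R)"])
       (auto simp: chain_Suc_Suc linear_tree_Node)
qed

lemma sum_grow_chain:
  fixes h :: "rtree \<Rightarrow> real"
  assumes "\<And>b. \<not> linear_tree b \<Longrightarrow> h b = 0"
  shows "(\<Sum>b\<in>#grow (chain (Suc m)). h b) = h (chain (Suc (Suc m)))"
proof -
  obtain R where R: "grow (chain (Suc m)) = add_mset (chain (Suc (Suc m))) R" "\<forall>b\<in>#R. \<not> linear_tree b"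
    using grow_chain by blast
  then have "image_mset h R = image_mset (\<lambda>_. 0) R" using assms by (intro image_mset_cong) auto
  then show ?thesis by (simp add: R)
qed

lemma sum_mset_sum_mset:
  fixes h :: "'a \<Rightarrow> 'b::comm_monoid_add"
  shows "(\<Sum>x\<in>#(\<Sum>\<^sub># MM). h x) = (\<Sum>M\<in>#MM. \<Sum>x\<in>#M. h x)"
  by (induction MM) auto

text \<open>Kingman's recursion in tree form: a leaf at the root adds a part 1, a leaf at the tip of
  a chain lengthens a part, and every other growth leaves the path forests, where \<open>h\<close>
  vanishes.\<close>

lemma sum_grow_path_forest:
  fixes h :: "rtree \<Rightarrow> real"
  assumes l: "int_partition l" and h: "\<And>b. \<not> path_forest b \<Longrightarrow> h b = 0"
  shows "(\<Sum>b\<in>#grow (path_forest_tree l). h b) =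
    h (path_forest_tree (add_mset 1 l)) + (\<Sum>j\<in>#l. h (path_forest_tree (add_mset (Suc j) (l - {#j#}))))"
proof -
  let ?M = "image_mset chain l"
  have "(\<Sum>b\<in>#grow (path_forest_tree l). h b) = h (Node (add_mset bullet ?M))
     + (\<Sum>c\<in>#?M. \<Sum>b\<in>#grow c. h (Node (add_mset b (?M - {#c#}))))"
    by (simp add: path_forest_tree_def sum_mset_sum_mset multiset.map_comp comp_def)
  also have "(\<Sum>c\<in>#?M. \<Sum>b\<in>#grow c. h (Node (add_mset b (?M - {#c#}))))
    = (\<Sum>j\<in>#l. \<Sum>b\<in>#grow (chain j). h (Node (add_mset b (?M - {#chain j#}))))"
    by (simp add: multiset.map_comp comp_def)
  also have "\<dots> = (\<Sum>j\<in>#l. h (path_forest_tree (add_mset (Suc j) (l - {#j#}))))"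
  proof (intro arg_cong[where f = sum_mset] image_mset_cong)
    fix j assume j: "j \<in># l"
    then obtain i where i: "j = Suc i" using l by (cases j) (auto simp: int_partition_def)
    have "?M - {#chain j#} = image_mset chain (l - {#j#})"
      using j by (simp add: image_mset_Diff)
    then show "(\<Sum>b\<in>#grow (chain j). h (Node (add_mset b (?M - {#chain j#})))) = h (path_forest_tree (add_mset (Suc j) (l - {#j#})))"
      unfolding i by (subst sum_grow_chain) (auto simp: path_forest_tree_def path_forest_iff intro!: h)
  qed
  finally show ?thesis by (simp add: path_forest_tree_def)
qed

text \<open>Growth never removes a second child: a tree that grows into a linear tree is itself
  linear.\<close>

lemma not_path_forest_grow:
  assumes "\<not> path_forest t" "b \<in># grow t" shows "\<not> path_forest b"
proof -
  obtain M where t: "t = Node M" by (cases t)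
  have lin: "linear_tree c" if "d \<in># grow c" "linear_tree d" for c d
    using that
  proof (induction c arbitrary: d)
    case (Node N)
    then show ?case
      by (fastforce simp: linear_tree_Node add_mset_eq_single dest: multi_member_split)
  qed
  obtain c where c: "c \<in># M" "\<not> linear_tree c" using assms by (auto simp: path_forest_iff t)
  from assms(2) consider "b = Node (add_mset bullet M)"
    | e d where "e \<in># M" "d \<in># grow e" "b = Node (add_mset d (M - {#e#}))"
    by (auto simp: t)
  then show ?thesis
  proof cases
    case 1
    then show ?thesis using c by (auto simp: path_forest_iff)
  next
    case 2
    show ?thesis
    proof (cases "e = c")
      case True
      then show ?thesis using 2 c lin by (auto simp: path_forest_iff)
    next
      case False
      then have "c \<in># M - {#e#}" using c by (simp add: in_diff_count)
      then show ?thesis using 2 c by (auto simp: path_forest_iff)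
    qed
  qed
qed

text \<open>On a growth path from \<open>bullet\<close> to \<open>t\<close>, the first step out of
  the path forests makes a linear branch non-linear. That branch alone under a root is a term of
  some chain defect, and adding the other branches leads on to \<open>t\<close>.\<close>

lemma not_path_forest_reach:
  assumes "\<not> path_forest t"
  obtains m b where "b \<in># grow (chain (Suc m))" "\<not> linear_tree b" "reach (Node {#b#}) t"
proof -
  have "reach bullet t" by (rule reach_bullet)
  then have "\<not> path_forest t \<Longrightarrow> \<exists>m b. b \<in># grow (chain (Suc m)) \<and> \<not> linear_tree b \<and> reach (Node {#b#}) t"
    unfolding reach_def
  proof (induction rule: rtranclp_induct)
    case base
    then show ?case by (simp add: path_forest_iff bullet_def)
  next
    case (step s t)
    show ?case
    proof (cases "path_forest s")
      case True
      obtain M where s: "s = Node M" by (cases s)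
      have lin: "\<forall>c\<in>#M. linear_tree c" using True by (simp add: path_forest_iff s)
      from step(2) consider "t = Node (add_mset bullet M)"
        | c d where "c \<in># M" "d \<in># grow c" "t = Node (add_mset d (M - {#c#}))"
        by (auto simp: s)
      then show ?thesis
      proof cases
        case 1
        then have "path_forest t" using lin by (auto simp: path_forest_iff simp flip: chain_1)
        then show ?thesis using step by simp
      next
        case 2
        have "\<not> linear_tree d"
          using step.prems lin 2 by (auto simp: path_forest_iff dest: in_diffD)
        moreover obtain m where "c = chain (Suc m)" using lin 2 by (auto simp: linear_tree_def)
        moreover have "reach (Node {#d#}) t" using reach_union[of "{#d#}"] 2 by simp
        ultimately show ?thesis using 2 unfolding reach_def by blast
      qed
    next
      case False
      then show ?thesis using step rtranclp.rtrancl_into_rtrancl by (metis (no_types, lifting))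
    qed
  qed
  then show ?thesis using assms that by blast
qed

subsection \<open>Harmonic functions and left Pieri states\<close>

definition harmonic :: "(rtree \<Rightarrow> real) \<Rightarrow> bool" where
  "harmonic \<phi> \<longleftrightarrow> \<phi> bullet = 1 \<and> (\<forall>t. 0 \<le> \<phi> t) \<and> (\<forall>t. (\<Sum>b\<in>#grow t. \<phi> b) = \<phi> t)"

definition lin_ext :: "(rtree \<Rightarrow> real) \<Rightarrow> gl \<Rightarrow> real" where
  "lin_ext \<phi> x = (\<Sum>t\<in>Poly_Mapping.keys x. Poly_Mapping.lookup x t * \<phi> t)"

lemma lookup_scaleR [simp]:
  fixes x :: "'a \<Rightarrow>\<^sub>0 real"
  shows "Poly_Mapping.lookup (r *\<^sub>R x) t = r * Poly_Mapping.lookup x t"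
proof -
  have "finite {i. r * Poly_Mapping.lookup x i \<noteq> 0}"
    by (rule finite_subset[OF _ finite_lookup[of x]]) auto
  then show ?thesis by (simp add: scaleR_poly_mapping_def)
qed

lemma lin_ext_superset:
  "finite S \<Longrightarrow> Poly_Mapping.keys x \<subseteq> S \<Longrightarrow> lin_ext \<phi> x = (\<Sum>t\<in>S. Poly_Mapping.lookup x t * \<phi> t)"
  unfolding lin_ext_def by (intro sum.mono_neutral_left) (auto simp: in_keys_iff)

lemma linear_lin_ext: "linear (lin_ext \<phi>)"
proof (rule linearI)
  fix x y :: gl and r :: real
  let ?S = "Poly_Mapping.keys x \<union> Poly_Mapping.keys y"
  have "lin_ext \<phi> (x + y) = (\<Sum>t\<in>?S. Poly_Mapping.lookup (x + y) t * \<phi> t)"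
    by (intro lin_ext_superset keys_add) auto
  also have "\<dots> = (\<Sum>t\<in>?S. Poly_Mapping.lookup x t * \<phi> t) + (\<Sum>t\<in>?S. Poly_Mapping.lookup y t * \<phi> t)"
    by (simp add: lookup_add algebra_simps sum.distrib)
  also have "\<dots> = lin_ext \<phi> x + lin_ext \<phi> y"
    by (simp add: lin_ext_superset[of ?S])
  finally show "lin_ext \<phi> (x + y) = lin_ext \<phi> x + lin_ext \<phi> y" .
  have "lin_ext \<phi> (r *\<^sub>R x) = (\<Sum>t\<in>Poly_Mapping.keys x. Poly_Mapping.lookup (r *\<^sub>R x) t * \<phi> t)"
    by (intro lin_ext_superset) (auto simp: in_keys_iff)
  then show "lin_ext \<phi> (r *\<^sub>R x) = r *\<^sub>R lin_ext \<phi> x"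
    by (simp add: lin_ext_def sum_distrib_left mult.assoc)
qed

lemma lin_ext_basis [simp]: "lin_ext \<phi> (basis_F t) = \<phi> t"
  by (simp add: lin_ext_def basis_F_def)

lemma gl_mult_basis_left:
  "basis_F s \<star> x = (\<Sum>t\<in>Poly_Mapping.keys x. Poly_Mapping.lookup x t *\<^sub>R gl_basis_mult s t)"
  by (simp add: gl_mult_def basis_F_def)

lemma gl_mult_basis: "basis_F s \<star> basis_F t = gl_basis_mult s t"
  unfolding gl_mult_basis_left by (simp add: basis_F_def)

text \<open>The products that matter have \<open>tau\<close> or a chain as left factor. With a
  single root branch the maps \<open>f\<close> reduce to the choice of one vertex.\<close>

lemma gl_basis_mult_single:
  assumes "branches s = {#c#}"
  shows "gl_basis_mult s t = (\<Sum>v\<in>verts t. basis_F (graft t (\<lambda>w. if w = v then {#c#} else {#})))"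
proof -
  have "mset (branch_list s) = {#c#}" using assms by simp
  then have b: "branch_list s = [c]" by (metis mset_single_iff)
  have "gl_basis_mult s t = (\<Sum>f\<in>{..<Suc 0} \<rightarrow>\<^sub>E verts t. basis_F (graft t (\<lambda>w. if w = f 0 then {#c#} else {#})))"
  proof -
    have "graft_along t [c] f = graft t (\<lambda>w. if w = f 0 then {#c#} else {#})" for f
      unfolding graft_along_def by (rule arg_cong[where f = "graft t"]) auto
    then show ?thesis by (simp add: gl_basis_mult_def b)
  qed
  also have "\<dots> = (\<Sum>v\<in>verts t. basis_F (graft t (\<lambda>w. if w = v then {#c#} else {#})))"
  proof (rule sum.reindex_bij_witness[of _ "\<lambda>v. (\<lambda>i\<in>{..<Suc 0}. v)" "\<lambda>f. f 0"])
    fix f assume "f \<in> {..<Suc 0} \<rightarrow>\<^sub>E verts t"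
    then show "(\<lambda>i\<in>{..<Suc 0}. f 0) = f" by (intro ext) (auto simp: PiE_iff extensional_def)
  qed auto
  finally show ?thesis .
qed

text \<open>The only root branch of \<open>tau\<close> is a single vertex, so left multiplication by
  it sums over all leaf attachments. On basis elements the Pieri condition is therefore
  harmonicity.\<close>

lemma linear_gl_basis_mult_tau:
  assumes "linear L" shows "L (gl_basis_mult tau t) = (\<Sum>b\<in>#grow t. L (basis_F b))"
proof -
  have "L (gl_basis_mult tau t) = (\<Sum>v\<in>verts t. L (basis_F (graft t (leaf_at v))))"
    using assms by (subst gl_basis_mult_single[of _ bullet]) (simp_all add: tau_eq linear_sum)
  then show ?thesis using sum_verts_grow[of "\<lambda>b. L (basis_F b)" t] by simp
qed

lemma left_pieri_harmonic: "left_pieri_state L \<Longrightarrow> harmonic (\<lambda>t. L (basis_F t))"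
proof -
  assume L: "left_pieri_state L"
  then have "linear L" "L (basis_F tau \<star> basis_F t) = L (basis_F t)" for t
    by (simp_all add: left_pieri_state_def)
  then have "(\<Sum>b\<in>#grow t. L (basis_F b)) = L (basis_F t)" for t
    by (metis linear_gl_basis_mult_tau gl_mult_basis)
  then show ?thesis using L by (simp add: left_pieri_state_def harmonic_def)
qed

lemma harmonic_left_pieri:
  assumes "harmonic \<phi>" shows "left_pieri_state (lin_ext \<phi>)"
proof -
  let ?L = "lin_ext \<phi>"
  have "?L (basis_F tau \<star> x) = ?L x" for x
  proof -
    have "?L (basis_F tau \<star> x) = (\<Sum>t\<in>Poly_Mapping.keys x. Poly_Mapping.lookup x t * ?L (gl_basis_mult tau t))"
      using linear_lin_ext[of \<phi>] by (simp add: gl_mult_basis_left linear_sum linear_scale)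
    also have "\<dots> = ?L x"
      using assms by (simp add: linear_gl_basis_mult_tau[OF linear_lin_ext] harmonic_def) (simp add: lin_ext_def)
    finally show ?thesis .
  qed
  then show ?thesis using assms linear_lin_ext by (simp add: left_pieri_state_def harmonic_def)
qed

lemma sum_mset_nonneg_real:
  fixes h :: "'a \<Rightarrow> real"
  assumes "\<And>b. b \<in># R \<Longrightarrow> 0 \<le> h b" shows "0 \<le> (\<Sum>b\<in>#R. h b)"
  using assms by (induction R) (auto intro!: add_nonneg_nonneg)

text \<open>Each direct growth contributes one of the nonnegative summands that make up the value at
  its source.\<close>

lemma harmonic_mono: assumes "harmonic \<phi>" "reach s t" shows "\<phi> t \<le> \<phi> s"
  using assms(2) unfolding reach_def
proof (induction rule: rtranclp_induct)
  case (step t u)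
  obtain M where "grow t = add_mset u M" using step(2) by (metis multi_member_split)
  moreover have "(\<Sum>b\<in>#grow t. \<phi> b) = \<phi> t" using assms(1) by (simp add: harmonic_def)
  moreover have "0 \<le> (\<Sum>b\<in>#M. \<phi> b)" using assms(1) by (auto simp: harmonic_def intro!: sum_mset_nonneg_real)
  ultimately show ?case using step by simp
qed simp

lemma harmonic_le_1: "harmonic \<phi> \<Longrightarrow> \<phi> t \<le> 1"
  using harmonic_mono[OF _ reach_bullet] by (simp add: harmonic_def)

text \<open>The representative of a tree is an arbitrary choice, but \<open>tau\<close> has only one
  plane embedding. This makes the addresses of its vertices explicit.\<close>

lemma plane_tau: "plane tau = PNode [PNode []]"
proof -
  obtain ts where ts: "plane tau = PNode ts" by (cases "plane tau")
  have "shape (PNode ts) = Node {#bullet#}" using shape_plane[of tau] ts tau_eq by metis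
  then have "mset (map shape ts) = {#bullet#}" by (simp only: shape.simps rtree.inject)
  then have "map shape ts = [bullet]" by (simp only: mset_single_iff)
  then obtain p where p: "ts = [p]" "shape p = bullet"
    by (auto simp: map_eq_Cons_conv)
  obtain us where us: "p = PNode us" by (cases p)
  with p(2) have "mset (map shape us) = {#}" by (simp only: shape.simps bullet_def rtree.inject)
  then have "us = []" by simp
  with us have "p = PNode []" by simp
  then show ?thesis using ts p by simp
qed

text \<open>The root branch \<open>chain (Suc k)\<close> can be hung under the leaf or under the
  root of \<open>tau\<close>.\<close>

lemma gl_basis_mult_chain_tau:
  "gl_basis_mult (chain (Suc (Suc k))) tau
    = basis_F (chain (Suc (Suc (Suc k)))) + basis_F (Node {#bullet, chain (Suc k)#})"
proof -
  have v: "verts tau = {[], [0]}" by (simp add: verts_def plane_tau lessThan_Suc)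
  show ?thesis
    by (subst gl_basis_mult_single[of _ "chain (Suc k)"])
       (simp_all add: v chain_Suc_Suc graft_def plane_tau bullet_def add.commute add_mset_commute)
qed

text \<open>Expanding the value at the chain by harmonicity, the growth at the root and the growth
  at the tip cancel against the two trees of the product with \<open>tau\<close>. What remains are
  the trees of \<open>R\<close> hung under a new root. For \<open>k = 0\<close> the remainder
  \<open>R\<close> is empty.\<close>

lemma delta_eq:
  assumes L: "left_pieri_state L" and R: "grow (chain (Suc k)) = add_mset (chain (Suc (Suc k))) R"
  shows "delta (Suc (Suc k)) L = (\<Sum>b\<in>#R. L (basis_F (Node {#b#})))"
proof -
  have "L (basis_F (chain (Suc (Suc k)))) = (\<Sum>b\<in>#grow (chain (Suc (Suc k))). L (basis_F b))"
    using left_pieri_harmonic[OF L] by (simp add: harmonic_def)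
  also have "\<dots> = L (basis_F (Node {#bullet, chain (Suc k)#})) + L (basis_F (chain (Suc (Suc (Suc k)))))
      + (\<Sum>b\<in>#R. L (basis_F (Node {#b#})))"
    unfolding chain_Suc_Suc grow_Node1 by (simp add: R multiset.map_comp comp_def chain_Suc_Suc)
  finally show ?thesis
    using L by (simp add: delta_def gl_mult_basis gl_basis_mult_chain_tau left_pieri_state_def linear_add)
qed

text \<open>The lower bound turns the face into a zero set; the upper bound lets the weighted series
  of defects converge uniformly.\<close>

lemma delta_bounds:
  assumes L: "left_pieri_state L" and m: "m \<ge> 3"
  shows "0 \<le> delta m L" "delta m L \<le> 1"
proof -
  define k where "k = m - 2"
  have k: "m = Suc (Suc k)" using m by (simp add: k_def)
  have nn: "0 \<le> L (basis_F t)" "L (basis_F t) \<le> 1" for t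
    using L harmonic_le_1[OF left_pieri_harmonic[OF L]] by (auto simp: left_pieri_state_def)
  obtain R where R: "grow (chain (Suc k)) = add_mset (chain (Suc (Suc k))) R" using grow_chain by blast
  show "0 \<le> delta m L" unfolding k delta_eq[OF L R] by (auto intro!: sum_mset_nonneg_real nn)
  have "L (basis_F (chain m) \<star> basis_F tau) \<ge> 0"
    using L nn by (simp add: k gl_mult_basis gl_basis_mult_chain_tau left_pieri_state_def linear_add)
  then show "delta m L \<le> 1" using nn(2)[of "chain m"] by (simp add: delta_def)
qed

lemma sum_mset_eq_0_iff_real:
  fixes h :: "'a \<Rightarrow> real"
  assumes "\<And>b. b \<in># R \<Longrightarrow> 0 \<le> h b"
  shows "(\<Sum>b\<in>#R. h b) = 0 \<longleftrightarrow> (\<forall>b\<in>#R. h b = 0)"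
  using assms
proof (induction R)
  case (add b R)
  have 1: "0 \<le> h b" by (rule add.prems) simp
  have 2: "0 \<le> (\<Sum>b\<in>#R. h b)" by (rule sum_mset_nonneg_real, rule add.prems) simp
  have 3: "(\<Sum>b\<in>#R. h b) = 0 \<longleftrightarrow> (\<forall>b\<in>#R. h b = 0)" by (rule add.IH, rule add.prems) simp
  show ?case using add_nonneg_eq_0_iff[OF 1 2] 3 by simp
qed simp

text \<open>A vanishing sum of nonnegative terms kills every root with one non-linear growth of a
  chain as branch; monotonicity along \<open>reach\<close> carries the zero to all trees that are
  not path forests.\<close>

lemma delta_zero_iff:
  assumes L: "left_pieri_state L"
  shows "(\<forall>m\<ge>3. delta m L = 0) \<longleftrightarrow> (\<forall>t. \<not> path_forest t \<longrightarrow> L (basis_F t) = 0)"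
proof
  have nn: "0 \<le> L (basis_F t)" for t using L by (auto simp: left_pieri_state_def)
  assume *: "\<forall>m\<ge>3. delta m L = 0"
  show "\<forall>t. \<not> path_forest t \<longrightarrow> L (basis_F t) = 0"
  proof (intro allI impI)
    fix t assume "\<not> path_forest t"
    then obtain m b where b: "b \<in># grow (chain (Suc m))" "\<not> linear_tree b" "reach (Node {#b#}) t"
      by (rule not_path_forest_reach)
    obtain R where R: "grow (chain (Suc m)) = add_mset (chain (Suc (Suc m))) R" using grow_chain by blast
    \<comment> \<open>\<open>bullet\<close> has no non-linear growth, so the defect that is used has
      index at least 3.\<close>
    have "m \<noteq> 0"
    proof
      assume "m = 0"
      then have "b = chain (Suc (Suc 0))" using b(1) by (simp add: bullet_def chain_Suc_Suc)
      then show False using b(2) by simp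
    qed
    then have "delta (Suc (Suc m)) L = 0" using * by simp
    then have "(\<Sum>b\<in>#R. L (basis_F (Node {#b#}))) = 0" using delta_eq[OF L R] by simp
    then have "\<forall>b\<in>#R. L (basis_F (Node {#b#})) = 0" by (subst (asm) sum_mset_eq_0_iff_real) (use nn in auto)
    moreover have "b \<in># R" using b R by auto
    ultimately have "L (basis_F (Node {#b#})) = 0" by blast
    then show "L (basis_F t) = 0"
      using harmonic_mono[OF left_pieri_harmonic[OF L] b(3)] nn[of t] by simp
  qed
next
  assume *: "\<forall>t. \<not> path_forest t \<longrightarrow> L (basis_F t) = 0"
  show "\<forall>m\<ge>3. delta m L = 0"
  proof (intro allI impI)
    fix m :: nat assume "m \<ge> 3"
    moreover define k where "k = m - 2"
    ultimately have k: "m = Suc (Suc k)" by simp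
    obtain R where R: "grow (chain (Suc k)) = add_mset (chain (Suc (Suc k))) R" "\<forall>b\<in>#R. \<not> linear_tree b"
      using grow_chain by blast
    then have "image_mset (\<lambda>b. L (basis_F (Node {#b#}))) R = image_mset (\<lambda>_. 0) R"
      using * by (intro image_mset_cong) (auto simp: path_forest_iff)
    then show "delta m L = 0" by (simp add: k delta_eq[OF L R(1)])
  qed
qed

text \<open>A tree with \<open>n\<close> vertices has \<open>n\<close> growths, which dictates the
  factorial: this is the harmonic function of the random recursive tree. Being positive everywhere,
  it shows that the face is proper.\<close>

lemma harmonic_factorial: "harmonic (\<lambda>t. 1 / fact (nv t - 1))"
proof -
  have "(\<Sum>b\<in>#grow t. 1 / fact (nv b - 1)) = (1 / fact (nv t - 1) :: real)" for t
  proof -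
    obtain n where n: "nv t = Suc n" using nv_pos[of t] by (cases "nv t") auto
    have "image_mset (\<lambda>b. 1 / fact (nv b - 1) :: real) (grow t) = image_mset (\<lambda>_. 1 / fact (Suc n)) (grow t)"
      by (intro image_mset_cong) (simp add: nv_grow n del: fact_Suc)
    moreover have "real (Suc n) * (1 / fact (Suc n)) = (1 / fact n :: real)"
      by (simp del: of_nat_Suc)
    ultimately show ?thesis by (simp add: n size_grow del: fact_Suc of_nat_Suc)
  qed
  then show ?thesis by (simp add: harmonic_def)
qed

lemma ex_not_path_forest: "\<exists>t. \<not> path_forest t"
proof
  show "\<not> path_forest (Node {#Node {#bullet, bullet#}#})"
    by (simp add: path_forest_iff linear_tree_Node)
qed

subsection \<open>Measures on path spaces over finite alphabets\<close>

text \<open>Dividing the weight of a prolonged word by the weight of the word gives transition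
  kernels, which the Ionescu-Tulcea theorem glues together. The result is applied to edge sequences
  and to the codes of points of the simplex.\<close>

lemma cylinder_extension:
  fixes R :: "nat \<Rightarrow> 'a set" and w :: "'a list \<Rightarrow> real"
  assumes fin: "\<And>i. finite (R i)"
    and nonneg: "\<And>xs. 0 \<le> w xs" and w0: "w [] = 1"
    and cons: "\<And>xs. (\<forall>i<length xs. xs ! i \<in> R i) \<Longrightarrow> (\<Sum>a\<in>R (length xs). w (xs @ [a])) = w xs"
  shows "\<exists>M. prob_space M \<and> sets M = sets (PiM UNIV (\<lambda>i. count_space (R i))) \<and>
    (\<forall>xs. (\<forall>i<length xs. xs ! i \<in> R i) \<longrightarrow>
       measure M {\<omega> \<in> PiE UNIV R. \<forall>i<length xs. \<omega> i = xs ! i} = w xs)"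
proof -
  \<comment> \<open>Words of positive weight exist at every length, so no alphabet
    \<open>R i\<close> is empty.\<close>
  have ex: "\<exists>xs. length xs = n \<and> (\<forall>i<length xs. xs ! i \<in> R i) \<and> w xs > 0" for n
  proof (induction n)
    case 0
    then show ?case using w0 by auto
  next
    case (Suc n)
    then obtain xs where xs: "length xs = n" "\<forall>i<length xs. xs ! i \<in> R i" "w xs > 0" by blast
    have "\<exists>a\<in>R n. w (xs @ [a]) > 0"
    proof (rule ccontr)
      assume "\<not> ?thesis"
      then have "(\<Sum>a\<in>R (length xs). w (xs @ [a])) = 0"
        using xs(1) nonneg by (intro sum.neutral) (metis leD leI le_less)
      then show False using cons[OF xs(2)] xs(3) by simp
    qed
    then obtain a where "a \<in> R n" "w (xs @ [a]) > 0" by blast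
    then show ?case using xs by (intro exI[of _ "xs @ [a]"]) (auto simp: nth_append less_Suc_eq)
  qed
  have "R i \<noteq> {}" for i using ex[of "Suc i"] by auto
  then have some: "(SOME a. a \<in> R i) \<in> R i" for i by (simp add: some_in_eq)
  define M where "M = (\<lambda>i. count_space (R i))"
  \<comment> \<open>After a word of weight zero no conditional law exists; a point mass at an
    arbitrary letter keeps the kernel a probability measure.\<close>
  define k where "k n x a = (if w (map x [0..<n]) > 0 then w (map x [0..<n] @ [a]) / w (map x [0..<n])
       else of_bool (a = (SOME a. a \<in> R n)))" for n and x :: "nat \<Rightarrow> 'a" and a
  define P where "P n x = point_measure (R n) (\<lambda>a. ennreal (k n x a))" for n x
  have k_nonneg: "k n x a \<ge> 0" for n x a unfolding k_def by (auto intro!: divide_nonneg_nonneg nonneg)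
  have PiM_fin: "PiM {0..<n} M = count_space (PiE {0..<n} R)" for n
    unfolding M_def by (rule count_space_PiM_finite) (simp_all add: countable_finite fin)
  have sets_P: "sets (P n x) = sets (M n)" for n x by (simp add: P_def M_def sets_point_measure)
  have space_P: "space (P n x) = R n" for n x by (simp add: P_def space_point_measure)
  have k_sum: "(\<Sum>a\<in>R n. k n x a) = 1" if "x \<in> PiE {0..<n} R" for n x
  proof (cases "w (map x [0..<n]) > 0")
    case True
    have "(\<Sum>a\<in>R (length (map x [0..<n])). w (map x [0..<n] @ [a])) = w (map x [0..<n])"
      using that by (intro cons) auto
    then show ?thesis using True by (simp add: k_def flip: sum_divide_distrib)
  next
    case False
    then show ?thesis using some[of n] fin[of n] by (simp add: k_def)
  qed
  have prob_P: "prob_space (P n x)" if "x \<in> PiE {0..<n} R" for n x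
    using k_sum[OF that] fin[of n]
    by (intro prob_spaceI) (simp add: space_P, simp add: P_def emeasure_point_measure_finite sum_ennreal k_nonneg)
  interpret IT: Ionescu_Tulcea P M
  proof (rule Ionescu_Tulcea.intro)
    fix n
    have "P n x \<in> space (subprob_algebra (M n))" if "x \<in> PiE {0..<n} R" for x
      using prob_P[OF that] sets_P by (simp add: space_subprob_algebra prob_space_imp_subprob_space)
    then show "P n \<in> measurable (PiM {0..<n} M) (subprob_algebra (M n))"
      unfolding PiM_fin by simp
  next
    fix n x assume "x \<in> space (PiM {0..<n} M)"
    then show "prob_space (P n x)" using prob_P by (simp add: PiM_fin)
  qed
  \<comment> \<open>The product of the conditional weights along a word telescopes to the weight of
    the word.\<close>
  have C: "emeasure (IT.C 0 n (\<lambda>_. undefined)) {x} = ennreal (w (map x [0..<n]))" if "x \<in> PiE {0..<n} R" for n x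
    using that
  proof (induction n arbitrary: x)
    case 0
    have "emeasure (return (PiM {0..<0} M) (\<lambda>_. undefined)) {x} = indicator {x} (\<lambda>_. undefined)"
      using 0 unfolding PiM_fin by (intro emeasure_return) simp
    then show ?case using 0 by (simp add: w0)
  next
    case (Suc n)
    \<comment> \<open>\<open>?y\<close> is the restriction of \<open>x\<close> to the first
      \<open>n\<close> places, since members of \<open>PiE\<close> are \<open>undefined\<close>
      outside their index set.\<close>
    let ?u = "\<lambda>_. undefined :: 'a" and ?y = "x(n := undefined)"
    have u: "?u \<in> space (PiM {0..<0} M)" by (simp add: PiM_fin)
    have spC: "space (IT.C 0 n ?u) = PiE {0..<n} R" using IT.space_C[OF u, of n] by (simp add: PiM_fin)
    have setsC: "sets (IT.C 0 n ?u) = Pow (PiE {0..<n} R)" using IT.sets_C[OF u, of n] by (simp add: PiM_fin)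
    have y: "?y \<in> PiE {0..<n} R" using Suc.prems by (auto simp: PiE_iff extensional_def)
    have my: "map ?y [0..<n] = map x [0..<n]" by simp
    have eP: "emeasure (IT.eP n z) {x} = ennreal (k n ?y (x n)) * indicator {?y} z" if z: "z \<in> PiE {0..<n} R" for z
    proof -
      have "emeasure (IT.eP n z) {x} = emeasure (P n z) ((\<lambda>a. z(n := a)) -` {x} \<inter> R n)"
        using z Suc.prems by (subst IT.emeasure_eP) (simp_all add: PiM_fin, simp add: M_def)
      also have "(\<lambda>a. z(n := a)) -` {x} \<inter> R n = (if z = ?y then {x n} else {})"
      proof -
        have "z n = undefined" using z by (auto simp: PiE_iff extensional_def)
        then have "z(n := a) = x \<longleftrightarrow> z = ?y \<and> a = x n" for a
          by (metis fun_upd_same fun_upd_triv fun_upd_upd)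
        moreover have "x n \<in> R n" using Suc.prems by auto
        ultimately have "a \<in> (\<lambda>a. z(n := a)) -` {x} \<inter> R n \<longleftrightarrow> a \<in> (if z = ?y then {x n} else {})" for a
          by (cases "z = ?y"; cases "a = x n"; simp)
        then show ?thesis by (rule set_eqI)
      qed
      also have "emeasure (P n z) \<dots> = ennreal (k n ?y (x n)) * indicator {?y} z"
        using Suc.prems fin[of n] by (auto simp: P_def emeasure_point_measure_finite PiE_iff)
      finally show ?thesis .
    qed
    have "emeasure (IT.C 0 (Suc n) ?u) {x} = (\<integral>\<^sup>+z. emeasure (IT.eP n z) {x} \<partial>IT.C 0 n ?u)"
    proof -
      have "IT.eP n \<in> measurable (IT.C 0 n ?u) (subprob_algebra (PiM {0..<Suc n} M))"
        using IT.measurable_eP[of n] IT.sets_C[OF u, of n] by (simp cong: measurable_cong_sets)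
      moreover have "space (IT.C 0 n ?u) \<noteq> {}" using y by (auto simp: spC)
      moreover have "{x} \<in> sets (PiM {0..<Suc n} M)" using Suc.prems by (simp add: PiM_fin)
      ultimately show ?thesis by (simp add: emeasure_bind)
    qed
    also have "\<dots> = (\<integral>\<^sup>+z. ennreal (k n ?y (x n)) * indicator {?y} z \<partial>IT.C 0 n ?u)"
      by (intro nn_integral_cong) (simp add: eP spC)
    also have "\<dots> = ennreal (k n ?y (x n)) * emeasure (IT.C 0 n ?u) {?y}"
      using y by (intro nn_integral_cmult_indicator) (simp add: setsC)
    also have "\<dots> = ennreal (k n ?y (x n) * w (map x [0..<n]))"
      unfolding Suc.IH[OF y] my by (simp add: ennreal_mult k_nonneg nonneg)
    also have "k n ?y (x n) * w (map x [0..<n]) = w (map x [0..<n] @ [x n])"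
    proof (cases "w (map x [0..<n]) > 0")
      \<comment> \<open>A word of weight zero has only prolongations of weight zero, so the default
        kernel leaves no trace.\<close>
      case False
      then have 0: "w (map x [0..<n]) = 0" using nonneg[of "map x [0..<n]"] by simp
      have "(\<Sum>a\<in>R (length (map x [0..<n])). w (map x [0..<n] @ [a])) = w (map x [0..<n])"
        using Suc.prems by (intro cons) auto
      then have "w (map x [0..<n] @ [x n]) = 0"
        using 0 nonneg fin[of n] Suc.prems by (auto simp: sum_nonneg_eq_0_iff)
      then show ?thesis using 0 by simp
    qed (simp add: k_def my)
    finally show ?case by simp
  qed
  have cyl: "emeasure IT.PF.lim {\<omega> \<in> PiE UNIV R. \<forall>i<length xs. \<omega> i = xs ! i} = ennreal (w xs)"
    if xs: "\<forall>i<length xs. xs ! i \<in> R i" for xs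
  proof -
    define n x where "n = length xs" and "x = (\<lambda>i\<in>{0..<n}. xs ! i)"
    have x: "x \<in> PiE {0..<n} R" using xs by (auto simp: x_def n_def)
    have mx: "map x [0..<n] = xs" by (auto simp: x_def n_def intro!: nth_equalityI)
    have sx: "{x} \<in> sets (PiM {0..<n} M)" using x by (simp add: PiM_fin)
    have "{\<omega> \<in> PiE UNIV R. \<forall>i<length xs. \<omega> i = xs ! i} = prod_emb UNIV M {0..<n} {x}"
      by (auto simp: prod_emb_def M_def x_def n_def restrict_def fun_eq_iff) (metis)+
    then have "emeasure IT.PF.lim {\<omega> \<in> PiE UNIV R. \<forall>i<length xs. \<omega> i = xs ! i} = emeasure (IT.CI {0..<n}) {x}"
      by (simp add: IT.lim sx)
    also have "\<dots> = emeasure (IT.C 0 n (\<lambda>_. undefined)) (prod_emb {0..<n} M {0..<n} {x})"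
      by (intro IT.emeasure_CI sx) simp
    also have "prod_emb {0..<n} M {0..<n} {x} = {x}"
      using x by (intro prod_emb_id) (auto simp: M_def)
    finally show ?thesis using C[OF x] by (simp add: mx)
  qed
  show ?thesis
  proof (intro exI conjI allI impI)
    have "space IT.PF.lim = PiE UNIV R" by (simp add: space_PiM) (simp add: M_def)
    then show "prob_space IT.PF.lim" using cyl[of "[]"] w0 by (intro prob_spaceI) simp
    show "sets IT.PF.lim = sets (PiM UNIV (\<lambda>i. count_space (R i)))" by (simp flip: M_def)
    fix xs assume "\<forall>i<length xs. xs ! i \<in> R i"
    then show "measure IT.PF.lim {\<omega> \<in> PiE UNIV R. \<forall>i<length xs. \<omega> i = xs ! i} = w xs"
      using cyl[of xs] nonneg by (simp add: measure_def)
  qed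
qed

subsection \<open>Symmetric functions\<close>

lemma sum_mset_count:
  fixes f :: "'a \<Rightarrow> real"
  shows "(\<Sum>x\<in>#M. f x) = (\<Sum>x\<in>set_mset M. real (count M x) * f x)"
proof -
  have "(\<Sum>x\<in>#M. f x) = (\<Sum>x\<in>S. real (count M x) * f x)" if "finite S" "set_mset M \<subseteq> S" for S
    using that(2)
  proof (induction M)
    case (add a M)
    have "(\<Sum>x\<in>S. real (count (add_mset a M) x) * f x) = (\<Sum>x\<in>S. (if x = a then f x else 0) + real (count M x) * f x)"
      by (intro sum.cong) (auto simp: algebra_simps)
    also have "\<dots> = f a + (\<Sum>x\<in>S. real (count M x) * f x)"
      using add.prems that(1) by (simp add: sum.distrib)
    finally show ?case using add by simp
  qed simp
  then show ?thesis by simp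
qed

lemma exponents_empty [simp]: "exponents {#} = {#}" by (simp add: exponents_def)

lemma exponents_add_replicate:
  assumes "i \<notin># M" "j \<ge> 1"
  shows "exponents (M + replicate_mset j i) = add_mset j (exponents M)"
proof -
  have s: "set_mset (M + replicate_mset j i) = insert i (set_mset M)" using assms by auto
  have "image_mset (count (M + replicate_mset j i)) (mset_set (set_mset M)) = image_mset (count M) (mset_set (set_mset M))"
    using assms by (intro image_mset_cong) auto
  moreover have "count M i = 0" using assms by (simp add: not_in_iff)
  ultimately show ?thesis using assms unfolding exponents_def s by simp
qed

lemma multiset_split:
  obtains M' where "M = M' + replicate_mset (count M i) i" "i \<notin># M'"
proof
  show "M = filter_mset (\<lambda>x. x \<noteq> i) M + replicate_mset (count M i) i"
    by (auto simp: multiset_eq_iff)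
qed simp

lemma exponents_split: "i \<in># M \<Longrightarrow> M = M' + replicate_mset (count M i) i \<Longrightarrow> i \<notin># M' \<Longrightarrow>
   exponents M = add_mset (count M i) (exponents M')"
  using exponents_add_replicate[of i M' "count M i"] by simp

text \<open>Dividing a monomial by the \<open>k\<close>-th power of one variable lowers a single
  exponent, which disappears from the multiset if it was exactly \<open>k\<close>.\<close>

lemma exponents_diff_replicate:
  assumes "count M i \<ge> k" "k \<ge> 1"
  shows "exponents (M - replicate_mset k i) =
    (if count M i = k then exponents M - {#k#} else add_mset (count M i - k) (exponents M - {#count M i#}))"
proof -
  obtain M' where M': "M = M' + replicate_mset (count M i) i" "i \<notin># M'" using multiset_split .
  have i: "i \<in># M" using assms by (metis count_greater_zero_iff order_less_le_trans zero_less_one)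
  define c where "c = count M i"
  have "M - replicate_mset k i = M' + replicate_mset (c - k) i"
  proof (rule multiset_eqI)
    fix x
    have "count M x = count (M' + replicate_mset c i) x" using M'(1) c_def by simp
    moreover have "count M' i = 0" using M'(2) by (simp add: not_in_iff)
    ultimately show "count (M - replicate_mset k i) x = count (M' + replicate_mset (c - k) i) x"
      by (cases "x = i") auto
  qed
  then show ?thesis
    using exponents_split[OF i M'] exponents_add_replicate[OF M'(2), of "c - k"] assms
    by (auto simp: c_def[symmetric])
qed

lemma int_partition_exponents: "int_partition (exponents M)"
  by (auto simp: int_partition_def exponents_def count_eq_zero_iff)

lemma exponents_eq_empty: "exponents M = {#} \<longleftrightarrow> M = {#}"
  by (auto simp: exponents_def mset_set_empty_iff)

definition aut_factor :: "nat multiset \<Rightarrow> real" where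
  "aut_factor l = (\<Prod>j\<in>set_mset l. fact (count l j))"

lemma aut_factor_pos: "aut_factor l > 0"
  unfolding aut_factor_def by (intro prod_pos) auto

lemma aut_factor_add: "aut_factor (add_mset k l) = aut_factor l * real (Suc (count l k))"
proof -
  have *: "aut_factor l = (\<Prod>j\<in>S. fact (count l j))" if "finite S" "set_mset l \<subseteq> S" for l S
    unfolding aut_factor_def using that by (intro prod.mono_neutral_left) (auto simp: not_in_iff)
  let ?S = "insert k (set_mset l)"
  have "aut_factor (add_mset k l) = (\<Prod>j\<in>?S. fact (count (add_mset k l) j))" by (intro *) auto
  also have "\<dots> = fact (Suc (count l k)) * (\<Prod>j\<in>?S - {k}. fact (count l j))"
    by (subst prod.remove[of _ k]) (auto intro!: prod.cong)
  also have "\<dots> = real (Suc (count l k)) * (\<Prod>j\<in>?S. fact (count l j))"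
    by (subst (2) prod.remove[of _ k]) (auto simp: algebra_simps)
  also have "(\<Prod>j\<in>?S. fact (count l j)) = aut_factor l" by (intro *[symmetric]) auto
  finally show ?thesis by (simp add: mult.commute)
qed

lemma augmented_monomial: "augmented_monomial_sf l M = aut_factor l * of_bool (exponents M = l)"
  by (simp add: augmented_monomial_sf_def monomial_sf_def aut_factor_def)

lemma series_mult_nonzero:
  assumes "series_mult f g M \<noteq> 0" obtains A where "A \<subseteq># M" "f A \<noteq> 0" "g (M - A) \<noteq> 0"
proof -
  have "\<exists>A\<in>{A. A \<subseteq># M}. f A * g (M - A) \<noteq> 0"
    using assms sum.neutral[of "{A. A \<subseteq># M}" "\<lambda>A. f A * g (M - A)"] by (auto simp: series_mult_def)
  then show ?thesis using that by auto
qed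

lemma finite_multisets_bounded: "finite A \<Longrightarrow> finite {M. set_mset M \<subseteq> A \<and> size M \<le> d}"
proof -
  assume "finite A"
  then have "finite (\<Union>n\<in>{..d}. multisets_of_size A n)"
    by (intro finite_UN_I finite_multisets_of_size) auto
  moreover have "(\<Union>n\<in>{..d}. multisets_of_size A n) = {M. set_mset M \<subseteq> A \<and> size M \<le> d}"
    by (auto simp: multisets_of_size_def)
  ultimately show ?thesis by simp
qed

lemma finite_submultisets: "finite {A. A \<subseteq># M}"
  by (rule finite_subset[OF _ finite_multisets_bounded[of "set_mset M" "size M"]])
     (auto dest: mset_subset_eqD size_mset_mono)

lemma series_mult_power_sum:
  assumes "k \<ge> 1"
  shows "series_mult (power_sum k) g M = (\<Sum>i\<in>{i \<in> set_mset M. count M i \<ge> k}. g (M - replicate_mset k i))"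
proof -
  let ?I = "{i \<in> set_mset M. count M i \<ge> k}"
  have "x = y" if "replicate_mset k x = replicate_mset k y" for x y :: nat
  proof -
    have "count (replicate_mset k x) x = count (replicate_mset k y) x" using that by simp
    then show ?thesis using assms by (simp split: if_splits)
  qed
  then have inj: "inj_on (replicate_mset k) ?I" by (auto intro!: inj_onI)
  have "series_mult (power_sum k) g M = (\<Sum>A\<in>replicate_mset k ` ?I. g (M - A))"
    unfolding series_mult_def
  proof (rule sum.mono_neutral_cong_right)
    show "finite {A. A \<subseteq># M}" by (rule finite_submultisets)
    show "replicate_mset k ` ?I \<subseteq> {A. A \<subseteq># M}"
      by (auto simp: count_le_replicate_mset_subset_eq)
    show "\<forall>A\<in>{A. A \<subseteq># M} - replicate_mset k ` ?I. power_sum k A * g (M - A) = 0"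
    proof (intro ballI)
      fix A assume A: "A \<in> {A. A \<subseteq># M} - replicate_mset k ` ?I"
      have "\<nexists>i. A = replicate_mset k i"
      proof
        assume "\<exists>i. A = replicate_mset k i"
        then obtain i where i: "A = replicate_mset k i" by blast
        then have "count M i \<ge> k" using A by (auto simp: count_le_replicate_mset_subset_eq)
        then have "i \<in> ?I" using assms by (auto simp flip: count_greater_zero_iff)
        then show False using A i by blast
      qed
      then show "power_sum k A * g (M - A) = 0" by (simp add: power_sum_def)
    qed
    show "power_sum k A * g (M - A) = g (M - A)" if "A \<in> replicate_mset k ` ?I" for A
      using that by (auto simp: power_sum_def)
  qed
  also have "\<dots> = (\<Sum>i\<in>?I. g (M - replicate_mset k i))"
    by (simp add: sum.reindex[OF inj])
  finally show ?thesis .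
qed

text \<open>When a sum over distinct indices is multiplied by a power sum, the new index either
  differs from all old ones or equals one of them. The augmentation makes every part of
  \<open>l\<close> count with coefficient 1. All later recursions over partitions come from this
  identity.\<close>

lemma power_sum_mult_augmented:
  assumes l: "int_partition l" and k: "k \<ge> 1"
  shows "series_mult (power_sum k) (augmented_monomial_sf l) M =
    augmented_monomial_sf (add_mset k l) M + (\<Sum>j\<in>#l. augmented_monomial_sf (add_mset (j + k) (l - {#j#})) M)"
proof -
  define E where "E = exponents M"
  \<comment> \<open>\<open>F c\<close> is the multiset of exponents after lowering one exponent
    \<open>c\<close> of \<open>M\<close> by \<open>k\<close>.\<close>
  define F where "F c = (if c = k then E - {#k#} else add_mset (c - k) (E - {#c#}))" for c
  define h where "h c = (of_bool (c \<ge> k \<and> F c = l) :: real)" for c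
  have "series_mult (power_sum k) (augmented_monomial_sf l) M
    = (\<Sum>i\<in>{i \<in> set_mset M. count M i \<ge> k}. aut_factor l * of_bool (exponents (M - replicate_mset k i) = l))"
    by (simp add: series_mult_power_sum[OF k] augmented_monomial)
  also have "\<dots> = (\<Sum>i\<in>set_mset M. aut_factor l * h (count M i))"
    unfolding h_def F_def E_def
    by (rule sum.mono_neutral_cong_left) (use k in \<open>auto simp: exponents_diff_replicate\<close>)
  also have "\<dots> = aut_factor l * (\<Sum>i\<in>set_mset M. h (count M i))" by (simp add: sum_distrib_left)
  also have "(\<Sum>i\<in>set_mset M. h (count M i)) = (\<Sum>c\<in>#E. h c)"
    by (simp add: E_def exponents_def multiset.map_comp comp_def sum_unfold_sum_mset)
  also have "(\<Sum>c\<in>#E. h c) = (\<Sum>c\<in>set_mset E. real (count E c) * h c)" by (rule sum_mset_count)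
  also have "\<dots> = real (count E k) * h k + (\<Sum>c\<in>set_mset E - {k}. real (count E c) * h c)"
    by (cases "k \<in># E") (auto simp: sum.remove[of _ k] not_in_iff)
  also have "(\<Sum>c\<in>set_mset E - {k}. real (count E c) * h c)
     = (\<Sum>c\<in>{c \<in> set_mset E - {k}. h c \<noteq> 0}. real (count E c) * h c)"
    by (rule sum.mono_neutral_right) auto
  \<comment> \<open>Apart from \<open>c = k\<close>, which accounts for the adjoined part
    \<open>k\<close>, a contributing exponent \<open>c\<close> of \<open>M\<close> comes from the
    part \<open>j = c - k\<close> of \<open>l\<close>.\<close>
  also have "\<dots> = (\<Sum>j\<in>{j \<in> set_mset l. E = add_mset (j + k) (l - {#j#})}.
       real (count E (j + k)) * of_bool (E = add_mset (j + k) (l - {#j#})))"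
  proof (rule sum.reindex_bij_witness[where i = "\<lambda>j. j + k" and j = "\<lambda>c. c - k"])
    fix c assume "c \<in> {c \<in> set_mset E - {k}. h c \<noteq> 0}"
    then have c: "c \<in># E" "c > k" "add_mset (c - k) (E - {#c#}) = l" by (auto simp: h_def F_def split: if_splits)
    show "c - k + k = c" using c by simp
    have "l - {#c - k#} = E - {#c#}" using c(3) by auto
    then have E: "E = add_mset (c - k + k) (l - {#c - k#})" using c by simp
    have "c - k \<in># l" using c(3) by (metis union_single_eq_member)
    then show "c - k \<in> {j \<in> set_mset l. E = add_mset (j + k) (l - {#j#})}" using E by simp
    have "h c = 1" using c by (simp add: h_def F_def)
    then show "real (count E (c - k + k)) * of_bool (E = add_mset (c - k + k) (l - {#c - k#})) = real (count E c) * h c"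
      unfolding E[symmetric] using c by simp
  next
    fix j assume "j \<in> {j \<in> set_mset l. E = add_mset (j + k) (l - {#j#})}"
    then have j: "j \<in># l" "E = add_mset (j + k) (l - {#j#})" by auto
    then have "j > 0" using l by (auto simp: int_partition_def intro: gr0I)
    show "j + k - k = j" by simp
    have "F (j + k) = l" using j \<open>j > 0\<close> by (simp add: F_def)
    then have "h (j + k) = 1" by (simp add: h_def)
    moreover have "j + k \<in># E" unfolding j(2) by simp
    ultimately show "j + k \<in> {c \<in> set_mset E - {k}. h c \<noteq> 0}" using \<open>j > 0\<close> by simp
  qed
  also have "\<dots> = (\<Sum>j\<in>set_mset l. real (count E (j + k)) * of_bool (E = add_mset (j + k) (l - {#j#})))"
    by (rule sum.mono_neutral_left) auto
  finally have "series_mult (power_sum k) (augmented_monomial_sf l) M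
    = aut_factor l * (real (count E k) * h k) + (\<Sum>j\<in>set_mset l. aut_factor l * (real (count E (j + k)) * of_bool (E = add_mset (j + k) (l - {#j#}))))"
    by (simp only: distrib_left sum_distrib_left)
  also have "aut_factor l * (real (count E k) * h k) = augmented_monomial_sf (add_mset k l) M"
  proof (cases "E = add_mset k l")
    case True
    then have "h k = 1" by (simp add: h_def F_def)
    then show ?thesis using True by (simp add: augmented_monomial aut_factor_add E_def[symmetric])
  next
    case False
    then have "count E k = 0 \<or> h k = 0"
      by (auto simp: h_def F_def not_in_iff[symmetric])
    then show ?thesis using False by (auto simp: augmented_monomial E_def[symmetric])
  qed
  \<comment> \<open>Compared with the partition without \<open>j\<close>, the factor of
    \<open>l\<close> gains the multiplicity of \<open>j\<close> in \<open>l\<close>, and the factor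
    of the new partition gains the multiplicity of \<open>j + k\<close> in \<open>E\<close>.\<close>
  also have "(\<Sum>j\<in>set_mset l. aut_factor l * (real (count E (j + k)) * of_bool (E = add_mset (j + k) (l - {#j#}))))
    = (\<Sum>j\<in>set_mset l. real (count l j) * augmented_monomial_sf (add_mset (j + k) (l - {#j#})) M)"
  proof (intro sum.cong refl)
    fix j assume "j \<in># l"
    then obtain l' where l': "l = add_mset j l'" by (metis multi_member_split)
    show "aut_factor l * (real (count E (j + k)) * of_bool (E = add_mset (j + k) (l - {#j#})))
      = real (count l j) * augmented_monomial_sf (add_mset (j + k) (l - {#j#})) M"
      using k by (auto simp: l' augmented_monomial aut_factor_add E_def[symmetric])
  qed
  also have "\<dots> = (\<Sum>j\<in>#l. augmented_monomial_sf (add_mset (j + k) (l - {#j#})) M)"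
    by (rule sum_mset_count[symmetric])
  finally show ?thesis .
qed

section \<open>The algebra \<open>Lambda\<close> and its augmented monomial basis\<close>

lemma LambdaI:
  assumes "\<And>\<pi> M. bij \<pi> \<Longrightarrow> f (image_mset \<pi> M) = f M" "\<And>M. f M \<noteq> 0 \<Longrightarrow> size M \<le> d"
  shows "f \<in> Lambda"
  using assms unfolding Lambda_def by blast

lemma Lambda_sym: "f \<in> Lambda \<Longrightarrow> bij \<pi> \<Longrightarrow> f (image_mset \<pi> M) = f M"
  by (simp add: Lambda_def)

lemma Lambda_bound: assumes "f \<in> Lambda" obtains d where "\<And>M. f M \<noteq> 0 \<Longrightarrow> size M \<le> d"
  using assms by (auto simp: Lambda_def)

abbreviation sf_one :: series where "sf_one \<equiv> (\<lambda>M. of_bool (M = {#}))"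

lemma Lambda_one: "sf_one \<in> Lambda"
  by (rule LambdaI[where d = 0]) auto

lemma Lambda_add:
  assumes "f \<in> Lambda" "g \<in> Lambda" shows "(\<lambda>M. f M + g M) \<in> Lambda"
proof -
  obtain d where d: "\<And>M. f M \<noteq> 0 \<Longrightarrow> size M \<le> d" using Lambda_bound[OF assms(1)] by blast
  obtain e where e: "\<And>M. g M \<noteq> 0 \<Longrightarrow> size M \<le> e" using Lambda_bound[OF assms(2)] by blast
  show ?thesis
  proof (rule LambdaI[where d = "max d e"])
    fix M assume "f M + g M \<noteq> 0"
    then have "f M \<noteq> 0 \<or> g M \<noteq> 0" by auto
    then show "size M \<le> max d e" using d[of M] e[of M] by auto
  qed (simp add: Lambda_sym assms)
qed

lemma Lambda_cmult:
  assumes "f \<in> Lambda" shows "(\<lambda>M. c * f M) \<in> Lambda"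
proof -
  obtain d where d: "\<And>M. f M \<noteq> 0 \<Longrightarrow> size M \<le> d" using Lambda_bound[OF assms(1)] by blast
  show ?thesis by (rule LambdaI[where d = d]) (auto simp: Lambda_sym assms d)
qed

lemma Lambda_mult:
  assumes "f \<in> Lambda" "g \<in> Lambda" shows "series_mult f g \<in> Lambda"
proof -
  obtain d where d: "\<And>M. f M \<noteq> 0 \<Longrightarrow> size M \<le> d" using Lambda_bound[OF assms(1)] by blast
  obtain e where e: "\<And>M. g M \<noteq> 0 \<Longrightarrow> size M \<le> e" using Lambda_bound[OF assms(2)] by blast
  show ?thesis
  proof (rule LambdaI[where d = "d + e"])
    fix \<pi> :: "nat \<Rightarrow> nat" and M assume \<pi>: "bij \<pi>"
    have inv1: "image_mset (inv \<pi>) (image_mset \<pi> A) = A" "image_mset \<pi> (image_mset (inv \<pi>) A) = A" for A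
      using \<pi> by (simp_all add: multiset.map_comp comp_def bij_is_inj bij_is_surj surj_f_inv_f)
    show "series_mult f g (image_mset \<pi> M) = series_mult f g M"
      unfolding series_mult_def
    proof (rule sum.reindex_bij_witness[where i = "image_mset \<pi>" and j = "image_mset (inv \<pi>)"])
      fix A assume A: "A \<in> {A. A \<subseteq># image_mset \<pi> M}"
      then have A': "image_mset (inv \<pi>) A \<subseteq># M" using image_mset_subseteq_mono inv1(1) by (metis mem_Collect_eq)
      then show "image_mset (inv \<pi>) A \<in> {A. A \<subseteq># M}" by simp
      have "g (image_mset \<pi> M - A) = g (image_mset \<pi> (M - image_mset (inv \<pi>) A))"
        using A' by (simp add: image_mset_Diff inv1)
      then show "f (image_mset (inv \<pi>) A) * g (M - image_mset (inv \<pi>) A) = f A * g (image_mset \<pi> M - A)"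
        using \<pi> assms by (simp add: Lambda_sym bij_imp_bij_inv)
    qed (auto simp: inv1 image_mset_subseteq_mono)
  next
    fix M assume "series_mult f g M \<noteq> 0"
    then obtain A where "A \<subseteq># M" "f A \<noteq> 0" "g (M - A) \<noteq> 0" by (rule series_mult_nonzero)
    then show "size M \<le> d + e" using d[of A] e[of "M - A"] size_Diff_submset[of A M] size_mset_mono[of A M] by simp
  qed
qed

lemma Lambda_power_sum: "power_sum k \<in> Lambda"
proof (rule LambdaI[where d = k])
  fix \<pi> :: "nat \<Rightarrow> nat" and M assume \<pi>: "bij \<pi>"
  have "(\<exists>i. image_mset \<pi> M = replicate_mset k i) \<longleftrightarrow> (\<exists>i. M = replicate_mset k i)"
  proof safe
    fix i assume "image_mset \<pi> M = replicate_mset k i"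
    then have "image_mset (inv \<pi>) (image_mset \<pi> M) = image_mset (inv \<pi>) (replicate_mset k i)" by simp
    then show "\<exists>i. M = replicate_mset k i"
      using \<pi> by (auto simp: multiset.map_comp comp_def bij_is_inj)
  qed auto
  then show "power_sum k (image_mset \<pi> M) = power_sum k M" by (simp add: power_sum_def)
qed (auto simp: power_sum_def)

lemma count_image_mset_inj: "inj \<pi> \<Longrightarrow> count (image_mset \<pi> M) (\<pi> x) = count M x"
  by (induction M) (auto simp: inj_eq)

lemma exponents_image: assumes "inj \<pi>" shows "exponents (image_mset \<pi> M) = exponents M"
proof -
  have "mset_set (\<pi> ` set_mset M) = image_mset \<pi> (mset_set (set_mset M))"
    using assms by (simp add: image_mset_mset_set inj_on_subset)
  then show ?thesis
    using assms by (simp add: exponents_def multiset.map_comp comp_def count_image_mset_inj)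
qed

lemma size_exponents: "sum_mset (exponents M) = size M"
  by (simp add: exponents_def size_multiset_overloaded_eq sum_unfold_sum_mset)

lemma Lambda_augmented: "augmented_monomial_sf l \<in> Lambda"
  by (rule LambdaI[where d = "sum_mset l"])
     (auto simp: augmented_monomial exponents_image bij_is_inj size_exponents[symmetric])

lemma augmented_empty: "augmented_monomial_sf {#} = sf_one"
  by (rule ext) (simp add: augmented_monomial exponents_eq_empty aut_factor_def)

lemma image_mset_set_eq_bij:
  assumes "finite A" "finite B" "image_mset f (mset_set A) = image_mset g (mset_set B)"
  shows "\<exists>h. bij_betw h A B \<and> (\<forall>x\<in>A. g (h x) = f x)"
  using assms
proof (induction A arbitrary: B rule: finite_induct)
  case empty
  then have "B = {}" by (simp add: mset_set_empty_iff)
  then show ?case by (auto simp: bij_betw_def)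
next
  case (insert a A)
  have "f a \<in># image_mset g (mset_set B)" unfolding insert.prems(2)[symmetric] using insert.hyps by simp
  then obtain b where b: "b \<in> B" "g b = f a" using insert.prems by auto
  have "mset_set B = add_mset b (mset_set (B - {b}))" using b insert.prems by (simp add: mset_set.remove)
  then have "image_mset f (mset_set A) = image_mset g (mset_set (B - {b}))"
    using insert.prems(2) insert.hyps b by simp
  then obtain h where h: "bij_betw h A (B - {b})" "\<forall>x\<in>A. g (h x) = f x"
    using insert.IH[of "B - {b}"] insert.prems by auto
  have "bij_betw (h(a := b)) A (B - {b})"
    using h(1) insert.hyps by (subst bij_betw_cong[where g = h]) auto
  moreover have "bij_betw (h(a := b)) {a} {b}" by simp
  ultimately have "bij_betw (h(a := b)) (A \<union> {a}) ((B - {b}) \<union> {b})" by (rule bij_betw_combine) simp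
  moreover have "A \<union> {a} = insert a A" "(B - {b}) \<union> {b} = B" using b by auto
  ultimately have "bij_betw (h(a := b)) (insert a A) B" by simp
  moreover have "\<forall>x\<in>insert a A. g ((h(a := b)) x) = f x" using h b insert.hyps by auto
  ultimately show ?case by blast
qed

text \<open>Symmetry refers to permutations of all variables, so a matching of the two supports has
  to be extended: the rest of their union is matched by cardinality, and all other variables stay
  fixed.\<close>

lemma exponents_eq_bij:
  assumes "exponents M = exponents M'"
  obtains \<pi> where "bij \<pi>" "image_mset \<pi> M = M'"
proof -
  let ?A = "set_mset M" and ?B = "set_mset M'"
  let ?S = "?A \<union> ?B"
  obtain h where h: "bij_betw h ?A ?B" "\<forall>x\<in>?A. count M' (h x) = count M x"
    using image_mset_set_eq_bij[of ?A ?B "count M" "count M'"] assms by (auto simp: exponents_def)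
  have "card (?S - ?A) = card (?S - ?B)"
    using bij_betw_same_card[OF h(1)] by (simp add: card_Diff_subset)
  then obtain k where k: "bij_betw k (?S - ?A) (?S - ?B)"
    using finite_same_card_bij[of "?S - ?A" "?S - ?B"] by auto
  define \<pi> where "\<pi> x = (if x \<in> ?A then h x else if x \<in> ?B then k x else x)" for x
  have 1: "bij_betw \<pi> ?A ?B" using h(1) by (subst bij_betw_cong[where g = h]) (auto simp: \<pi>_def)
  have 2: "bij_betw \<pi> (?S - ?A) (?S - ?B)" using k by (subst bij_betw_cong[where g = k]) (auto simp: \<pi>_def)
  have 3: "bij_betw \<pi> (- ?S) (- ?S)" by (subst bij_betw_cong[where g = id]) (auto simp: \<pi>_def)
  have "bij_betw \<pi> (?A \<union> (?S - ?A) \<union> - ?S) (?B \<union> (?S - ?B) \<union> - ?S)"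
    by (intro bij_betw_combine 1 2 3) auto
  moreover have "?A \<union> (?S - ?A) \<union> - ?S = UNIV" "?B \<union> (?S - ?B) \<union> - ?S = UNIV" by auto
  ultimately have bij: "bij \<pi>" by simp
  have "image_mset \<pi> M = M'"
  proof (rule multiset_eqI)
    fix y
    obtain x where y: "y = \<pi> x" using bij by (metis bij_pointE)
    have "count (image_mset \<pi> M) y = count M x" unfolding y using bij by (simp add: count_image_mset_inj bij_is_inj)
    also have "\<dots> = count M' y"
    proof (cases "x \<in> ?A")
      case True
      then show ?thesis using h(2) by (simp add: y \<pi>_def)
    next
      case False
      have "\<pi> x \<notin> ?B"
      proof
        assume "\<pi> x \<in> ?B"
        then obtain x' where "x' \<in> ?A" "\<pi> x' = \<pi> x" using 1 by (metis bij_betw_imp_surj_on imageE)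
        then show False using False bij by (metis bij_pointE)
      qed
      then show ?thesis using False by (simp add: y not_in_iff)
    qed
    finally show "count (image_mset \<pi> M) y = count M' y" .
  qed
  then show ?thesis using bij that by blast
qed

lemma Lambda_exponents: "f \<in> Lambda \<Longrightarrow> exponents M = exponents M' \<Longrightarrow> f M = f M'"
  by (metis exponents_eq_bij Lambda_sym)

text \<open>The coefficients of a symmetric series depend on the exponents only, and the bounded
  degree leaves finitely many multisets of exponents.\<close>

lemma Lambda_decomp:
  assumes f: "f \<in> Lambda"
  obtains S c where "finite S" "\<And>l. l \<in> S \<Longrightarrow> int_partition l"
    "f = (\<lambda>M. \<Sum>l\<in>S. c l * augmented_monomial_sf l M)"
proof -
  obtain d where d: "\<And>M. f M \<noteq> 0 \<Longrightarrow> size M \<le> d" using Lambda_bound[OF f] by blast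
  define S where "S = exponents ` {M. f M \<noteq> 0}"
  define c where "c l = f (SOME M. exponents M = l) / aut_factor l" for l
  have "S \<subseteq> {l. set_mset l \<subseteq> {..d} \<and> size l \<le> d}"
  proof
    fix l assume l: "l \<in> S"
    then obtain M where M: "f M \<noteq> 0" "l = exponents M" by (auto simp: S_def)
    have "size l = card (set_mset M)" by (simp add: M exponents_def)
    also have "\<dots> \<le> size M" by (simp add: size_multiset_overloaded_eq) (metis One_nat_def Suc_leI card_eq_sum count_greater_zero_iff sum_mono)
    finally have 1: "size l \<le> d" using d[OF M(1)] by simp
    have "set_mset l \<subseteq> {..d}"
    proof
      fix j assume "j \<in># l"
      then obtain i where "j = count M i" by (auto simp: M exponents_def)
      then show "j \<in> {..d}" using d[OF M(1)] count_le_size[of M i] by simp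
    qed
    with 1 show "l \<in> {l. set_mset l \<subseteq> {..d} \<and> size l \<le> d}" by simp
  qed
  then have fin: "finite S" using finite_multisets_bounded[of "{..d}" d] finite_subset by blast
  show ?thesis
  proof (rule that[OF fin])
    show "int_partition l" if "l \<in> S" for l using that by (auto simp: S_def int_partition_exponents)
    show "f = (\<lambda>M. \<Sum>l\<in>S. c l * augmented_monomial_sf l M)"
    proof
      fix M
      have "(\<Sum>l\<in>S. c l * augmented_monomial_sf l M) = (\<Sum>l\<in>S. if l = exponents M then c l * aut_factor l else 0)"
        by (intro sum.cong) (auto simp: augmented_monomial)
      also have "\<dots> = (if exponents M \<in> S then f M else 0)"
      proof -
        have "exponents (SOME M'. exponents M' = exponents M) = exponents M"
          by (rule someI[of "\<lambda>M'. exponents M' = exponents M"]) simp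
        then have "f (SOME M'. exponents M' = exponents M) = f M" by (rule Lambda_exponents[OF f])
        then show ?thesis using fin aut_factor_pos[of "exponents M"] by (simp add: c_def)
      qed
      also have "\<dots> = f M" by (auto simp: S_def)
      finally show "f M = (\<Sum>l\<in>S. c l * augmented_monomial_sf l M)" by simp
    qed
  qed
qed

lemma Lambda_sum:
  assumes "finite S" "\<And>l. l \<in> S \<Longrightarrow> g l \<in> Lambda" shows "(\<lambda>M. \<Sum>l\<in>S. g l M) \<in> Lambda"
  using assms
proof (induction S rule: finite_induct)
  case empty
  show ?case using Lambda_cmult[OF Lambda_one, of 0] by simp
next
  case (insert x S)
  then show ?case using Lambda_add[of "g x" "\<lambda>M. \<Sum>l\<in>S. g l M"] by simp
qed

lemma Lambda_sum_mset:
  assumes "\<And>l. l \<in># S \<Longrightarrow> g l \<in> Lambda" shows "(\<lambda>M. \<Sum>l\<in>#S. g l M) \<in> Lambda"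
  using assms
proof (induction S)
  case empty
  show ?case using Lambda_cmult[OF Lambda_one, of 0] by simp
next
  case (add x S)
  then show ?case using Lambda_add[of "g x" "\<lambda>M. \<Sum>l\<in>#S. g l M"] by simp
qed

text \<open>Over the reals the power sums generate the algebra of symmetric functions.\<close>

lemma Lambda_induct [consumes 1, case_names one power_sum add cmult mult]:
  assumes f: "f \<in> Lambda" and one: "P sf_one"
    and ps: "\<And>k. k \<ge> 1 \<Longrightarrow> P (power_sum k)"
    and add: "\<And>f g. f \<in> Lambda \<Longrightarrow> g \<in> Lambda \<Longrightarrow> P f \<Longrightarrow> P g \<Longrightarrow> P (\<lambda>M. f M + g M)"
    and cmult: "\<And>c f. f \<in> Lambda \<Longrightarrow> P f \<Longrightarrow> P (\<lambda>M. c * f M)"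
    and mult: "\<And>f g. f \<in> Lambda \<Longrightarrow> g \<in> Lambda \<Longrightarrow> P f \<Longrightarrow> P g \<Longrightarrow> P (series_mult f g)"
  shows "P f"
proof -
  have zero: "P (\<lambda>_. 0)" using cmult[OF Lambda_one one, of 0] by simp
  have sum_mset: "P (\<lambda>M. \<Sum>j\<in>#S. g j M)" if "\<And>j. j \<in># S \<Longrightarrow> g j \<in> Lambda \<and> P (g j)"
    for S :: "nat multiset" and g :: "nat \<Rightarrow> series"
    using that
  proof (induction S)
    case (add x S)
    then show ?case using assms(4)[of "g x" "\<lambda>M. \<Sum>l\<in>#S. g l M"] Lambda_sum_mset[of S g] by simp
  qed (simp add: zero)
  \<comment> \<open>Induction on the number of parts: in the product of a power sum with an
    augmented monomial function, every term but the wanted one has fewer parts.\<close>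
  have aug: "P (augmented_monomial_sf l)" if "int_partition l" for l
    using that
  proof (induction "size l" arbitrary: l)
    case 0
    then show ?case using one by (simp add: augmented_empty)
  next
    case (Suc n)
    then obtain k l' where l: "l = add_mset k l'" by (metis size_eq_Suc_imp_eq_union)
    have k: "k \<ge> 1" "int_partition l'" using Suc.prems by (auto simp: int_partition_def l)
    let ?R = "\<lambda>M. \<Sum>j\<in>#l'. augmented_monomial_sf (add_mset (j + k) (l' - {#j#})) M"
    have "P ?R"
    proof (rule sum_mset)
      fix j assume j: "j \<in># l'"
      have "P (augmented_monomial_sf (add_mset (j + k) (l' - {#j#})))"
      proof (rule Suc.hyps(1))
        show "n = size (add_mset (j + k) (l' - {#j#}))" using Suc.hyps(2) j by (simp add: l size_Suc_Diff1)
        show "int_partition (add_mset (j + k) (l' - {#j#}))"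
          using k by (auto simp: int_partition_def dest: in_diffD)
      qed
      then show "augmented_monomial_sf (add_mset (j + k) (l' - {#j#})) \<in> Lambda
          \<and> P (augmented_monomial_sf (add_mset (j + k) (l' - {#j#})))"
        by (simp add: Lambda_augmented)
    qed
    moreover have "?R \<in> Lambda" by (intro Lambda_sum_mset Lambda_augmented)
    ultimately have R: "P (\<lambda>M. -1 * ?R M)" by (intro cmult)
    have R': "(\<lambda>M. -1 * ?R M) \<in> Lambda" by (intro Lambda_cmult Lambda_sum_mset Lambda_augmented)
    have "P (series_mult (power_sum k) (augmented_monomial_sf l'))"
      using Suc.hyps k by (intro mult ps Lambda_power_sum Lambda_augmented) (auto simp: l)
    then have "P (\<lambda>M. series_mult (power_sum k) (augmented_monomial_sf l') M + -1 * ?R M)"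
      by (intro add R R' Lambda_mult Lambda_power_sum Lambda_augmented)
    also have "(\<lambda>M. series_mult (power_sum k) (augmented_monomial_sf l') M + -1 * ?R M) = augmented_monomial_sf l"
      by (rule ext) (simp add: power_sum_mult_augmented[OF k(2,1)] l)
    finally show ?case .
  qed
  obtain S c where S: "finite S" "\<And>l. l \<in> S \<Longrightarrow> int_partition l"
    "f = (\<lambda>M. \<Sum>l\<in>S. c l * augmented_monomial_sf l M)" using Lambda_decomp[OF f] by blast
  have "P (\<lambda>M. \<Sum>l\<in>S. c l * augmented_monomial_sf l M)"
    using S(1,2)
  proof (induction S rule: finite_induct)
    case (insert x S)
    then have "P (\<lambda>M. c x * augmented_monomial_sf x M + (\<Sum>l\<in>S. c l * augmented_monomial_sf l M))"
      by (intro add Lambda_cmult Lambda_augmented Lambda_sum cmult aug) auto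
    then show ?case using insert.hyps by simp
  qed (simp add: zero)
  then show ?thesis using S(3) by simp
qed

subsection \<open>Evaluation at finitely many variables\<close>

definition monom_val :: "(nat \<Rightarrow> real) \<Rightarrow> nat multiset \<Rightarrow> real" where
  "monom_val x M = prod_mset (image_mset x M)"

text \<open>Summing over nonzero coefficients only makes the sum finite for each member of
  \<open>Lambda\<close> without naming a degree.\<close>

definition eval_series :: "nat \<Rightarrow> (nat \<Rightarrow> real) \<Rightarrow> series \<Rightarrow> real" where
  "eval_series n x f = (\<Sum>M | set_mset M \<subseteq> {..<n} \<and> f M \<noteq> 0. f M * monom_val x M)"

lemma monom_val_add: "monom_val x (A + B) = monom_val x A * monom_val x B"
  by (simp add: monom_val_def)

lemma eval_series_eq:
  assumes "\<And>M. set_mset M \<subseteq> {..<n} \<Longrightarrow> f M \<noteq> 0 \<Longrightarrow> size M \<le> d"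
  shows "eval_series n x f = (\<Sum>M | set_mset M \<subseteq> {..<n} \<and> size M \<le> d. f M * monom_val x M)"
  unfolding eval_series_def
  by (intro sum.mono_neutral_left finite_multisets_bounded) (auto simp: assms)

lemma eval_series_add:
  assumes "f \<in> Lambda" "g \<in> Lambda"
  shows "eval_series n x (\<lambda>M. f M + g M) = eval_series n x f + eval_series n x g"
proof -
  obtain d where d: "\<And>M. f M \<noteq> 0 \<Longrightarrow> size M \<le> d" using Lambda_bound[OF assms(1)] by blast
  obtain e where e: "\<And>M. g M \<noteq> 0 \<Longrightarrow> size M \<le> e" using Lambda_bound[OF assms(2)] by blast
  have 1: "size M \<le> max d e" if "f M \<noteq> 0" for M using d[OF that] by simp
  have 2: "size M \<le> max d e" if "g M \<noteq> 0" for M using e[OF that] by simp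
  have 3: "size M \<le> max d e" if "f M + g M \<noteq> 0" for M using 1[of M] 2[of M] that by (cases "f M = 0") auto
  show ?thesis
    by (simp add: eval_series_eq[where d = "max d e"] 1 2 3 algebra_simps sum.distrib)
qed

lemma eval_series_cmult:
  assumes "f \<in> Lambda" shows "eval_series n x (\<lambda>M. c * f M) = c * eval_series n x f"
proof -
  obtain d where d: "\<And>M. f M \<noteq> 0 \<Longrightarrow> size M \<le> d" using Lambda_bound[OF assms(1)] by blast
  then have "eval_series n x (\<lambda>M. c * f M) = (\<Sum>M | set_mset M \<subseteq> {..<n} \<and> size M \<le> d. c * f M * monom_val x M)"
    by (intro eval_series_eq) auto
  also have "\<dots> = c * eval_series n x f"
    using d by (simp add: eval_series_eq[where d = d] mult.assoc sum_distrib_left)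
  finally show ?thesis .
qed

lemma eval_series_one: "eval_series n x sf_one = 1"
proof -
  have "{M. set_mset M \<subseteq> {..<n} \<and> (of_bool (M = {#}) :: real) \<noteq> 0} = {{#}}" by auto
  then show ?thesis unfolding eval_series_def by (simp only:) (simp add: monom_val_def)
qed

text \<open>Factorizations of monomials correspond to pairs of monomials, and pairs beyond the two
  degree bounds contribute zero.\<close>

lemma eval_series_mult:
  assumes "f \<in> Lambda" "g \<in> Lambda"
  shows "eval_series n x (series_mult f g) = eval_series n x f * eval_series n x g"
proof -
  obtain d where d: "\<And>M. f M \<noteq> 0 \<Longrightarrow> size M \<le> d" using Lambda_bound[OF assms(1)] by blast
  obtain e where e: "\<And>M. g M \<noteq> 0 \<Longrightarrow> size M \<le> e" using Lambda_bound[OF assms(2)] by blast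
  define T where "T d = {M. set_mset M \<subseteq> {..<n} \<and> size M \<le> d}" for d
  have finT: "finite (T d)" for d unfolding T_def by (rule finite_multisets_bounded) simp
  have bound: "size M \<le> d + e" if nz: "series_mult f g M \<noteq> 0" for M
  proof -
    obtain A where "A \<subseteq># M" "f A \<noteq> 0" "g (M - A) \<noteq> 0" using nz by (rule series_mult_nonzero)
    then show ?thesis using d[of A] e[of "M - A"] size_Diff_submset[of A M] size_mset_mono[of A M] by simp
  qed
  let ?F = "\<lambda>A B. f A * monom_val x A * (g B * monom_val x B)"
  have "eval_series n x (series_mult f g) = (\<Sum>M\<in>T (d + e). series_mult f g M * monom_val x M)"
    unfolding T_def by (intro eval_series_eq bound)
  also have "\<dots> = (\<Sum>M\<in>T (d + e). \<Sum>A | A \<subseteq># M. ?F A (M - A))"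
    unfolding series_mult_def
  proof (intro sum.cong refl)
    fix M
    have "monom_val x A * monom_val x (M - A) = monom_val x M" if "A \<subseteq># M" for A
      using that by (simp flip: monom_val_add)
    then show "(\<Sum>A | A \<subseteq># M. f A * g (M - A)) * monom_val x M = (\<Sum>A | A \<subseteq># M. ?F A (M - A))"
      unfolding sum_distrib_right by (intro sum.cong) (auto simp: mult_ac)
  qed
  also have "\<dots> = (\<Sum>(M, A)\<in>(SIGMA M:T (d + e). {A. A \<subseteq># M}). ?F A (M - A))"
    by (rule sum.Sigma) (auto simp: finT finite_submultisets)
  also have "\<dots> = (\<Sum>(A, B)\<in>{(A, B). A + B \<in> T (d + e)}. ?F A B)"
    by (rule sum.reindex_bij_witness[where i = "\<lambda>(A, B). (A + B, A)" and j = "\<lambda>(M, A). (A, M - A)"]) auto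
  also have "\<dots> = (\<Sum>(A, B)\<in>T d \<times> T e. ?F A B)"
  proof (rule sum.mono_neutral_right)
    show "finite {(A, B). A + B \<in> T (d + e)}"
      by (rule finite_subset[of _ "T (d + e) \<times> T (d + e)"]) (use finT[of "d + e"] in \<open>auto simp: T_def\<close>)
    show "T d \<times> T e \<subseteq> {(A, B). A + B \<in> T (d + e)}" by (auto simp: T_def)
    show "\<forall>i\<in>{(A, B). A + B \<in> T (d + e)} - T d \<times> T e. (case i of (A, B) \<Rightarrow> ?F A B) = 0"
      using d e by (auto simp: T_def)
  qed
  also have "\<dots> = eval_series n x f * eval_series n x g"
    using d e by (simp add: eval_series_eq[where d = d] eval_series_eq[of n g e] T_def sum_product sum.cartesian_product)
  finally show ?thesis .
qed

lemma eval_series_power_sum: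
  assumes "k \<ge> 1" shows "eval_series n x (power_sum k) = (\<Sum>i<n. x i ^ k)"
proof -
  have "eval_series n x (power_sum k) = (\<Sum>M\<in>replicate_mset k ` {..<n}. power_sum k M * monom_val x M)"
    unfolding eval_series_def by (rule sum.cong) (use assms in \<open>auto simp: power_sum_def split: if_splits\<close>)
  also have "\<dots> = (\<Sum>i<n. power_sum k (replicate_mset k i) * monom_val x (replicate_mset k i))"
  proof (rule sum.reindex_cong[OF _ refl refl])
    show "inj_on (replicate_mset k) {..<n}"
    proof (rule inj_onI)
      fix i j assume "replicate_mset k i = replicate_mset k j"
      then have "count (replicate_mset k i) i = count (replicate_mset k j) i" by simp
      then show "i = j" using assms by (simp split: if_splits)
    qed
  qed
  also have "\<dots> = (\<Sum>i<n. x i ^ k)"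
    by (intro sum.cong) (auto simp: power_sum_def monom_val_def prod_mset_constant image_replicate_mset)
  finally show ?thesis .
qed

lemma eval_series_nonneg:
  assumes "\<And>M. f M \<ge> 0" "\<And>i. i < n \<Longrightarrow> x i \<ge> 0" shows "eval_series n x f \<ge> 0"
proof -
  have "monom_val x M \<ge> 0" if "set_mset M \<subseteq> {..<n}" for M
    using that assms(2) unfolding monom_val_def by (induction M) auto
  then show ?thesis unfolding eval_series_def by (intro sum_nonneg mult_nonneg_nonneg assms) auto
qed

subsection \<open>The characters of Kingman's simplex\<close>

lemma unital_algebra_homD:
  assumes "unital_algebra_hom \<phi>"
  shows "\<phi> sf_one = 1" "f \<in> Lambda \<Longrightarrow> g \<in> Lambda \<Longrightarrow> \<phi> (\<lambda>M. f M + g M) = \<phi> f + \<phi> g"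
    "f \<in> Lambda \<Longrightarrow> \<phi> (\<lambda>M. c * f M) = c * \<phi> f"
    "f \<in> Lambda \<Longrightarrow> g \<in> Lambda \<Longrightarrow> \<phi> (series_mult f g) = \<phi> f * \<phi> g"
  using assms unfolding unital_algebra_hom_def by blast+

lemma unital_algebra_hom_eqI:
  assumes \<phi>: "unital_algebra_hom \<phi>" and \<psi>: "unital_algebra_hom \<psi>"
    and ps: "\<And>k. k \<ge> 1 \<Longrightarrow> \<phi> (power_sum k) = \<psi> (power_sum k)" and f: "f \<in> Lambda"
  shows "\<phi> f = \<psi> f"
  using f by (induction rule: Lambda_induct)
    (simp_all only: unital_algebra_homD[OF \<phi>] unital_algebra_homD[OF \<psi>] ps)

lemma unital_algebra_hom_sum:
  assumes \<phi>: "unital_algebra_hom \<phi>" and "finite S" "\<And>l. l \<in> S \<Longrightarrow> g l \<in> Lambda"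
  shows "\<phi> (\<lambda>M. \<Sum>l\<in>S. c l * g l M) = (\<Sum>l\<in>S. c l * \<phi> (g l))"
  using assms(2,3)
proof (induction S rule: finite_induct)
  case empty
  show ?case using unital_algebra_homD(3)[OF \<phi> Lambda_one, of 0] by simp
next
  case (insert x S)
  have "\<phi> (\<lambda>M. c x * g x M + (\<Sum>l\<in>S. c l * g l M)) = \<phi> (\<lambda>M. c x * g x M) + \<phi> (\<lambda>M. \<Sum>l\<in>S. c l * g l M)"
    using insert.prems insert.hyps by (intro unital_algebra_homD(2)[OF \<phi>] Lambda_cmult Lambda_sum) auto
  then show ?case using insert by (simp add: unital_algebra_homD(3)[OF \<phi>])
qed

lemma unital_algebra_hom_sum_mset:
  assumes \<phi>: "unital_algebra_hom \<phi>" and "\<And>l. l \<in># S \<Longrightarrow> g l \<in> Lambda"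
  shows "\<phi> (\<lambda>M. \<Sum>l\<in>#S. g l M) = (\<Sum>l\<in>#S. \<phi> (g l))"
  using assms(2)
proof (induction S)
  case empty
  show ?case using unital_algebra_homD(3)[OF \<phi> Lambda_one, of 0] by simp
next
  case (add x S)
  have "\<phi> (\<lambda>M. g x M + (\<Sum>l\<in>#S. g l M)) = \<phi> (g x) + \<phi> (\<lambda>M. \<Sum>l\<in>#S. g l M)"
    using add.prems by (intro unital_algebra_homD(2)[OF \<phi>] Lambda_sum_mset) auto
  then show ?case using add by simp
qed

lemma unital_algebra_hom_augmented_rec:
  assumes \<phi>: "unital_algebra_hom \<phi>" and l: "int_partition l" and k: "k \<ge> 1"
  shows "\<phi> (power_sum k) * \<phi> (augmented_monomial_sf l) = \<phi> (augmented_monomial_sf (add_mset k l))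
     + (\<Sum>j\<in>#l. \<phi> (augmented_monomial_sf (add_mset (j + k) (l - {#j#}))))"
proof -
  have "\<phi> (power_sum k) * \<phi> (augmented_monomial_sf l) = \<phi> (series_mult (power_sum k) (augmented_monomial_sf l))"
    by (simp add: unital_algebra_homD(4)[OF \<phi>] Lambda_power_sum Lambda_augmented)
  also have "series_mult (power_sum k) (augmented_monomial_sf l) = (\<lambda>M. augmented_monomial_sf (add_mset k l) M
     + (\<Sum>j\<in>#l. augmented_monomial_sf (add_mset (j + k) (l - {#j#})) M))"
    by (rule ext) (rule power_sum_mult_augmented[OF l k])
  also have "\<phi> \<dots> = \<phi> (augmented_monomial_sf (add_mset k l))
     + (\<Sum>j\<in>#l. \<phi> (augmented_monomial_sf (add_mset (j + k) (l - {#j#}))))"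
    using unital_algebra_hom_sum_mset[OF \<phi>, of l "\<lambda>j. augmented_monomial_sf (add_mset (j + k) (l - {#j#}))"]
    by (subst unital_algebra_homD(2)[OF \<phi>]) (auto intro!: Lambda_augmented Lambda_sum_mset)
  finally show ?thesis .
qed

lemma nablaD:
  assumes "p \<in> nabla"
  shows "\<And>i. p (Suc i) \<le> p i" "\<And>i. 0 \<le> p i" "summable p" "suminf p \<le> 1"
  using assms by (auto simp: nabla_def)

lemma nabla_sum_le: assumes "p \<in> nabla" "finite I" shows "(\<Sum>i\<in>I. p i) \<le> 1"
  using sum_le_suminf[OF nablaD(3)[OF assms(1)] assms(2)] nablaD[OF assms(1)] by (meson order_trans)

text \<open>The first \<open>i + 1\<close> coordinates are all at least \<open>p i\<close> and sum
  to at most 1. The bound does not depend on \<open>p\<close>, hence the uniform convergence of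
  power sums of degree at least 2 and the finiteness of rounded points.\<close>

lemma nabla_le_inverse: assumes "p \<in> nabla" shows "p i \<le> 1 / real (Suc i)"
proof -
  have mono: "p i \<le> p j" if "j \<le> i" for j
    using that by (induction rule: inc_induct) (auto intro: order_trans nablaD(1)[OF assms])
  have "real (Suc i) * p i = (\<Sum>j<Suc i. p i)" by simp
  also have "\<dots> \<le> (\<Sum>j<Suc i. p j)" using mono by (intro sum_mono) auto
  also have "\<dots> \<le> 1" by (rule nabla_sum_le[OF assms]) simp
  finally show ?thesis by (simp add: field_simps)
qed

lemma nabla_le_1: "p \<in> nabla \<Longrightarrow> p i \<le> 1"
  using nabla_le_inverse[of p i] by (smt (verit) divide_le_eq_1 of_nat_1 of_nat_Suc of_nat_0_le_iff)

lemma nabla_power_bound: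
  assumes "p \<in> nabla" "k \<ge> 2" shows "p i ^ k \<le> 1 / real (Suc i) ^ 2"
proof -
  have "p i ^ k \<le> p i ^ 2" using assms nablaD(2)[OF assms(1)] nabla_le_1 by (intro power_decreasing) auto
  also have "\<dots> \<le> (1 / real (Suc i)) ^ 2" using assms nablaD(2) nabla_le_inverse by (intro power_mono) auto
  finally show ?thesis by (simp add: power_divide)
qed

lemma summable_inverse_squares: "summable (\<lambda>i. 1 / real (Suc i) ^ 2)"
  using inverse_squares_sums by (simp add: sums_iff)

lemma nabla_summable_power: "p \<in> nabla \<Longrightarrow> k \<ge> 2 \<Longrightarrow> summable (\<lambda>i. p i ^ k)"
  by (rule summable_comparison_test'[OF summable_inverse_squares, of 0])
     (use nabla_power_bound nablaD(2) in auto)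

text \<open>A point of Kingman's simplex is approximated by finitely many atoms summing to one: the missing
  mass is spread evenly over many atoms.\<close>

definition dust :: "(nat \<Rightarrow> real) \<Rightarrow> nat \<Rightarrow> nat \<Rightarrow> real" where
  "dust p N i = (if i < N then p i else (1 - (\<Sum>j<N. p j)) / real N)"

lemma dust_nonneg: "p \<in> nabla \<Longrightarrow> dust p N i \<ge> 0"
  using nabla_sum_le[of p "{..<N}"] nablaD(2)[of p] by (simp add: dust_def)

lemma sum_dust: "(\<Sum>i<2 * N. dust p N i ^ k) = (\<Sum>i<N. p i ^ k) + real N * ((1 - (\<Sum>j<N. p j)) / real N) ^ k"
proof -
  have "{..<2 * N} = {..<N} \<union> {N..<2 * N}" by auto
  then have "(\<Sum>i<2 * N. dust p N i ^ k) = (\<Sum>i<N. dust p N i ^ k) + (\<Sum>i\<in>{N..<2 * N}. dust p N i ^ k)"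
    by (simp add: sum.union_disjoint ivl_disj_int)
  then show ?thesis by (simp add: dust_def)
qed

lemma sum_dust_1: "N \<ge> 1 \<Longrightarrow> (\<Sum>i<2 * N. dust p N i ^ 1) = 1"
  unfolding sum_dust by simp

text \<open>The \<open>N\<close> equal atoms have total mass at most 1, so they add at most
  \<open>1 / N\<close> to a power sum of degree at least 2, while in degree 1 they restore the
  missing mass.\<close>

lemma sum_dust_lim:
  assumes p: "p \<in> nabla" and k: "k \<ge> 2"
  shows "(\<lambda>N. \<Sum>i<2 * N. dust p N i ^ k) \<longlonglongrightarrow> suminf (\<lambda>i. p i ^ k)"
proof -
  have "(\<lambda>N. real N * ((1 - (\<Sum>j<N. p j)) / real N) ^ k) \<longlonglongrightarrow> 0"
  proof (rule tendsto_sandwich[OF _ _ tendsto_const lim_1_over_n])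
    show "\<forall>\<^sub>F N in sequentially. 0 \<le> real N * ((1 - (\<Sum>j<N. p j)) / real N) ^ k"
      using nabla_sum_le[OF p] by (intro always_eventually allI mult_nonneg_nonneg zero_le_power divide_nonneg_nonneg) auto
    show "\<forall>\<^sub>F N in sequentially. real N * ((1 - (\<Sum>j<N. p j)) / real N) ^ k \<le> 1 / real N"
    proof (rule eventually_mono[OF eventually_gt_at_top[of 0]])
      fix N :: nat assume N: "0 < N"
      define s where "s = 1 - (\<Sum>j<N. p j)"
      have s: "0 \<le> s" "s \<le> 1" unfolding s_def using nabla_sum_le[OF p, of "{..<N}"] nablaD(2)[OF p] by (auto intro: sum_nonneg)
      have "s / real N \<le> 1 / real N" using s N by (intro divide_right_mono) auto
      moreover have "1 / real N \<le> 1" using N by simp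
      ultimately have "(s / real N) ^ k \<le> (s / real N) ^ 2" using s k by (intro power_decreasing) auto
      also have "\<dots> \<le> (1 / real N) ^ 2" using s N by (intro power_mono divide_right_mono) auto
      finally have "real N * (s / real N) ^ k \<le> real N * (1 / real N) ^ 2" by (intro mult_left_mono) auto
      also have "\<dots> = 1 / real N" using N by (simp add: power2_eq_square)
      finally show "real N * ((1 - (\<Sum>j<N. p j)) / real N) ^ k \<le> 1 / real N" unfolding s_def .
    qed
  qed
  moreover have "(\<lambda>N. \<Sum>i<N. p i ^ k) \<longlonglongrightarrow> suminf (\<lambda>i. p i ^ k)"
    using nabla_summable_power[OF p k] by (simp add: summable_LIMSEQ)
  ultimately show ?thesis unfolding sum_dust using tendsto_add by fastforce
qed

text \<open>This limit of evaluations shows that the homomorphism described by \<open>chi\<close>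
  exists. As a limit of evaluations at nonnegative points it is also visibly nonnegative on series
  with nonnegative coefficients.\<close>

definition chi_lim :: "(nat \<Rightarrow> real) \<Rightarrow> series \<Rightarrow> real" where
  "chi_lim p f = lim (\<lambda>N. eval_series (2 * N) (dust p N) f)"

text \<open>Convergence passes to sums, multiples and products, so it is only to be checked for the
  generating power sums.\<close>

lemma chi_lim:
  assumes p: "p \<in> nabla" and f: "f \<in> Lambda"
  shows "(\<lambda>N. eval_series (2 * N) (dust p N) f) \<longlonglongrightarrow> chi_lim p f"
proof -
  have "convergent (\<lambda>N. eval_series (2 * N) (dust p N) f)" using f
  proof (induction rule: Lambda_induct)
    case one
    then show ?case by (simp add: eval_series_one convergent_const)
  next
    case (power_sum k)
    show ?case
    proof (cases "k = 1")
      case True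
      have "(\<lambda>N. eval_series (2 * N) (dust p N) (power_sum k)) \<longlonglongrightarrow> 1"
        by (rule tendsto_eventually, rule eventually_mono[OF eventually_ge_at_top[of 1]])
           (unfold True, subst eval_series_power_sum, use sum_dust_1 in auto)
      then show ?thesis by (rule convergentI)
    next
      case False
      then show ?thesis using sum_dust_lim[OF p, of k] power_sum by (auto simp: eval_series_power_sum intro: convergentI)
    qed
  next
    case (add f g)
    then show ?case by (simp add: eval_series_add convergent_add)
  next
    case (cmult c f)
    then show ?case by (auto simp: eval_series_cmult convergent_def intro: tendsto_mult_left)
  next
    case (mult f g)
    then show ?case by (simp add: eval_series_mult convergent_mult)
  qed
  then show ?thesis unfolding chi_lim_def by (simp add: convergent_LIMSEQ_iff)
qed

lemma chi_limI: "p \<in> nabla \<Longrightarrow> f \<in> Lambda \<Longrightarrow> (\<lambda>N. eval_series (2 * N) (dust p N) f) \<longlonglongrightarrow> c \<Longrightarrow> chi_lim p f = c"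
  using chi_lim LIMSEQ_unique by blast

lemma chi_lim_hom:
  assumes p: "p \<in> nabla"
  shows "unital_algebra_hom (restrict (chi_lim p) Lambda)"
proof -
  note L = chi_lim[OF p]
  have "chi_lim p (\<lambda>M. f M + g M) = chi_lim p f + chi_lim p g" if "f \<in> Lambda" "g \<in> Lambda" for f g
    using that tendsto_add[OF L L] by (intro chi_limI p Lambda_add) (simp_all add: eval_series_add)
  moreover have "chi_lim p (\<lambda>M. c * f M) = c * chi_lim p f" if "f \<in> Lambda" for c f
    using that tendsto_mult_left[OF L] by (intro chi_limI p Lambda_cmult) (simp_all add: eval_series_cmult)
  moreover have "chi_lim p (series_mult f g) = chi_lim p f * chi_lim p g" if "f \<in> Lambda" "g \<in> Lambda" for f g
    using that tendsto_mult[OF L L] by (intro chi_limI p Lambda_mult) (simp_all add: eval_series_mult)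
  moreover have "chi_lim p sf_one = 1"
    by (intro chi_limI p Lambda_one) (simp add: eval_series_one)
  ultimately show ?thesis
    unfolding unital_algebra_hom_def by (simp add: Lambda_one Lambda_add Lambda_cmult Lambda_mult)
qed

lemma chi_lim_power_sum:
  assumes p: "p \<in> nabla"
  shows "chi_lim p (power_sum 1) = 1" "k \<ge> 2 \<Longrightarrow> chi_lim p (power_sum k) = suminf (\<lambda>i. p i ^ k)"
proof -
  have "(\<lambda>N. eval_series (2 * N) (dust p N) (power_sum 1)) \<longlonglongrightarrow> 1"
    by (rule tendsto_eventually, rule eventually_mono[OF eventually_ge_at_top[of 1]])
       (subst eval_series_power_sum, use sum_dust_1 in auto)
  then show "chi_lim p (power_sum 1) = 1" by (intro chi_limI p Lambda_power_sum)
  show "k \<ge> 2 \<Longrightarrow> chi_lim p (power_sum k) = suminf (\<lambda>i. p i ^ k)"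
    using sum_dust_lim[OF p, of k] by (intro chi_limI p Lambda_power_sum) (simp add: eval_series_power_sum)
qed

text \<open>Uniqueness holds because the power sums generate \<open>Lambda\<close> and
  extensionality fixes the values outside it.\<close>

lemma chi_eq:
  assumes p: "p \<in> nabla" shows "chi p = restrict (chi_lim p) Lambda"
  unfolding chi_def
proof (rule the_equality)
  show "restrict (chi_lim p) Lambda \<in> extensional Lambda \<and> unital_algebra_hom (restrict (chi_lim p) Lambda) \<and>
    restrict (chi_lim p) Lambda (power_sum 1) = 1 \<and>
    (\<forall>k\<ge>2. restrict (chi_lim p) Lambda (power_sum k) = suminf (\<lambda>i. p i ^ k))"
    using chi_lim_hom[OF p] chi_lim_power_sum[OF p] Lambda_power_sum by simp
next
  fix \<phi> assume \<phi>: "\<phi> \<in> extensional Lambda \<and> unital_algebra_hom \<phi> \<and> \<phi> (power_sum 1) = 1 \<and>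
    (\<forall>k\<ge>2. \<phi> (power_sum k) = suminf (\<lambda>i. p i ^ k))"
  have "\<phi> (power_sum k) = restrict (chi_lim p) Lambda (power_sum k)" if "k \<ge> 1" for k
    using \<phi> chi_lim_power_sum[OF p] Lambda_power_sum that by (cases "k = 1") auto
  then have "\<phi> f = restrict (chi_lim p) Lambda f" if "f \<in> Lambda" for f
    using \<phi> chi_lim_hom[OF p] that unital_algebra_hom_eqI[of \<phi> "restrict (chi_lim p) Lambda" f] by blast
  then show "\<phi> = restrict (chi_lim p) Lambda"
    using \<phi> extensionalityI[of \<phi> Lambda "restrict (chi_lim p) Lambda"] restrict_extensional by blast
qed

lemma chi_hom: "p \<in> nabla \<Longrightarrow> unital_algebra_hom (chi p)"
  using chi_lim_hom chi_eq by simp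

lemma chi_power_sum_1: "p \<in> nabla \<Longrightarrow> chi p (power_sum (Suc 0)) = 1"
  using chi_lim_power_sum(1) chi_eq Lambda_power_sum by simp

lemma chi_power_sum: "p \<in> nabla \<Longrightarrow> k \<ge> 2 \<Longrightarrow> chi p (power_sum k) = suminf (\<lambda>i. p i ^ k)"
  using chi_lim_power_sum(2) chi_eq Lambda_power_sum by simp

lemma chi_nonneg:
  assumes "p \<in> nabla" "f \<in> Lambda" "\<And>M. f M \<ge> 0" shows "chi p f \<ge> 0"
proof -
  have "chi_lim p f \<ge> 0"
    by (rule LIMSEQ_le_const[OF chi_lim[OF assms(1,2)]]) (use eval_series_nonneg dust_nonneg assms in blast)
  then show ?thesis using assms chi_eq by simp
qed

definition cval :: "(nat \<Rightarrow> real) \<Rightarrow> nat multiset \<Rightarrow> real" where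
  "cval p l = chi p (augmented_monomial_sf l)"

lemma cval_empty: "p \<in> nabla \<Longrightarrow> cval p {#} = 1"
  using unital_algebra_homD(1)[OF chi_hom] by (simp add: cval_def augmented_empty)

lemma cval_nonneg: "p \<in> nabla \<Longrightarrow> cval p l \<ge> 0"
  unfolding cval_def
  by (rule chi_nonneg) (auto simp: Lambda_augmented augmented_monomial aut_factor_pos less_imp_le)

lemma cval_rec:
  assumes "p \<in> nabla" "int_partition l" "k \<ge> 1"
  shows "cval p (add_mset k l) = chi p (power_sum k) * cval p l - (\<Sum>j\<in>#l. cval p (add_mset (j + k) (l - {#j#})))"
  using unital_algebra_hom_augmented_rec[OF chi_hom[OF assms(1)] assms(2,3)] by (simp add: cval_def)

lemma cval_harmonic:
  assumes "p \<in> nabla" "int_partition l"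
  shows "cval p l = cval p (add_mset 1 l) + (\<Sum>j\<in>#l. cval p (add_mset (Suc j) (l - {#j#})))"
  using cval_rec[OF assms, of 1] chi_power_sum_1[OF assms(1)] by simp

text \<open>The scheme that fits \<open>cval_rec\<close>: each partition on the right-hand side has
  fewer parts than \<open>add_mset k l\<close>.\<close>

lemma partition_rec_induct [consumes 1, case_names empty add]:
  assumes "int_partition l" and "P {#}"
    and "\<And>k l. int_partition l \<Longrightarrow> k \<ge> 1 \<Longrightarrow> P l \<Longrightarrow> (\<And>j. j \<in># l \<Longrightarrow> P (add_mset (j + k) (l - {#j#}))) \<Longrightarrow> P (add_mset k l)"
  shows "P l"
  using assms(1)
proof (induction "size l" arbitrary: l)
  case 0
  then have "l = {#}" by simp
  then show ?case using assms(2) by (simp only:)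
next
  case (Suc n)
  then obtain k l' where l: "l = add_mset k l'" by (metis size_eq_Suc_imp_eq_union)
  have k: "k \<ge> 1" "int_partition l'" using Suc.prems by (auto simp: int_partition_def l)
  have "P (add_mset (j + k) (l' - {#j#}))" if "j \<in># l'" for j
  proof (rule Suc.hyps(1))
    show "n = size (add_mset (j + k) (l' - {#j#}))" using Suc.hyps(2) that by (simp add: l size_Suc_Diff1)
    show "int_partition (add_mset (j + k) (l' - {#j#}))" using k by (auto simp: int_partition_def dest: in_diffD)
  qed
  moreover have "P l'" using Suc.hyps(2) k(2) by (intro Suc.hyps(1)) (simp_all add: l)
  ultimately show ?case unfolding l by (intro assms(3)[OF k(2) k(1)])
qed

subsection \<open>Kingman's simplex\<close>

text \<open>Bounding every partial sum replaces the condition on the infinite sum by closed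
  conditions on finitely many coordinates, inside a compact cube.\<close>

lemma compact_nabla: "compact nabla"
proof -
  have "compactin (product_topology (\<lambda>_::nat. euclideanreal) UNIV) (PiE UNIV (\<lambda>_. {0..1}))"
    by (simp add: compactin_PiE compactin_euclidean_iff)
  then have cube: "compact (PiE UNIV (\<lambda>_::nat. {0..1::real}))"
    by (simp add: euclidean_product_topology compactin_euclidean_iff)
  have eq: "nabla = PiE UNIV (\<lambda>_. {0..1}) \<inter> ((\<Inter>i. {p. p (Suc i) \<le> p i}) \<inter> (\<Inter>n. {p. (\<Sum>i<n. p i) \<le> 1}))"
  proof (intro equalityI subsetI)
    fix p :: "nat \<Rightarrow> real" assume p: "p \<in> nabla"
    then have "(\<Sum>i<n. p i) \<le> 1" for n by (rule nabla_sum_le) simp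
    then show "p \<in> PiE UNIV (\<lambda>_. {0..1}) \<inter> ((\<Inter>i. {p. p (Suc i) \<le> p i}) \<inter> (\<Inter>n. {p. (\<Sum>i<n. p i) \<le> 1}))"
      using nablaD[OF p] nabla_le_1[OF p] by auto
  next
    fix p :: "nat \<Rightarrow> real"
    assume p: "p \<in> PiE UNIV (\<lambda>_. {0..1}) \<inter> ((\<Inter>i. {p. p (Suc i) \<le> p i}) \<inter> (\<Inter>n. {p. (\<Sum>i<n. p i) \<le> 1}))"
    then have nn: "0 \<le> p i" and le: "(\<Sum>i<n. p i) \<le> 1" for i n by auto
    then have s: "summable p" by (intro summableI_nonneg_bounded)
    then have "suminf p \<le> 1" using le by (intro suminf_le_const)
    then show "p \<in> nabla" using p s nn by (auto simp: nabla_def)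
  qed
  have cl: "closed ((\<Inter>i. {p. p (Suc i) \<le> p i}) \<inter> (\<Inter>n. {p. (\<Sum>i<n. p i) \<le> 1}) :: (nat \<Rightarrow> real) set)"
    by (intro closed_Int closed_INT ballI closed_Collect_le continuous_on_sum continuous_on_const continuous_on_product_coordinates)
  show ?thesis unfolding eq by (rule compact_Int_closed[OF cube cl])
qed

text \<open>The terms are bounded by \<open>1 / (i + 1)^2\<close> uniformly on the simplex. The sum
  of the coordinates itself is not continuous, as mass may spread over ever smaller coordinates; the
  value 1 prescribed by \<open>chi\<close> in degree 1 avoids this.\<close>

lemma continuous_on_power_sum_nabla:
  assumes "k \<ge> 2" shows "continuous_on nabla (\<lambda>p. suminf (\<lambda>i. p i ^ k))"
proof (rule uniform_limit_theorem)
  show "uniform_limit nabla (\<lambda>n p. \<Sum>i<n. p i ^ k) (\<lambda>p. suminf (\<lambda>i. p i ^ k)) sequentially"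
    by (rule Weierstrass_m_test[OF _ summable_inverse_squares])
       (use nabla_power_bound[OF _ assms] nablaD(2) in auto)
  show "\<forall>\<^sub>F n in sequentially. continuous_on nabla (\<lambda>p. \<Sum>i<n. p i ^ k)"
    by (intro always_eventually allI continuous_on_sum continuous_on_power)
       (rule continuous_on_subset[OF continuous_on_product_coordinates], simp)
qed simp

lemma continuous_on_chi_power_sum:
  assumes "k \<ge> 1" shows "continuous_on nabla (\<lambda>p. chi p (power_sum k))"
proof (cases "k = 1")
  case True
  then show ?thesis by (subst continuous_on_cong[OF refl, where g = "\<lambda>_. 1"]) (auto simp: chi_power_sum_1)
next
  case False
  then show ?thesis using assms continuous_on_power_sum_nabla[of k]
    by (subst continuous_on_cong[OF refl, where g = "\<lambda>p. suminf (\<lambda>i. p i ^ k)"]) (auto simp: chi_power_sum)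
qed

lemma continuous_on_cval:
  assumes "int_partition l" shows "continuous_on nabla (\<lambda>p. cval p l)"
  using assms
proof (induction rule: partition_rec_induct)
  case empty
  then show ?case by (subst continuous_on_cong[OF refl, where g = "\<lambda>_. 1"]) (auto simp: cval_empty)
next
  case (add k l)
  have "continuous_on nabla (\<lambda>p. chi p (power_sum k) * cval p l
     - (\<Sum>j\<in>set_mset l. real (count l j) * cval p (add_mset (j + k) (l - {#j#}))))"
    by (intro continuous_intros continuous_on_chi_power_sum add)
  then show ?case
    using add.hyps
    by (subst continuous_on_cong[OF refl, where g = "\<lambda>p. chi p (power_sum k) * cval p l
     - (\<Sum>j\<in>set_mset l. real (count l j) * cval p (add_mset (j + k) (l - {#j#})))"])
       (auto simp: cval_rec sum_mset_count)
qed

lemma chi_decomp: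
  assumes "f \<in> Lambda"
  obtains S c where "finite S" "\<And>l. l \<in> S \<Longrightarrow> int_partition l" "\<And>p. p \<in> nabla \<Longrightarrow> chi p f = (\<Sum>l\<in>S. c l * cval p l)"
proof -
  obtain S c where S: "finite S" "\<And>l. l \<in> S \<Longrightarrow> int_partition l"
    "f = (\<lambda>M. \<Sum>l\<in>S. c l * augmented_monomial_sf l M)" using Lambda_decomp[OF assms] by blast
  then have "chi p f = (\<Sum>l\<in>S. c l * cval p l)" if "p \<in> nabla" for p
    unfolding cval_def S(3) using that Lambda_augmented S(1) by (intro unital_algebra_hom_sum chi_hom)
  then show ?thesis using S that by blast
qed

lemma continuous_on_chi:
  assumes "f \<in> Lambda" shows "continuous_on nabla (\<lambda>p. chi p f)"
proof -
  obtain S c where S: "finite S" "\<And>l. l \<in> S \<Longrightarrow> int_partition l"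
    "\<And>p. p \<in> nabla \<Longrightarrow> chi p f = (\<Sum>l\<in>S. c l * cval p l)" using chi_decomp[OF assms] by blast
  have "continuous_on nabla (\<lambda>p. \<Sum>l\<in>S. c l * cval p l)"
    by (intro continuous_intros continuous_on_cval S)
  then show ?thesis
    by (subst continuous_on_cong[OF refl, where g = "\<lambda>p. \<Sum>l\<in>S. c l * cval p l"]) (auto simp: S)
qed

text \<open>At the first coordinate where two points differ, the larger value dominates the high power sums.\<close>

lemma nabla_separated_aux:
  assumes p: "p \<in> nabla" and q: "q \<in> nabla" and eq: "\<And>k. k \<ge> 2 \<Longrightarrow> suminf (\<lambda>i. p i ^ k) = suminf (\<lambda>i. q i ^ k)"
    and i: "\<And>j. j < i \<Longrightarrow> p j = q j" "q i < p i"
  shows False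
proof -
  have q0: "0 \<le> q i" using nablaD(2)[OF q] .
  have mono: "q j \<le> q i" if "i \<le> j" for j
    using that by (induction rule: dec_induct) (auto intro: order_trans nablaD(1)[OF q])
  \<comment> \<open>Equal power sums and equal earlier coordinates make the tails from
    \<open>i\<close> on agree. In the tail of \<open>q\<close>, \<open>k\<close> factors are bounded
    by \<open>q i\<close> and one by 1, which leaves a mass of at most 1.\<close>
  have main: "p i ^ (k + 2) \<le> q i ^ k" for k
  proof -
    have sp: "summable (\<lambda>j. p j ^ (k + 2))" and sq: "summable (\<lambda>j. q j ^ (k + 2))" and sq2: "summable (\<lambda>j. q j)"
      using p q nabla_summable_power[of _ "k + 2"] nablaD(3) by auto
    have "p i ^ (k + 2) \<le> suminf (\<lambda>j. p (j + i) ^ (k + 2))"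
      using sum_le_suminf[OF summable_ignore_initial_segment[OF sp, of i], of "{0}"] nablaD(2)[OF p] by simp
    also have "\<dots> = suminf (\<lambda>j. q (j + i) ^ (k + 2))"
      using suminf_minus_initial_segment[OF sp, of i] suminf_minus_initial_segment[OF sq, of i] eq[of "k + 2"] i(1) by simp
    also have "\<dots> \<le> suminf (\<lambda>j. q i ^ k * q (j + i))"
    proof (rule suminf_le)
      show "q (j + i) ^ (k + 2) \<le> q i ^ k * q (j + i)" for j
      proof -
        have "q (j + i) ^ k \<le> q i ^ k" using mono[of "j + i"] nablaD(2)[OF q] by (intro power_mono) auto
        moreover have "q (j + i) ^ 2 \<le> q (j + i) ^ 1"
          using nablaD(2)[OF q] nabla_le_1[OF q] by (intro power_decreasing) auto
        ultimately have "q (j + i) ^ k * q (j + i) ^ 2 \<le> q i ^ k * q (j + i) ^ 1"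
          using nablaD(2)[OF q] by (intro mult_mono) auto
        then show ?thesis unfolding power_add power_one_right .
      qed
    qed (intro summable_ignore_initial_segment sq, intro summable_mult summable_ignore_initial_segment sq2)
    also have "\<dots> = q i ^ k * suminf (\<lambda>j. q (j + i))"
      by (intro suminf_mult summable_ignore_initial_segment sq2)
    also have "suminf (\<lambda>j. q (j + i)) \<le> 1"
      using suminf_minus_initial_segment[OF sq2, of i] nablaD(4)[OF q] sum_nonneg[of "{..<i}" q] nablaD(2)[OF q] by simp
    then have "q i ^ k * suminf (\<lambda>j. q (j + i)) \<le> q i ^ k * 1" using q0 by (intro mult_left_mono) auto
    finally show ?thesis by simp
  qed
  show False
  proof (cases "q i = 0")
    case True
    then show False using main[of 1] i(2) by (simp add: not_less[symmetric])
  next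
    case False
    then have q1: "q i > 0" using q0 by simp
    obtain k where k: "1 / p i ^ 2 < (p i / q i) ^ k"
      using real_arch_pow[of "p i / q i"] q1 i(2) by auto
    have "p i ^ (k + 2) = p i ^ k * p i ^ 2" by (rule power_add)
    then have "(p i / q i) ^ k \<le> 1 / p i ^ 2"
      using main[of k] q1 i(2) by (simp add: power_divide field_simps power2_eq_square)
    then show False using k by simp
  qed
qed

lemma nabla_separated:
  assumes p: "p \<in> nabla" and q: "q \<in> nabla" and eq: "\<And>k. k \<ge> 2 \<Longrightarrow> suminf (\<lambda>i. p i ^ k) = suminf (\<lambda>i. q i ^ k)"
  shows "p = q"
proof (rule ccontr)
  assume "p \<noteq> q"
  then have ex: "\<exists>i. p i \<noteq> q i" by auto
  define i where "i = (LEAST i. p i \<noteq> q i)"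
  have i: "p i \<noteq> q i" unfolding i_def using ex by (rule LeastI_ex)
  have j: "p j = q j" if "j < i" for j using that not_less_Least unfolding i_def by blast
  show False
  proof (cases "q i < p i")
    case True
    then show False using nabla_separated_aux[OF p q eq j] by blast
  next
    case False
    then have "p i < q i" using i by simp
    then show False using nabla_separated_aux[OF q p eq[symmetric] j[symmetric]] by blast
  qed
qed

text \<open>Multiplicativity of \<open>chi p\<close> makes these functions of \<open>p\<close> an
  algebra, and the power sums of degree at least 2 separate points.\<close>

lemma chi_dense:
  assumes f: "continuous_on nabla f" and e: "e > 0"
  obtains g where "g \<in> Lambda" "\<And>p. p \<in> nabla \<Longrightarrow> \<bar>f p - chi p g\<bar> < e"
proof -
  interpret R: function_ring_on "{h. \<exists>g\<in>Lambda. \<forall>p\<in>nabla. h p = chi p g}" nabla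
  proof
    show "compact nabla" by (rule compact_nabla)
    show "continuous_on nabla h" if "h \<in> {h. \<exists>g\<in>Lambda. \<forall>p\<in>nabla. h p = chi p g}" for h
      using that continuous_on_chi continuous_on_cong[OF refl, of nabla h] by auto
  next
    fix h h' assume "h \<in> {h. \<exists>g\<in>Lambda. \<forall>p\<in>nabla. h p = chi p g}" "h' \<in> {h. \<exists>g\<in>Lambda. \<forall>p\<in>nabla. h p = chi p g}"
    then obtain g g' where g: "g \<in> Lambda" "\<forall>p\<in>nabla. h p = chi p g" "g' \<in> Lambda" "\<forall>p\<in>nabla. h' p = chi p g'" by blast
    have "\<forall>p\<in>nabla. h p + h' p = chi p (\<lambda>M. g M + g' M)" using g by (simp add: unital_algebra_homD(2)[OF chi_hom])
    then show "(\<lambda>x. h x + h' x) \<in> {h. \<exists>g\<in>Lambda. \<forall>p\<in>nabla. h p = chi p g}" using Lambda_add g by blast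
    have "\<forall>p\<in>nabla. h p * h' p = chi p (series_mult g g')" using g by (simp add: unital_algebra_homD(4)[OF chi_hom])
    then show "(\<lambda>x. h x * h' x) \<in> {h. \<exists>g\<in>Lambda. \<forall>p\<in>nabla. h p = chi p g}" using Lambda_mult g by blast
  next
    fix c :: real
    have "\<forall>p\<in>nabla. c = chi p (\<lambda>M. c * sf_one M)"
      using unital_algebra_homD(3)[OF chi_hom Lambda_one] unital_algebra_homD(1)[OF chi_hom] by simp
    then show "(\<lambda>_. c) \<in> {h. \<exists>g\<in>Lambda. \<forall>p\<in>nabla. h p = chi p g}" using Lambda_cmult[OF Lambda_one] by blast
  next
    fix p q assume pq: "p \<in> nabla" "q \<in> nabla" "p \<noteq> q"
    then obtain k where k: "k \<ge> 2" "suminf (\<lambda>i. p i ^ k) \<noteq> suminf (\<lambda>i. q i ^ k)" using nabla_separated by blast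
    then have "chi p (power_sum k) \<noteq> chi q (power_sum k)" using pq by (simp add: chi_power_sum)
    then show "\<exists>h\<in>{h. \<exists>g\<in>Lambda. \<forall>p\<in>nabla. h p = chi p g}. h p \<noteq> h q"
      using Lambda_power_sum by (intro bexI[of _ "\<lambda>p. chi p (power_sum k)"]) auto
  qed
  obtain h g where "g \<in> Lambda" "\<forall>p\<in>nabla. h p = chi p g" "\<forall>p\<in>nabla. \<bar>f p - h p\<bar> < e"
    using R.Stone_Weierstrass_basic[OF f e] by blast
  then show ?thesis using that by simp
qed

section \<open>Rounding points of the simplex to finite grids\<close>

definition snap :: "nat \<Rightarrow> (nat \<Rightarrow> real) \<Rightarrow> nat \<Rightarrow> real" where
  "snap m p i = real_of_int \<lfloor>real m * p i\<rfloor> / real m"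

lemma snap_bounds:
  assumes "m \<ge> 1" shows "snap m p i \<le> p i" "p i - 1 / real m \<le> snap m p i"
proof -
  have "real_of_int \<lfloor>real m * p i\<rfloor> \<le> real m * p i" by simp
  then show "snap m p i \<le> p i" using assms by (simp add: snap_def field_simps)
  have "real m * p i - 1 \<le> real_of_int \<lfloor>real m * p i\<rfloor>" by linarith
  then have "(real m * p i - 1) / real m \<le> snap m p i" unfolding snap_def by (rule divide_right_mono) simp
  moreover have "(real m * p i - 1) / real m = p i - 1 / real m" using assms by (simp add: field_simps)
  ultimately show "p i - 1 / real m \<le> snap m p i" by simp
qed

text \<open>Rounding down is monotone and only decreases coordinates, so neither the order nor the
  bound on the mass is lost.\<close>

lemma snap_in_nabla:
  assumes m: "m \<ge> 1" and p: "p \<in> nabla" shows "snap m p \<in> nabla"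
proof -
  have nn: "0 \<le> snap m p i" for i using nablaD(2)[OF p] by (simp add: snap_def)
  have "summable (snap m p)"
    by (rule summable_comparison_test'[OF nablaD(3)[OF p], of 0]) (use nn snap_bounds(1)[OF m] in auto)
  moreover from this have "suminf (snap m p) \<le> suminf p"
    by (intro suminf_le snap_bounds m nablaD(3)[OF p])
  moreover have "snap m p (Suc i) \<le> snap m p i" for i
    unfolding snap_def using nablaD(1)[OF p] by (intro divide_right_mono of_int_le_iff[THEN iffD2] floor_mono mult_left_mono) (auto intro: floor_mono mult_left_mono)
  ultimately show ?thesis using nn nablaD(4)[OF p] by (auto simp: nabla_def)
qed

text \<open>Since \<open>p i \<le> 1 / (i + 1)\<close>, rounding down to multiples of
  \<open>1 / m\<close> kills all coordinates from index \<open>m\<close> on; the others have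
  finitely many possible values.\<close>

lemma finite_range_snap: assumes "m \<ge> 1" shows "finite (snap m ` nabla)"
proof (rule finite_subset)
  let ?V = "(\<lambda>k. real_of_int k / real m) ` {0..int m}"
  show "finite {f. \<forall>x. (x \<in> {..<m} \<longrightarrow> f x \<in> ?V) \<and> (x \<notin> {..<m} \<longrightarrow> f x = 0)}"
    by (rule finite_set_of_finite_funs) auto
  show "snap m ` nabla \<subseteq> {f. \<forall>x. (x \<in> {..<m} \<longrightarrow> f x \<in> ?V) \<and> (x \<notin> {..<m} \<longrightarrow> f x = 0)}"
  proof (intro subsetI CollectI allI conjI impI)
    fix f i assume "f \<in> snap m ` nabla"
    then obtain p where p: "p \<in> nabla" "f = snap m p" by blast
    have "real m * p i \<le> real m * 1" using nabla_le_1[OF p(1)] by (intro mult_left_mono) auto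
    then have "\<lfloor>real m * p i\<rfloor> \<in> {0..int m}" using nablaD(2)[OF p(1)] by (auto simp: floor_le_iff)
    then show "f i \<in> ?V" by (auto simp: p snap_def)
    assume "i \<notin> {..<m}"
    then have "real m * p i \<le> real i * (1 / real (Suc i))"
      using nabla_le_inverse[OF p(1)] nablaD(2)[OF p(1)] by (intro mult_mono) auto
    also have "\<dots> < 1" by (simp add: field_simps)
    finally have "\<lfloor>real m * p i\<rfloor> = 0" using nablaD(2)[OF p(1)] by (simp add: floor_eq_iff)
    then show "f i = 0" by (simp add: p snap_def)
  qed
qed

text \<open>The metric on sequences is a series with weights \<open>(1 / 2) ^ n\<close>, whose total
  is the factor 2.\<close>

lemma dist_fun_le:
  fixes x y :: "nat \<Rightarrow> real"
  assumes "\<And>i. \<bar>x i - y i\<bar> \<le> c"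
  shows "dist x y \<le> 2 * c"
proof -
  have s: "summable (\<lambda>n. (1 / 2) ^ n * c)" by (intro summable_mult2 summable_geometric) simp
  have le: "(1 / 2) ^ n * min (dist (x (from_nat n)) (y (from_nat n))) 1 \<le> (1 / 2) ^ n * c" for n
    using assms by (intro mult_left_mono) (auto simp: dist_real_def min_le_iff_disj)
  have s': "summable (\<lambda>n. (1 / 2) ^ n * min (dist (x (from_nat n)) (y (from_nat n))) 1)"
    by (rule summable_comparison_test'[OF s, of 0]) (use le in auto)
  have "dist x y \<le> suminf (\<lambda>n. (1 / 2) ^ n * c)" unfolding dist_fun_def by (rule suminf_le[OF le s' s])
  also have "\<dots> = 2 * c" using suminf_mult2[OF summable_geometric[of "1/2::real"], of c] suminf_geometric[of "1/2::real"] by simp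
  finally show ?thesis .
qed

text \<open>Uniform continuity on a compact set, restated in terms of coordinatewise errors, which
  are what rounding controls.\<close>

lemma nabla_uniform:
  fixes f :: "(nat \<Rightarrow> real) \<Rightarrow> real"
  assumes f: "continuous_on nabla f" and e: "e > 0"
  obtains m0 where "m0 \<ge> 1"
    "\<And>m p q. m \<ge> m0 \<Longrightarrow> p \<in> nabla \<Longrightarrow> q \<in> nabla \<Longrightarrow> (\<And>i. \<bar>q i - p i\<bar> \<le> 1 / real m) \<Longrightarrow> \<bar>f q - f p\<bar> < e"
proof -
  have "uniformly_continuous_on nabla f" using f compact_nabla by (rule compact_uniformly_continuous)
  then obtain d where d: "d > 0" "\<And>x y. x \<in> nabla \<Longrightarrow> y \<in> nabla \<Longrightarrow> dist y x < d \<Longrightarrow> dist (f y) (f x) < e"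
    using e unfolding uniformly_continuous_on_def by metis
  obtain m0 where m0: "2 / d < real m0" using reals_Archimedean2 by blast
  show ?thesis
  proof (rule that[of "max 1 m0"])
    fix m p q assume m: "max 1 m0 \<le> m" and p: "p \<in> nabla" and q: "q \<in> nabla" and "\<And>i. \<bar>q i - p i\<bar> \<le> 1 / real m"
    then have "dist q p \<le> 2 * (1 / real m)" by (intro dist_fun_le)
    also have "\<dots> < d"
    proof -
      have "2 / d < real m" using m0 m by simp
      then show ?thesis using d(1) m by (simp add: field_simps)
    qed
    finally show "\<bar>f q - f p\<bar> < e" using d(2)[OF p q] by (simp add: dist_real_def)
  qed simp
qed

lemma snap_diff: "m \<ge> 1 \<Longrightarrow> \<bar>snap m p i - p i\<bar> \<le> 1 / real m"
  using snap_bounds[of m p i] by simp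

section \<open>The states \<open>psi p\<close> as harmonic functions\<close>

lemma psi_basis_path_forest_tree: "int_partition l \<Longrightarrow> psi_basis p (path_forest_tree l) = cval p l"
  by (simp add: psi_basis_def path_forest_path_forest_tree the_partition cval_def)

lemma psi_basis_not_path_forest: "\<not> path_forest t \<Longrightarrow> psi_basis p t = 0"
  by (simp add: psi_basis_def)

lemma psi_lin_ext: "psi p = lin_ext (psi_basis p)"
  by (rule ext) (simp add: psi_def lin_ext_def)

lemma bullet_path_forest_tree: "bullet = path_forest_tree {#}" "int_partition {#}"
  by (simp_all add: bullet_def path_forest_tree_def int_partition_def)

text \<open>On path forests harmonicity is the product formula for \<open>power_sum 1\<close>, whose
  value under \<open>chi p\<close> is 1. Elsewhere both sides vanish, as growth does not lead back
  to path forests.\<close>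

lemma harmonic_psi_basis:
  assumes p: "p \<in> nabla" shows "harmonic (psi_basis p)"
  unfolding harmonic_def
proof (intro conjI allI)
  show "psi_basis p bullet = 1"
    using p by (simp add: bullet_path_forest_tree psi_basis_path_forest_tree cval_empty)
  fix t
  show "0 \<le> psi_basis p t"
    by (metis cval_nonneg[OF p] path_forest_obtain psi_basis_path_forest_tree psi_basis_not_path_forest order_refl)
  show "(\<Sum>b\<in>#grow t. psi_basis p b) = psi_basis p t"
  proof (cases "path_forest t")
    case True
    then obtain l where l: "int_partition l" "t = path_forest_tree l" by (rule path_forest_obtain)
    have l': "int_partition (add_mset 1 l)" "int_partition (add_mset (Suc j) (l - {#j#}))" for j
      using l(1) by (auto simp: int_partition_def dest: in_diffD)
    have "(\<Sum>b\<in>#grow t. psi_basis p b) = psi_basis p (path_forest_tree (add_mset 1 l))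
        + (\<Sum>j\<in>#l. psi_basis p (path_forest_tree (add_mset (Suc j) (l - {#j#}))))"
      unfolding l(2) by (rule sum_grow_path_forest[OF l(1)]) (rule psi_basis_not_path_forest)
    also have "\<dots> = cval p (add_mset 1 l) + (\<Sum>j\<in>#l. cval p (add_mset (Suc j) (l - {#j#})))"
      by (simp only: psi_basis_path_forest_tree l')
    finally have "(\<Sum>b\<in>#grow t. psi_basis p b) = cval p (add_mset 1 l) + (\<Sum>j\<in>#l. cval p (add_mset (Suc j) (l - {#j#})))" .
    then show ?thesis using cval_harmonic[OF p l(1)] l by (simp add: psi_basis_path_forest_tree)
  next
    case False
    then have "image_mset (psi_basis p) (grow t) = image_mset (\<lambda>_. 0) (grow t)"
      using not_path_forest_grow by (intro image_mset_cong) (auto simp: psi_basis_not_path_forest)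
    then show ?thesis using False by (simp add: psi_basis_not_path_forest)
  qed
qed

lemma continuous_on_psi_basis: "continuous_on nabla (\<lambda>p. psi_basis p t)"
proof (cases "path_forest t")
  case True
  then obtain l where "int_partition l" "t = path_forest_tree l" by (rule path_forest_obtain)
  then show ?thesis using continuous_on_cval by (simp add: psi_basis_path_forest_tree)
qed (simp add: psi_basis_not_path_forest)

subsection \<open>Sampling from exchangeable words\<close>

text \<open>The augmented monomial symmetric function in the variables \<open>x a\<close> with
  \<open>a \<in> A\<close>, as a sum over distinct indices chosen one after another; a list of
  exponents permits the recursion.\<close>

primrec isum :: "nat set \<Rightarrow> (nat \<Rightarrow> real) \<Rightarrow> nat list \<Rightarrow> real" where
  "isum A x [] = 1"
| "isum A x (k # ks) = (\<Sum>a\<in>A. x a ^ k * isum (A - {a}) x ks)"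

declare isum.simps(2) [simp del]

lemma isum_swap:
  assumes "finite A"
  shows "(\<Sum>b\<in>A. x b ^ m * isum (A - {b}) x (k # ks)) = isum A x (k # m # ks)"
proof -
  have aux: "sum g (A - {b}) = (\<Sum>a\<in>A. if a \<noteq> b then g a else 0)" for g :: "nat \<Rightarrow> real" and b
    using assms by (intro sum.mono_neutral_cong_left) auto
  have "(\<Sum>b\<in>A. x b ^ m * isum (A - {b}) x (k # ks))
     = (\<Sum>b\<in>A. \<Sum>a\<in>A. if a \<noteq> b then x b ^ m * (x a ^ k * isum (A - {b} - {a}) x ks) else 0)"
    unfolding isum.simps(2) sum_distrib_left by (intro sum.cong refl aux)
  also have "\<dots> = (\<Sum>a\<in>A. \<Sum>b\<in>A. if a \<noteq> b then x b ^ m * (x a ^ k * isum (A - {b} - {a}) x ks) else 0)"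
    by (rule sum.swap)
  also have "\<dots> = (\<Sum>a\<in>A. \<Sum>b\<in>A. if b \<noteq> a then x a ^ k * (x b ^ m * isum (A - {a} - {b}) x ks) else 0)"
    by (intro sum.cong refl) (auto simp: Diff_insert2 [symmetric] insert_commute Diff_insert[symmetric])
  also have "\<dots> = isum A x (k # m # ks)"
    unfolding isum.simps(2) sum_distrib_left by (intro sum.cong refl aux[symmetric])
  finally show ?thesis .
qed

text \<open>The index of the power sum either differs from all chosen indices or coincides with one
  of them: the product formula for augmented monomial functions again.\<close>

lemma isum_rec:
  assumes "finite A"
  shows "(\<Sum>a\<in>A. x a ^ k) * isum A x ks = isum A x (k # ks) + (\<Sum>i<length ks. isum A x (ks[i := ks ! i + k]))"
  using assms
proof (induction ks arbitrary: A)
  case Nil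
  then show ?case by (simp add: isum.simps(2))
next
  case (Cons m ks)
  let ?P = "\<lambda>A. \<Sum>a\<in>A. x a ^ k"
  have "?P A * isum A x (m # ks) = (\<Sum>b\<in>A. x b ^ m * (?P A * isum (A - {b}) x ks))"
    by (simp add: isum.simps(2) sum_distrib_left mult_ac)
  also have "\<dots> = (\<Sum>b\<in>A. x b ^ (m + k) * isum (A - {b}) x ks + (x b ^ m * isum (A - {b}) x (k # ks)
      + (\<Sum>i<length ks. x b ^ m * isum (A - {b}) x (ks[i := ks ! i + k]))))"
  proof (intro sum.cong refl)
    fix b assume b: "b \<in> A"
    have "?P A * isum (A - {b}) x ks = x b ^ k * isum (A - {b}) x ks + ?P (A - {b}) * isum (A - {b}) x ks"
      using b Cons.prems by (simp add: sum.remove algebra_simps)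
    also have "?P (A - {b}) * isum (A - {b}) x ks = isum (A - {b}) x (k # ks)
       + (\<Sum>i<length ks. isum (A - {b}) x (ks[i := ks ! i + k]))"
      using Cons.prems by (intro Cons.IH) simp
    finally show "x b ^ m * (?P A * isum (A - {b}) x ks) = x b ^ (m + k) * isum (A - {b}) x ks + (x b ^ m * isum (A - {b}) x (k # ks)
      + (\<Sum>i<length ks. x b ^ m * isum (A - {b}) x (ks[i := ks ! i + k])))"
      by (simp add: power_add algebra_simps sum_distrib_left)
  qed
  also have "\<dots> = isum A x ((m + k) # ks) + (isum A x (k # m # ks)
      + (\<Sum>i<length ks. isum A x (m # ks[i := ks ! i + k])))"
    unfolding sum.distrib isum_swap[OF Cons.prems] by (subst sum.swap) (simp add: isum.simps(2))
  finally show ?case by (simp add: lessThan_Suc_eq_insert_0 sum.reindex)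
qed

text \<open>Both sides satisfy the same recursion on the number of parts, so agreement on power sums
  is enough.\<close>

lemma cval_isum:
  assumes p: "p \<in> nabla" and A: "finite A"
    and P: "\<And>k. k \<ge> 1 \<Longrightarrow> chi p (power_sum k) = (\<Sum>a\<in>A. x a ^ k)" and ks: "0 \<notin> set ks"
  shows "cval p (mset ks) = isum A x ks"
  using ks
proof (induction "length ks" arbitrary: ks)
  case 0
  then show ?case by (simp add: cval_empty[OF p])
next
  case (Suc n)
  then obtain k ks' where ks: "ks = k # ks'" by (cases ks) auto
  have k: "k \<ge> 1" "int_partition (mset ks')" using Suc.prems by (auto simp: ks int_partition_def)
  have len: "n = length ks'" using Suc.hyps(2) ks by simp
  have "cval p (mset ks) = chi p (power_sum k) * cval p (mset ks') - (\<Sum>j\<in>#mset ks'. cval p (add_mset (j + k) (mset ks' - {#j#})))"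
    using cval_rec[OF p k(2,1)] by (simp add: ks)
  also have "(\<Sum>j\<in>#mset ks'. cval p (add_mset (j + k) (mset ks' - {#j#})))
     = (\<Sum>i<length ks'. cval p (add_mset (ks' ! i + k) (mset ks' - {#ks' ! i#})))" by (rule sum_mset_mset_nth)
  also have "\<dots> = (\<Sum>i<length ks'. isum A x (ks'[i := ks' ! i + k]))"
  proof (intro sum.cong refl)
    fix i assume i: "i \<in> {..<length ks'}"
    have "0 \<notin> set (ks'[i := ks' ! i + k])" using set_update_subset_insert[of ks' i "ks' ! i + k"] k Suc.prems ks by auto
    then have "cval p (mset (ks'[i := ks' ! i + k])) = isum A x (ks'[i := ks' ! i + k])" using len by (intro Suc.hyps(1)) auto
    then show "cval p (add_mset (ks' ! i + k) (mset ks' - {#ks' ! i#})) = isum A x (ks'[i := ks' ! i + k])"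
      using i by (simp add: mset_update)
  qed
  also have "cval p (mset ks') = isum A x ks'" using len Suc.prems ks by (intro Suc.hyps(1)) auto
  also have "chi p (power_sum k) = (\<Sum>a\<in>A. x a ^ k)" using P k by simp
  finally show ?case using isum_rec[OF A, of x k ks'] by (simp add: ks)
qed

text \<open>Taking the blocks of equal letters to be consecutive fixes one set partition of the
  positions for given block sizes, while the distinct letters range over \<open>A\<close>.\<close>

primrec block_words :: "nat set \<Rightarrow> nat list \<Rightarrow> nat list set" where
  "block_words A [] = {[]}"
| "block_words A (k # ks) = (\<Union>a\<in>A. (\<lambda>u. replicate k a @ u) ` block_words (A - {a}) ks)"

text \<open>The falling factorial, which counts the ways to label \<open>r\<close> blocks by
  distinct letters out of \<open>N\<close>; subtraction is real, so nothing is truncated.\<close>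

definition ff :: "nat \<Rightarrow> nat \<Rightarrow> real" where
  "ff N r = (\<Prod>i<r. real N - real i)"

lemma ff_pos: "r \<le> N \<Longrightarrow> ff N r > 0"
  unfolding ff_def by (intro prod_pos) auto

lemma ff_Suc: "ff N (Suc r) = ff N r * (real N - real r)"
  by (simp add: ff_def)

lemma ff_Suc_left: "N \<ge> 1 \<Longrightarrow> ff N (Suc r) = real N * ff (N - 1) r"
  unfolding ff_def by (subst prod.lessThan_Suc_shift) (auto intro!: prod.cong simp: of_nat_diff)

lemma finite_block_words: "finite A \<Longrightarrow> finite (block_words A ks)"
  by (induction ks arbitrary: A) auto

lemma block_words_props:
  "u \<in> block_words A ks \<Longrightarrow> 0 \<notin> set ks \<Longrightarrow> set u \<subseteq> A \<and> length u = sum_list ks \<and> exponents (mset u) = mset ks \<and> card (set u) = length ks"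
proof (induction ks arbitrary: A u)
  case (Cons k ks)
  then obtain a v where a: "a \<in> A" "v \<in> block_words (A - {a}) ks" "u = replicate k a @ v" by auto
  have IH: "set v \<subseteq> A - {a}" "length v = sum_list ks" "exponents (mset v) = mset ks" "card (set v) = length ks"
    using Cons.IH[OF a(2)] Cons.prems by auto
  have k: "k \<ge> 1" using Cons.prems by (auto simp: Suc_le_eq)
  have "a \<notin># mset v" using IH(1) by auto
  then have "exponents (mset v + replicate_mset k a) = add_mset k (mset ks)"
    using exponents_add_replicate[of a "mset v" k] k IH(3) by simp
  moreover have "a \<notin> set v" using IH(1) by auto
  ultimately show ?case using a IH k by (auto simp: add.commute)
qed simp

lemma block_words_disjoint:
  assumes "k \<ge> 1" "a \<noteq> b"
  shows "(\<lambda>u. replicate k a @ u) ` X \<inter> (\<lambda>u. replicate k b @ u) ` Y = {}"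
  using assms by (cases k) auto

lemma sum_block_words:
  assumes "finite A" "0 \<notin> set ks"
  shows "(\<Sum>u\<in>block_words A ks. prod_list (map x u)) = isum A x ks"
  using assms
proof (induction ks arbitrary: A)
  case (Cons k ks)
  have k: "k \<ge> 1" using Cons.prems by (auto simp: Suc_le_eq)
  have "(\<Sum>u\<in>block_words A (k # ks). prod_list (map x u))
     = (\<Sum>a\<in>A. \<Sum>u\<in>(\<lambda>u. replicate k a @ u) ` block_words (A - {a}) ks. prod_list (map x u))"
    unfolding block_words.simps using Cons.prems(1)
    by (intro sum.UNION_disjoint ballI impI block_words_disjoint[OF k] finite_imageI finite_block_words) auto
  also have "\<dots> = (\<Sum>a\<in>A. \<Sum>u\<in>block_words (A - {a}) ks. x a ^ k * prod_list (map x u))"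
    by (rule sum.cong[OF refl]) (subst sum.reindex, auto intro: inj_onI)
  also have "\<dots> = isum A x (k # ks)"
    using Cons by (simp add: isum.simps(2) flip: sum_distrib_left)
  finally show ?case .
qed simp

lemma card_block_words:
  assumes "finite A" "0 \<notin> set ks" "length ks \<le> card A"
  shows "real (card (block_words A ks)) = ff (card A) (length ks)"
  using assms
proof (induction ks arbitrary: A)
  case (Cons k ks)
  have k: "k \<ge> 1" using Cons.prems by (auto simp: Suc_le_eq)
  have "card (block_words A (k # ks)) = (\<Sum>a\<in>A. card ((\<lambda>u. replicate k a @ u) ` block_words (A - {a}) ks))"
    unfolding block_words.simps using Cons.prems(1)
    by (intro card_UN_disjoint ballI impI block_words_disjoint[OF k] finite_imageI finite_block_words) auto
  also have "\<dots> = (\<Sum>a\<in>A. card (block_words (A - {a}) ks))"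
    by (intro sum.cong refl card_image) (auto intro: inj_onI)
  also have "real \<dots> = (\<Sum>a\<in>A. ff (card A - 1) (length ks))"
    unfolding of_nat_sum
  proof (intro sum.cong refl)
    fix a assume "a \<in> A"
    then show "real (card (block_words (A - {a}) ks)) = ff (card A - 1) (length ks)"
      using Cons.prems by (subst Cons.IH) auto
  qed
  also have "\<dots> = ff (card A) (length (k # ks))"
    using Cons.prems by (simp add: ff_Suc_left)
  finally show ?case .
qed (simp add: ff_def)

text \<open>Kingman's exchangeable partition probability functions. The recursion describes adding
  one element to a set partition: it forms a new block or joins a block of size
  \<open>j\<close>.\<close>

definition kingman :: "(nat multiset \<Rightarrow> real) \<Rightarrow> bool" where
  "kingman \<phi> \<longleftrightarrow> \<phi> {#} = 1 \<and> (\<forall>l. 0 \<le> \<phi> l \<and> \<phi> l \<le> 1) \<and>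
    (\<forall>l. int_partition l \<longrightarrow> \<phi> l = \<phi> (add_mset 1 l) + (\<Sum>j\<in>#l. \<phi> (add_mset (Suc j) (l - {#j#}))))"

text \<open>The weight of a word with letters below \<open>N\<close> whose letter content is \<open>M\<close>: the value of \<open>\<phi>\<close> is spread
  evenly over all ways of labelling the blocks of equal letters. Depending on the content only, it is
  exchangeable.\<close>

definition word_weight :: "(nat multiset \<Rightarrow> real) \<Rightarrow> nat \<Rightarrow> nat multiset \<Rightarrow> real" where
  "word_weight \<phi> N M = \<phi> (exponents M) / ff N (card (set_mset M))"

lemma card_set_mset_le_size: "card (set_mset M) \<le> size M"
  by (induction M) (auto simp: card_insert_if)

lemma word_weight_nonneg:
  assumes "kingman \<phi>" "set_mset M \<subseteq> {..<N}" shows "word_weight \<phi> N M \<ge> 0"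
proof -
  have "card (set_mset M) \<le> N" using assms(2) card_mono[of "{..<N}" "set_mset M"] by simp
  then show ?thesis using assms(1) ff_pos[of "card (set_mset M)" N] by (simp add: word_weight_def kingman_def)
qed

lemma exponents_add_mem:
  assumes "a \<in># M" shows "exponents (add_mset a M) = add_mset (Suc (count M a)) (exponents M - {#count M a#})"
proof -
  obtain M' where M': "M = M' + replicate_mset (count M a) a" "a \<notin># M'" using multiset_split .
  have "add_mset a M = M' + replicate_mset (Suc (count M a)) a" by (subst M'(1)) simp
  then show ?thesis using exponents_split[OF assms M'] exponents_add_replicate[OF M'(2), of "Suc (count M a)"] by simp
qed

lemma exponents_add_new: "a \<notin># M \<Longrightarrow> exponents (add_mset a M) = add_mset 1 (exponents M)"
  using exponents_add_replicate[of a M 1] by simp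

text \<open>If \<open>r\<close> letters have been used, the \<open>N - r\<close> new ones share the
  value with an additional part 1, and their number cancels the last factor of
  \<open>ff N (Suc r)\<close>. A used letter lengthens its block. Together this is Kingman's
  recursion.\<close>

lemma word_weight_consistent:
  assumes \<phi>: "kingman \<phi>" and M: "set_mset M \<subseteq> {..<N}" "size M < N"
  shows "(\<Sum>a<N. word_weight \<phi> N (add_mset a M)) = word_weight \<phi> N M"
proof -
  let ?E = "exponents M" and ?r = "card (set_mset M)"
  have r: "?r < N" using M(2) card_set_mset_le_size[of M] by simp
  have "(\<Sum>a<N. word_weight \<phi> N (add_mset a M))
    = (\<Sum>a\<in>{..<N} - set_mset M. word_weight \<phi> N (add_mset a M)) + (\<Sum>a\<in>set_mset M. word_weight \<phi> N (add_mset a M))"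
    using M(1) by (intro sum.subset_diff) auto
  also have "(\<Sum>a\<in>{..<N} - set_mset M. word_weight \<phi> N (add_mset a M))
     = (\<Sum>a\<in>{..<N} - set_mset M. \<phi> (add_mset 1 ?E) / ff N (Suc ?r))"
    by (intro sum.cong refl) (auto simp: word_weight_def exponents_add_new)
  also have "\<dots> = (real N - real ?r) * (\<phi> (add_mset 1 ?E) / ff N (Suc ?r))"
    using M(1) r by (simp add: card_Diff_subset of_nat_diff)
  also have "\<dots> = \<phi> (add_mset 1 ?E) / ff N ?r"
    using r ff_pos[of ?r N] by (simp add: ff_Suc)
  also have "(\<Sum>a\<in>set_mset M. word_weight \<phi> N (add_mset a M))
    = (\<Sum>a\<in>set_mset M. \<phi> (add_mset (Suc (count M a)) (?E - {#count M a#})) / ff N ?r)"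
    by (intro sum.cong refl) (auto simp: word_weight_def exponents_add_mem insert_absorb)
  also have "\<dots> = (\<Sum>j\<in>#?E. \<phi> (add_mset (Suc j) (?E - {#j#}))) / ff N ?r"
    unfolding sum_divide_distrib[symmetric]
    by (simp add: exponents_def[of M] multiset.map_comp comp_def sum_unfold_sum_mset)
  also have "\<phi> (add_mset 1 ?E) / ff N ?r + \<dots> = \<phi> ?E / ff N ?r"
    using \<phi> int_partition_exponents[of M] unfolding kingman_def by (simp flip: add_divide_distrib)
  finally show ?thesis by (simp add: word_weight_def)
qed

text \<open>Words are indexed by arbitrary finite sets of positions, so that the positions outside a
  sample can be summed out.\<close>

definition fun_weight :: "(nat multiset \<Rightarrow> real) \<Rightarrow> nat \<Rightarrow> nat set \<Rightarrow> (nat \<Rightarrow> nat) \<Rightarrow> real" where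
  "fun_weight \<phi> N I w = word_weight \<phi> N (image_mset w (mset_set I))"

lemma fun_weight_nonneg:
  "kingman \<phi> \<Longrightarrow> finite I \<Longrightarrow> w \<in> I \<rightarrow>\<^sub>E {..<N} \<Longrightarrow> fun_weight \<phi> N I w \<ge> 0"
  unfolding fun_weight_def by (rule word_weight_nonneg) auto

text \<open>Consistency sums out one position at a time; as the weight sees the letter content only,
  it does not matter which one.\<close>

lemma fun_weight_marginal:
  assumes \<phi>: "kingman \<phi>" and "finite K" "finite J" "J \<inter> K = {}" "card (J \<union> K) \<le> N" and u: "u \<in> J \<rightarrow>\<^sub>E {..<N}"
  shows "(\<Sum>w\<in>{w \<in> J \<union> K \<rightarrow>\<^sub>E {..<N}. \<forall>j\<in>J. w j = u j}. fun_weight \<phi> N (J \<union> K) w) = fun_weight \<phi> N J u"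
  using assms(2-5)
proof (induction K rule: finite_induct)
  case empty
  have "{w \<in> J \<rightarrow>\<^sub>E {..<N}. \<forall>j\<in>J. w j = u j} = {u}"
    using u by (auto intro: PiE_ext)
  then show ?case by simp
next
  case (insert i K)
  let ?I = "J \<union> K"
  have i: "i \<notin> ?I" "i \<notin> J" using insert by auto
  have fin: "finite ?I" using insert by simp
  have ins: "J \<union> insert i K = insert i ?I" by auto
  have cardI: "card ?I < N" using insert.prems(3) fin i unfolding ins by simp
  let ?S = "{w \<in> ?I \<rightarrow>\<^sub>E {..<N}. \<forall>j\<in>J. w j = u j}"
  have set_eq: "{w \<in> insert i ?I \<rightarrow>\<^sub>E {..<N}. \<forall>j\<in>J. w j = u j} = (\<lambda>(a, g). g(i := a)) ` ({..<N} \<times> ?S)"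
  proof (intro equalityI subsetI)
    fix w assume w: "w \<in> {w \<in> insert i ?I \<rightarrow>\<^sub>E {..<N}. \<forall>j\<in>J. w j = u j}"
    then have "w \<in> (\<lambda>(a, g). g(i := a)) ` ({..<N} \<times> (?I \<rightarrow>\<^sub>E {..<N}))" by (simp add: PiE_insert_eq)
    then obtain a g where g: "a \<in> {..<N}" "g \<in> ?I \<rightarrow>\<^sub>E {..<N}" "w = g(i := a)" by auto
    have "\<forall>j\<in>J. g j = u j"
    proof
      fix j assume j: "j \<in> J"
      then have "w j = u j" using w by simp
      moreover have "j \<noteq> i" using j i by blast
      ultimately show "g j = u j" using g(3) by simp
    qed
    then show "w \<in> (\<lambda>(a, g). g(i := a)) ` ({..<N} \<times> ?S)" using g by auto
  next
    fix w assume "w \<in> (\<lambda>(a, g). g(i := a)) ` ({..<N} \<times> ?S)"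
    then obtain a g where g: "a \<in> {..<N}" "g \<in> ?S" "w = g(i := a)" by auto
    then have "w \<in> insert i ?I \<rightarrow>\<^sub>E {..<N}" by (auto simp: PiE_insert_eq)
    moreover have "\<forall>j\<in>J. w j = u j"
    proof
      fix j assume j: "j \<in> J"
      then have "g j = u j" using g by simp
      moreover have "j \<noteq> i" using j i by blast
      ultimately show "w j = u j" using g(3) by simp
    qed
    ultimately show "w \<in> {w \<in> insert i ?I \<rightarrow>\<^sub>E {..<N}. \<forall>j\<in>J. w j = u j}" by simp
  qed
  have inj: "inj_on (\<lambda>(a, g). g(i := a)) ({..<N} \<times> ?S)"
    by (rule inj_on_subset[OF inj_combinator[OF i(1), of "\<lambda>_. {..<N}"]]) auto
  have "(\<Sum>w\<in>{w \<in> insert i ?I \<rightarrow>\<^sub>E {..<N}. \<forall>j\<in>J. w j = u j}. fun_weight \<phi> N (insert i ?I) w)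
     = (\<Sum>(a, g)\<in>{..<N} \<times> ?S. fun_weight \<phi> N (insert i ?I) (g(i := a)))"
    unfolding set_eq by (subst sum.reindex[OF inj]) (simp add: case_prod_unfold comp_def)
  also have "\<dots> = (\<Sum>g\<in>?S. \<Sum>a<N. fun_weight \<phi> N (insert i ?I) (g(i := a)))"
    by (subst sum.swap) (simp add: sum.cartesian_product)
  also have "\<dots> = (\<Sum>g\<in>?S. fun_weight \<phi> N ?I g)"
  proof (intro sum.cong refl)
    fix g assume g: "g \<in> ?S"
    have im: "image_mset (g(i := a)) (mset_set (insert i ?I)) = add_mset a (image_mset g (mset_set ?I))" for a
    proof -
      have "image_mset (g(i := a)) (mset_set ?I) = image_mset g (mset_set ?I)"
        using i fin by (intro image_mset_cong) auto
      then show ?thesis using fin i by simp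
    qed
    have "set_mset (image_mset g (mset_set ?I)) \<subseteq> {..<N}" using g fin by auto
    then show "(\<Sum>a<N. fun_weight \<phi> N (insert i ?I) (g(i := a))) = fun_weight \<phi> N ?I g"
      unfolding fun_weight_def im using cardI by (intro word_weight_consistent[OF \<phi>]) auto
  qed
  also have "\<dots> = fun_weight \<phi> N J u" using insert cardI by (intro insert.IH) auto
  finally show ?case unfolding ins .
qed

lemma fun_weight_total:
  assumes "kingman \<phi>" "finite I" "card I \<le> N"
  shows "(\<Sum>w\<in>I \<rightarrow>\<^sub>E {..<N}. fun_weight \<phi> N I w) = 1"
  using fun_weight_marginal[of \<phi> I "{}" N "\<lambda>_. undefined"] assms
  by (simp add: fun_weight_def word_weight_def ff_def kingman_def)

text \<open>Summing out the unread positions leaves a weight that ignores the order of reading, so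
  reading along any distinct positions has the law of a shorter exchangeable word.\<close>

lemma fun_weight_sample:
  assumes \<phi>: "kingman \<phi>" and I: "finite I" "card I \<le> N" and \<sigma>: "distinct \<sigma>" "set \<sigma> \<subseteq> I"
    and u: "length u = length \<sigma>" "set u \<subseteq> {..<N}"
  shows "(\<Sum>w\<in>{w \<in> I \<rightarrow>\<^sub>E {..<N}. map w \<sigma> = u}. fun_weight \<phi> N I w) = word_weight \<phi> N (mset u)"
proof -
  define v where "v = (\<lambda>j\<in>set \<sigma>. the (map_of (zip \<sigma> u) j))"
  have nth: "v (\<sigma> ! i) = u ! i" if "i < length \<sigma>" for i
    using that \<sigma> u by (simp add: v_def map_of_zip_nth)
  have mv: "map v \<sigma> = u" using nth u by (intro nth_equalityI) auto
  have "v \<in> set \<sigma> \<rightarrow>\<^sub>E {..<N}"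
  proof (rule PiE_I)
    fix j assume "j \<in> set \<sigma>"
    then have "v j \<in> set u" using mv by (metis imageI list.set_map)
    then show "v j \<in> {..<N}" using u by blast
  qed (simp add: v_def)
  moreover have "card (set \<sigma> \<union> (I - set \<sigma>)) \<le> N" using I \<sigma> by (simp add: Un_absorb1)
  ultimately have "(\<Sum>w\<in>{w \<in> set \<sigma> \<union> (I - set \<sigma>) \<rightarrow>\<^sub>E {..<N}. \<forall>j\<in>set \<sigma>. w j = v j}. fun_weight \<phi> N (set \<sigma> \<union> (I - set \<sigma>)) w)
      = fun_weight \<phi> N (set \<sigma>) v"
    using I by (intro fun_weight_marginal[OF \<phi>]) auto
  moreover have "set \<sigma> \<union> (I - set \<sigma>) = I" using \<sigma> by auto
  moreover have "(\<forall>j\<in>set \<sigma>. w j = v j) \<longleftrightarrow> map w \<sigma> = u" for w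
    unfolding mv[symmetric] by auto
  moreover have "fun_weight \<phi> N (set \<sigma>) v = word_weight \<phi> N (mset u)"
    unfolding fun_weight_def using \<sigma>(1) mv by (metis mset_map mset_set_set)
  ultimately show ?thesis by simp
qed

text \<open>Each letter of \<open>u\<close> picks its position independently of the others: this is
  sampling with replacement.\<close>

lemma card_map_eq:
  assumes "finite I"
  shows "real (card {\<sigma>. set \<sigma> \<subseteq> I \<and> map w \<sigma> = u}) = prod_list (map (\<lambda>a. real (card {i \<in> I. w i = a})) u)"
proof (induction u)
  case Nil
  have "{\<sigma>. set \<sigma> \<subseteq> I \<and> map w \<sigma> = []} = {[]}" by auto
  then show ?case by simp
next
  case (Cons a u)
  have "{\<sigma>. set \<sigma> \<subseteq> I \<and> map w \<sigma> = a # u} = (\<lambda>(i, \<tau>). i # \<tau>) ` ({i \<in> I. w i = a} \<times> {\<tau>. set \<tau> \<subseteq> I \<and> map w \<tau> = u})"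
    by (auto simp: map_eq_Cons_conv image_iff)
  then have "card {\<sigma>. set \<sigma> \<subseteq> I \<and> map w \<sigma> = a # u} = card ({i \<in> I. w i = a} \<times> {\<tau>. set \<tau> \<subseteq> I \<and> map w \<tau> = u})"
    by (simp only:) (rule card_image, auto intro!: inj_onI)
  then show ?case using Cons by (simp add: card_cartesian_product)
qed

definition freq :: "nat set \<Rightarrow> (nat \<Rightarrow> nat) \<Rightarrow> nat \<Rightarrow> real" where
  "freq I w a = real (card {i \<in> I. w i = a}) / real (card I)"

lemma prod_list_freq:
  "prod_list (map (freq I w) u) = prod_list (map (\<lambda>a. real (card {i \<in> I. w i = a})) u) / real (card I) ^ length u"
  by (induction u) (auto simp: freq_def)

text \<open>Products of frequencies count lists of positions, so \<open>isum\<close> becomes the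
  probability that positions drawn with replacement show the prescribed blocks.\<close>

lemma isum_freq:
  assumes "finite I" "finite A" "0 \<notin> set ks"
  shows "isum A (freq I w) ks
    = real (card {\<sigma>. set \<sigma> \<subseteq> I \<and> length \<sigma> = sum_list ks \<and> map w \<sigma> \<in> block_words A ks}) / real (card I) ^ sum_list ks"
proof -
  let ?F = "\<lambda>u. {\<sigma>. set \<sigma> \<subseteq> I \<and> map w \<sigma> = u}"
  have fin: "finite (?F u)" for u
    by (rule finite_subset[OF _ finite_lists_length_eq[OF assms(1), of "length u"]]) auto
  have "isum A (freq I w) ks = (\<Sum>u\<in>block_words A ks. real (card (?F u)) / real (card I) ^ sum_list ks)"
    unfolding sum_block_words[OF assms(2,3), symmetric]
    using block_words_props[OF _ assms(3)] by (intro sum.cong refl) (simp add: prod_list_freq card_map_eq[OF assms(1)])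
  also have "\<dots> = real (\<Sum>u\<in>block_words A ks. card (?F u)) / real (card I) ^ sum_list ks"
    by (simp add: sum_divide_distrib)
  also have "(\<Sum>u\<in>block_words A ks. card (?F u)) = card (\<Union>u\<in>block_words A ks. ?F u)"
    using fin finite_block_words[OF assms(2)] by (intro card_UN_disjoint[symmetric]) auto
  also have "(\<Union>u\<in>block_words A ks. ?F u) = {\<sigma>. set \<sigma> \<subseteq> I \<and> length \<sigma> = sum_list ks \<and> map w \<sigma> \<in> block_words A ks}"
    using block_words_props[OF _ assms(3)] by auto (metis length_map)
  finally show ?thesis .
qed

lemma length_le_sum_list: "0 \<notin> set ks \<Longrightarrow> length ks \<le> sum_list (ks :: nat list)"
  by (induction ks) (auto simp: Suc_le_eq)

lemma card_distinct_lists: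
  assumes "K \<le> n"
  shows "real (card {\<sigma>. length \<sigma> = K \<and> distinct \<sigma> \<and> set \<sigma> \<subseteq> {..<n}}) = ff n K"
proof -
  have "card {\<sigma>. length \<sigma> = K \<and> distinct \<sigma> \<and> set \<sigma> \<subseteq> {..<n}} = \<Prod>{n - K + 1..n}"
    using card_lists_distinct_length_eq[of "{..<n}" K] assms by simp
  also have "real \<dots> = (\<Prod>i<K. real (n - i))"
    unfolding of_nat_prod
    by (rule prod.reindex_bij_witness[where i = "\<lambda>i. n - i" and j = "\<lambda>i. n - i"]) (use assms in auto)
  also have "\<dots> = ff n K" unfolding ff_def using assms by (intro prod.cong) (auto simp: of_nat_diff)
  finally show ?thesis .
qed

text \<open>Sampling positions with replacement differs from sampling without replacement only on the
  lists of positions with a repetition.\<close>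

lemma kingman_word_approx:
  assumes \<phi>: "kingman \<phi>" and ks: "0 \<notin> set ks" and n: "sum_list ks \<le> n" "n \<ge> 1"
  shows "\<bar>(\<Sum>w\<in>{..<n} \<rightarrow>\<^sub>E {..<n}. fun_weight \<phi> n {..<n} w * isum {..<n} (freq {..<n} w) ks) - \<phi> (mset ks)\<bar>
     \<le> 1 - ff n (sum_list ks) / real n ^ sum_list ks"
proof -
  define K where "K = sum_list ks"
  define B where "B = block_words {..<n} ks"
  define \<Omega> where "\<Omega> = ({..<n} \<rightarrow>\<^sub>E {..<n} :: (nat \<Rightarrow> nat) set)"
  define fw where "fw = fun_weight \<phi> n {..<n}"
  define L where "L = {\<sigma> :: nat list. set \<sigma> \<subseteq> {..<n} \<and> length \<sigma> = K}"
  define D where "D = {\<sigma>. length \<sigma> = K \<and> distinct \<sigma> \<and> set \<sigma> \<subseteq> {..<n}}"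
  \<comment> \<open>\<open>g \<sigma>\<close> is the probability that the random word, read along
    the positions \<open>\<sigma>\<close>, shows the prescribed blocks.\<close>
  define g where "g \<sigma> = (\<Sum>w\<in>{w \<in> \<Omega>. map w \<sigma> \<in> B}. fw w)" for \<sigma>
  have fin: "finite \<Omega>" "finite L" "finite B"
    unfolding \<Omega>_def L_def B_def by (auto intro!: finite_PiE finite_lists_length_eq finite_block_words)
  have D: "D \<subseteq> L" by (auto simp: D_def L_def)
  have fw: "fw w \<ge> 0" if "w \<in> \<Omega>" for w using that fun_weight_nonneg[OF \<phi>] by (simp add: fw_def \<Omega>_def)
  have tot: "(\<Sum>w\<in>\<Omega>. fw w) = 1" unfolding fw_def \<Omega>_def by (rule fun_weight_total[OF \<phi>]) auto
  have cardL: "real (card L) = real n ^ K" unfolding L_def by (simp add: card_lists_length_eq)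
  have cardD: "real (card D) = ff n K" unfolding D_def using n by (intro card_distinct_lists) (simp add: K_def)
  have "(\<Sum>w\<in>\<Omega>. fw w * isum {..<n} (freq {..<n} w) ks) = (\<Sum>w\<in>\<Omega>. \<Sum>\<sigma>\<in>L. fw w * of_bool (map w \<sigma> \<in> B) / real n ^ K)"
  proof (intro sum.cong refl)
    fix w
    have "{\<sigma>. set \<sigma> \<subseteq> {..<n} \<and> length \<sigma> = sum_list ks \<and> map w \<sigma> \<in> block_words {..<n} ks} = {\<sigma> \<in> L. map w \<sigma> \<in> B}"
      by (auto simp: L_def B_def K_def)
    then have "isum {..<n} (freq {..<n} w) ks = real (card {\<sigma> \<in> L. map w \<sigma> \<in> B}) / real n ^ K"
      by (simp add: isum_freq[OF _ _ ks] K_def)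
    also have "real (card {\<sigma> \<in> L. map w \<sigma> \<in> B}) = (\<Sum>\<sigma>\<in>L. of_bool (map w \<sigma> \<in> B))"
      using fin by (simp add: Int_def)
    finally show "fw w * isum {..<n} (freq {..<n} w) ks = (\<Sum>\<sigma>\<in>L. fw w * of_bool (map w \<sigma> \<in> B) / real n ^ K)"
      by (simp add: sum_distrib_left sum_divide_distrib)
  qed
  also have "\<dots> = (\<Sum>\<sigma>\<in>L. \<Sum>w\<in>\<Omega>. fw w * of_bool (map w \<sigma> \<in> B) / real n ^ K)" by (rule sum.swap)
  also have "\<dots> = (\<Sum>\<sigma>\<in>L. g \<sigma> / real n ^ K)"
  proof (intro sum.cong refl)
    fix \<sigma>
    have "(\<Sum>w\<in>\<Omega>. fw w * of_bool (map w \<sigma> \<in> B)) = g \<sigma>"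
      unfolding g_def using fin by (intro sum.mono_neutral_cong_right) auto
    then show "(\<Sum>w\<in>\<Omega>. fw w * of_bool (map w \<sigma> \<in> B) / real n ^ K) = g \<sigma> / real n ^ K"
      by (simp flip: sum_divide_distrib)
  qed
  finally have 1: "(\<Sum>w\<in>\<Omega>. fw w * isum {..<n} (freq {..<n} w) ks) = (\<Sum>\<sigma>\<in>L. g \<sigma> / real n ^ K)" .
  \<comment> \<open>For distinct positions each admissible reading has probability
    \<open>\<phi> (mset ks) / ff n (length ks)\<close>, and the denominator is the number of such
    readings.\<close>
  have gD: "g \<sigma> = \<phi> (mset ks)" if \<sigma>: "\<sigma> \<in> D" for \<sigma>
  proof -
    have len: "length ks \<le> n" using length_le_sum_list[OF ks] n by simp
    have "g \<sigma> = (\<Sum>w\<in>(\<Union>u\<in>B. {w \<in> \<Omega>. map w \<sigma> = u}). fw w)"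
      unfolding g_def by (intro sum.cong) auto
    also have "\<dots> = (\<Sum>u\<in>B. \<Sum>w\<in>{w \<in> \<Omega>. map w \<sigma> = u}. fw w)"
      using fin by (intro sum.UNION_disjoint) auto
    also have "\<dots> = (\<Sum>u\<in>B. \<phi> (mset ks) / ff n (length ks))"
    proof (intro sum.cong refl)
      fix u assume "u \<in> B"
      then have u: "set u \<subseteq> {..<n}" "length u = K" "exponents (mset u) = mset ks" "card (set u) = length ks"
        using block_words_props[OF _ ks] by (auto simp: B_def K_def)
      have "(\<Sum>w\<in>{w \<in> \<Omega>. map w \<sigma> = u}. fw w) = word_weight \<phi> n (mset u)"
        unfolding \<Omega>_def fw_def using \<sigma> u by (intro fun_weight_sample[OF \<phi>]) (auto simp: D_def)
      then show "(\<Sum>w\<in>{w \<in> \<Omega>. map w \<sigma> = u}. fw w) = \<phi> (mset ks) / ff n (length ks)"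
        using u by (simp add: word_weight_def)
    qed
    also have "\<dots> = real (card B) * (\<phi> (mset ks) / ff n (length ks))" by simp
    also have "real (card B) = ff n (length ks)"
      using card_block_words[OF _ ks, of "{..<n}"] len by (simp add: B_def)
    finally show ?thesis using ff_pos[OF len] by simp
  qed
  have g01: "0 \<le> g \<sigma>" "g \<sigma> \<le> 1" for \<sigma>
  proof -
    show "0 \<le> g \<sigma>" unfolding g_def by (intro sum_nonneg fw) auto
    have "g \<sigma> \<le> (\<Sum>w\<in>\<Omega>. fw w)" unfolding g_def using fin fw by (intro sum_mono2) auto
    then show "g \<sigma> \<le> 1" using tot by simp
  qed
  have \<phi>01: "0 \<le> \<phi> (mset ks)" "\<phi> (mset ks) \<le> 1" using \<phi> by (auto simp: kingman_def)
  have np: "real n ^ K > 0" using n by simp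
  have "(\<Sum>\<sigma>\<in>L. g \<sigma> / real n ^ K) - \<phi> (mset ks) = (\<Sum>\<sigma>\<in>L. (g \<sigma> - \<phi> (mset ks)) / real n ^ K)"
    using np cardL by (simp add: sum_subtractf diff_divide_distrib)
  also have "\<bar>\<dots>\<bar> \<le> (\<Sum>\<sigma>\<in>L. (if \<sigma> \<in> D then 0 else 1) / real n ^ K)"
  proof (rule order_trans[OF sum_abs sum_mono])
    fix \<sigma>
    have "\<bar>g \<sigma> - \<phi> (mset ks)\<bar> \<le> (if \<sigma> \<in> D then 0 else 1)" using gD g01[of \<sigma>] \<phi>01 by (auto simp: abs_le_iff)
    then show "\<bar>(g \<sigma> - \<phi> (mset ks)) / real n ^ K\<bar> \<le> (if \<sigma> \<in> D then 0 else 1) / real n ^ K"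
      using np by (simp add: divide_right_mono)
  qed
  also have "\<dots> = (\<Sum>\<sigma>\<in>L - D. 1 / real n ^ K)"
    using fin by (intro sum.mono_neutral_cong_right) auto
  also have "\<dots> = (real n ^ K - ff n K) / real n ^ K"
  proof -
    have "finite D" using D fin finite_subset by blast
    then have "real (card (L - D)) = real n ^ K - ff n K"
      using D fin card_mono[OF fin(2) D] by (simp add: card_Diff_subset of_nat_diff cardL cardD)
    then show ?thesis by simp
  qed
  also have "\<dots> = 1 - ff n K / real n ^ K" using np by (simp add: diff_divide_distrib)
  finally show ?thesis using 1 unfolding fw_def \<Omega>_def K_def by simp
qed

lemma ff_ratio_lim: "(\<lambda>n. 1 - ff n K / real n ^ K) \<longlonglongrightarrow> 0"
proof -
  have "(\<lambda>n. \<Prod>i<K. 1 - real i * (1 / real n)) \<longlonglongrightarrow> (\<Prod>i<K. 1 - real i * 0)"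
    by (intro tendsto_intros lim_1_over_n)
  moreover have "\<forall>\<^sub>F n in sequentially. (\<Prod>i<K. 1 - real i * (1 / real n)) = ff n K / real n ^ K"
  proof (rule eventually_mono[OF eventually_gt_at_top[of 0]])
    fix n :: nat assume "0 < n"
    then have "(\<Prod>i<K. 1 - real i * (1 / real n)) = (\<Prod>i<K. (real n - real i) / real n)"
      by (intro prod.cong) (auto simp: field_simps)
    then show "(\<Prod>i<K. 1 - real i * (1 / real n)) = ff n K / real n ^ K"
      by (simp add: ff_def prod_dividef)
  qed
  ultimately have "(\<lambda>n. ff n K / real n ^ K) \<longlonglongrightarrow> 1" using Lim_transform_eventually by fastforce
  then show ?thesis using tendsto_diff[OF tendsto_const[of 1]] by fastforce
qed

section \<open>Letter frequencies as points of the simplex\<close>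

definition sorted_seq :: "real list \<Rightarrow> nat \<Rightarrow> real" where
  "sorted_seq xs i = (if i < length xs then rev (sort xs) ! i else 0)"

text \<open>Sorting does not change power sums, and padding with zeros adds nothing in positive
  degree; in degree 0 every padded zero would count 1.\<close>

lemma sorted_seq_power:
  assumes "k \<ge> 1"
  shows "(\<lambda>i. sorted_seq xs i ^ k) sums sum_list (map (\<lambda>x. x ^ k) xs)"
proof -
  have "(\<lambda>i. sorted_seq xs i ^ k) sums (\<Sum>i<length xs. sorted_seq xs i ^ k)"
    by (rule sums_finite) (use assms in \<open>auto simp: sorted_seq_def\<close>)
  also have "(\<Sum>i<length xs. sorted_seq xs i ^ k) = sum_list (map (\<lambda>x. x ^ k) (rev (sort xs)))"
    by (simp add: sum_list_sum_nth atLeast0LessThan sorted_seq_def)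
  also have "\<dots> = \<Sum>\<^sub># (mset (map (\<lambda>x. x ^ k) (rev (sort xs))))" by (rule sum_mset_sum_list[symmetric])
  also have "mset (map (\<lambda>x. x ^ k) (rev (sort xs))) = mset (map (\<lambda>x. x ^ k) xs)" by simp
  also have "\<Sum>\<^sub># \<dots> = sum_list (map (\<lambda>x. x ^ k) xs)" by (rule sum_mset_sum_list)
  finally show ?thesis .
qed

lemma sorted_seq_nabla:
  assumes "\<And>x. x \<in> set xs \<Longrightarrow> 0 \<le> x" "sum_list xs \<le> 1"
  shows "sorted_seq xs \<in> nabla"
proof -
  have nn: "0 \<le> sorted_seq xs i" for i
  proof (cases "i < length xs")
    case True
    then have "rev (sort xs) ! i \<in> set xs" by (metis length_rev length_sort nth_mem set_rev set_sort)
    then show ?thesis using assms(1) True by (simp add: sorted_seq_def)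
  qed (simp add: sorted_seq_def)
  have dec: "sorted_seq xs (Suc i) \<le> sorted_seq xs i" for i
  proof (cases "Suc i < length xs")
    case True
    then have "rev (sort xs) ! Suc i = sort xs ! (length xs - Suc (Suc i))" "rev (sort xs) ! i = sort xs ! (length xs - Suc i)"
      by (simp_all add: rev_nth)
    moreover have "sort xs ! (length xs - Suc (Suc i)) \<le> sort xs ! (length xs - Suc i)"
      using True by (intro sorted_nth_mono) auto
    ultimately show ?thesis using True by (simp add: sorted_seq_def)
  next
    case False
    then have "sorted_seq xs (Suc i) = 0" by (simp add: sorted_seq_def)
    then show ?thesis using nn by simp
  qed
  have "sorted_seq xs sums sum_list xs" using sorted_seq_power[of 1 xs] by simp
  then show ?thesis using nn dec assms(2) by (auto simp: nabla_def sums_iff)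
qed

text \<open>With total mass exactly 1 there is no dust, so the formula is correct even in degree 1,
  where \<open>chi\<close> has a prescribed value.\<close>

lemma chi_sorted_seq:
  assumes "\<And>x. x \<in> set xs \<Longrightarrow> 0 \<le> x" "sum_list xs = 1" "k \<ge> 1"
  shows "chi (sorted_seq xs) (power_sum k) = sum_list (map (\<lambda>x. x ^ k) xs)"
proof -
  have p: "sorted_seq xs \<in> nabla" using assms by (intro sorted_seq_nabla) auto
  show ?thesis
  proof (cases "k = 1")
    case True
    then show ?thesis using assms(2) chi_power_sum_1[OF p] by simp
  next
    case False
    then have "chi (sorted_seq xs) (power_sum k) = suminf (\<lambda>i. sorted_seq xs i ^ k)"
      using assms(3) by (intro chi_power_sum p) simp
    also have "\<dots> = sum_list (map (\<lambda>x. x ^ k) xs)" using sorted_seq_power[OF assms(3), of xs] by (simp add: sums_iff)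
    finally show ?thesis .
  qed
qed

definition word_point :: "nat \<Rightarrow> (nat \<Rightarrow> nat) \<Rightarrow> nat \<Rightarrow> real" where
  "word_point n w = sorted_seq (map (freq {..<n} w) [0..<n])"

lemma word_point:
  assumes n: "n \<ge> 1" and w: "w \<in> {..<n} \<rightarrow>\<^sub>E {..<n}"
  shows "word_point n w \<in> nabla"
    and "0 \<notin> set ks \<Longrightarrow> cval (word_point n w) (mset ks) = isum {..<n} (freq {..<n} w) ks"
proof -
  let ?xs = "map (freq {..<n} w) [0..<n]"
  have nn: "0 \<le> x" if "x \<in> set ?xs" for x using that by (auto simp: freq_def)
  have "(\<Sum>a<n. card {i \<in> {..<n}. w i = a}) = card (\<Union>a<n. {i \<in> {..<n}. w i = a})"
    by (intro card_UN_disjoint[symmetric]) auto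
  also have "(\<Union>a<n. {i \<in> {..<n}. w i = a}) = {..<n}" using w by auto
  finally have "real (\<Sum>a<n. card {i \<in> {..<n}. w i = a}) = real n" by simp
  then have "(\<Sum>a<n. freq {..<n} w a) = 1"
    using n by (simp add: freq_def flip: sum_divide_distrib)
  then have s: "sum_list ?xs = 1" by (simp add: sum_list_sum_nth atLeast0LessThan)
  show p: "word_point n w \<in> nabla" unfolding word_point_def using nn s by (intro sorted_seq_nabla) auto
  have "chi (word_point n w) (power_sum k) = (\<Sum>a<n. freq {..<n} w a ^ k)" if "k \<ge> 1" for k
    unfolding word_point_def using chi_sorted_seq[OF nn s that] by (simp add: sum_list_sum_nth atLeast0LessThan)
  then show "0 \<notin> set ks \<Longrightarrow> cval (word_point n w) (mset ks) = isum {..<n} (freq {..<n} w) ks"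
    by (intro cval_isum p) auto
qed

text \<open>At the frequency point of a word, \<open>cval\<close> is the chance to see the blocks
  when sampling with replacement; its mean approaches the chance without replacement, which is
  \<open>\<phi> l\<close>.\<close>

lemma kingman_approx:
  assumes \<phi>: "kingman \<phi>" and l: "int_partition l"
  shows "(\<lambda>n. \<Sum>w\<in>{..<n} \<rightarrow>\<^sub>E {..<n}. fun_weight \<phi> n {..<n} w * cval (word_point n w) l) \<longlonglongrightarrow> \<phi> l"
proof -
  obtain ks where ks: "mset ks = l" using ex_mset by blast
  then have ks0: "0 \<notin> set ks" using l by (auto simp: int_partition_def)
  have "(\<lambda>n. (\<Sum>w\<in>{..<n} \<rightarrow>\<^sub>E {..<n}. fun_weight \<phi> n {..<n} w * cval (word_point n w) l) - \<phi> l) \<longlonglongrightarrow> 0"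
  proof (rule Lim_null_comparison[OF _ ff_ratio_lim[of "sum_list ks"]])
    show "\<forall>\<^sub>F n in sequentially. norm ((\<Sum>w\<in>{..<n} \<rightarrow>\<^sub>E {..<n}. fun_weight \<phi> n {..<n} w * cval (word_point n w) l) - \<phi> l)
        \<le> 1 - ff n (sum_list ks) / real n ^ sum_list ks"
    proof (rule eventually_mono[OF eventually_ge_at_top[of "max 1 (sum_list ks)"]])
      fix n :: nat assume n: "max 1 (sum_list ks) \<le> n"
      have "(\<Sum>w\<in>{..<n} \<rightarrow>\<^sub>E {..<n}. fun_weight \<phi> n {..<n} w * cval (word_point n w) l)
        = (\<Sum>w\<in>{..<n} \<rightarrow>\<^sub>E {..<n}. fun_weight \<phi> n {..<n} w * isum {..<n} (freq {..<n} w) ks)"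
        using n word_point(2)[OF _ _ ks0, of n] by (intro sum.cong refl) (simp add: ks)
      then show "norm ((\<Sum>w\<in>{..<n} \<rightarrow>\<^sub>E {..<n}. fun_weight \<phi> n {..<n} w * cval (word_point n w) l) - \<phi> l)
        \<le> 1 - ff n (sum_list ks) / real n ^ sum_list ks"
        using kingman_word_approx[OF \<phi> ks0, of n] n by (simp add: ks)
    qed
  qed
  then show ?thesis by (rule LIM_zero_cancel)
qed

subsection \<open>Weak limits on Kingman's simplex\<close>

lemma space_borel_on [simp]: "space (borel_on X) = topspace X"
  unfolding borel_on_def by (rule space_measure_of) (auto dest: openin_subset)

lemma sets_borel_on: "sets (borel_on X) = sigma_sets (topspace X) {U. openin X U}"
  unfolding borel_on_def by (rule sets_measure_of) (auto dest: openin_subset)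

lemma openin_borel_on: "openin X U \<Longrightarrow> U \<in> sets (borel_on X)"
  by (auto simp: sets_borel_on)

lemma borel_measurable_borel_on:
  fixes f :: "'a \<Rightarrow> 'b::topological_space"
  assumes "continuous_map X euclidean f" shows "f \<in> borel_measurable (borel_on X)"
proof (rule borel_measurableI)
  fix S :: "'b set" assume "open S"
  then have "openin X {x \<in> topspace X. f x \<in> S}" using assms by (auto simp: continuous_map_def)
  moreover have "f -` S \<inter> space (borel_on X) = {x \<in> topspace X. f x \<in> S}" by auto
  ultimately show "f -` S \<inter> space (borel_on X) \<in> sets (borel_on X)" by (simp add: openin_borel_on)
qed

lemma measurable_borel_onI:
  assumes "\<And>x. x \<in> space M \<Longrightarrow> f x \<in> topspace X" "\<And>U. openin X U \<Longrightarrow> f -` U \<inter> space M \<in> sets M"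
  shows "f \<in> measurable M (borel_on X)"
  unfolding borel_on_def by (rule measurable_measure_of) (use assms in \<open>auto dest: openin_subset\<close>)

lemma prob_measuresD:
  assumes "\<mu> \<in> prob_measures X"
  shows "prob_space \<mu>" "sets \<mu> = sets (borel_on X)" "space \<mu> = topspace X"
  using assms sets_eq_imp_space_eq[of \<mu> "borel_on X"] by (auto simp: prob_measures_def)

lemma tendsto_fun_iff:
  fixes f :: "'c \<Rightarrow> 'a \<Rightarrow> 'b::topological_space"
  shows "(f \<longlongrightarrow> l) F \<longleftrightarrow> (\<forall>i. ((\<lambda>c. f c i) \<longlongrightarrow> l i) F)"
  using limitin_componentwise[of "\<lambda>_::'a. euclidean :: 'b topology" UNIV f l F]
  by (simp add: euclidean_product_topology)

definition vlists :: "(nat \<Rightarrow> 'a set) \<Rightarrow> nat \<Rightarrow> 'a list set" where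
  "vlists R n = {xs. length xs = n \<and> (\<forall>i<n. xs ! i \<in> R i)}"

lemma finite_vlists: assumes "\<And>i. finite (R i)" shows "finite (vlists R n)"
proof (rule finite_subset)
  show "vlists R n \<subseteq> {xs. set xs \<subseteq> (\<Union>i<n. R i) \<and> length xs = n}"
    by (auto simp: vlists_def in_set_conv_nth) blast
  show "finite {xs. set xs \<subseteq> (\<Union>i<n. R i) \<and> length xs = n}"
    using assms by (intro finite_lists_length_eq) auto
qed

lemma cylinder_sets_PiM:
  "{\<omega> \<in> PiE UNIV R. \<forall>i<length xs. \<omega> i = xs ! i} \<in> sets (PiM UNIV (\<lambda>i::nat. count_space (R i)))"
proof -
  let ?M = "PiM UNIV (\<lambda>i::nat. count_space (R i))"
  have "{\<omega> \<in> space ?M. \<forall>i\<in>{..<length xs}. \<omega> i = xs ! i} \<in> sets ?M"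
  proof (rule sets.sets_Collect_finite_All)
    fix i assume "i \<in> {..<length xs}"
    have "(\<lambda>\<omega>. \<omega> i) -` ({xs ! i} \<inter> R i) \<inter> space ?M \<in> sets ?M"
      by (rule measurable_sets[OF measurable_component_singleton]) auto
    also have "(\<lambda>\<omega>. \<omega> i) -` ({xs ! i} \<inter> R i) \<inter> space ?M = {\<omega> \<in> space ?M. \<omega> i = xs ! i}"
      by (auto simp: space_PiM)
    finally show "{\<omega> \<in> space ?M. \<omega> i = xs ! i} \<in> sets ?M" .
  qed auto
  moreover have "{\<omega> \<in> space ?M. \<forall>i\<in>{..<length xs}. \<omega> i = xs ! i} = {\<omega> \<in> PiE UNIV R. \<forall>i<length xs. \<omega> i = xs ! i}"
    by (rule Collect_cong) (simp add: space_PiM Ball_def)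
  ultimately show ?thesis by (simp only:)
qed

text \<open>A function of the first \<open>n\<close> coordinates is a finite combination of
  indicators of cylinders.\<close>

lemma integral_cylinder:
  fixes h :: "'a list \<Rightarrow> real"
  assumes M: "prob_space M" "sets M = sets (PiM UNIV (\<lambda>i. count_space (R i)))" and fin: "\<And>i. finite (R i)"
    and cyl: "\<And>xs. (\<forall>i<length xs. xs ! i \<in> R i) \<Longrightarrow> measure M {\<omega> \<in> PiE UNIV R. \<forall>i<length xs. \<omega> i = xs ! i} = w xs"
  shows "integrable M (\<lambda>\<omega>. h (map \<omega> [0..<n]))" "(\<integral>\<omega>. h (map \<omega> [0..<n]) \<partial>M) = (\<Sum>xs\<in>vlists R n. w xs * h xs)"
proof -
  interpret prob_space M by fact
  have space: "space M = PiE UNIV R" using sets_eq_imp_space_eq[OF M(2)] by (simp add: space_PiM)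
  let ?C = "\<lambda>xs. {\<omega> \<in> PiE UNIV R. \<forall>i<length xs. \<omega> i = xs ! i}"
  have eq: "h (map \<omega> [0..<n]) = (\<Sum>xs\<in>vlists R n. h xs * indicator (?C xs) \<omega>)" if \<omega>: "\<omega> \<in> space M" for \<omega>
  proof -
    have C: "\<omega> \<in> ?C xs \<longleftrightarrow> xs = map \<omega> [0..<n]" if "xs \<in> vlists R n" for xs
    proof -
      have "length xs = n" using that by (simp add: vlists_def)
      then have "(\<forall>i<length xs. \<omega> i = xs ! i) \<longleftrightarrow> xs = map \<omega> [0..<n]" unfolding list_eq_iff_nth_eq by auto
      then show ?thesis using \<omega> by (simp only: space mem_Collect_eq simp_thms)
    qed
    have "(\<Sum>xs\<in>vlists R n. h xs * indicator (?C xs) \<omega>) = (\<Sum>xs\<in>vlists R n. if xs = map \<omega> [0..<n] then h xs else 0)"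
      by (intro sum.cong refl) (simp add: C indicator_def del: mem_Collect_eq)
    also have "\<dots> = h (map \<omega> [0..<n])"
    proof -
      have "map \<omega> [0..<n] \<in> vlists R n" using \<omega> by (auto simp: vlists_def space)
      then show ?thesis using finite_vlists[of R n, OF fin] by simp
    qed
    finally show ?thesis by simp
  qed
  have meas: "?C xs \<in> sets M" for xs unfolding M(2) by (rule cylinder_sets_PiM)
  have int: "integrable M (\<lambda>\<omega>. \<Sum>xs\<in>vlists R n. h xs * indicator (?C xs) \<omega>)"
  proof (rule Bochner_Integration.integrable_sum, rule integrable_mult_right, rule integrable_real_indicator[OF meas])
    fix xs show "emeasure M (?C xs) < \<infinity>" by (simp add: emeasure_eq_measure)
  qed
  show "integrable M (\<lambda>\<omega>. h (map \<omega> [0..<n]))"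
    by (rule iffD2[OF Bochner_Integration.integrable_cong[OF refl eq] int])
  have "(\<integral>\<omega>. h (map \<omega> [0..<n]) \<partial>M) = (\<integral>\<omega>. (\<Sum>xs\<in>vlists R n. h xs * indicator (?C xs) \<omega>) \<partial>M)"
    by (rule Bochner_Integration.integral_cong[OF refl eq])
  also have "\<dots> = (\<Sum>xs\<in>vlists R n. h xs * measure M (?C xs))"
  proof -
    have i: "integrable M (\<lambda>\<omega>. h xs * indicator (?C xs) \<omega>)" for xs
      by (rule integrable_mult_right, rule integrable_real_indicator[OF meas]) (simp add: emeasure_eq_measure)
    have "(\<integral>\<omega>. h xs * indicator (?C xs) \<omega> \<partial>M) = h xs * measure M (?C xs)" for xs
    proof -
      have "?C xs \<inter> space M = ?C xs" by (auto simp: space)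
      then show ?thesis by (simp only: integral_mult_right_zero Bochner_Integration.integral_indicator)
    qed
    then show ?thesis by (simp only: Bochner_Integration.integral_sum[OF i])
  qed
  also have "\<dots> = (\<Sum>xs\<in>vlists R n. w xs * h xs)"
  proof (intro sum.cong refl)
    fix xs assume "xs \<in> vlists R n"
    then have "\<forall>i<length xs. xs ! i \<in> R i" by (simp add: vlists_def)
    then show "h xs * measure M (?C xs) = w xs * h xs" using cyl[of xs] by (simp only: mult.commute)
  qed
  finally show "(\<integral>\<omega>. h (map \<omega> [0..<n]) \<partial>M) = (\<Sum>xs\<in>vlists R n. w xs * h xs)" .
qed

text \<open>A point of the simplex is coded by its sequence of roundings; the cylinder weights of the coded
  measures converge along a subsequence and define a measure on codes, which is then decoded.\<close>

lemma nabla_weak_limit: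
  fixes A :: "nat \<Rightarrow> 'b set" and W :: "nat \<Rightarrow> 'b \<Rightarrow> real"
  assumes A: "\<And>n. finite (A n)" and W: "\<And>n a. a \<in> A n \<Longrightarrow> 0 \<le> W n a" "\<And>n. (\<Sum>a\<in>A n. W n a) = 1"
    and q: "\<And>n a. a \<in> A n \<Longrightarrow> q n a \<in> nabla"
  obtains \<rho> r where "\<rho> \<in> prob_measures (top_of_set nabla)" "strict_mono r"
    "\<forall>f. continuous_on nabla f \<longrightarrow> (\<lambda>n. \<Sum>a\<in>A (r n). W (r n) a * f (q (r n) a)) \<longlonglongrightarrow> (\<integral>p. f p \<partial>\<rho>)"
proof -
  \<comment> \<open>The letter at place \<open>i\<close> of a code is the point rounded to multiples
    of \<open>1 / (i + 1)\<close>; the shift keeps the denominator positive.\<close>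
  define R where "R i = snap (Suc i) ` nabla" for i
  have finR: "finite (R i)" for i unfolding R_def by (rule finite_range_snap) simp
  have R_nabla: "R i \<subseteq> nabla" for i unfolding R_def using snap_in_nabla by auto
  define V where "V = {xs. \<forall>i<length xs. xs ! i \<in> R i}"
  have "V = (\<Union>n. vlists R n)" by (auto simp: V_def vlists_def)
  then have countV: "countable V" by (simp add: countable_finite finite_vlists[of R, OF finR])
  define match where "match n a xs \<longleftrightarrow> (\<forall>i<length xs. snap (Suc i) (q n a) = xs ! i)" for n a xs
  \<comment> \<open>The mass that the \<open>n\<close>-th measure gives to the points whose code
    starts with \<open>xs\<close>.\<close>
  define wn where "wn n xs = (\<Sum>a\<in>A n. W n a * of_bool (match n a xs))" for n xs
  have wn01: "0 \<le> wn n xs" "wn n xs \<le> 1" for n xs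
  proof -
    show "0 \<le> wn n xs" unfolding wn_def by (intro sum_nonneg mult_nonneg_nonneg W) auto
    have "wn n xs \<le> (\<Sum>a\<in>A n. W n a)" unfolding wn_def by (intro sum_mono) (use W in auto)
    then show "wn n xs \<le> 1" using W by simp
  qed
  have wn_sum: "(\<Sum>xs\<in>vlists R m. wn n xs * h xs) = (\<Sum>a\<in>A n. W n a * h (map (\<lambda>i. snap (Suc i) (q n a)) [0..<m]))"
    for m n and h :: "(nat \<Rightarrow> real) list \<Rightarrow> real"
  proof -
    have "(\<Sum>xs\<in>vlists R m. wn n xs * h xs) = (\<Sum>xs\<in>vlists R m. \<Sum>a\<in>A n. W n a * of_bool (match n a xs) * h xs)"
      by (simp add: wn_def sum_distrib_right)
    also have "\<dots> = (\<Sum>a\<in>A n. \<Sum>xs\<in>vlists R m. W n a * of_bool (match n a xs) * h xs)" by (rule sum.swap)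
    also have "\<dots> = (\<Sum>a\<in>A n. W n a * h (map (\<lambda>i. snap (Suc i) (q n a)) [0..<m]))"
    proof (intro sum.cong refl)
      fix a assume a: "a \<in> A n"
      let ?x = "map (\<lambda>i. snap (Suc i) (q n a)) [0..<m]"
      have "?x \<in> vlists R m" using q[OF a] by (auto simp: vlists_def R_def)
      have "(\<Sum>xs\<in>vlists R m. W n a * of_bool (match n a xs) * h xs) = (\<Sum>xs\<in>vlists R m. if xs = ?x then W n a * h xs else 0)"
        by (intro sum.cong refl) (auto simp: vlists_def match_def list_eq_iff_nth_eq)
      also have "\<dots> = W n a * h ?x" using \<open>?x \<in> vlists R m\<close> finite_vlists[of R, OF finR] by simp
      finally show "(\<Sum>xs\<in>vlists R m. W n a * of_bool (match n a xs) * h xs) = W n a * h ?x" .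
    qed
    finally show ?thesis .
  qed
  \<comment> \<open>Enumerating the countably many words places all weights in one countable cube,
    whose sequential compactness yields a single subsequence for all of them.\<close>
  define hh where "hh n j = wn n (from_nat_into V j)" for n j
  have "compactin (product_topology (\<lambda>_::nat. euclideanreal) UNIV) (PiE UNIV (\<lambda>_. {0..1}))"
    by (simp add: compactin_PiE compactin_euclidean_iff)
  then have "compact (PiE UNIV (\<lambda>_::nat. {0..1::real}))"
    by (simp add: euclidean_product_topology compactin_euclidean_iff)
  then have "seq_compact (PiE UNIV (\<lambda>_::nat. {0..1::real}))" by (rule compact_imp_seq_compact)
  moreover have "\<forall>n. hh n \<in> PiE UNIV (\<lambda>_. {0..1})" using wn01 by (auto simp: hh_def)
  ultimately obtain l r where r: "strict_mono (r :: nat \<Rightarrow> nat)" "(hh \<circ> r) \<longlonglongrightarrow> l"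
    by (rule seq_compactE)
  have conv: "convergent (\<lambda>n. wn (r n) xs)" if xs: "xs \<in> V" for xs
  proof -
    obtain j where j: "from_nat_into V j = xs" using from_nat_into_surj[OF countV xs] by blast
    have "(\<lambda>n. (hh \<circ> r) n j) \<longlonglongrightarrow> l j" using r(2) unfolding tendsto_fun_iff by blast
    then show ?thesis by (auto simp: hh_def j convergent_def)
  qed
  define w where "w xs = (if xs \<in> V then lim (\<lambda>n. wn (r n) xs) else 0)" for xs
  have w: "(\<lambda>n. wn (r n) xs) \<longlonglongrightarrow> w xs" if "xs \<in> V" for xs
    using conv[OF that] that by (simp add: w_def convergent_LIMSEQ_iff)
  have vV: "xs \<in> V" if "xs \<in> vlists R m" for xs m using that by (auto simp: V_def vlists_def)
  have w_nonneg: "0 \<le> w xs" for xs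
  proof (cases "xs \<in> V")
    case True
    then show ?thesis by (intro LIMSEQ_le_const[OF w[OF True]]) (use wn01 in auto)
  qed (simp add: w_def)
  have "wn n [] = 1" for n using W by (simp add: wn_def match_def)
  then have w_Nil: "w [] = 1" using w[of "[]"] by (simp add: V_def LIMSEQ_const_iff)
  have w_cons: "(\<Sum>c\<in>R (length xs). w (xs @ [c])) = w xs" if xs: "\<forall>i<length xs. xs ! i \<in> R i" for xs
  proof -
    have xs': "xs \<in> V" "\<And>c. c \<in> R (length xs) \<Longrightarrow> xs @ [c] \<in> V"
      using xs by (auto simp: V_def nth_append less_Suc_eq)
    have "(\<Sum>c\<in>R (length xs). wn n (xs @ [c])) = wn n xs" for n
    proof -
      have "(\<Sum>c\<in>R (length xs). wn n (xs @ [c])) = (\<Sum>a\<in>A n. \<Sum>c\<in>R (length xs). W n a * of_bool (match n a (xs @ [c])))"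
        unfolding wn_def by (rule sum.swap)
      also have "\<dots> = wn n xs" unfolding wn_def
      proof (intro sum.cong refl)
        fix a assume a: "a \<in> A n"
        have "match n a (xs @ [c]) \<longleftrightarrow> match n a xs \<and> c = snap (Suc (length xs)) (q n a)" for c
          by (auto simp: match_def nth_append less_Suc_eq)
        then have "(\<Sum>c\<in>R (length xs). W n a * of_bool (match n a (xs @ [c])))
          = (\<Sum>c\<in>R (length xs). if c = snap (Suc (length xs)) (q n a) then W n a * of_bool (match n a xs) else 0)"
          by (intro sum.cong refl) auto
        then show "(\<Sum>c\<in>R (length xs). W n a * of_bool (match n a (xs @ [c]))) = W n a * of_bool (match n a xs)"
          using q[OF a] finR by (simp add: R_def)
      qed
      finally show ?thesis .
    qed
    moreover have "(\<lambda>n. \<Sum>c\<in>R (length xs). wn (r n) (xs @ [c])) \<longlonglongrightarrow> (\<Sum>c\<in>R (length xs). w (xs @ [c]))"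
      by (intro tendsto_sum w xs')
    ultimately show ?thesis using w[OF xs'(1)] by (simp add: LIMSEQ_unique)
  qed
  obtain M where M: "prob_space M" "sets M = sets (PiM UNIV (\<lambda>i. count_space (R i)))"
    "\<forall>xs. (\<forall>i<length xs. xs ! i \<in> R i) \<longrightarrow> measure M {\<omega> \<in> PiE UNIV R. \<forall>i<length xs. \<omega> i = xs ! i} = w xs"
    using cylinder_extension[of R w, OF finR w_nonneg w_Nil w_cons] by blast
  interpret prob_space M by fact
  have space: "space M = PiE UNIV R" using sets_eq_imp_space_eq[OF M(2)] by (simp add: space_PiM)
  have coord: "(\<lambda>\<omega>. g (\<omega> m)) \<in> borel_measurable M" for g :: "(nat \<Rightarrow> real) \<Rightarrow> real" and m
  proof -
    have "(\<lambda>\<omega>. \<omega> m) \<in> measurable M (count_space (R m))"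
      unfolding measurable_cong_sets[OF M(2) refl] by (rule measurable_component_singleton) simp
    moreover have "g \<in> measurable (count_space (R m)) borel" by simp
    ultimately show ?thesis by (rule measurable_compose)
  qed
  note int = integral_cylinder[OF M(1,2) finR M(3)[rule_format]]
  have lim_m: "(\<lambda>n. \<Sum>a\<in>A (r n). W (r n) a * f (snap (Suc m) (q (r n) a))) \<longlonglongrightarrow> (\<integral>\<omega>. f (\<omega> m) \<partial>M)" for f m
  proof -
    have "(\<lambda>n. \<Sum>xs\<in>vlists R (Suc m). wn (r n) xs * f (xs ! m)) \<longlonglongrightarrow> (\<Sum>xs\<in>vlists R (Suc m). w xs * f (xs ! m))"
      by (intro tendsto_intros w vV)
    moreover have "(\<integral>\<omega>. f (\<omega> m) \<partial>M) = (\<Sum>xs\<in>vlists R (Suc m). w xs * f (xs ! m))"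
      using int(2)[of "\<lambda>xs. f (xs ! m)" "Suc m"] by (simp add: nth_append)
    ultimately show ?thesis by (simp add: wn_sum nth_append)
  qed
  \<comment> \<open>Two roundings of the same point differ by at most the sum of their mesh sizes.
    The condition involves two letters of a code only, so it passes to the limit measure almost
    surely.\<close>
  define close where "close m k x y \<longleftrightarrow> (\<forall>i. \<bar>x i - y i\<bar> \<le> 1 / real (Suc m) + 1 / real (Suc k))"
    for m k and x y :: "nat \<Rightarrow> real"
  have "AE \<omega> in M. close m k (\<omega> m) (\<omega> k)" for m k
  proof -
    let ?N = "Suc (max m k)" and ?h = "\<lambda>xs. of_bool (\<not> close m k (xs ! m) (xs ! k)) :: real"
    have "wn n xs * ?h xs = 0" if "xs \<in> vlists R ?N" for n xs
    proof (cases "close m k (xs ! m) (xs ! k)")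
      case False
      have "\<not> match n a xs" if a: "a \<in> A n" for a
      proof
        assume "match n a xs"
        then have "xs ! m = snap (Suc m) (q n a)" "xs ! k = snap (Suc k) (q n a)"
          using \<open>xs \<in> vlists R ?N\<close> by (auto simp: match_def vlists_def less_Suc_eq_le)
        moreover have "\<bar>snap (Suc m) (q n a) i - snap (Suc k) (q n a) i\<bar> \<le> 1 / real (Suc m) + 1 / real (Suc k)" for i
          using snap_diff[of "Suc m" "q n a" i] snap_diff[of "Suc k" "q n a" i] by linarith
        ultimately show False using False by (simp add: close_def)
      qed
      then show ?thesis by (simp add: wn_def)
    qed simp
    then have "w xs * ?h xs = 0" if "xs \<in> vlists R ?N" for xs
      using that tendsto_mult_right[OF w[OF vV[OF that]], of "?h xs"] by (simp only: LIMSEQ_const_iff)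
    then have 0: "(\<integral>\<omega>. ?h (map \<omega> [0..<?N]) \<partial>M) = 0" using int(2)[of ?h ?N] by (simp add: sum.neutral)
    have "AE \<omega> in M. ?h (map \<omega> [0..<?N]) = 0"
      using 0 by (subst (asm) integral_nonneg_eq_0_iff_AE[OF int(1)]) auto
    then show ?thesis by (rule AE_mp) (auto simp: nth_append less_Suc_eq_le simp del: upt_Suc)
  qed
  then have good: "AE \<omega> in M. \<forall>m k. close m k (\<omega> m) (\<omega> k)" by (simp add: AE_all_countable)
  define good where "good \<omega> \<longleftrightarrow> (\<forall>m k. close m k (\<omega> m) (\<omega> k))" for \<omega> :: "nat \<Rightarrow> nat \<Rightarrow> real"
  \<comment> \<open>Decoding: coherent codes converge coordinatewise. On the null set of incoherent
    codes the zero point is a harmless value in \<open>nabla\<close>.\<close>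
  define G where "G \<omega> = (if good \<omega> then (\<lambda>i. lim (\<lambda>m. \<omega> m i)) else (\<lambda>_. 0))" for \<omega> :: "nat \<Rightarrow> nat \<Rightarrow> real"
  have zero: "(\<lambda>_. 0) \<in> nabla" by (simp add: nabla_def)
  have G_lim: "(\<lambda>m. \<omega> m i) \<longlonglongrightarrow> G \<omega> i" if "good \<omega>" for \<omega> i
  proof -
    have "Cauchy (\<lambda>m. \<omega> m i)"
    proof (rule metric_CauchyI)
      fix e :: real assume e: "e > 0"
      obtain N where N: "inverse (real (Suc N)) < e / 2" using reals_Archimedean[of "e / 2"] e by auto
      show "\<exists>N. \<forall>m\<ge>N. \<forall>k\<ge>N. dist (\<omega> m i) (\<omega> k i) < e"
      proof (intro exI[of _ N] allI impI)
        fix m k assume mk: "N \<le> m" "N \<le> k"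
        have "1 / real (Suc m) \<le> 1 / real (Suc N)" "1 / real (Suc k) \<le> 1 / real (Suc N)"
          using mk by (auto intro!: divide_left_mono)
        moreover have "\<bar>\<omega> m i - \<omega> k i\<bar> \<le> 1 / real (Suc m) + 1 / real (Suc k)" using that by (simp add: good_def close_def)
        ultimately show "dist (\<omega> m i) (\<omega> k i) < e" using N by (simp add: dist_real_def inverse_eq_divide)
      qed
    qed
    then show ?thesis using that by (simp add: G_def Cauchy_convergent_iff convergent_LIMSEQ_iff)
  qed
  have G_nabla: "G \<omega> \<in> nabla" if "\<omega> \<in> space M" for \<omega>
  proof (cases "good \<omega>")
    case True
    have "(\<lambda>m. \<omega> m) \<longlonglongrightarrow> G \<omega>"
      using G_lim[OF True] by (simp add: tendsto_fun_iff)
    moreover have "\<omega> m \<in> nabla" for m using that R_nabla by (auto simp: space)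
    ultimately show ?thesis using compact_imp_closed[OF compact_nabla] by (meson closed_sequentially)
  qed (simp add: G_def zero)
  have G_close: "\<bar>\<omega> m i - G \<omega> i\<bar> \<le> 1 / real (Suc m)" if "good \<omega>" for \<omega> m i
  proof (rule LIMSEQ_le[OF _ _ exI[of _ 0]])
    show "(\<lambda>k. \<bar>\<omega> m i - \<omega> k i\<bar>) \<longlonglongrightarrow> \<bar>\<omega> m i - G \<omega> i\<bar>" by (intro tendsto_intros G_lim that)
    have "(\<lambda>k. 1 / real (Suc m) + 1 / real (Suc k)) \<longlonglongrightarrow> 1 / real (Suc m) + 0"
      using LIMSEQ_inverse_real_of_nat by (intro tendsto_intros) (simp add: inverse_eq_divide)
    then show "(\<lambda>k. 1 / real (Suc m) + 1 / real (Suc k)) \<longlonglongrightarrow> 1 / real (Suc m)" by simp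
    show "\<forall>k\<ge>0. \<bar>\<omega> m i - \<omega> k i\<bar> \<le> 1 / real (Suc m) + 1 / real (Suc k)" using that by (simp add: good_def close_def)
  qed
  have good_meas: "{\<omega> \<in> space M. good \<omega>} \<in> sets M"
  proof -
    have "{\<omega> \<in> space M. \<bar>\<omega> m i - \<omega> k i\<bar> \<le> 1 / real (Suc m) + 1 / real (Suc k)} \<in> sets M" for m k i
      using coord[of "\<lambda>x. x i" m] coord[of "\<lambda>x. x i" k] by measurable
    then have "{\<omega> \<in> space M. \<forall>m k i. \<bar>\<omega> m i - \<omega> k i\<bar> \<le> 1 / real (Suc m) + 1 / real (Suc k)} \<in> sets M"
      by (intro sets.sets_Collect_countable_All)
    then show ?thesis unfolding good_def close_def .
  qed
  have "(\<lambda>\<omega>. G \<omega> i) \<in> borel_measurable M" for i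
  proof -
    show ?thesis
    proof (rule borel_measurable_LIMSEQ_real)
      show "(\<lambda>m. if good \<omega> then \<omega> m i else 0) \<longlonglongrightarrow> G \<omega> i" for \<omega>
        using G_lim[of \<omega> i] by (cases "good \<omega>") (simp_all add: G_def)
      show "(\<lambda>\<omega>. if good \<omega> then \<omega> m i else 0) \<in> borel_measurable M" for m
        using good_meas coord[of "\<lambda>x. x i" m] by (intro measurable_If) auto
    qed
  qed
  then have G_borel: "G \<in> measurable M borel" by (rule measurable_coordinatewise_then_product)
  have G_meas: "G \<in> measurable M (borel_on (top_of_set nabla))"
  proof (rule measurable_borel_onI)
    show "G x \<in> topspace (top_of_set nabla)" if "x \<in> space M" for x using G_nabla[OF that] by simp
    fix U assume "openin (top_of_set nabla) U"
    then obtain T where T: "open T" "U = nabla \<inter> T" by (auto simp: openin_open)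
    then have "G -` U \<inter> space M = G -` T \<inter> space M" using G_nabla by auto
    then show "G -` U \<inter> space M \<in> sets M" using measurable_sets[OF G_borel, of T] T by simp
  qed
  define \<rho> where "\<rho> = distr M (borel_on (top_of_set nabla)) G"
  have \<rho>: "\<rho> \<in> prob_measures (top_of_set nabla)"
    unfolding \<rho>_def prob_measures_def using prob_space_distr[OF G_meas] by simp
  have "(\<lambda>n. \<Sum>a\<in>A (r n). W (r n) a * f (q (r n) a)) \<longlonglongrightarrow> (\<integral>p. f p \<partial>\<rho>)"
    if f: "continuous_on nabla f" for f
  proof -
    from f have f': "f \<in> borel_measurable (borel_on (top_of_set nabla))" by (intro borel_measurable_borel_on) simp
    have fG: "(\<integral>p. f p \<partial>\<rho>) = (\<integral>\<omega>. f (G \<omega>) \<partial>M)" unfolding \<rho>_def by (rule integral_distr[OF G_meas f'])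
    have "bounded (f ` nabla)" using compact_continuous_image[OF f compact_nabla] by (rule compact_imp_bounded)
    then obtain B where B: "\<And>p. p \<in> nabla \<Longrightarrow> \<bar>f p\<bar> \<le> B" by (auto simp: bounded_iff)
    have intG: "integrable M (\<lambda>\<omega>. f (G \<omega>))"
      using measurable_compose[OF G_meas f'] B G_nabla by (intro integrable_const_bound[where B = B]) auto
    have intm: "integrable M (\<lambda>\<omega>. f (\<omega> m))" for m
      using int(1)[of "\<lambda>xs. f (xs ! m)" "Suc m"] by (simp add: nth_append)
    show "(\<lambda>n. \<Sum>a\<in>A (r n). W (r n) a * f (q (r n) a)) \<longlonglongrightarrow> (\<integral>p. f p \<partial>\<rho>)"
    proof (rule LIMSEQ_I)
      fix e :: real assume e: "e > 0"
      \<comment> \<open>Three errors of size \<open>e / 4\<close> will be added: rounding under the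
        limit measure, rounding in the approximating sums, and convergence at one fixed
        scale.\<close>
      obtain m0 where m0: "m0 \<ge> 1" "\<And>m p q. m \<ge> m0 \<Longrightarrow> p \<in> nabla \<Longrightarrow> q \<in> nabla \<Longrightarrow> (\<And>i. \<bar>q i - p i\<bar> \<le> 1 / real m) \<Longrightarrow> \<bar>f q - f p\<bar> < e / 4"
        using nabla_uniform[OF f, of "e / 4"] e by auto
      have "\<bar>(\<integral>\<omega>. f (\<omega> m0) \<partial>M) - (\<integral>\<omega>. f (G \<omega>) \<partial>M)\<bar> = \<bar>\<integral>\<omega>. f (\<omega> m0) - f (G \<omega>) \<partial>M\<bar>"
        using intG intm by simp
      also have "\<dots> \<le> (\<integral>\<omega>. \<bar>f (\<omega> m0) - f (G \<omega>)\<bar> \<partial>M)" by (rule integral_abs_bound)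
      also have "\<dots> \<le> (\<integral>\<omega>. e / 4 \<partial>M)"
      proof (rule integral_mono_AE)
        show "integrable M (\<lambda>\<omega>. \<bar>f (\<omega> m0) - f (G \<omega>)\<bar>)"
          by (intro integrable_abs Bochner_Integration.integrable_diff intm intG)
        show "integrable M (\<lambda>\<omega>. e / 4)" by simp
        show "AE \<omega> in M. \<bar>f (\<omega> m0) - f (G \<omega>)\<bar> \<le> e / 4"
          using good
        proof (rule AE_mp, intro AE_I2 impI)
          fix \<omega> assume \<omega>: "\<omega> \<in> space M" "\<forall>m k. close m k (\<omega> m) (\<omega> k)"
          then have g: "good \<omega>" by (simp add: good_def)
          have "\<omega> m0 \<in> nabla" using \<omega>(1) R_nabla by (auto simp: space)
          then have "\<bar>f (\<omega> m0) - f (G \<omega>)\<bar> < e / 4"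
            using m0(2)[of "Suc m0" "G \<omega>" "\<omega> m0"] G_nabla[OF \<omega>(1)] G_close[OF g, of m0] by simp
          then show "\<bar>f (\<omega> m0) - f (G \<omega>)\<bar> \<le> e / 4" by simp
        qed
      qed
      also have "\<dots> = e / 4" by (simp add: prob_space)
      finally have 1: "\<bar>(\<integral>\<omega>. f (\<omega> m0) \<partial>M) - (\<integral>\<omega>. f (G \<omega>) \<partial>M)\<bar> \<le> e / 4" .
      have 2: "\<bar>(\<Sum>a\<in>A n. W n a * f (snap (Suc m0) (q n a))) - (\<Sum>a\<in>A n. W n a * f (q n a))\<bar> \<le> e / 4" for n
      proof -
        have "\<bar>(\<Sum>a\<in>A n. W n a * f (snap (Suc m0) (q n a))) - (\<Sum>a\<in>A n. W n a * f (q n a))\<bar>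
          = \<bar>\<Sum>a\<in>A n. W n a * (f (snap (Suc m0) (q n a)) - f (q n a))\<bar>"
          by (simp add: sum_subtractf right_diff_distrib)
        also have "\<dots> \<le> (\<Sum>a\<in>A n. W n a * (e / 4))"
        proof (rule order_trans[OF sum_abs sum_mono])
          fix a assume a: "a \<in> A n"
          have "\<bar>f (snap (Suc m0) (q n a)) - f (q n a)\<bar> < e / 4"
            by (rule m0(2)[of "Suc m0"]) (use q[OF a] snap_in_nabla[of "Suc m0"] snap_diff[of "Suc m0"] in auto)
          then show "\<bar>W n a * (f (snap (Suc m0) (q n a)) - f (q n a))\<bar> \<le> W n a * (e / 4)"
            unfolding abs_mult abs_of_nonneg[OF W(1)[OF a]] by (intro mult_left_mono W(1)[OF a]) simp
        qed
        also have "\<dots> = e / 4" using W(2)[of n] by (simp only: sum_distrib_right[symmetric] mult_1)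
        finally show ?thesis .
      qed
      obtain N where N: "\<And>n. n \<ge> N \<Longrightarrow> \<bar>(\<Sum>a\<in>A (r n). W (r n) a * f (snap (Suc m0) (q (r n) a))) - (\<integral>\<omega>. f (\<omega> m0) \<partial>M)\<bar> < e / 4"
        using LIMSEQ_D[OF lim_m[of f m0], of "e / 4"] e by auto
      show "\<exists>N. \<forall>n\<ge>N. norm ((\<Sum>a\<in>A (r n). W (r n) a * f (q (r n) a)) - (\<integral>p. f p \<partial>\<rho>)) < e"
      proof (intro exI[of _ N] allI impI)
        fix n assume "N \<le> n"
        then show "norm ((\<Sum>a\<in>A (r n). W (r n) a * f (q (r n) a)) - (\<integral>p. f p \<partial>\<rho>)) < e"
          using N[of n] 1 2[of "r n"] e unfolding fG real_norm_def by linarith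
      qed
    qed
  qed
  with \<rho> r(1) show ?thesis using that by blast
qed

theorem kingman_representation:
  assumes \<phi>: "kingman \<phi>"
  obtains \<rho> where "\<rho> \<in> prob_measures (top_of_set nabla)"
    "\<And>l. int_partition l \<Longrightarrow> \<phi> l = (\<integral>p. cval p l \<partial>\<rho>)"
proof -
  \<comment> \<open>Length and alphabet size are both \<open>Suc n\<close>: positive, so the
    frequencies sum to 1, and equal, so the word weights stay consistent up to the full
    length.\<close>
  define A where "A n = ({..<Suc n} \<rightarrow>\<^sub>E {..<Suc n} :: (nat \<Rightarrow> nat) set)" for n
  have 1: "finite (A n)" for n by (auto simp: A_def intro!: finite_PiE)
  have 2: "0 \<le> fun_weight \<phi> (Suc n) {..<Suc n} w" if "w \<in> A n" for n w
    using that by (intro fun_weight_nonneg[OF \<phi>]) (auto simp: A_def)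
  have 3: "(\<Sum>w\<in>A n. fun_weight \<phi> (Suc n) {..<Suc n} w) = 1" for n
    unfolding A_def by (rule fun_weight_total[OF \<phi>]) auto
  have 4: "word_point (Suc n) w \<in> nabla" if "w \<in> A n" for n w
    using that by (intro word_point) (auto simp: A_def)
  obtain \<rho> r where \<rho>: "\<rho> \<in> prob_measures (top_of_set nabla)" and r: "strict_mono r"
    and lim: "\<forall>f. continuous_on nabla f \<longrightarrow> (\<lambda>n. \<Sum>w\<in>A (r n). fun_weight \<phi> (Suc (r n)) {..<Suc (r n)} w * f (word_point (Suc (r n)) w)) \<longlonglongrightarrow> (\<integral>p. f p \<partial>\<rho>)"
    by (rule nabla_weak_limit[where A = A and W = "\<lambda>n. fun_weight \<phi> (Suc n) {..<Suc n}" and q = "\<lambda>n. word_point (Suc n)", OF 1 2 3 4]) blast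
  have "\<phi> l = (\<integral>p. cval p l \<partial>\<rho>)" if l: "int_partition l" for l
  proof (rule LIMSEQ_unique)
    show "(\<lambda>n. \<Sum>w\<in>A (r n). fun_weight \<phi> (Suc (r n)) {..<Suc (r n)} w * cval (word_point (Suc (r n)) w) l) \<longlonglongrightarrow> (\<integral>p. cval p l \<partial>\<rho>)"
      by (rule lim[rule_format, OF continuous_on_cval[OF l]])
    have "strict_mono (\<lambda>n. Suc (r n))" using r by (simp add: strict_mono_def)
    from LIMSEQ_subseq_LIMSEQ[OF kingman_approx[OF \<phi> l] this]
    show "(\<lambda>n. \<Sum>w\<in>A (r n). fun_weight \<phi> (Suc (r n)) {..<Suc (r n)} w * cval (word_point (Suc (r n)) w) l) \<longlonglongrightarrow> \<phi> l"
      by (simp add: comp_def A_def)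
  qed
  then show ?thesis using \<rho> that by blast
qed

subsection \<open>Paths in the Hoffman graph\<close>

text \<open>Reading the endpoint off the last edge turns \<open>is_path bullet\<close> into a
  predicate on edge lists, which are the words that index cylinders.\<close>

definition endpoint :: "edge list \<Rightarrow> rtree" where
  "endpoint \<gamma> = (if \<gamma> = [] then bullet else target (last \<gamma>))"

definition bpath :: "edge list \<Rightarrow> bool" where
  "bpath \<gamma> \<longleftrightarrow> is_path bullet \<gamma> (endpoint \<gamma>)"

definition level :: "nat \<Rightarrow> edge set" where
  "level n = {e \<in> edges. source e \<in> trees (n + 1)}"

abbreviation out_edges :: "rtree \<Rightarrow> edge set" where
  "out_edges s \<equiv> {e \<in> edges. source e = s}"

lemma is_path_snoc: "is_path s (\<gamma> @ [e]) t \<longleftrightarrow> is_path s \<gamma> (source e) \<and> e \<in> edges \<and> target e = t"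
  by (induction \<gamma> arbitrary: s) auto

lemma is_path_last: "is_path s \<gamma> t \<Longrightarrow> t = (if \<gamma> = [] then s else target (last \<gamma>))"
  by (induction \<gamma> arbitrary: s) auto

lemma is_path_bpath: "is_path bullet \<gamma> t \<longleftrightarrow> bpath \<gamma> \<and> endpoint \<gamma> = t"
proof -
  have "endpoint \<gamma> = t" if "is_path bullet \<gamma> t"
    using is_path_last[OF that] by (simp add: endpoint_def)
  then show ?thesis unfolding bpath_def by blast
qed

lemma bpath_Nil [simp]: "bpath []" by (simp add: bpath_def endpoint_def)

lemma endpoint_Nil [simp]: "endpoint [] = bullet" by (simp add: endpoint_def)

lemma endpoint_snoc [simp]: "endpoint (\<gamma> @ [e]) = target e" by (simp add: endpoint_def)

lemma bpath_snoc: "bpath (\<gamma> @ [e]) \<longleftrightarrow> bpath \<gamma> \<and> e \<in> edges \<and> source e = endpoint \<gamma>"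
  unfolding bpath_def[of "\<gamma> @ [e]"] is_path_snoc endpoint_snoc is_path_bpath by auto

lemma edges_iff: "e \<in> edges \<longleftrightarrow> snd (snd e) < count (grow (source e)) (target e)"
  by (cases e) (auto simp: edges_def leaf_mult_count)

lemma edge_target: "e \<in> edges \<Longrightarrow> target e \<in># grow (source e)"
  unfolding edges_iff count_greater_zero_iff[symmetric] by (rule le_less_trans[OF le0])

lemma bpath_length:
  "bpath \<gamma> \<Longrightarrow> nv (endpoint \<gamma>) = Suc (length \<gamma>) \<and> (\<forall>i<length \<gamma>. \<gamma> ! i \<in> level i)"
proof (induction \<gamma> rule: rev_induct)
  case (snoc e \<gamma>)
  then have e: "bpath \<gamma>" "e \<in> edges" "source e = endpoint \<gamma>" by (auto simp: bpath_snoc)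
  have "nv (target e) = Suc (nv (source e))" using nv_grow[OF edge_target[OF e(2)]] .
  moreover have "e \<in> level (length \<gamma>)" using e snoc.IH by (simp add: level_def trees_iff)
  ultimately show ?case using e snoc.IH by (auto simp: nth_append less_Suc_eq)
qed simp

lemma out_edges_eq: "out_edges s = (\<lambda>(t, j). (s, t, j)) ` (SIGMA t:set_mset (grow s). {..<count (grow s) t})"
proof (intro equalityI subsetI)
  fix e assume e: "e \<in> out_edges s"
  then obtain t j where e': "e = (s, t, j)" by (cases e) auto
  then have "t \<in># grow s" "j < count (grow s) t" using e edge_target[of e] by (simp_all add: edges_iff)
  then show "e \<in> (\<lambda>(t, j). (s, t, j)) ` (SIGMA t:set_mset (grow s). {..<count (grow s) t})"
    unfolding e' by (intro image_eqI[of _ _ "(t, j)"]) auto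
qed (auto simp: edges_iff)

lemma finite_out_edges: "finite (out_edges s)"
  unfolding out_edges_eq by auto

lemma sum_out_edges:
  fixes h :: "rtree \<Rightarrow> real"
  shows "(\<Sum>e\<in>out_edges s. h (target e)) = (\<Sum>b\<in>#grow s. h b)"
proof -
  have "(\<Sum>e\<in>out_edges s. h (target e)) = (\<Sum>(t, j)\<in>(SIGMA t:set_mset (grow s). {..<count (grow s) t}). h t)"
    unfolding out_edges_eq by (subst sum.reindex) (auto intro!: inj_onI sum.cong)
  also have "\<dots> = (\<Sum>t\<in>set_mset (grow s). \<Sum>j<count (grow s) t. h t)"
    by (rule sum.Sigma[symmetric]) auto
  also have "\<dots> = (\<Sum>b\<in>#grow s. h b)" by (simp add: sum_mset_count)
  finally show ?thesis .
qed

lemma ex_bpath: "\<exists>\<gamma>. bpath \<gamma> \<and> endpoint \<gamma> = t"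
proof -
  have "(\<lambda>s t. t \<in># grow s)\<^sup>*\<^sup>* bullet t" using reach_bullet[of t] by (simp add: reach_def)
  then show ?thesis
  proof (induction rule: rtranclp_induct)
    case base
    show ?case by (intro exI[of _ "[]"]) simp
  next
    case (step s t)
    then obtain \<gamma> where \<gamma>: "bpath \<gamma>" "endpoint \<gamma> = s" by blast
    have "(s, t, 0) \<in> edges" using step(2) by (simp add: edges_iff)
    then show ?case using \<gamma> by (intro exI[of _ "\<gamma> @ [(s, t, 0)]"]) (simp add: bpath_snoc)
  qed
qed

text \<open>Every tree except \<open>bullet\<close> is a growth of a tree with one vertex less, and
  a tree has finitely many growths.\<close>

lemma finite_trees: "finite (trees n)"
proof (induction n)
  case 0
  have "t \<notin> trees 0" for t using nv_pos[of t] by (simp add: trees_iff)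
  then have "trees 0 = {}" by blast
  then show ?case by simp
next
  case (Suc n)
  have "trees (Suc n) \<subseteq> insert bullet (\<Union>s\<in>trees n. set_mset (grow s))"
  proof
    fix t assume t: "t \<in> trees (Suc n)"
    obtain \<gamma> where \<gamma>: "bpath \<gamma>" "endpoint \<gamma> = t" using ex_bpath by blast
    show "t \<in> insert bullet (\<Union>s\<in>trees n. set_mset (grow s))"
    proof (cases \<gamma> rule: rev_cases)
      case (snoc \<delta> e)
      then have e: "e \<in> edges" "target e = t" using \<gamma> by (auto simp: bpath_snoc)
      then have "nv t = Suc (nv (source e))" using nv_grow[OF edge_target[OF e(1)]] by simp
      then show ?thesis using edge_target[OF e(1)] e(2) t by (auto simp: trees_iff)
    qed (use \<gamma> in simp)
  qed
  then show ?case using Suc by (auto intro: finite_subset)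
qed

lemma finite_level: "finite (level n)"
proof -
  have "level n = (\<Union>s\<in>trees (n + 1). out_edges s)" by (auto simp: level_def)
  then show ?thesis using finite_trees finite_out_edges by simp
qed

lemma bpath_vlists: "bpath \<gamma> \<Longrightarrow> \<gamma> \<in> vlists level (length \<gamma>)"
  using bpath_length by (simp add: vlists_def)

lemma finite_paths_to: "finite {\<gamma>. is_path bullet \<gamma> t}"
proof (rule finite_subset)
  show "{\<gamma>. is_path bullet \<gamma> t} \<subseteq> vlists level (nv t - 1)"
  proof
    fix \<gamma> assume "\<gamma> \<in> {\<gamma>. is_path bullet \<gamma> t}"
    then have "bpath \<gamma>" "endpoint \<gamma> = t" by (simp_all add: is_path_bpath)
    then show "\<gamma> \<in> vlists level (nv t - 1)" using bpath_length[of \<gamma>] bpath_vlists[of \<gamma>] by simp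
  qed
qed (intro finite_vlists finite_level)

lemma num_paths_pos: "num_paths t > 0"
proof -
  obtain \<gamma> where "is_path bullet \<gamma> t" using ex_bpath[of t] unfolding is_path_bpath by blast
  then have "{\<gamma>. is_path bullet \<gamma> t} \<noteq> {}" by blast
  then show ?thesis unfolding num_paths_def card_gt_0_iff using finite_paths_to by blast
qed

lemma inf_pathsD:
  assumes "\<omega> \<in> inf_paths"
  shows "source (\<omega> 0) = bullet" "\<omega> n \<in> edges" "target (\<omega> n) = source (\<omega> (Suc n))"
proof -
  have *: "source (\<omega> 0) = bullet \<and> (\<forall>n. \<omega> n \<in> edges \<and> target (\<omega> n) = source (\<omega> (Suc n)))"
    using assms unfolding inf_paths_def by (rule CollectD)
  show "source (\<omega> 0) = bullet" by (rule conjunct1[OF *])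
  show "\<omega> n \<in> edges" by (rule conjunct1[OF spec[OF conjunct2[OF *]]])
  show "target (\<omega> n) = source (\<omega> (Suc n))" by (rule conjunct2[OF spec[OF conjunct2[OF *]]])
qed

lemma map_upt_Suc: "map \<omega> [0..<Suc n] = map \<omega> [0..<n] @ [\<omega> n]"
  by simp

lemma inf_paths_prefix:
  assumes "\<omega> \<in> inf_paths"
  shows "bpath (map \<omega> [0..<n]) \<and> endpoint (map \<omega> [0..<n]) = source (\<omega> n)"
proof (induction n)
  case 0
  then show ?case using inf_pathsD(1)[OF assms] by simp
next
  case (Suc n)
  then show ?case unfolding map_upt_Suc bpath_snoc endpoint_snoc
    using inf_pathsD(2,3)[OF assms, of n] by simp
qed

lemma source_endpoint: "\<omega> \<in> inf_paths \<Longrightarrow> source (\<omega> n) = endpoint (map \<omega> [0..<n])"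
  using inf_paths_prefix by simp

text \<open>Being a path is a condition on finite prefixes; measurability and closedness of
  \<open>inf_paths\<close> both rest on this.\<close>

lemma inf_paths_iff: "\<omega> \<in> inf_paths \<longleftrightarrow> (\<forall>n. bpath (map \<omega> [0..<n]))"
proof
  assume "\<omega> \<in> inf_paths"
  then show "\<forall>n. bpath (map \<omega> [0..<n])" using inf_paths_prefix by blast
next
  assume *: "\<forall>n. bpath (map \<omega> [0..<n])"
  have e: "\<omega> n \<in> edges" "source (\<omega> n) = endpoint (map \<omega> [0..<n])" for n
    using *[THEN spec, of "Suc n"] unfolding map_upt_Suc bpath_snoc by blast+
  have "target (\<omega> n) = source (\<omega> (Suc n))" for n
    unfolding e(2)[of "Suc n"] map_upt_Suc endpoint_snoc ..
  moreover have "source (\<omega> 0) = bullet" using e(2)[of 0] by simp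
  ultimately show "\<omega> \<in> inf_paths" unfolding inf_paths_def using e(1) by blast
qed

lemma inf_paths_level: assumes "\<omega> \<in> inf_paths" shows "\<omega> n \<in> level n"
proof -
  have "bpath (map \<omega> [0..<Suc n])" using assms unfolding inf_paths_iff by blast
  from bpath_length[OF this] have "map \<omega> [0..<Suc n] ! n \<in> level n" by (simp del: upt_Suc)
  then show ?thesis by (simp add: nth_append)
qed

section \<open>Topology and Borel sets of the path space\<close>

lemma path_top_eq: "path_top = subtopology (product_topology (\<lambda>n. discrete_topology (level n)) UNIV) inf_paths"
  by (simp add: path_top_def level_def)

lemma topspace_path_top [simp]: "topspace path_top = inf_paths"
  using inf_paths_level by (auto simp: path_top_eq)

lemma cylinder_iff: "\<omega> \<in> cylinder \<gamma> \<longleftrightarrow> \<omega> \<in> inf_paths \<and> map \<omega> [0..<length \<gamma>] = \<gamma>"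
proof -
  have "map \<omega> [0..<length \<gamma>] = \<gamma> \<longleftrightarrow> (\<forall>i<length \<gamma>. \<omega> i = \<gamma> ! i)"
    by (subst list_eq_iff_nth_eq) simp
  then show ?thesis by (simp add: cylinder_def)
qed

lemma cylinder_subset: "cylinder \<gamma> \<subseteq> inf_paths" by (auto simp: cylinder_def)

lemma cylinder_bpath: "\<omega> \<in> cylinder \<gamma> \<Longrightarrow> bpath \<gamma>"
  using inf_paths_prefix[of \<omega> "length \<gamma>"] by (simp add: cylinder_iff)

lemma cylinder_not_bpath: "\<not> bpath \<gamma> \<Longrightarrow> cylinder \<gamma> = {}"
  using cylinder_bpath by blast

lemma mem_cylinder_map: "\<omega> \<in> inf_paths \<Longrightarrow> \<omega> \<in> cylinder (map \<omega> [0..<n])"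
  by (simp add: cylinder_iff)

lemma openin_cylinder: "openin path_top (cylinder \<gamma>)"
proof -
  let ?S = "\<lambda>i. if i < length \<gamma> then {\<gamma> ! i} \<inter> level i else level i"
  have "finite {i. ?S i \<noteq> level i}" by (rule finite_subset[of _ "{..<length \<gamma>}"]) auto
  then have "openin (product_topology (\<lambda>n. discrete_topology (level n)) UNIV) (PiE UNIV ?S)"
    by (subst openin_PiE_gen) auto
  moreover have "cylinder \<gamma> = PiE UNIV ?S \<inter> inf_paths"
  proof (intro equalityI subsetI)
    fix \<omega> assume \<omega>: "\<omega> \<in> cylinder \<gamma>"
    then have in_inf: "\<omega> \<in> inf_paths" and eq: "\<And>i. i < length \<gamma> \<Longrightarrow> \<omega> i = \<gamma> ! i" by (auto simp: cylinder_def)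
    have "\<omega> i \<in> ?S i" for i using inf_paths_level[OF in_inf, of i] eq[of i, symmetric] by (cases "i < length \<gamma>") simp_all
    then show "\<omega> \<in> PiE UNIV ?S \<inter> inf_paths" using in_inf by (simp add: PiE_iff)
  next
    fix \<omega> assume \<omega>: "\<omega> \<in> PiE UNIV ?S \<inter> inf_paths"
    then have "\<omega> i \<in> ?S i" for i by (simp add: PiE_iff)
    then have "\<omega> i = \<gamma> ! i" if "i < length \<gamma>" for i using that by (metis Int_iff singletonD)
    then show "\<omega> \<in> cylinder \<gamma>" using \<omega> by (simp add: cylinder_def)
  qed
  ultimately show ?thesis unfolding path_top_eq openin_subtopology by blast
qed

text \<open>A basic open set of the product restricts finitely many coordinates, all of which lie
  below some \<open>n\<close>.\<close>

lemma openin_path_top_cylinder: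
  assumes "openin path_top U" "\<omega> \<in> U" obtains n where "cylinder (map \<omega> [0..<n]) \<subseteq> U"
proof -
  obtain T where T: "openin (product_topology (\<lambda>n. discrete_topology (level n)) UNIV) T" "U = T \<inter> inf_paths"
    using assms(1) unfolding path_top_eq openin_subtopology by blast
  have "\<omega> \<in> T" using assms(2) T by simp
  then obtain W where W: "finite {i \<in> UNIV. W i \<noteq> topspace (discrete_topology (level i))}" "\<omega> \<in> PiE UNIV W" "PiE UNIV W \<subseteq> T"
    using T(1) unfolding openin_product_topology_alt by blast
  obtain n where n: "\<And>i. W i \<noteq> level i \<Longrightarrow> i < n"
    using finite_nat_bounded[OF W(1)] by (auto simp: subset_iff)
  have "cylinder (map \<omega> [0..<n]) \<subseteq> U"
  proof
    fix \<omega>' assume \<omega>': "\<omega>' \<in> cylinder (map \<omega> [0..<n])"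
    then have in_inf: "\<omega>' \<in> inf_paths" and eq: "\<And>i. i < n \<Longrightarrow> \<omega>' i = \<omega> i" by (auto simp: cylinder_def)
    have "\<omega>' i \<in> W i" for i
    proof (cases "i < n")
      case True
      then show ?thesis using eq W(2) by (simp add: PiE_iff)
    next
      case False
      then have "W i = level i" using n by blast
      then show ?thesis using inf_paths_level[OF in_inf] by simp
    qed
    then have "\<omega>' \<in> T" using W(3) by (auto simp: PiE_iff)
    then show "\<omega>' \<in> U" using in_inf T by simp
  qed
  then show ?thesis by (rule that)
qed

lemma countable_bpaths: "countable {\<gamma>. bpath \<gamma>}"
proof (rule countable_subset)
  show "{\<gamma>. bpath \<gamma>} \<subseteq> (\<Union>n. vlists level n)" using bpath_vlists by blast
  show "countable (\<Union>n. vlists level n)" by (simp add: countable_finite finite_vlists[of level, OF finite_level])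
qed

lemma openin_path_top_Union:
  assumes "openin path_top U"
  shows "U = \<Union> (cylinder ` {\<gamma>. bpath \<gamma> \<and> cylinder \<gamma> \<subseteq> U})" "countable {\<gamma>. bpath \<gamma> \<and> cylinder \<gamma> \<subseteq> U}"
proof -
  show "countable {\<gamma>. bpath \<gamma> \<and> cylinder \<gamma> \<subseteq> U}" by (rule countable_subset[OF _ countable_bpaths]) auto
  have U: "U \<subseteq> inf_paths" using openin_subset[OF assms] by simp
  show "U = \<Union> (cylinder ` {\<gamma>. bpath \<gamma> \<and> cylinder \<gamma> \<subseteq> U})"
  proof (intro equalityI subsetI)
    fix \<omega> assume \<omega>: "\<omega> \<in> U"
    then obtain n where "cylinder (map \<omega> [0..<n]) \<subseteq> U" using openin_path_top_cylinder[OF assms] by blast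
    moreover have "\<omega> \<in> cylinder (map \<omega> [0..<n])" using \<omega> U mem_cylinder_map by blast
    ultimately show "\<omega> \<in> \<Union> (cylinder ` {\<gamma>. bpath \<gamma> \<and> cylinder \<gamma> \<subseteq> U})" using cylinder_bpath by blast
  qed blast
qed

definition cylinders :: "(nat \<Rightarrow> edge) set set" where
  "cylinders = insert {} (range cylinder)"

text \<open>There are only countably many finite paths, so each open set is a countable union of
  cylinders.\<close>

lemma sets_borel_path_top: "sets (borel_on path_top) = sigma_sets inf_paths cylinders"
proof -
  have "sigma_sets inf_paths {U. openin path_top U} = sigma_sets inf_paths cylinders"
  proof (rule sigma_sets_eqI)
    fix U assume "U \<in> {U. openin path_top U}"
    then have U: "openin path_top U" by simp
    have "\<Union> (cylinder ` {\<gamma>. bpath \<gamma> \<and> cylinder \<gamma> \<subseteq> U}) \<in> sigma_sets inf_paths cylinders"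
      using openin_path_top_Union(2)[OF U] by (intro sigma_sets_UNION countable_image) (auto simp: cylinders_def)
    then show "U \<in> sigma_sets inf_paths cylinders" using openin_path_top_Union(1)[OF U] by simp
  next
    fix C assume "C \<in> cylinders"
    then show "C \<in> sigma_sets inf_paths {U. openin path_top U}"
      using openin_cylinder by (auto simp: cylinders_def intro: sigma_sets.Empty)
  qed
  then show ?thesis by (simp add: sets_borel_on)
qed

lemma cylinder_sets [measurable, simp]: "cylinder \<gamma> \<in> sets (borel_on path_top)"
  by (rule openin_borel_on[OF openin_cylinder])

lemma cylinder_Int:
  assumes "length \<gamma> \<le> length \<delta>"
  shows "cylinder \<gamma> \<inter> cylinder \<delta> = (if take (length \<gamma>) \<delta> = \<gamma> then cylinder \<delta> else {})"
proof -
  have "\<omega> \<in> cylinder \<gamma> \<longleftrightarrow> take (length \<gamma>) \<delta> = \<gamma>" if "\<omega> \<in> cylinder \<delta>" for \<omega>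
  proof -
    have d: "map \<omega> [0..<length \<delta>] = \<delta>" "\<omega> \<in> inf_paths" using that by (auto simp: cylinder_iff)
    have "take (length \<gamma>) \<delta> = map \<omega> [0..<length \<gamma>]" using assms by (subst d(1)[symmetric]) (simp add: take_map)
    then show ?thesis using d by (simp add: cylinder_iff)
  qed
  then show ?thesis by auto
qed

text \<open>Two cylinders are nested or disjoint, according to whether one word is a prefix of the
  other.\<close>

lemma Int_stable_cylinders: "Int_stable cylinders"
proof (rule Int_stableI)
  fix A B assume "A \<in> cylinders" "B \<in> cylinders"
  then consider "A = {} \<or> B = {}" | \<gamma> \<delta> where "A = cylinder \<gamma>" "B = cylinder \<delta>" by (auto simp: cylinders_def)
  then show "A \<inter> B \<in> cylinders"
  proof cases
    case 2
    show ?thesis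
    proof (cases "length \<gamma> \<le> length \<delta>")
      case True
      then show ?thesis unfolding 2 cylinder_Int[OF True] by (auto simp: cylinders_def)
    next
      case False
      then have "length \<delta> \<le> length \<gamma>" by simp
      then show ?thesis unfolding 2 Int_commute[of "cylinder \<gamma>"] by (subst cylinder_Int) (auto simp: cylinders_def)
    qed
  qed (auto simp: cylinders_def)
qed

lemma cylinder_Nil [simp]: "cylinder [] = inf_paths" by (simp add: cylinder_def)

lemma prob_measures_path_eqI:
  assumes \<mu>: "\<mu> \<in> prob_measures path_top" and \<nu>: "\<nu> \<in> prob_measures path_top"
    and eq: "\<And>\<gamma>. bpath \<gamma> \<Longrightarrow> measure \<mu> (cylinder \<gamma>) = measure \<nu> (cylinder \<gamma>)"
  shows "\<mu> = \<nu>"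
proof (rule measure_eqI_generator_eq[OF Int_stable_cylinders])
  interpret \<mu>: prob_space \<mu> using prob_measuresD[OF \<mu>] by simp
  interpret \<nu>: prob_space \<nu> using prob_measuresD[OF \<nu>] by simp
  show "cylinders \<subseteq> Pow inf_paths" using cylinder_subset by (auto simp: cylinders_def)
  show "emeasure \<mu> X = emeasure \<nu> X" if X: "X \<in> cylinders" for X
  proof -
    show ?thesis
    proof (cases "X = {}")
      case False
      then obtain \<gamma> where \<gamma>: "X = cylinder \<gamma>" using X by (auto simp: cylinders_def)
      then have "bpath \<gamma>" using False cylinder_not_bpath by blast
      then show ?thesis unfolding \<gamma> \<mu>.emeasure_eq_measure \<nu>.emeasure_eq_measure by (simp add: eq)
    qed simp
  qed
  show "sets \<mu> = sigma_sets inf_paths cylinders" "sets \<nu> = sigma_sets inf_paths cylinders"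
    using prob_measuresD(2)[OF \<mu>] prob_measuresD(2)[OF \<nu>] by (simp_all add: sets_borel_path_top)
  show "range (\<lambda>_::nat. inf_paths) \<subseteq> cylinders"
    by (auto simp: cylinders_def) (metis cylinder_Nil rangeI)
  show "emeasure \<mu> inf_paths \<noteq> \<infinity>" for i :: nat by simp
qed simp

lemma cylinder_split:
  assumes "bpath \<gamma>"
  shows "cylinder \<gamma> = (\<Union>e\<in>out_edges (endpoint \<gamma>). cylinder (\<gamma> @ [e]))"
proof (intro equalityI subsetI)
  fix \<omega> assume \<omega>: "\<omega> \<in> cylinder \<gamma>"
  then have m: "\<omega> \<in> inf_paths" "map \<omega> [0..<length \<gamma>] = \<gamma>" by (auto simp: cylinder_iff)
  then have "bpath (map \<omega> [0..<Suc (length \<gamma>)])" unfolding inf_paths_iff by blast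
  then have "\<omega> (length \<gamma>) \<in> out_edges (endpoint \<gamma>)" using m(2) by (simp add: bpath_snoc)
  moreover have "\<omega> \<in> cylinder (\<gamma> @ [\<omega> (length \<gamma>)])" using m by (simp add: cylinder_iff)
  ultimately show "\<omega> \<in> (\<Union>e\<in>out_edges (endpoint \<gamma>). cylinder (\<gamma> @ [e]))" by blast
next
  fix \<omega> assume "\<omega> \<in> (\<Union>e\<in>out_edges (endpoint \<gamma>). cylinder (\<gamma> @ [e]))"
  then obtain e where "\<omega> \<in> cylinder (\<gamma> @ [e])" by blast
  then show "\<omega> \<in> cylinder \<gamma>" by (simp add: cylinder_iff)
qed

lemma cylinder_disjoint: "length \<gamma> = length \<delta> \<Longrightarrow> \<gamma> \<noteq> \<delta> \<Longrightarrow> cylinder \<gamma> \<inter> cylinder \<delta> = {}"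
  by (simp add: cylinder_Int)

lemma measure_cylinder_split:
  assumes \<mu>: "\<mu> \<in> prob_measures path_top" and "bpath \<gamma>"
  shows "measure \<mu> (cylinder \<gamma>) = (\<Sum>e\<in>out_edges (endpoint \<gamma>). measure \<mu> (cylinder (\<gamma> @ [e])))"
proof -
  interpret \<mu>: prob_space \<mu> using prob_measuresD[OF \<mu>] by simp
  show ?thesis unfolding cylinder_split[OF assms(2)]
    by (rule \<mu>.finite_measure_finite_Union[OF finite_out_edges])
       (auto simp: prob_measuresD(2)[OF \<mu>] disjoint_family_on_def cylinder_disjoint)
qed

lemma vertex_set_eq:
  assumes "nv t = n"
  shows "{\<omega> \<in> inf_paths. vertex_at n \<omega> = t} = (\<Union>\<gamma>\<in>{\<gamma>. is_path bullet \<gamma> t}. cylinder \<gamma>)"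
proof -
  have n: "n \<ge> 1" using nv_pos[of t] assms by simp
  have v: "vertex_at n \<omega> = endpoint (map \<omega> [0..<n - 1])" if "\<omega> \<in> inf_paths" for \<omega>
    using source_endpoint[OF that] by (simp add: vertex_at_def)
  show ?thesis
  proof (intro equalityI subsetI)
    fix \<omega> assume \<omega>: "\<omega> \<in> {\<omega> \<in> inf_paths. vertex_at n \<omega> = t}"
    then have "is_path bullet (map \<omega> [0..<n - 1]) t" using v inf_paths_iff by (auto simp: is_path_bpath)
    moreover have "\<omega> \<in> cylinder (map \<omega> [0..<n - 1])" using \<omega> by (intro mem_cylinder_map) simp
    ultimately show "\<omega> \<in> (\<Union>\<gamma>\<in>{\<gamma>. is_path bullet \<gamma> t}. cylinder \<gamma>)" by blast
  next
    fix \<omega> assume "\<omega> \<in> (\<Union>\<gamma>\<in>{\<gamma>. is_path bullet \<gamma> t}. cylinder \<gamma>)"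
    then obtain \<gamma> where \<gamma>: "bpath \<gamma>" "endpoint \<gamma> = t" "\<omega> \<in> cylinder \<gamma>" by (auto simp: is_path_bpath)
    then have "length \<gamma> = n - 1" using bpath_length[of \<gamma>] assms by simp
    then have "map \<omega> [0..<n - 1] = \<gamma>" "\<omega> \<in> inf_paths" using \<gamma>(3) by (auto simp: cylinder_iff)
    then show "\<omega> \<in> {\<omega> \<in> inf_paths. vertex_at n \<omega> = t}" using v \<gamma>(2) by simp
  qed
qed

lemma measure_vertex_set:
  assumes \<mu>: "\<mu> \<in> prob_measures path_top" and "nv t = n"
    and c: "\<And>\<gamma>. is_path bullet \<gamma> t \<Longrightarrow> measure \<mu> (cylinder \<gamma>) = c"
  shows "measure \<mu> {\<omega> \<in> inf_paths. vertex_at n \<omega> = t} = real (num_paths t) * c"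
proof -
  interpret \<mu>: prob_space \<mu> using prob_measuresD[OF \<mu>] by simp
  have "disjoint_family_on cylinder {\<gamma>. is_path bullet \<gamma> t}"
    unfolding disjoint_family_on_def
  proof (intro ballI impI)
    fix \<gamma> \<delta> assume "\<gamma> \<in> {\<gamma>. is_path bullet \<gamma> t}" "\<delta> \<in> {\<gamma>. is_path bullet \<gamma> t}" "\<gamma> \<noteq> \<delta>"
    then show "cylinder \<gamma> \<inter> cylinder \<delta> = {}"
      using bpath_length[of \<gamma>] bpath_length[of \<delta>] by (intro cylinder_disjoint) (auto simp: is_path_bpath)
  qed
  then have "measure \<mu> (\<Union>\<gamma>\<in>{\<gamma>. is_path bullet \<gamma> t}. cylinder \<gamma>) = (\<Sum>\<gamma>\<in>{\<gamma>. is_path bullet \<gamma> t}. measure \<mu> (cylinder \<gamma>))"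
    by (intro \<mu>.finite_measure_finite_Union[OF finite_paths_to] image_subsetI) (simp_all add: prob_measuresD(2)[OF \<mu>])
  also have "\<dots> = (\<Sum>\<gamma>\<in>{\<gamma>. is_path bullet \<gamma> t}. c)" by (intro sum.cong refl c) simp
  finally show ?thesis by (simp add: vertex_set_eq[OF assms(2)] num_paths_def)
qed

text \<open>For a central measure this is the common mass of all cylinders that end at
  \<open>t\<close>, hence the value of the corresponding state on \<open>basis_F t\<close>.\<close>

definition phi :: "(nat \<Rightarrow> edge) measure \<Rightarrow> rtree \<Rightarrow> real" where
  "phi \<mu> t = measure \<mu> {\<omega> \<in> inf_paths. vertex_at (nv t) \<omega> = t} / real (num_paths t)"

lemma phi_eqI:
  assumes \<mu>: "\<mu> \<in> prob_measures path_top"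
    and c: "\<And>\<gamma>. is_path bullet \<gamma> t \<Longrightarrow> measure \<mu> (cylinder \<gamma>) = c"
  shows "phi \<mu> t = c"
  using measure_vertex_set[OF \<mu> refl c] num_paths_pos[of t] by (simp add: phi_def)

lemma central_measuresI:
  assumes \<mu>: "\<mu> \<in> prob_measures path_top"
    and c: "\<And>\<gamma>. bpath \<gamma> \<Longrightarrow> measure \<mu> (cylinder \<gamma>) = \<phi> (endpoint \<gamma>)"
  shows "\<mu> \<in> central_measures"
  unfolding central_measures_def
proof (intro CollectI conjI allI impI ballI \<mu>)
  fix n t \<gamma> assume "t \<in> trees n" "is_path bullet \<gamma> t"
  then show "measure \<mu> (cylinder \<gamma>) = measure \<mu> {\<omega> \<in> inf_paths. vertex_at n \<omega> = t} / real (num_paths t)"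
    using phi_eqI[OF \<mu>, of t "\<phi> t"] c by (auto simp: trees_iff is_path_bpath phi_def)
qed

lemma centralD:
  assumes "\<mu> \<in> central_measures"
  shows "\<mu> \<in> prob_measures path_top" "bpath \<gamma> \<Longrightarrow> measure \<mu> (cylinder \<gamma>) = phi \<mu> (endpoint \<gamma>)"
proof -
  show "\<mu> \<in> prob_measures path_top" using assms by (simp add: central_measures_def)
  show "bpath \<gamma> \<Longrightarrow> measure \<mu> (cylinder \<gamma>) = phi \<mu> (endpoint \<gamma>)"
    using assms nv_pos[of "endpoint \<gamma>"] by (auto simp: central_measures_def phi_def trees_iff is_path_bpath)
qed

lemma central_eqI:
  assumes "\<mu> \<in> central_measures" "\<nu> \<in> central_measures" "\<And>t. phi \<mu> t = phi \<nu> t"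
  shows "\<mu> = \<nu>"
  using assms centralD by (intro prob_measures_path_eqI) auto

text \<open>Splitting one cylinder by its next edge gives the harmonic equation, because the edge
  copies to \<open>b\<close> are counted by the occurrences of \<open>b\<close> in
  \<open>grow t\<close>.\<close>

lemma harmonic_phi:
  assumes \<mu>: "\<mu> \<in> central_measures" shows "harmonic (phi \<mu>)"
  unfolding harmonic_def
proof (intro conjI allI)
  interpret \<mu>: prob_space \<mu> using prob_measuresD[OF centralD(1)[OF \<mu>]] by simp
  have "measure \<mu> inf_paths = 1"
    using \<mu>.prob_space prob_measuresD(3)[OF centralD(1)[OF \<mu>]] by simp
  then show "phi \<mu> bullet = 1" using centralD(2)[OF \<mu> bpath_Nil] by simp
  fix t
  show "0 \<le> phi \<mu> t" by (simp add: phi_def)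
  obtain \<gamma> where \<gamma>: "bpath \<gamma>" "endpoint \<gamma> = t" using ex_bpath by blast
  have "phi \<mu> t = (\<Sum>e\<in>out_edges t. measure \<mu> (cylinder (\<gamma> @ [e])))"
    using centralD(2)[OF \<mu> \<gamma>(1)] measure_cylinder_split[OF centralD(1)[OF \<mu>] \<gamma>(1)] \<gamma>(2) by simp
  also have "\<dots> = (\<Sum>e\<in>out_edges t. phi \<mu> (target e))"
    using \<gamma> centralD(2)[OF \<mu>] by (intro sum.cong refl) (simp add: bpath_snoc)
  also have "\<dots> = (\<Sum>b\<in>#grow t. phi \<mu> b)" by (rule sum_out_edges)
  finally show "(\<Sum>b\<in>#grow t. phi \<mu> b) = phi \<mu> t" by simp
qed

subsection \<open>Central measures and harmonic functions\<close>

text \<open>Harmonicity is consistency of the weights \<open>\<phi> (endpoint \<gamma>)\<close>. The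
  extension lives on all edge sequences, gives full mass to the infinite paths, and is then
  transported to them.\<close>

lemma ex_measure_of_harmonic:
  assumes \<phi>: "harmonic \<phi>"
  shows "\<exists>\<mu>\<in>prob_measures path_top. \<forall>\<gamma>. bpath \<gamma> \<longrightarrow> measure \<mu> (cylinder \<gamma>) = \<phi> (endpoint \<gamma>)"
proof -
  \<comment> \<open>Edge words that are not paths get weight zero, which makes the alphabet at each
    place independent of the preceding letters.\<close>
  define w where "w \<gamma> = (if bpath \<gamma> then \<phi> (endpoint \<gamma>) else 0)" for \<gamma>
  have "0 \<le> w \<gamma>" for \<gamma> using \<phi> by (simp add: w_def harmonic_def)
  moreover have "w [] = 1" using \<phi> by (simp add: w_def harmonic_def)
  moreover have "(\<Sum>e\<in>level (length \<gamma>). w (\<gamma> @ [e])) = w \<gamma>" for \<gamma>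
  proof (cases "bpath \<gamma>")
    case True
    have "(\<Sum>e\<in>level (length \<gamma>). w (\<gamma> @ [e])) = (\<Sum>e\<in>out_edges (endpoint \<gamma>). \<phi> (target e))"
    proof (rule sum.mono_neutral_cong_right)
      show "out_edges (endpoint \<gamma>) \<subseteq> level (length \<gamma>)"
        using bpath_length[OF True] by (auto simp: level_def trees_iff)
      show "\<forall>e\<in>level (length \<gamma>) - out_edges (endpoint \<gamma>). w (\<gamma> @ [e]) = 0"
        by (auto simp: w_def bpath_snoc)
      show "w (\<gamma> @ [e]) = \<phi> (target e)" if "e \<in> out_edges (endpoint \<gamma>)" for e
        using that True by (simp add: w_def bpath_snoc)
    qed (rule finite_level)
    also have "\<dots> = \<phi> (endpoint \<gamma>)" using \<phi> by (simp add: sum_out_edges harmonic_def)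
    finally show ?thesis using True by (simp add: w_def)
  qed (simp add: w_def bpath_snoc)
  ultimately obtain M where M: "prob_space M" "sets M = sets (PiM UNIV (\<lambda>i. count_space (level i)))"
    "\<forall>\<gamma>. (\<forall>i<length \<gamma>. \<gamma> ! i \<in> level i) \<longrightarrow> measure M {\<omega> \<in> PiE UNIV level. \<forall>i<length \<gamma>. \<omega> i = \<gamma> ! i} = w \<gamma>"
    using cylinder_extension[of level w, OF finite_level] by blast
  interpret prob_space M by fact
  have space: "space M = PiE UNIV level" using sets_eq_imp_space_eq[OF M(2)] by (simp add: space_PiM)
  define C where "C \<gamma> = {\<omega> \<in> PiE UNIV level. \<forall>i<length \<gamma>. \<omega> i = \<gamma> ! i}" for \<gamma>
  have C_sets: "C \<gamma> \<in> sets M" for \<gamma> unfolding C_def M(2) by (rule cylinder_sets_PiM)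
  have C_iff: "\<omega> \<in> C \<gamma> \<longleftrightarrow> \<omega> \<in> space M \<and> map \<omega> [0..<length \<gamma>] = \<gamma>" for \<omega> \<gamma>
  proof -
    have "map \<omega> [0..<length \<gamma>] = \<gamma> \<longleftrightarrow> (\<forall>i<length \<gamma>. \<omega> i = \<gamma> ! i)"
      by (subst list_eq_iff_nth_eq) simp
    then show ?thesis by (simp add: C_def space)
  qed
  have inf_space: "inf_paths \<subseteq> space M" using inf_paths_level by (auto simp: space PiE_iff)
  have cyl: "cylinder \<gamma> = C \<gamma> \<inter> inf_paths" for \<gamma>
    using inf_space by (auto simp: C_iff cylinder_iff)
  note int = integral_cylinder[of M level w, OF M(1,2) finite_level M(3)[rule_format]]
  have "AE \<omega> in M. bpath (map \<omega> [0..<n])" for n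
  proof -
    let ?h = "\<lambda>\<gamma>. of_bool (\<not> bpath \<gamma>) :: real"
    have "(\<integral>\<omega>. ?h (map \<omega> [0..<n]) \<partial>M) = 0" using int(2)[of ?h n] by (simp add: w_def sum.neutral)
    then have "AE \<omega> in M. ?h (map \<omega> [0..<n]) = 0"
      by (subst (asm) integral_nonneg_eq_0_iff_AE[OF int(1)]) auto
    then show ?thesis by (rule AE_mp) simp
  qed
  then have "AE \<omega> in M. \<forall>n. bpath (map \<omega> [0..<n])" by (simp add: AE_all_countable)
  then have AE_inf: "AE \<omega> in M. \<omega> \<in> inf_paths" unfolding inf_paths_iff .
  \<comment> \<open>That infinite paths exist at all is read off from their probability being
    1.\<close>
  have "inf_paths \<noteq> {}"
  proof
    assume "inf_paths = {}"
    then have "AE \<omega> in M. False" using AE_inf by simp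
    then show False by simp
  qed
  then obtain \<omega>0 where \<omega>0: "\<omega>0 \<in> inf_paths" by blast
  have inf_sets: "inf_paths \<in> sets M"
  proof -
    have "{\<omega> \<in> space M. bpath (map \<omega> [0..<n])} = (\<Union>\<gamma>\<in>{\<gamma> \<in> vlists level n. bpath \<gamma>}. C \<gamma>)" for n
    proof (intro equalityI subsetI)
      fix \<omega> assume \<omega>: "\<omega> \<in> {\<omega> \<in> space M. bpath (map \<omega> [0..<n])}"
      then have "map \<omega> [0..<n] \<in> vlists level n" "\<omega> \<in> C (map \<omega> [0..<n])"
        using bpath_vlists[of "map \<omega> [0..<n]"] by (simp_all add: C_iff)
      then show "\<omega> \<in> (\<Union>\<gamma>\<in>{\<gamma> \<in> vlists level n. bpath \<gamma>}. C \<gamma>)" using \<omega> by blast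
    next
      fix \<omega> assume "\<omega> \<in> (\<Union>\<gamma>\<in>{\<gamma> \<in> vlists level n. bpath \<gamma>}. C \<gamma>)"
      then obtain \<gamma> where "length \<gamma> = n" "bpath \<gamma>" "\<omega> \<in> C \<gamma>" by (auto simp: vlists_def)
      then show "\<omega> \<in> {\<omega> \<in> space M. bpath (map \<omega> [0..<n])}" by (auto simp: C_iff)
    qed
    moreover have "finite {\<gamma> \<in> vlists level n. bpath \<gamma>}" for n using finite_vlists[of level n, OF finite_level] by simp
    ultimately have "{\<omega> \<in> space M. bpath (map \<omega> [0..<n])} \<in> sets M" for n
      using C_sets by (simp only:) (intro sets.finite_UN, auto)
    then have "{\<omega> \<in> space M. \<forall>n. bpath (map \<omega> [0..<n])} \<in> sets M" by (intro sets.sets_Collect_countable_All)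
    moreover have "{\<omega> \<in> space M. \<forall>n. bpath (map \<omega> [0..<n])} = inf_paths"
      using inf_space unfolding inf_paths_iff[symmetric] by blast
    ultimately show ?thesis by (simp only:)
  qed
  \<comment> \<open>Sequences outside the path space form a null set and may all be sent to an
    arbitrary path.\<close>
  define g where "g \<omega> = (if \<omega> \<in> inf_paths then \<omega> else \<omega>0)" for \<omega>
  have g: "g \<in> measurable M (borel_on path_top)"
  proof (rule measurable_borel_onI)
    show "g \<omega> \<in> topspace path_top" for \<omega> using \<omega>0 by (simp add: g_def)
    fix U assume U: "openin path_top U"
    let ?\<Gamma> = "{\<gamma>. bpath \<gamma> \<and> cylinder \<gamma> \<subseteq> U}"
    have "U = (\<Union>\<gamma>\<in>?\<Gamma>. cylinder \<gamma>)" by (rule openin_path_top_Union(1)[OF U])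
    moreover have "(\<Union>\<gamma>\<in>?\<Gamma>. cylinder \<gamma>) \<in> sets M"
      using openin_path_top_Union(2)[OF U] C_sets inf_sets by (intro sets.countable_UN') (auto simp: cyl)
    ultimately have Us: "U \<in> sets M" by simp
    have "U \<subseteq> inf_paths" using openin_subset[OF U] by simp
    then have "g -` U \<inter> space M = U \<union> (if \<omega>0 \<in> U then space M - inf_paths else {})"
      using inf_space by (auto simp: g_def split: if_splits)
    then show "g -` U \<inter> space M \<in> sets M" using Us inf_sets by simp
  qed
  define \<mu> where "\<mu> = distr M (borel_on path_top) g"
  have "\<mu> \<in> prob_measures path_top"
    unfolding \<mu>_def prob_measures_def using prob_space_distr[OF g] by simp
  moreover have "measure \<mu> (cylinder \<gamma>) = \<phi> (endpoint \<gamma>)" if \<gamma>: "bpath \<gamma>" for \<gamma>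
  proof -
    have "measure \<mu> (cylinder \<gamma>) = measure M (g -` cylinder \<gamma> \<inter> space M)"
      unfolding \<mu>_def by (rule measure_distr[OF g cylinder_sets])
    also have "\<dots> = measure M (C \<gamma>)"
    proof (rule measure_eq_AE)
      show "AE \<omega> in M. \<omega> \<in> g -` cylinder \<gamma> \<inter> space M \<longleftrightarrow> \<omega> \<in> C \<gamma>"
        using AE_inf by (rule AE_mp) (auto simp: g_def cyl)
    qed (use measurable_sets[OF g cylinder_sets] C_sets in auto)
    also have "\<dots> = w \<gamma>" unfolding C_def using M(3) bpath_length[OF \<gamma>] by blast
    finally show ?thesis using \<gamma> by (simp add: w_def)
  qed
  ultimately show ?thesis by blast
qed

lemma measure_of_state:
  assumes L: "left_pieri_state L"
  shows "measure_of_state L \<in> prob_measures path_top"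
    "is_path bullet \<gamma> t \<Longrightarrow> measure (measure_of_state L) (cylinder \<gamma>) = L (basis_F t)"
proof -
  let ?P = "\<lambda>\<mu>. \<mu> \<in> prob_measures path_top \<and> (\<forall>\<gamma> t. is_path bullet \<gamma> t \<longrightarrow> measure \<mu> (cylinder \<gamma>) = L (basis_F t))"
  obtain \<mu> where \<mu>: "\<mu> \<in> prob_measures path_top" "\<forall>\<gamma>. bpath \<gamma> \<longrightarrow> measure \<mu> (cylinder \<gamma>) = L (basis_F (endpoint \<gamma>))"
    using ex_measure_of_harmonic[OF left_pieri_harmonic[OF L]] by blast
  then have ex: "?P \<mu>" by (auto simp: is_path_bpath)
  moreover have "\<nu> = \<mu>" if "?P \<nu>" for \<nu>
    using that ex by (intro prob_measures_path_eqI) (auto simp: is_path_bpath)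
  ultimately have "?P (THE \<mu>. ?P \<mu>)" by (rule theI)
  then show "measure_of_state L \<in> prob_measures path_top"
    "is_path bullet \<gamma> t \<Longrightarrow> measure (measure_of_state L) (cylinder \<gamma>) = L (basis_F t)"
    unfolding measure_of_state_def by blast+
qed

definition mst :: "(rtree \<Rightarrow> real) \<Rightarrow> (nat \<Rightarrow> edge) measure" where
  "mst \<phi> = measure_of_state (lin_ext \<phi>)"

lemma mst_central:
  assumes "harmonic \<phi>" shows "mst \<phi> \<in> central_measures"
  using measure_of_state[OF harmonic_left_pieri[OF assms]]
  by (intro central_measuresI[where \<phi> = \<phi>]) (auto simp: mst_def is_path_bpath)

lemma phi_mst:
  assumes "harmonic \<phi>" shows "phi (mst \<phi>) t = \<phi> t"
  using measure_of_state[OF harmonic_left_pieri[OF assms]]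
  by (intro phi_eqI) (auto simp: mst_def)

lemma mst_phi:
  assumes "\<mu> \<in> central_measures" shows "mst (phi \<mu>) = \<mu>"
  using assms harmonic_phi[OF assms] by (intro central_eqI mst_central phi_mst)

text \<open>\<open>inv_into\<close> provides some state with the given measure; the cylinder masses
  then force its values on the basis.\<close>

lemma state_of_measure:
  assumes \<mu>: "\<mu> \<in> central_measures"
  shows "left_pieri_state (state_of_measure \<mu>)" "state_of_measure \<mu> (basis_F t) = phi \<mu> t"
proof -
  have "measure_of_state (lin_ext (phi \<mu>)) = \<mu>" using mst_phi[OF \<mu>] by (simp add: mst_def)
  moreover have "left_pieri_state (lin_ext (phi \<mu>))" by (rule harmonic_left_pieri[OF harmonic_phi[OF \<mu>]])
  ultimately have *: "\<mu> \<in> measure_of_state ` {L. left_pieri_state L}" by (intro image_eqI[of _ _ "lin_ext (phi \<mu>)"]) auto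
  show L: "left_pieri_state (state_of_measure \<mu>)"
    using inv_into_into[OF *] by (simp add: state_of_measure_def)
  have eq: "measure_of_state (state_of_measure \<mu>) = \<mu>"
    unfolding state_of_measure_def by (rule f_inv_into_f[OF *])
  obtain \<gamma> where "bpath \<gamma>" "endpoint \<gamma> = t" using ex_bpath by blast
  then show "state_of_measure \<mu> (basis_F t) = phi \<mu> t"
    using measure_of_state(2)[OF L, of \<gamma> t] centralD(2)[OF \<mu>, of \<gamma>] by (simp add: eq is_path_bpath)
qed

subsection \<open>Weak topologies\<close>

lemma topspace_weak_topology [simp]: "topspace (weak_topology X) = prob_measures X"
proof -
  have "prob_measures X \<in> {{\<mu> \<in> prob_measures X. (\<integral>x. f x \<partial>\<mu>) \<in> U} | f U.
        continuous_map X euclideanreal f \<and> bounded (f ` topspace X) \<and> open U}"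
    by (intro CollectI exI[of _ "\<lambda>_. 0"] exI[of _ UNIV]) (auto simp: bounded_iff)
  then show ?thesis unfolding weak_topology_def topology_generated_by_topspace by blast
qed

lemma continuous_map_weak_integral:
  assumes "continuous_map X euclideanreal f" "bounded (f ` topspace X)"
  shows "continuous_map (weak_topology X) euclideanreal (\<lambda>\<mu>. \<integral>x. f x \<partial>\<mu>)"
  unfolding continuous_map_def
proof (intro conjI allI impI)
  fix U :: "real set" assume "openin euclideanreal U"
  then show "openin (weak_topology X) {\<mu> \<in> topspace (weak_topology X). (\<integral>x. f x \<partial>\<mu>) \<in> U}"
    unfolding topspace_weak_topology unfolding weak_topology_def
    by (intro topology_generated_by_Basis) (use assms in auto)
qed simp

lemma continuous_map_into_weak:
  assumes h: "\<And>z. z \<in> topspace Z \<Longrightarrow> h z \<in> prob_measures X"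
    and cont: "\<And>f. continuous_map X euclideanreal f \<Longrightarrow> bounded (f ` topspace X) \<Longrightarrow>
       continuous_map Z euclideanreal (\<lambda>z. \<integral>x. f x \<partial>h z)"
  shows "continuous_map Z (weak_topology X) h"
  unfolding weak_topology_def
proof (rule continuous_on_generated_topo)
  fix U assume "U \<in> {{\<mu> \<in> prob_measures X. (\<integral>x. f x \<partial>\<mu>) \<in> U} | f U.
        continuous_map X euclideanreal f \<and> bounded (f ` topspace X) \<and> open U}"
  then obtain f V where U: "U = {\<mu> \<in> prob_measures X. (\<integral>x. f x \<partial>\<mu>) \<in> V}"
    and f: "continuous_map X euclideanreal f" "bounded (f ` topspace X)" and V: "open V" by blast
  have "openin Z {z \<in> topspace Z. (\<integral>x. f x \<partial>h z) \<in> V}"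
    using cont[OF f] V by (simp add: continuous_map_def)
  moreover have "h -` U \<inter> topspace Z = {z \<in> topspace Z. (\<integral>x. f x \<partial>h z) \<in> V}"
    unfolding U using h by auto
  ultimately show "openin Z (h -` U \<inter> topspace Z)" by simp
next
  have "h ` topspace Z \<subseteq> topspace (weak_topology X)" using h by auto
  then show "h ` topspace Z \<subseteq> \<Union> {{\<mu> \<in> prob_measures X. (\<integral>x. f x \<partial>\<mu>) \<in> U} | f U.
        continuous_map X euclideanreal f \<and> bounded (f ` topspace X) \<and> open U}"
    unfolding weak_topology_def topology_generated_by_topspace .
qed

text \<open>A uniform limit of continuous functions is continuous. This serves for functionals that
  are only approximated by finitely many values of \<open>phi\<close>.\<close>

lemma continuous_map_approx:
  fixes f :: "'a \<Rightarrow> real"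
  assumes "\<And>e. e > 0 \<Longrightarrow> \<exists>g. continuous_map Z euclideanreal g \<and> (\<forall>z\<in>topspace Z. \<bar>g z - f z\<bar> \<le> e)"
  shows "continuous_map Z euclideanreal f"
proof -
  obtain g where g: "\<And>e. e > 0 \<Longrightarrow> continuous_map Z euclideanreal (g e)"
    "\<And>e z. e > 0 \<Longrightarrow> z \<in> topspace Z \<Longrightarrow> \<bar>g e z - f z\<bar> \<le> e"
    using assms by metis
  have "continuous_map Z Met_TC.mtopology f"
  proof (rule Met_TC.continuous_map_uniform_limit[where F = sequentially and f = "\<lambda>n. g (1 / real (Suc n))"])
    show "\<forall>\<^sub>F n in sequentially. continuous_map Z Met_TC.mtopology (g (1 / real (Suc n)))"
      using g(1) by simp
    fix e :: real assume e: "e > 0"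
    obtain N where N: "inverse (real (Suc N)) < e" using reals_Archimedean[OF e] by blast
    show "\<forall>\<^sub>F n in sequentially. \<forall>z\<in>topspace Z. f z \<in> UNIV \<and> dist (g (1 / real (Suc n)) z) (f z) < e"
    proof (rule eventually_mono[OF eventually_ge_at_top[of N]], intro ballI conjI UNIV_I)
      fix n z assume n: "N \<le> n" and z: "z \<in> topspace Z"
      have "\<bar>g (1 / real (Suc n)) z - f z\<bar> \<le> 1 / real (Suc n)" using g(2) z by simp
      also have "\<dots> \<le> 1 / real (Suc N)" using n by (intro divide_left_mono) auto
      also have "\<dots> < e" using N by (simp add: inverse_eq_divide)
      finally show "dist (g (1 / real (Suc n)) z) (f z) < e" by (simp add: dist_real_def)
    qed
  qed simp
  then show ?thesis by simp
qed

text \<open>A sequence that is not a path fails on some finite prefix, so the paths are closed in a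
  product of finite discrete spaces.\<close>

lemma compact_space_path_top: "compact_space path_top"
proof -
  let ?P = "product_topology (\<lambda>n. discrete_topology (level n)) UNIV"
  have "compact_space ?P"
    by (simp add: compact_space_product_topology compact_space_discrete_topology finite_level)
  moreover have "closedin ?P inf_paths"
    unfolding closedin_def
  proof (intro conjI)
    show "inf_paths \<subseteq> topspace ?P" using inf_paths_level by auto
    show "openin ?P (topspace ?P - inf_paths)"
    proof (subst openin_subopen, intro ballI)
      fix \<omega> assume \<omega>: "\<omega> \<in> topspace ?P - inf_paths"
      then obtain n where n: "\<not> bpath (map \<omega> [0..<n])" using inf_paths_iff[of \<omega>] by blast
      let ?S = "\<lambda>i. if i < n then {\<omega> i} else level i"
      have lev: "\<omega> i \<in> level i" for i using \<omega> by auto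
      have "finite {i. ?S i \<noteq> level i}" by (rule finite_subset[of _ "{..<n}"]) auto
      then have "openin ?P (PiE UNIV ?S)" using lev by (subst openin_PiE_gen) auto
      moreover have "\<omega> \<in> PiE UNIV ?S" using lev by (auto simp: PiE_iff)
      moreover have "PiE UNIV ?S \<subseteq> topspace ?P - inf_paths"
      proof
        fix \<omega>' assume \<omega>': "\<omega>' \<in> PiE UNIV ?S"
        then have S: "\<omega>' i \<in> ?S i" for i by (simp add: PiE_iff)
        have "\<omega>' i \<in> level i" for i using S[of i] lev[of i] by (simp split: if_splits)
        moreover have m: "map \<omega>' [0..<n] = map \<omega> [0..<n]"
        proof (rule map_cong[OF refl])
          fix i assume "i \<in> set [0..<n]"
          then show "\<omega>' i = \<omega> i" using S[of i] by simp
        qed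
        have "\<not> bpath (map \<omega>' [0..<n])" unfolding m by (rule n)
        then have "\<omega>' \<notin> inf_paths" using inf_paths_iff[of \<omega>'] by blast
        ultimately show "\<omega>' \<in> topspace ?P - inf_paths" by auto
      qed
      ultimately show "\<exists>T. openin ?P T \<and> \<omega> \<in> T \<and> T \<subseteq> topspace ?P - inf_paths" by blast
    qed
  qed
  ultimately have "compactin ?P inf_paths" by (rule closedin_compact_space)
  then show ?thesis unfolding path_top_eq by (rule compact_space_subtopology)
qed

text \<open>Finitely many cylinders on which \<open>f\<close> oscillates by less than
  \<open>e\<close> cover the space; the longest of their words gives \<open>n\<close>.\<close>

lemma path_top_uniform:
  assumes f: "continuous_map path_top euclideanreal f" and e: "e > 0"
  obtains n where "\<And>\<omega> \<omega>'. \<omega> \<in> inf_paths \<Longrightarrow> \<omega>' \<in> cylinder (map \<omega> [0..<n]) \<Longrightarrow> \<bar>f \<omega> - f \<omega>'\<bar> < e"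
proof -
  define \<Gamma> where "\<Gamma> = {\<gamma>. \<forall>x\<in>cylinder \<gamma>. \<forall>y\<in>cylinder \<gamma>. \<bar>f x - f y\<bar> < e}"
  have cover: "inf_paths \<subseteq> \<Union> (cylinder ` \<Gamma>)"
  proof
    fix \<omega> assume \<omega>: "\<omega> \<in> inf_paths"
    let ?U = "{x \<in> topspace path_top. f x \<in> ball (f \<omega>) (e / 2)}"
    have "openin euclideanreal (ball (f \<omega>) (e / 2))" by (simp add: open_openin[symmetric])
    then have "openin path_top ?U" using f unfolding continuous_map_def by blast
    moreover have "\<omega> \<in> ?U" using \<omega> e by simp
    ultimately obtain n where n: "cylinder (map \<omega> [0..<n]) \<subseteq> ?U" by (rule openin_path_top_cylinder)
    have "map \<omega> [0..<n] \<in> \<Gamma>" unfolding \<Gamma>_def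
    proof (intro CollectI ballI)
      fix x y assume "x \<in> cylinder (map \<omega> [0..<n])" "y \<in> cylinder (map \<omega> [0..<n])"
      then have "\<bar>f x - f \<omega>\<bar> < e / 2" "\<bar>f y - f \<omega>\<bar> < e / 2" using n by (auto simp: dist_real_def abs_minus_commute)
      then show "\<bar>f x - f y\<bar> < e" by linarith
    qed
    then show "\<omega> \<in> \<Union> (cylinder ` \<Gamma>)" using mem_cylinder_map[OF \<omega>] by blast
  qed
  have "\<exists>\<F>. finite \<F> \<and> \<F> \<subseteq> cylinder ` \<Gamma> \<and> inf_paths \<subseteq> \<Union>\<F>"
    using compact_space_path_top[unfolded compact_space_alt, rule_format, of "cylinder ` \<Gamma>"] cover openin_cylinder
    by auto
  then obtain \<F> where "finite \<F>" "\<F> \<subseteq> cylinder ` \<Gamma>" and cov: "inf_paths \<subseteq> \<Union>\<F>" by blast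
  then obtain \<Gamma>0 where \<Gamma>0: "\<Gamma>0 \<subseteq> \<Gamma>" "finite \<Gamma>0" "\<F> = cylinder ` \<Gamma>0" by (meson finite_subset_image)
  obtain n where n: "\<And>\<gamma>. \<gamma> \<in> \<Gamma>0 \<Longrightarrow> length \<gamma> \<le> n"
    using finite_nat_set_iff_bounded_le[of "length ` \<Gamma>0"] \<Gamma>0(2) by auto
  show ?thesis
  proof (rule that[of n])
    fix \<omega> \<omega>' assume \<omega>: "\<omega> \<in> inf_paths" "\<omega>' \<in> cylinder (map \<omega> [0..<n])"
    obtain \<gamma> where \<gamma>: "\<gamma> \<in> \<Gamma>0" "\<omega> \<in> cylinder \<gamma>" using cov \<omega>(1) \<Gamma>0(3) by blast
    have "\<omega>' \<in> cylinder \<gamma>" using \<gamma>(2) \<omega>(2) n[OF \<gamma>(1)] by (auto simp: cylinder_def)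
    then show "\<bar>f \<omega> - f \<omega>'\<bar> < e" using \<gamma> \<Gamma>0(1) by (auto simp: \<Gamma>_def)
  qed
qed

subsection \<open>The compact convex set of central measures\<close>

definition bpaths :: "nat \<Rightarrow> edge list set" where
  "bpaths n = {\<gamma>. bpath \<gamma> \<and> length \<gamma> = n}"

lemma finite_bpaths: "finite (bpaths n)"
  by (rule finite_subset[OF _ finite_vlists[of level n, OF finite_level]])
     (use bpath_vlists in \<open>auto simp: bpaths_def\<close>)

lemma map_in_bpaths: "\<omega> \<in> inf_paths \<Longrightarrow> map \<omega> [0..<n] \<in> bpaths n"
  using inf_paths_prefix[of \<omega> n] by (simp add: bpaths_def)

lemma prefix_function_eq:
  fixes h :: "edge list \<Rightarrow> real"
  assumes "\<omega> \<in> inf_paths"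
  shows "h (map \<omega> [0..<n]) = (\<Sum>\<gamma>\<in>bpaths n. indicat_real (cylinder \<gamma>) \<omega> * h \<gamma>)"
proof -
  have *: "indicat_real (cylinder \<gamma>) \<omega> * h \<gamma> = (if \<gamma> = map \<omega> [0..<n] then h \<gamma> else 0)" if "\<gamma> \<in> bpaths n" for \<gamma>
    using that assms by (auto simp: cylinder_iff bpaths_def indicator_def)
  have "(\<Sum>\<gamma>\<in>bpaths n. indicat_real (cylinder \<gamma>) \<omega> * h \<gamma>) = (\<Sum>\<gamma>\<in>bpaths n. if \<gamma> = map \<omega> [0..<n] then h \<gamma> else 0)"
    by (intro sum.cong refl *)
  then show ?thesis using map_in_bpaths[OF assms] by (simp add: sum.delta[OF finite_bpaths])
qed

lemma integral_prefix_function: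
  fixes h :: "edge list \<Rightarrow> real"
  assumes \<mu>: "\<mu> \<in> prob_measures path_top"
  shows "integrable \<mu> (\<lambda>\<omega>. h (map \<omega> [0..<n]))"
    "(\<integral>\<omega>. h (map \<omega> [0..<n]) \<partial>\<mu>) = (\<Sum>\<gamma>\<in>bpaths n. measure \<mu> (cylinder \<gamma>) * h \<gamma>)"
proof -
  interpret prob_space \<mu> using prob_measuresD[OF \<mu>] by simp
  have sp: "space \<mu> = inf_paths" using prob_measuresD(3)[OF \<mu>] by simp
  have s: "cylinder \<gamma> \<in> sets \<mu>" for \<gamma> using prob_measuresD(2)[OF \<mu>] by simp
  have i: "integrable \<mu> (\<lambda>\<omega>. indicat_real (cylinder \<gamma>) \<omega> * h \<gamma>)" for \<gamma>
    using s by (intro integrable_mult_left integrable_real_indicator) (auto simp: less_top[symmetric])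
  show "integrable \<mu> (\<lambda>\<omega>. h (map \<omega> [0..<n]))"
    by (subst Bochner_Integration.integrable_cong[OF refl prefix_function_eq]) (auto simp: sp intro!: i)
  have "(\<integral>\<omega>. h (map \<omega> [0..<n]) \<partial>\<mu>) = (\<integral>\<omega>. (\<Sum>\<gamma>\<in>bpaths n. indicat_real (cylinder \<gamma>) \<omega> * h \<gamma>) \<partial>\<mu>)"
    by (intro Bochner_Integration.integral_cong refl prefix_function_eq) (simp add: sp)
  also have "\<dots> = (\<Sum>\<gamma>\<in>bpaths n. measure \<mu> (cylinder \<gamma>) * h \<gamma>)"
    using i s by (subst Bochner_Integration.integral_sum) (auto simp: sp Int_absorb2[OF cylinder_subset])
  finally show "(\<integral>\<omega>. h (map \<omega> [0..<n]) \<partial>\<mu>) = (\<Sum>\<gamma>\<in>bpaths n. measure \<mu> (cylinder \<gamma>) * h \<gamma>)" .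
qed

lemma continuous_prefix_function:
  fixes h :: "edge list \<Rightarrow> real"
  shows "continuous_map path_top euclideanreal (\<lambda>\<omega>. h (map \<omega> [0..<n]))"
  unfolding continuous_map_def
proof (intro conjI allI impI)
  fix U :: "real set"
  have "{\<omega> \<in> topspace path_top. h (map \<omega> [0..<n]) \<in> U} = (\<Union>\<gamma>\<in>{\<gamma>. length \<gamma> = n \<and> h \<gamma> \<in> U}. cylinder \<gamma>)"
    by (auto simp: cylinder_iff)
  then show "openin path_top {\<omega> \<in> topspace path_top. h (map \<omega> [0..<n]) \<in> U}"
    using openin_cylinder by auto
qed simp

lemma topspace_central_top [simp]: "topspace central_top = central_measures"
  by (auto simp: central_top_def central_measures_def)

text \<open>Cylinders are open and closed, so their indicators are continuous test
  functions.\<close>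

lemma continuous_map_phi: "continuous_map central_top euclideanreal (\<lambda>\<mu>. phi \<mu> t)"
proof -
  obtain \<gamma> where \<gamma>: "bpath \<gamma>" "endpoint \<gamma> = t" using ex_bpath by blast
  let ?f = "\<lambda>\<omega>. of_bool (map \<omega> [0..<length \<gamma>] = \<gamma>) :: real"
  have "continuous_map (weak_topology path_top) euclideanreal (\<lambda>\<mu>. \<integral>\<omega>. ?f \<omega> \<partial>\<mu>)"
    by (rule continuous_map_weak_integral[OF continuous_prefix_function[of "\<lambda>x. of_bool (x = \<gamma>)"]])
       (auto simp: bounded_iff intro!: exI[of _ 1])
  then have "continuous_map central_top euclideanreal (\<lambda>\<mu>. \<integral>\<omega>. ?f \<omega> \<partial>\<mu>)"
    unfolding central_top_def by (rule continuous_map_from_subtopology)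
  moreover have "(\<integral>\<omega>. ?f \<omega> \<partial>\<mu>) = phi \<mu> t" if "\<mu> \<in> topspace central_top" for \<mu>
  proof -
    have \<mu>: "\<mu> \<in> central_measures" using that by simp
    have "(\<integral>\<omega>. ?f \<omega> \<partial>\<mu>) = (\<Sum>\<delta>\<in>bpaths (length \<gamma>). measure \<mu> (cylinder \<delta>) * of_bool (\<delta> = \<gamma>))"
      by (rule integral_prefix_function(2)[OF centralD(1)[OF \<mu>], of "\<lambda>x. of_bool (x = \<gamma>)"])
    also have "\<dots> = (\<Sum>\<delta>\<in>bpaths (length \<gamma>). if \<delta> = \<gamma> then measure \<mu> (cylinder \<delta>) else 0)"
      by (intro sum.cong) auto
    also have "\<dots> = measure \<mu> (cylinder \<gamma>)"
      using \<gamma> by (subst sum.delta[OF finite_bpaths]) (simp add: bpaths_def)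
    finally show ?thesis using centralD(2)[OF \<mu> \<gamma>(1)] \<gamma>(2) by simp
  qed
  ultimately show ?thesis by (rule continuous_map_eq)
qed

text \<open>A continuous function on paths is uniformly close to a function of a finite prefix,
  whose integral is a finite combination of values of \<open>phi\<close>. On central measures the
  weak topology is thus pointwise convergence of \<open>phi\<close>.\<close>

lemma continuous_into_central:
  assumes h: "\<And>z. z \<in> topspace Z \<Longrightarrow> h z \<in> central_measures"
    and cont: "\<And>t. continuous_map Z euclideanreal (\<lambda>z. phi (h z) t)"
  shows "continuous_map Z central_top h"
  unfolding central_top_def
proof (rule continuous_map_into_subtopology[OF continuous_map_into_weak])
  show "h z \<in> prob_measures path_top" if "z \<in> topspace Z" for z
    using centralD(1)[OF h[OF that]] .
  show "h \<in> topspace Z \<rightarrow> central_measures" using h by blast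
  fix f :: "(nat \<Rightarrow> edge) \<Rightarrow> real"
  assume f: "continuous_map path_top euclideanreal f" "bounded (f ` topspace path_top)"
  show "continuous_map Z euclideanreal (\<lambda>z. \<integral>\<omega>. f \<omega> \<partial>h z)"
  proof (rule continuous_map_approx)
    fix e :: real assume e: "e > 0"
    obtain n where n: "\<And>\<omega> \<omega>'. \<omega> \<in> inf_paths \<Longrightarrow> \<omega>' \<in> cylinder (map \<omega> [0..<n]) \<Longrightarrow> \<bar>f \<omega> - f \<omega>'\<bar> < e"
      using path_top_uniform[OF f(1) e] by blast
    define k where "k \<gamma> = f (SOME \<omega>. \<omega> \<in> cylinder \<gamma>)" for \<gamma>
    have k: "\<bar>f \<omega> - k (map \<omega> [0..<n])\<bar> \<le> e" if "\<omega> \<in> inf_paths" for \<omega>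
      unfolding k_def using n[OF that] someI_ex[of "\<lambda>\<omega>'. \<omega>' \<in> cylinder (map \<omega> [0..<n])"]
        mem_cylinder_map[OF that, of n] by (meson less_imp_le)
    show "\<exists>g. continuous_map Z euclideanreal g \<and> (\<forall>z\<in>topspace Z. \<bar>g z - (\<integral>\<omega>. f \<omega> \<partial>h z)\<bar> \<le> e)"
    proof (intro exI conjI ballI)
      show "continuous_map Z euclideanreal (\<lambda>z. \<Sum>\<gamma>\<in>bpaths n. phi (h z) (endpoint \<gamma>) * k \<gamma>)"
        using finite_bpaths cont by (intro continuous_intros) auto
      fix z assume "z \<in> topspace Z"
      note hz = h[OF this]
      note hp = centralD(1)[OF hz]
      interpret prob_space "h z" using prob_measuresD[OF hp] by simp
      have sp: "space (h z) = inf_paths" using prob_measuresD(3)[OF hp] by simp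
      obtain B where B: "\<And>\<omega>. \<omega> \<in> inf_paths \<Longrightarrow> \<bar>f \<omega>\<bar> \<le> B" using f(2) by (auto simp: bounded_iff)
      have "f \<in> borel_measurable (h z)"
        using borel_measurable_borel_on[OF f(1)] measurable_cong_sets[OF prob_measuresD(2)[OF hp] refl] by blast
      then have fi: "integrable (h z) f" by (rule integrable_const_bound[of _ B, rotated]) (use B sp in auto)
      note ki = integral_prefix_function[OF hp, of k n]
      have "(\<Sum>\<gamma>\<in>bpaths n. phi (h z) (endpoint \<gamma>) * k \<gamma>) = (\<Sum>\<gamma>\<in>bpaths n. measure (h z) (cylinder \<gamma>) * k \<gamma>)"
        using centralD(2)[OF hz] by (intro sum.cong) (auto simp: bpaths_def)
      then have "(\<Sum>\<gamma>\<in>bpaths n. phi (h z) (endpoint \<gamma>) * k \<gamma>) - (\<integral>\<omega>. f \<omega> \<partial>h z)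
          = (\<integral>\<omega>. k (map \<omega> [0..<n]) - f \<omega> \<partial>h z)"
        using fi ki by (simp add: Bochner_Integration.integral_diff)
      also have "\<bar>\<dots>\<bar> \<le> (\<integral>\<omega>. \<bar>k (map \<omega> [0..<n]) - f \<omega>\<bar> \<partial>h z)" by (rule integral_abs_bound)
      also have "\<dots> \<le> (\<integral>\<omega>. e \<partial>h z)"
        by (rule integral_mono) (use fi ki k sp in \<open>auto simp: abs_minus_commute\<close>)
      also have "\<dots> = e" by (simp add: prob_space)
      finally show "\<bar>(\<Sum>\<gamma>\<in>bpaths n. phi (h z) (endpoint \<gamma>) * k \<gamma>) - (\<integral>\<omega>. f \<omega> \<partial>h z)\<bar> \<le> e" .
    qed
  qed
qed

text \<open>The bound by 1 places harmonic functions in a compact cube, and each defining equation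
  involves finitely many coordinates.\<close>

lemma compact_harmonic: "compact {\<phi>. harmonic \<phi>}"
proof -
  have "compactin (product_topology (\<lambda>_::rtree. euclideanreal) UNIV) (PiE UNIV (\<lambda>_. {0..1}))"
    by (simp add: compactin_PiE compactin_euclidean_iff)
  then have cube: "compact (PiE UNIV (\<lambda>_::rtree. {0..1::real}))"
    by (simp add: euclidean_product_topology compactin_euclidean_iff)
  have eq: "{\<phi>. harmonic \<phi>} = PiE UNIV (\<lambda>_. {0..1}) \<inter> ({\<phi>. \<phi> bullet = 1} \<inter>
      (\<Inter>t. {\<phi>. (\<Sum>x\<in>set_mset (grow t). real (count (grow t) x) * \<phi> x) = \<phi> t}))"
    using harmonic_le_1 by (auto simp: harmonic_def sum_mset_count)
  have "closed ({\<phi>. \<phi> bullet = (1::real)} \<inter>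
      (\<Inter>t. {\<phi>. (\<Sum>x\<in>set_mset (grow t). real (count (grow t) x) * \<phi> x) = \<phi> t}))"
    by (intro closed_Int closed_INT ballI closed_Collect_eq continuous_intros continuous_on_product_coordinates)
  then show ?thesis unfolding eq using cube by (rule compact_Int_closed[rotated])
qed

lemma compact_space_central_top: "compact_space central_top"
proof -
  have "continuous_map (top_of_set {\<phi>. harmonic \<phi>}) central_top mst"
  proof (rule continuous_into_central)
    show "mst \<phi> \<in> central_measures" if "\<phi> \<in> topspace (top_of_set {\<phi>. harmonic \<phi>})" for \<phi>
      using that by (simp add: mst_central)
    fix t
    have "continuous_on {\<phi>. harmonic \<phi>} (\<lambda>\<phi>. phi (mst \<phi>) t) \<longleftrightarrow> continuous_on {\<phi>. harmonic \<phi>} (\<lambda>\<phi>. \<phi> t)"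
      by (rule continuous_on_cong) (auto simp: phi_mst)
    moreover have "continuous_on {\<phi>. harmonic \<phi>} (\<lambda>\<phi>. \<phi> t)" by (intro continuous_on_product_coordinates[THEN continuous_on_subset]) simp
    ultimately show "continuous_map (top_of_set {\<phi>. harmonic \<phi>}) euclideanreal (\<lambda>\<phi>. phi (mst \<phi>) t)" by simp
  qed
  moreover have "compactin (top_of_set {\<phi>. harmonic \<phi>}) {\<phi>. harmonic \<phi>}"
    using compact_harmonic by (simp add: compactin_subtopology compactin_euclidean_iff)
  ultimately have "compactin central_top (mst ` {\<phi>. harmonic \<phi>})" by (rule image_compactin[rotated])
  moreover have "mst ` {\<phi>. harmonic \<phi>} = central_measures"
  proof
    show "mst ` {\<phi>. harmonic \<phi>} \<subseteq> central_measures" using mst_central by blast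
    show "central_measures \<subseteq> mst ` {\<phi>. harmonic \<phi>}"
    proof
      fix \<mu> assume "\<mu> \<in> central_measures"
      then show "\<mu> \<in> mst ` {\<phi>. harmonic \<phi>}" using mst_phi harmonic_phi by (intro image_eqI[of _ _ "phi \<mu>"]) auto
    qed
  qed
  ultimately show ?thesis by (simp add: compact_space_def)
qed

lemma Hausdorff_space_central_top: "Hausdorff_space central_top"
proof (rule Hausdorff_space_injective_preimage)
  show "Hausdorff_space (product_topology (\<lambda>_::rtree. euclideanreal) UNIV)"
    by (simp add: Hausdorff_space_product_topology)
  show "continuous_map central_top (product_topology (\<lambda>_. euclideanreal) UNIV) phi"
    using continuous_map_phi by (simp add: continuous_map_componentwise_UNIV)
  show "inj_on phi (topspace central_top)"
    using central_eqI by (intro inj_onI) (simp add: fun_eq_iff)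
qed

text \<open>The event that the \<open>n\<close>-th vertex is no path forest has as probability the
  sum of the terms \<open>num_paths t * phi \<mu> t\<close>, which are nonnegative with positive
  path counts.\<close>

lemma path_forest_measures_iff:
  "\<mu> \<in> path_forest_measures \<longleftrightarrow> \<mu> \<in> central_measures \<and> (\<forall>t. \<not> path_forest t \<longrightarrow> phi \<mu> t = 0)"
proof (cases "\<mu> \<in> central_measures")
  case \<mu>: True
  interpret prob_space \<mu> using prob_measuresD[OF centralD(1)[OF \<mu>]] by simp
  have sp: "space \<mu> = inf_paths" using prob_measuresD(3)[OF centralD(1)[OF \<mu>]] by simp
  define A where "A t = {\<omega> \<in> inf_paths. vertex_at (nv t) \<omega> = t}" for t
  have A: "A t \<in> sets \<mu>" for t
    unfolding A_def vertex_set_eq[OF refl] using prob_measuresD(2)[OF centralD(1)[OF \<mu>]] finite_paths_to[of t]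
    by (intro sets.finite_UN) auto
  have mA: "measure \<mu> (A t) = real (num_paths t) * phi \<mu> t" for t
    using num_paths_pos[of t] by (simp add: phi_def A_def)
  have *: "measure \<mu> {\<omega> \<in> inf_paths. path_forest (vertex_at n \<omega>)} = 1 - (\<Sum>t\<in>{t\<in>trees n. \<not> path_forest t}. measure \<mu> (A t))"
    if n: "n \<ge> 1" for n
  proof -
    let ?T = "{t\<in>trees n. \<not> path_forest t}"
    have fin: "finite ?T" using finite_trees by simp
    have vt: "vertex_at n \<omega> \<in> trees n" if "\<omega> \<in> inf_paths" for \<omega>
      using inf_paths_level[OF that, of "n - 1"] n by (simp add: level_def vertex_at_def)
    have "{\<omega> \<in> inf_paths. path_forest (vertex_at n \<omega>)} = space \<mu> - (\<Union>t\<in>?T. A t)"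
      using vt by (auto simp: sp A_def trees_iff)
    also have "measure \<mu> \<dots> = 1 - measure \<mu> (\<Union>t\<in>?T. A t)"
      using fin A by (intro prob_compl sets.finite_UN) auto
    also have "measure \<mu> (\<Union>t\<in>?T. A t) = (\<Sum>t\<in>?T. measure \<mu> (A t))"
      using fin A by (intro finite_measure_finite_Union) (auto simp: disjoint_family_on_def A_def trees_iff)
    finally show ?thesis .
  qed
  show ?thesis
  proof
    assume "\<mu> \<in> path_forest_measures"
    then have pf: "measure \<mu> {\<omega> \<in> inf_paths. path_forest (vertex_at n \<omega>)} = 1" if "n \<ge> 1" for n
      using that by (simp add: path_forest_measures_def)
    have "phi \<mu> t = 0" if t: "\<not> path_forest t" for t
    proof -
      have n: "nv t \<ge> 1" using nv_pos[of t] by simp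
      have "(\<Sum>s\<in>{s\<in>trees (nv t). \<not> path_forest s}. measure \<mu> (A s)) = 0" using *[OF n] pf[OF n] by simp
      moreover have "finite {s\<in>trees (nv t). \<not> path_forest s}" using finite_trees by simp
      ultimately have "\<forall>s\<in>{s\<in>trees (nv t). \<not> path_forest s}. measure \<mu> (A s) = 0"
        by (subst (asm) sum_nonneg_eq_0_iff) auto
      then have "measure \<mu> (A t) = 0" using t by (simp add: trees_iff)
      then show ?thesis using mA[of t] num_paths_pos[of t] by simp
    qed
    then show "\<mu> \<in> central_measures \<and> (\<forall>t. \<not> path_forest t \<longrightarrow> phi \<mu> t = 0)" using \<mu> by blast
  next
    assume "\<mu> \<in> central_measures \<and> (\<forall>t. \<not> path_forest t \<longrightarrow> phi \<mu> t = 0)"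
    then have "measure \<mu> (A t) = 0" if "\<not> path_forest t" for t using that mA[of t] by simp
    then show "\<mu> \<in> path_forest_measures" using * \<mu> by (simp add: path_forest_measures_def)
  qed
qed (simp add: path_forest_measures_def)

subsection \<open>The exposing functional\<close>

text \<open>The defect of index \<open>k + 3\<close>, with the product by \<open>tau\<close>
  expanded into its two trees; the shift lets the series run over all natural numbers.\<close>

definition chain_defect :: "(nat \<Rightarrow> edge) measure \<Rightarrow> nat \<Rightarrow> real" where
  "chain_defect \<mu> k = phi \<mu> (chain (Suc (Suc (Suc k))))
     - (phi \<mu> (chain (Suc (Suc (Suc (Suc k))))) + phi \<mu> (Node {#bullet, chain (Suc (Suc k))#}))"

lemma delta_chain_defect:
  assumes \<mu>: "\<mu> \<in> central_measures"
  shows "delta (k + 3) (state_of_measure \<mu>) = chain_defect \<mu> k"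
proof -
  have lin: "linear (state_of_measure \<mu>)" using state_of_measure(1)[OF \<mu>] by (simp add: left_pieri_state_def)
  have k: "k + 3 = Suc (Suc (Suc k))" by simp
  show ?thesis
    unfolding delta_def k gl_mult_basis gl_basis_mult_chain_tau linear_add[OF lin]
      state_of_measure(2)[OF \<mu>] chain_defect_def by simp
qed

lemma chain_defect_bounds:
  assumes \<mu>: "\<mu> \<in> central_measures" shows "0 \<le> chain_defect \<mu> k" "chain_defect \<mu> k \<le> 1"
  using delta_bounds[OF state_of_measure(1)[OF \<mu>], of "k + 3"] by (simp_all add: delta_chain_defect[OF \<mu>])

lemma summable_chain_defect:
  assumes \<mu>: "\<mu> \<in> central_measures" shows "summable (\<lambda>k. 1 / 2 ^ (k + 3) * chain_defect \<mu> k)"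
proof (rule summable_comparison_test'[of "\<lambda>k. (1 / 2) ^ k" 0])
  show "summable (\<lambda>k. (1 / 2 :: real) ^ k)" by (rule summable_geometric) simp
  fix k :: nat
  have "1 / 2 ^ (k + 3) * chain_defect \<mu> k \<le> 1 / 2 ^ (k + 3) * 1"
    using chain_defect_bounds[OF \<mu>] by (intro mult_left_mono) auto
  also have "\<dots> \<le> (1 / 2) ^ k" by (simp add: power_add power_one_over field_simps)
  finally show "norm (1 / 2 ^ (k + 3) * chain_defect \<mu> k) \<le> (1 / 2) ^ k"
    using chain_defect_bounds[OF \<mu>, of k] by simp
qed

text \<open>For summable nonnegative terms the unordered sum over \<open>{3..}\<close> is an
  ordinary series after a shift of the index.\<close>

lemma face_functional_eq:
  assumes \<mu>: "\<mu> \<in> central_measures"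
  shows "face_functional \<mu> = suminf (\<lambda>k. 1 / 2 ^ (k + 3) * chain_defect \<mu> k)"
proof -
  let ?f = "\<lambda>m. (1 / 2 ^ m) * delta m (state_of_measure \<mu>)" and ?g = "\<lambda>k. 1 / 2 ^ (k + 3) * chain_defect \<mu> k"
  have r: "bij_betw (\<lambda>k. k + 3) UNIV {3::nat..}"
    by (rule bij_betw_byWitness[where f' = "\<lambda>m. m - 3"]) auto
  have "face_functional \<mu> = (\<Sum>\<^sub>\<infinity>k\<in>UNIV. ?f (k + 3))"
    unfolding face_functional_def by (rule infsum_reindex_bij_betw[OF r, symmetric])
  also have "\<dots> = (\<Sum>\<^sub>\<infinity>k\<in>UNIV. ?g k)" unfolding delta_chain_defect[OF \<mu>] ..
  also have "\<dots> = suminf ?g"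
  proof -
    have "?g summable_on UNIV"
      using summable_chain_defect[OF \<mu>] chain_defect_bounds(1)[OF \<mu>]
      by (intro norm_summable_imp_summable_on) simp
    from has_sum_imp_sums[OF has_sum_infsum[OF this]] show ?thesis by (simp add: sums_iff)
  qed
  finally show ?thesis .
qed

lemma face_functional_nonneg: "\<mu> \<in> central_measures \<Longrightarrow> 0 \<le> face_functional \<mu>"
  unfolding face_functional_eq by (rule suminf_nonneg[OF summable_chain_defect]) (simp_all add: chain_defect_bounds(1))

lemma face_functional_eq_0_iff:
  assumes \<mu>: "\<mu> \<in> central_measures"
  shows "face_functional \<mu> = 0 \<longleftrightarrow> \<mu> \<in> path_forest_measures"
proof -
  have "face_functional \<mu> = 0 \<longleftrightarrow> (\<forall>k. 1 / 2 ^ (k + 3) * chain_defect \<mu> k = 0)"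
    unfolding face_functional_eq[OF \<mu>]
    by (rule suminf_eq_zero_iff[OF summable_chain_defect[OF \<mu>]]) (use chain_defect_bounds(1)[OF \<mu>] in simp)
  also have "\<dots> \<longleftrightarrow> (\<forall>k. delta (k + 3) (state_of_measure \<mu>) = 0)"
    by (simp add: delta_chain_defect[OF \<mu>])
  also have "\<dots> \<longleftrightarrow> (\<forall>m\<ge>3. delta m (state_of_measure \<mu>) = 0)"
    by (metis add.commute le_add2 le_add_diff_inverse)
  also have "\<dots> \<longleftrightarrow> (\<forall>t. \<not> path_forest t \<longrightarrow> phi \<mu> t = 0)"
    by (subst delta_zero_iff[OF state_of_measure(1)[OF \<mu>]]) (simp add: state_of_measure(2)[OF \<mu>])
  finally show ?thesis using \<mu> by (simp add: path_forest_measures_iff)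
qed

lemma continuous_face_functional: "continuous_map central_top euclideanreal face_functional"
proof (rule continuous_map_approx)
  fix e :: real assume e: "e > 0"
  obtain N where N: "(1 / 2) ^ N < e" using real_arch_pow_inv[OF e, of "1/2"] by auto
  let ?a = "\<lambda>\<mu> k. 1 / 2 ^ (k + 3) * chain_defect \<mu> k"
  show "\<exists>g. continuous_map central_top euclideanreal g \<and> (\<forall>\<mu>\<in>topspace central_top. \<bar>g \<mu> - face_functional \<mu>\<bar> \<le> e)"
  proof (intro exI conjI ballI)
    show "continuous_map central_top euclideanreal (\<lambda>\<mu>. \<Sum>k<N. ?a \<mu> k)"
      unfolding chain_defect_def by (intro continuous_intros continuous_map_phi) auto
    fix \<mu> assume "\<mu> \<in> topspace central_top"
    then have \<mu>: "\<mu> \<in> central_measures" by simp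
    note s = summable_chain_defect[OF \<mu>]
    \<comment> \<open>This geometric series dominates the tail with weights
      \<open>1 / 2 ^ (k + N + 3)\<close> and has the exact sum \<open>(1 / 2) ^ N\<close>.\<close>
    have g: "summable (\<lambda>k. (1 / 2 :: real) ^ (k + N + 1))"
      unfolding power_add by (intro summable_mult2 summable_geometric) simp
    have "face_functional \<mu> = suminf (\<lambda>k. ?a \<mu> (k + N)) + (\<Sum>k<N. ?a \<mu> k)"
      unfolding face_functional_eq[OF \<mu>] by (rule suminf_split_initial_segment[OF s])
    moreover have "0 \<le> suminf (\<lambda>k. ?a \<mu> (k + N))"
      by (rule suminf_nonneg[OF summable_ignore_initial_segment[OF s]]) (use chain_defect_bounds(1)[OF \<mu>] in simp)
    moreover have "suminf (\<lambda>k. ?a \<mu> (k + N)) \<le> suminf (\<lambda>k. (1 / 2) ^ (k + N + 1))"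
    proof (rule suminf_le[OF _ summable_ignore_initial_segment[OF s] g])
      fix k
      have "?a \<mu> (k + N) \<le> 1 / 2 ^ (k + N + 3) * 1"
        using chain_defect_bounds[OF \<mu>] by (intro mult_left_mono) auto
      also have "\<dots> \<le> (1 / 2) ^ (k + N + 1)" by (simp add: power_add power_one_over field_simps)
      finally show "?a \<mu> (k + N) \<le> (1 / 2) ^ (k + N + 1)" .
    qed
    moreover have "suminf (\<lambda>k. (1 / 2 :: real) ^ (k + N + 1)) = (1 / 2) ^ N"
    proof -
      have "(\<lambda>k. (1 / 2 :: real) ^ k * (1 / 2) ^ (N + 1)) sums (1 / (1 - 1 / 2) * (1 / 2) ^ (N + 1))"
        by (intro sums_mult2 geometric_sums) simp
      then show ?thesis by (simp add: sums_iff power_add)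
    qed
    ultimately show "\<bar>(\<Sum>k<N. ?a \<mu> k) - face_functional \<mu>\<bar> \<le> e" using N by linarith
  qed
qed

lemma ex_central_not_path_forest: "\<exists>\<mu>\<in>central_measures. \<mu> \<notin> path_forest_measures"
proof -
  obtain t where t: "\<not> path_forest t" using ex_not_path_forest by blast
  have "phi (mst (\<lambda>t. 1 / fact (nv t - 1))) t \<noteq> 0" unfolding phi_mst[OF harmonic_factorial] by simp
  then show ?thesis using t mst_central[OF harmonic_factorial] path_forest_measures_iff by blast
qed

subsection \<open>Convex combinations of measures\<close>

lemma sets_mix [simp]: "sets (mix a \<mu> \<nu>) = sets \<mu>" and space_mix [simp]: "space (mix a \<mu> \<nu>) = space \<mu>"
  by (simp_all add: mix_def)

lemma emeasure_mix:
  assumes s: "sets \<nu> = sets \<mu>" and A: "A \<in> sets \<mu>"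
  shows "emeasure (mix a \<mu> \<nu>) A = ennreal a * emeasure \<mu> A + ennreal (1 - a) * emeasure \<nu> A"
  unfolding mix_def
proof (rule emeasure_measure_of_sigma[OF _ _ _ A])
  let ?m = "\<lambda>A. ennreal a * emeasure \<mu> A + ennreal (1 - a) * emeasure \<nu> A"
  show "sigma_algebra (space \<mu>) (sets \<mu>)" ..
  show "positive (sets \<mu>) ?m" by (simp add: positive_def)
  show "countably_additive (sets \<mu>) ?m"
  proof (rule countably_additiveI)
    fix F :: "nat \<Rightarrow> 'a set" assume F: "range F \<subseteq> sets \<mu>" "disjoint_family F"
    have "suminf (\<lambda>i. ?m (F i)) = ennreal a * suminf (\<lambda>i. emeasure \<mu> (F i)) + ennreal (1 - a) * suminf (\<lambda>i. emeasure \<nu> (F i))"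
      by (subst suminf_add[symmetric]) (auto intro: summableI)
    then show "suminf (\<lambda>i. ?m (F i)) = ?m (\<Union> (range F))"
      using suminf_emeasure[OF F] suminf_emeasure[of F \<nu>] F s by simp
  qed
qed

lemma measure_mix:
  assumes \<mu>: "\<mu> \<in> prob_measures X" and \<nu>: "\<nu> \<in> prob_measures X" and a: "a \<in> {0..1}"
    and A: "A \<in> sets (borel_on X)"
  shows "measure (mix a \<mu> \<nu>) A = a * measure \<mu> A + (1 - a) * measure \<nu> A"
proof -
  interpret \<mu>: prob_space \<mu> using prob_measuresD[OF \<mu>] by simp
  interpret \<nu>: prob_space \<nu> using prob_measuresD[OF \<nu>] by simp
  have "emeasure (mix a \<mu> \<nu>) A = ennreal (a * measure \<mu> A + (1 - a) * measure \<nu> A)"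
    using a A prob_measuresD(2)[OF \<mu>] prob_measuresD(2)[OF \<nu>]
    by (simp add: emeasure_mix \<mu>.emeasure_eq_measure \<nu>.emeasure_eq_measure ennreal_plus ennreal_mult)
  then show ?thesis using a by (intro measure_eq_emeasure_eq_ennreal) auto
qed

lemma mix_prob_measures:
  assumes \<mu>: "\<mu> \<in> prob_measures X" and \<nu>: "\<nu> \<in> prob_measures X" and a: "a \<in> {0..1}"
  shows "mix a \<mu> \<nu> \<in> prob_measures X"
proof -
  interpret \<mu>: prob_space \<mu> using prob_measuresD[OF \<mu>] by simp
  interpret \<nu>: prob_space \<nu> using prob_measuresD[OF \<nu>] by simp
  have "emeasure (mix a \<mu> \<nu>) (space \<mu>) = ennreal a * emeasure \<mu> (space \<mu>) + ennreal (1 - a) * emeasure \<nu> (space \<nu>)"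
    using prob_measuresD(2,3)[OF \<mu>] prob_measuresD(2,3)[OF \<nu>]
    using openin_borel_on[OF openin_topspace, of X] by (subst emeasure_mix) auto
  also have "\<dots> = ennreal a + ennreal (1 - a)" by (simp only: \<mu>.emeasure_space_1 \<nu>.emeasure_space_1 mult_1_right)
  also have "\<dots> = 1" using a by (simp flip: ennreal_plus)
  finally show ?thesis
    using prob_measuresD(2)[OF \<mu>] by (simp add: prob_measures_def prob_space.intro finite_measure.intro prob_spaceI)
qed

lemma nn_integral_mix:
  assumes s: "sets \<nu> = sets \<mu>" and f: "f \<in> borel_measurable \<mu>"
  shows "(\<integral>\<^sup>+x. f x \<partial>mix a \<mu> \<nu>) = ennreal a * (\<integral>\<^sup>+x. f x \<partial>\<mu>) + ennreal (1 - a) * (\<integral>\<^sup>+x. f x \<partial>\<nu>)"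
  using f
proof (induction rule: borel_measurable_induct)
  have sm: "sets (mix a \<mu> \<nu>) = sets \<mu>" and sp: "space \<nu> = space \<mu>" using s sets_eq_imp_space_eq by auto
  have mm: "g \<in> borel_measurable (mix a \<mu> \<nu>)" "g \<in> borel_measurable \<nu>" if "g \<in> borel_measurable \<mu>" for g :: "_ \<Rightarrow> ennreal"
    using that measurable_cong_sets[OF sm refl] measurable_cong_sets[OF s refl] by blast+
  {
    case (cong f g)
    have "(\<integral>\<^sup>+x. f x \<partial>M) = (\<integral>\<^sup>+x. g x \<partial>M)" if "space M = space \<mu>" for M
      using cong(3) that by (intro nn_integral_cong) simp
    then show ?case using cong(4) sp by simp
  next
    case (set A)
    then show ?case using s by (simp add: emeasure_mix)
  next
    case (mult u c)
    then show ?case using mm[OF mult.hyps(2)] mult.hyps mult.IH by (simp add: nn_integral_cmult distrib_left ac_simps)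
  next
    case (add u v)
    then show ?case using mm[OF add.hyps(1)] mm[OF add.hyps(3)] add.hyps add.IH by (simp add: nn_integral_add distrib_left ac_simps)
  next
    case (seq U)
    have conv: "(\<integral>\<^sup>+x. (SUP i. U i) x \<partial>M) = (SUP i. \<integral>\<^sup>+x. U i x \<partial>M)" if "\<And>i. U i \<in> borel_measurable M" for M
      unfolding SUP_apply by (rule nn_integral_monotone_convergence_SUP[OF seq.hyps(3) that])
    have inc: "incseq (\<lambda>i. \<integral>\<^sup>+x. U i x \<partial>M)" for M
      using seq.hyps(3) by (auto simp: incseq_def le_fun_def intro!: nn_integral_mono)
    have inc': "incseq (\<lambda>i. ennreal b * (\<integral>\<^sup>+x. U i x \<partial>M))" for M b
      using inc by (auto simp: incseq_def intro!: mult_left_mono)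
    show ?case
      unfolding conv[OF seq.hyps(1)] conv[OF mm(1)[OF seq.hyps(1)]] conv[OF mm(2)[OF seq.hyps(1)]] seq.IH
      by (simp only: SUP_mult_left_ennreal ennreal_SUP_add[OF inc' inc'])
  }
qed

text \<open>Adding the bound \<open>B\<close> reduces the claim to integrals of nonnegative
  functions; the shifts cancel because the two weights sum to 1.\<close>

lemma integral_mix:
  fixes f :: "'a \<Rightarrow> real"
  assumes \<mu>: "\<mu> \<in> prob_measures X" and \<nu>: "\<nu> \<in> prob_measures X" and a: "a \<in> {0..1}"
    and f: "f \<in> borel_measurable (borel_on X)" "\<And>x. x \<in> topspace X \<Longrightarrow> \<bar>f x\<bar> \<le> B"
  shows "(\<integral>x. f x \<partial>mix a \<mu> \<nu>) = a * (\<integral>x. f x \<partial>\<mu>) + (1 - a) * (\<integral>x. f x \<partial>\<nu>)"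
proof -
  have int: "integrable M f \<and> (\<integral>\<^sup>+x. ennreal (f x + B) \<partial>M) = ennreal ((\<integral>x. f x \<partial>M) + B) \<and> 0 \<le> (\<integral>x. f x \<partial>M) + B
      \<and> f \<in> borel_measurable M"
    if M: "M \<in> prob_measures X" for M
  proof -
    interpret prob_space M using prob_measuresD[OF M] by simp
    have m: "f \<in> borel_measurable M" using f(1) measurable_cong_sets[OF prob_measuresD(2)[OF M] refl] by blast
    have i: "integrable M f"
      by (rule integrable_const_bound[of _ B, OF _ m]) (use f(2) prob_measuresD(3)[OF M] in auto)
    have nn: "0 \<le> f x + B" if "x \<in> space M" for x using f(2)[of x] that prob_measuresD(3)[OF M] by auto
    have e: "(\<integral>x. f x + B \<partial>M) = (\<integral>x. f x \<partial>M) + B" using i by (simp add: prob_space)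
    have "(\<integral>\<^sup>+x. ennreal (f x + B) \<partial>M) = ennreal (\<integral>x. f x + B \<partial>M)"
      using i nn by (intro nn_integral_eq_integral) auto
    moreover have "0 \<le> (\<integral>x. f x + B \<partial>M)" using nn by (intro integral_nonneg_AE) auto
    ultimately show ?thesis using i m e by simp
  qed
  note i\<mu> = int[OF \<mu>] and i\<nu> = int[OF \<nu>] and im = int[OF mix_prob_measures[OF \<mu> \<nu> a]]
  have "(\<integral>\<^sup>+x. ennreal (f x + B) \<partial>mix a \<mu> \<nu>)
      = ennreal a * (\<integral>\<^sup>+x. ennreal (f x + B) \<partial>\<mu>) + ennreal (1 - a) * (\<integral>\<^sup>+x. ennreal (f x + B) \<partial>\<nu>)"
    using prob_measuresD(2)[OF \<mu>] prob_measuresD(2)[OF \<nu>] i\<mu> by (intro nn_integral_mix) auto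
  then have "ennreal ((\<integral>x. f x \<partial>mix a \<mu> \<nu>) + B)
      = ennreal (a * ((\<integral>x. f x \<partial>\<mu>) + B) + (1 - a) * ((\<integral>x. f x \<partial>\<nu>) + B))"
    using i\<mu> i\<nu> im a by (simp add: ennreal_plus ennreal_mult)
  then have "(\<integral>x. f x \<partial>mix a \<mu> \<nu>) + B = a * ((\<integral>x. f x \<partial>\<mu>) + B) + (1 - a) * ((\<integral>x. f x \<partial>\<nu>) + B)"
    using i\<mu> i\<nu> im a by (subst (asm) ennreal_inj) auto
  then show ?thesis by (simp add: algebra_simps)
qed

lemma mix_central:
  assumes \<mu>: "\<mu> \<in> central_measures" and \<nu>: "\<nu> \<in> central_measures" and a: "a \<in> {0..1}"
  shows "mix a \<mu> \<nu> \<in> central_measures" "phi (mix a \<mu> \<nu>) t = a * phi \<mu> t + (1 - a) * phi \<nu> t"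
proof -
  note m = centralD(1)[OF \<mu>] centralD(1)[OF \<nu>]
  have c: "measure (mix a \<mu> \<nu>) (cylinder \<gamma>) = a * phi \<mu> (endpoint \<gamma>) + (1 - a) * phi \<nu> (endpoint \<gamma>)"
    if "bpath \<gamma>" for \<gamma>
    using that by (simp add: measure_mix[OF m a] centralD(2)[OF \<mu>] centralD(2)[OF \<nu>])
  show "mix a \<mu> \<nu> \<in> central_measures"
    by (rule central_measuresI[OF mix_prob_measures[OF m a], where \<phi> = "\<lambda>t. a * phi \<mu> t + (1 - a) * phi \<nu> t"]) (rule c)
  show "phi (mix a \<mu> \<nu>) t = a * phi \<mu> t + (1 - a) * phi \<nu> t"
    using c by (intro phi_eqI[OF mix_prob_measures[OF m a]]) (auto simp: is_path_bpath)
qed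

lemma convex_central: "convex_measures central_measures"
  using mix_central(1) by (simp add: convex_measures_def)

lemma convex_path_forest: "convex_measures path_forest_measures"
  using mix_central by (auto simp: convex_measures_def path_forest_measures_iff)

lemma affine_face_functional: "affine_functional central_measures face_functional"
  unfolding affine_functional_def
proof (intro ballI)
  fix \<mu> \<nu> :: "(nat \<Rightarrow> edge) measure" and a :: real
  assume \<mu>: "\<mu> \<in> central_measures" and \<nu>: "\<nu> \<in> central_measures" and a: "a \<in> {0..1}"
  have "chain_defect (mix a \<mu> \<nu>) k = a * chain_defect \<mu> k + (1 - a) * chain_defect \<nu> k" for k
    unfolding chain_defect_def mix_central(2)[OF \<mu> \<nu> a] by (simp add: algebra_simps)
  moreover have distrib: "c * x = a * (c * y) + (1 - a) * (c * z)" if "x = a * y + (1 - a) * z" for c x y z :: real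
    unfolding that by (simp add: algebra_simps)
  ultimately have "1 / 2 ^ (k + 3) * chain_defect (mix a \<mu> \<nu>) k
      = a * (1 / 2 ^ (k + 3) * chain_defect \<mu> k) + (1 - a) * (1 / 2 ^ (k + 3) * chain_defect \<nu> k)" for k
    by (intro distrib)
  moreover have "(\<lambda>k. a * (1 / 2 ^ (k + 3) * chain_defect \<mu> k) + (1 - a) * (1 / 2 ^ (k + 3) * chain_defect \<nu> k))
      sums (a * face_functional \<mu> + (1 - a) * face_functional \<nu>)"
    unfolding face_functional_eq[OF \<mu>] face_functional_eq[OF \<nu>]
    by (intro sums_add sums_mult summable_sums summable_chain_defect \<mu> \<nu>)
  ultimately show "face_functional (mix a \<mu> \<nu>) = a * face_functional \<mu> + (1 - a) * face_functional \<nu>"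
    unfolding face_functional_eq[OF mix_central(1)[OF \<mu> \<nu> a]] by (simp only: sums_iff)
qed

subsection \<open>The barycentre map\<close>

lemma mu_eq: "mu p = mst (psi_basis p)"
  by (simp add: mu_def mst_def psi_lin_ext)

lemma mu_central: "p \<in> nabla \<Longrightarrow> mu p \<in> central_measures"
  by (simp add: mu_eq mst_central harmonic_psi_basis)

lemma phi_mu: "p \<in> nabla \<Longrightarrow> phi (mu p) t = psi_basis p t"
  by (simp add: mu_eq phi_mst harmonic_psi_basis)

lemma mu_path_forest: "p \<in> nabla \<Longrightarrow> mu p \<in> path_forest_measures"
  by (simp add: path_forest_measures_iff mu_central phi_mu psi_basis_not_path_forest)

lemma zero_in_nabla: "(\<lambda>_. 0) \<in> nabla"
  by (simp add: nabla_def)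

lemma path_forest_measures_nonempty: "path_forest_measures \<noteq> {}"
  using mu_path_forest[OF zero_in_nabla] by blast

text \<open>The functional is nonnegative and vanishes exactly on the face, and the face is
  nonempty, so 0 is attained as the minimum.\<close>

lemma exposed_face_path_forest: "exposed_face_by central_top path_forest_measures face_functional"
  unfolding exposed_face_by_def compact_convex_def cont_affine_def topspace_central_top
proof (intro conjI compact_space_central_top convex_central continuous_face_functional affine_face_functional)
  obtain \<mu>0 where \<mu>0: "\<mu>0 \<in> path_forest_measures" using path_forest_measures_nonempty by blast
  then have \<mu>0': "\<mu>0 \<in> central_measures" "face_functional \<mu>0 = 0"
    using face_functional_eq_0_iff[of \<mu>0] by (auto simp: path_forest_measures_def)
  show "path_forest_measures = {\<mu> \<in> central_measures. \<forall>\<nu>\<in>central_measures. face_functional \<mu> \<le> face_functional \<nu>}"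
  proof (intro equalityI subsetI)
    fix \<mu> assume m: "\<mu> \<in> path_forest_measures"
    then have \<mu>: "\<mu> \<in> central_measures" by (simp add: path_forest_measures_def)
    then have "face_functional \<mu> = 0" using face_functional_eq_0_iff m by blast
    then show "\<mu> \<in> {\<mu> \<in> central_measures. \<forall>\<nu>\<in>central_measures. face_functional \<mu> \<le> face_functional \<nu>}"
      using \<mu> face_functional_nonneg by simp
  next
    fix \<mu> assume "\<mu> \<in> {\<mu> \<in> central_measures. \<forall>\<nu>\<in>central_measures. face_functional \<mu> \<le> face_functional \<nu>}"
    then have \<mu>: "\<mu> \<in> central_measures" "face_functional \<mu> \<le> face_functional \<mu>0" using \<mu>0' by auto
    then have "face_functional \<mu> = 0" using face_functional_nonneg[OF \<mu>(1)] \<mu>0'(2) by linarith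
    then show "\<mu> \<in> path_forest_measures" using face_functional_eq_0_iff[OF \<mu>(1)] by blast
  qed
qed

abbreviation X_nabla :: "(nat \<Rightarrow> real) topology" where "X_nabla \<equiv> top_of_set nabla"

lemma integrable_bounded:
  fixes f :: "'a \<Rightarrow> real"
  assumes M: "M \<in> prob_measures X" and f: "continuous_map X euclideanreal f" "bounded (f ` topspace X)"
  shows "integrable M f"
proof -
  interpret prob_space M using prob_measuresD[OF M] by simp
  have m: "f \<in> borel_measurable M"
    using borel_measurable_borel_on[OF f(1)] measurable_cong_sets[OF prob_measuresD(2)[OF M] refl] by blast
  obtain B where "\<And>x. x \<in> topspace X \<Longrightarrow> norm (f x) \<le> B" using f(2) by (auto simp: bounded_iff)
  then show ?thesis
    by (intro integrable_const_bound[of _ B, OF _ m]) (use prob_measuresD(3)[OF M] in auto)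
qed

lemma continuous_nabla_bounded:
  fixes f :: "(nat \<Rightarrow> real) \<Rightarrow> real"
  shows "continuous_on nabla f \<Longrightarrow> bounded (f ` topspace X_nabla)"
  using compact_imp_bounded[OF compact_continuous_image[OF _ compact_nabla]] by simp

lemma integrable_nabla:
  fixes f :: "(nat \<Rightarrow> real) \<Rightarrow> real"
  assumes "\<rho> \<in> prob_measures X_nabla" "continuous_on nabla f" shows "integrable \<rho> f"
  by (rule integrable_bounded[OF assms(1) _ continuous_nabla_bounded[OF assms(2)]]) (simp add: assms)

text \<open>Measurability need only be checked on an intersection-stable generator; the mass of a
  cylinder is a continuous function of \<open>p\<close>.\<close>

lemma measurable_mu: "mu \<in> measurable (borel_on X_nabla) (subprob_algebra (borel_on path_top))"
proof (rule measurable_subprob_algebra_generated[OF sets_borel_path_top Int_stable_cylinders])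
  show "cylinders \<subseteq> Pow inf_paths" using cylinder_subset by (auto simp: cylinders_def)
  fix p assume "p \<in> space (borel_on X_nabla)"
  then have p: "p \<in> nabla" by simp
  note m = prob_measuresD[OF centralD(1)[OF mu_central[OF p]]]
  show "subprob_space (mu p)" using m(1) by (rule prob_space_imp_subprob_space)
  show "sets (mu p) = sets (borel_on path_top)" using m(2) .
next
  have *: "(\<lambda>p. emeasure (mu p) (cylinder \<gamma>)) \<in> borel_measurable (borel_on X_nabla)" for \<gamma>
  proof (cases "bpath \<gamma>")
    case True
    have "(\<lambda>p. emeasure (mu p) (cylinder \<gamma>)) \<in> borel_measurable (borel_on X_nabla)
        \<longleftrightarrow> (\<lambda>p. ennreal (psi_basis p (endpoint \<gamma>))) \<in> borel_measurable (borel_on X_nabla)"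
    proof (rule measurable_cong)
      fix p assume "p \<in> space (borel_on X_nabla)"
      then have p: "p \<in> nabla" by simp
      interpret prob_space "mu p" using prob_measuresD(1)[OF centralD(1)[OF mu_central[OF p]]] .
      show "emeasure (mu p) (cylinder \<gamma>) = ennreal (psi_basis p (endpoint \<gamma>))"
        using centralD(2)[OF mu_central[OF p] True] by (simp add: emeasure_eq_measure phi_mu[OF p])
    qed
    moreover have "(\<lambda>p. psi_basis p (endpoint \<gamma>)) \<in> borel_measurable (borel_on X_nabla)"
      using continuous_on_psi_basis by (intro borel_measurable_borel_on) simp
    ultimately show ?thesis by simp
  qed (simp add: cylinder_not_bpath)
  show "(\<lambda>p. emeasure (mu p) A) \<in> borel_measurable (borel_on X_nabla)" if "A \<in> cylinders" for A
    using that * by (auto simp: cylinders_def)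
  show "(\<lambda>p. emeasure (mu p) inf_paths) \<in> borel_measurable (borel_on X_nabla)"
    using *[of "[]"] by simp
qed

lemma bary_map:
  assumes \<rho>: "\<rho> \<in> prob_measures X_nabla"
  shows "bary_map \<rho> \<in> path_forest_measures" "phi (bary_map \<rho>) t = (\<integral>p. psi_basis p t \<partial>\<rho>)"
proof -
  interpret prob_space \<rho> using prob_measuresD[OF \<rho>] by simp
  have sp: "space \<rho> = nabla" using prob_measuresD(3)[OF \<rho>] by simp
  have ne: "space \<rho> \<noteq> {}" by (rule not_empty)
  have mm: "mu \<in> measurable \<rho> (subprob_algebra (borel_on path_top))"
    using measurable_mu measurable_cong_sets[OF prob_measuresD(2)[OF \<rho>] refl] by blast
  have s: "sets (mu p) = sets (borel_on path_top)" if "p \<in> space \<rho>" for p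
    using that sp prob_measuresD(2)[OF centralD(1)[OF mu_central]] by blast
  have "AE p in \<rho>. prob_space (mu p)"
    using prob_measuresD(1)[OF centralD(1)[OF mu_central]] sp by (intro AE_I2) blast
  then have "prob_space (bary_map \<rho>)" unfolding bary_map_def using mm by (rule prob_space_bind)
  moreover have "sets (bary_map \<rho>) = sets (borel_on path_top)"
    unfolding bary_map_def by (rule sets_bind[OF s ne])
  ultimately have P: "bary_map \<rho> \<in> prob_measures path_top" by (simp add: prob_measures_def)
  have cyl: "measure (bary_map \<rho>) (cylinder \<gamma>) = (\<integral>p. psi_basis p (endpoint \<gamma>) \<partial>\<rho>)" if \<gamma>: "bpath \<gamma>" for \<gamma>
  proof -
    have nn: "0 \<le> psi_basis p (endpoint \<gamma>)" if "p \<in> nabla" for p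
      using harmonic_psi_basis[OF that] by (simp add: harmonic_def)
    have "emeasure (bary_map \<rho>) (cylinder \<gamma>) = (\<integral>\<^sup>+p. emeasure (mu p) (cylinder \<gamma>) \<partial>\<rho>)"
      unfolding bary_map_def by (rule emeasure_bind[OF ne mm cylinder_sets])
    also have "\<dots> = (\<integral>\<^sup>+p. ennreal (psi_basis p (endpoint \<gamma>)) \<partial>\<rho>)"
    proof (rule nn_integral_cong)
      fix p assume "p \<in> space \<rho>"
      then have p: "p \<in> nabla" by (simp add: sp)
      interpret m: prob_space "mu p" using prob_measuresD(1)[OF centralD(1)[OF mu_central[OF p]]] .
      show "emeasure (mu p) (cylinder \<gamma>) = ennreal (psi_basis p (endpoint \<gamma>))"
        using centralD(2)[OF mu_central[OF p] \<gamma>] by (simp add: m.emeasure_eq_measure phi_mu[OF p])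
    qed
    also have "\<dots> = ennreal (\<integral>p. psi_basis p (endpoint \<gamma>) \<partial>\<rho>)"
      using nn sp by (intro nn_integral_eq_integral integrable_nabla[OF \<rho> continuous_on_psi_basis]) auto
    finally show ?thesis
      using nn sp by (intro measure_eq_emeasure_eq_ennreal integral_nonneg_AE) auto
  qed
  have C: "bary_map \<rho> \<in> central_measures" by (rule central_measuresI[OF P, where \<phi> = "\<lambda>t. \<integral>p. psi_basis p t \<partial>\<rho>"]) (rule cyl)
  show ph: "phi (bary_map \<rho>) t = (\<integral>p. psi_basis p t \<partial>\<rho>)" for t
    using cyl by (intro phi_eqI[OF P]) (auto simp: is_path_bpath)
  show "bary_map \<rho> \<in> path_forest_measures"
    unfolding path_forest_measures_iff using C by (simp add: ph psi_basis_not_path_forest)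
qed

lemma bary_map_central: "\<rho> \<in> prob_measures X_nabla \<Longrightarrow> bary_map \<rho> \<in> central_measures"
  using bary_map(1) by (simp add: path_forest_measures_def)

lemma affine_bary_map: "affine_map (prob_measures X_nabla) bary_map"
  unfolding affine_map_def
proof (intro ballI)
  fix \<rho> \<sigma> :: "(nat \<Rightarrow> real) measure" and a :: real
  assume \<rho>: "\<rho> \<in> prob_measures X_nabla" and \<sigma>: "\<sigma> \<in> prob_measures X_nabla" and a: "a \<in> {0..1}"
  note m = mix_prob_measures[OF \<rho> \<sigma> a]
  show "bary_map (mix a \<rho> \<sigma>) = mix a (bary_map \<rho>) (bary_map \<sigma>)"
  proof (rule central_eqI)
    show "bary_map (mix a \<rho> \<sigma>) \<in> central_measures" by (rule bary_map_central[OF m])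
    show "mix a (bary_map \<rho>) (bary_map \<sigma>) \<in> central_measures"
      by (rule mix_central(1)[OF bary_map_central[OF \<rho>] bary_map_central[OF \<sigma>] a])
    fix t
    obtain B where "\<And>p. p \<in> nabla \<Longrightarrow> \<bar>psi_basis p t\<bar> \<le> B"
      using continuous_nabla_bounded[OF continuous_on_psi_basis[of t]] by (auto simp: bounded_iff)
    then have "(\<integral>p. psi_basis p t \<partial>mix a \<rho> \<sigma>) = a * (\<integral>p. psi_basis p t \<partial>\<rho>) + (1 - a) * (\<integral>p. psi_basis p t \<partial>\<sigma>)"
      using continuous_on_psi_basis by (intro integral_mix[OF \<rho> \<sigma> a, where B = B] borel_measurable_borel_on) auto
    then show "phi (bary_map (mix a \<rho> \<sigma>)) t = phi (mix a (bary_map \<rho>) (bary_map \<sigma>)) t"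
      unfolding mix_central(2)[OF bary_map_central[OF \<rho>] bary_map_central[OF \<sigma>] a]
      by (simp add: bary_map(2)[OF m] bary_map(2)[OF \<rho>] bary_map(2)[OF \<sigma>])
  qed
qed

text \<open>The indicator of a relatively open set is a bounded pointwise limit of continuous
  functions built from the distance to the complement, and open sets form an intersection-stable
  generator.\<close>

lemma prob_measures_top_of_set_eqI:
  fixes S :: "'a::metric_space set"
  assumes \<mu>: "\<mu> \<in> prob_measures (top_of_set S)" and \<nu>: "\<nu> \<in> prob_measures (top_of_set S)"
    and eq: "\<And>f :: 'a \<Rightarrow> real. continuous_on S f \<Longrightarrow> (\<integral>x. f x \<partial>\<mu>) = (\<integral>x. f x \<partial>\<nu>)"
  shows "\<mu> = \<nu>"
proof (rule measure_eqI_generator_eq[where E = "{U. openin (top_of_set S) U}" and \<Omega> = S and A = "\<lambda>_. S"])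
  let ?X = "top_of_set S"
  interpret \<mu>: prob_space \<mu> using prob_measuresD[OF \<mu>] by simp
  interpret \<nu>: prob_space \<nu> using prob_measuresD[OF \<nu>] by simp
  show "Int_stable {U. openin ?X U}" unfolding Int_stable_def using openin_Int by blast
  show "{U. openin ?X U} \<subseteq> Pow S" using openin_subset[of ?X] by auto
  show "sets \<mu> = sigma_sets S {U. openin ?X U}" "sets \<nu> = sigma_sets S {U. openin ?X U}"
    using prob_measuresD(2)[OF \<mu>] prob_measuresD(2)[OF \<nu>] by (simp_all add: sets_borel_on)
  show "range (\<lambda>_::nat. S) \<subseteq> {U. openin ?X U}" using openin_topspace[of ?X] by simp
  fix U assume "U \<in> {U. openin ?X U}"
  then have U: "openin ?X U" by simp
  then obtain T where T: "open T" "U = S \<inter> T" by (auto simp: openin_open)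
  \<comment> \<open>\<open>infdist\<close> to the empty set is 0 by convention, so the case
    \<open>T = UNIV\<close> is treated separately.\<close>
  define f where "f n x = (if - T = {} then 1 else min 1 (real n * infdist x (- T)))" for n :: nat and x
  have "(\<lambda>n. f n x) \<longlonglongrightarrow> indicator U x" if x: "x \<in> S" for x
  proof (cases "x \<in> T")
    case xT: True
    have "\<forall>\<^sub>F n in sequentially. f n x = 1"
    proof (cases "- T = {}")
      case False
      have "infdist x (- T) \<noteq> 0" using in_closed_iff_infdist_zero[of "- T" x] False T(1) xT by auto
      then have pos: "infdist x (- T) > 0" using infdist_nonneg[of x "- T"] by linarith
      obtain N where N: "1 < real N * infdist x (- T)" using reals_Archimedean3[OF pos] by blast
      show ?thesis
      proof (rule eventually_mono[OF eventually_ge_at_top[of N]])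
        fix n assume "N \<le> n"
        then have "real N * infdist x (- T) \<le> real n * infdist x (- T)" using pos by (intro mult_right_mono) auto
        then show "f n x = 1" using N by (simp add: f_def)
      qed
    qed (simp add: f_def)
    then show ?thesis using xT x T(2) by (simp add: tendsto_eventually)
  next
    case False
    then have "infdist x (- T) = 0" by (intro infdist_zero) simp
    then have "f n x = 0" for n using False by (auto simp: f_def)
    then show ?thesis using False T(2) by simp
  qed
  moreover have f01: "norm (f n x) \<le> 1" for n x by (auto simp: f_def infdist_nonneg)
  have fc: "continuous_on S (f n)" for n
    unfolding f_def by (cases "- T = {}") (auto intro!: continuous_intros)
  ultimately have lim: "(\<lambda>n. \<integral>x. f n x \<partial>M) \<longlonglongrightarrow> measure M U" if M: "M \<in> prob_measures ?X" for M
  proof -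
    interpret prob_space M using prob_measuresD[OF M] by simp
    have sp: "space M = S" using prob_measuresD(3)[OF M] by simp
    have Us: "U \<in> sets M" using openin_borel_on[OF U] prob_measuresD(2)[OF M] by simp
    have "(\<lambda>n. \<integral>x. f n x \<partial>M) \<longlonglongrightarrow> (\<integral>x. indicator U x \<partial>M)"
    proof (rule integral_dominated_convergence[where w = "\<lambda>_. 1"])
      show "f n \<in> borel_measurable M" for n
        using borel_measurable_borel_on[of ?X "f n"] fc measurable_cong_sets[OF prob_measuresD(2)[OF M] refl] by auto
      show "AE x in M. (\<lambda>n. f n x) \<longlonglongrightarrow> indicator U x"
        by (intro AE_I2) (use \<open>\<And>x. x \<in> S \<Longrightarrow> (\<lambda>n. f n x) \<longlonglongrightarrow> indicator U x\<close> sp in simp)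
    qed (use Us f01 in auto)
    then show ?thesis using Us sp openin_subset[OF U] by (simp add: Int_absorb2)
  qed
  have "measure \<mu> U = measure \<nu> U"
    using lim[OF \<mu>] lim[OF \<nu>] unfolding eq[OF fc] by (rule LIMSEQ_unique)
  then show "emeasure \<mu> U = emeasure \<nu> U" by (simp add: \<mu>.emeasure_eq_measure \<nu>.emeasure_eq_measure)
next
  interpret \<mu>: prob_space \<mu> using prob_measuresD[OF \<mu>] by simp
  show "(\<Union>i. S) = S" by simp
  show "emeasure \<mu> S \<noteq> \<infinity>" by simp
qed

lemma integral_cval_phi:
  assumes "\<rho> \<in> prob_measures X_nabla" "int_partition l"
  shows "(\<integral>p. cval p l \<partial>\<rho>) = phi (bary_map \<rho>) (path_forest_tree l)"
  using assms by (simp add: bary_map(2) psi_basis_path_forest_tree)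

text \<open>Weak convergence on Kingman's simplex is convergence of the moments \<open>phi\<close> because the
  functions \<open>chi p g\<close> of \<open>p\<close> are uniformly dense.\<close>

lemma integral_nabla_approx:
  assumes f: "continuous_on nabla f" and e: "e > 0"
  obtains S c where "finite S" "\<And>l. l \<in> S \<Longrightarrow> int_partition l"
    "\<And>\<rho>. \<rho> \<in> prob_measures X_nabla \<Longrightarrow>
       \<bar>(\<Sum>l\<in>S. c l * phi (bary_map \<rho>) (path_forest_tree l)) - (\<integral>p. f p \<partial>\<rho>)\<bar> \<le> e"
proof -
  obtain g where g: "g \<in> Lambda" "\<And>p. p \<in> nabla \<Longrightarrow> \<bar>f p - chi p g\<bar> < e" using chi_dense[OF f e] by blast
  obtain S c where S: "finite S" "\<And>l. l \<in> S \<Longrightarrow> int_partition l"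
    "\<And>p. p \<in> nabla \<Longrightarrow> chi p g = (\<Sum>l\<in>S. c l * cval p l)" using chi_decomp[OF g(1)] by blast
  have "\<bar>(\<Sum>l\<in>S. c l * phi (bary_map \<rho>) (path_forest_tree l)) - (\<integral>p. f p \<partial>\<rho>)\<bar> \<le> e"
    if \<rho>: "\<rho> \<in> prob_measures X_nabla" for \<rho>
  proof -
    interpret prob_space \<rho> using prob_measuresD[OF \<rho>] by simp
    have sp: "space \<rho> = nabla" using prob_measuresD(3)[OF \<rho>] by simp
    have ci: "integrable \<rho> (\<lambda>p. c l * cval p l)" if "l \<in> S" for l
      using that S(2) by (intro integrable_mult_right integrable_nabla[OF \<rho> continuous_on_cval])
    have fi: "integrable \<rho> f" by (rule integrable_nabla[OF \<rho> f])
    have si: "integrable \<rho> (\<lambda>p. \<Sum>l\<in>S. c l * cval p l)" using ci by (rule Bochner_Integration.integrable_sum)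
    have "(\<Sum>l\<in>S. c l * phi (bary_map \<rho>) (path_forest_tree l)) = (\<integral>p. (\<Sum>l\<in>S. c l * cval p l) \<partial>\<rho>)"
      using ci S(2) by (subst Bochner_Integration.integral_sum) (auto simp: integral_cval_phi[OF \<rho>] intro!: sum.cong)
    then have "(\<Sum>l\<in>S. c l * phi (bary_map \<rho>) (path_forest_tree l)) - (\<integral>p. f p \<partial>\<rho>)
        = (\<integral>p. (\<Sum>l\<in>S. c l * cval p l) - f p \<partial>\<rho>)"
      using si fi by (simp add: Bochner_Integration.integral_diff)
    also have "\<bar>\<dots>\<bar> \<le> (\<integral>p. \<bar>(\<Sum>l\<in>S. c l * cval p l) - f p\<bar> \<partial>\<rho>)" by (rule integral_abs_bound)
    also have "\<dots> \<le> (\<integral>p. e \<partial>\<rho>)"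
    proof (rule integral_mono)
      fix p assume "p \<in> space \<rho>"
      then have p: "p \<in> nabla" by (simp add: sp)
      show "\<bar>(\<Sum>l\<in>S. c l * cval p l) - f p\<bar> \<le> e" using g(2)[OF p] S(3)[OF p] by linarith
    qed (use si fi in auto)
    also have "\<dots> = e" by (simp add: prob_space)
    finally show ?thesis .
  qed
  with S(1,2) show ?thesis by (rule that)
qed

lemma bary_map_inj:
  assumes \<rho>: "\<rho> \<in> prob_measures X_nabla" and \<sigma>: "\<sigma> \<in> prob_measures X_nabla" and eq: "bary_map \<rho> = bary_map \<sigma>"
  shows "\<rho> = \<sigma>"
proof (rule prob_measures_top_of_set_eqI[OF \<rho> \<sigma>])
  fix f :: "(nat \<Rightarrow> real) \<Rightarrow> real" assume f: "continuous_on nabla f"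
  have "\<bar>(\<integral>p. f p \<partial>\<rho>) - (\<integral>p. f p \<partial>\<sigma>)\<bar> \<le> e" if e: "e > 0" for e
  proof -
    have e2: "e / 2 > 0" using e by simp
    obtain S c where "\<And>\<rho>. \<rho> \<in> prob_measures X_nabla \<Longrightarrow>
       \<bar>(\<Sum>l\<in>S. c l * phi (bary_map \<rho>) (path_forest_tree l)) - (\<integral>p. f p \<partial>\<rho>)\<bar> \<le> e / 2"
      using integral_nabla_approx[OF f e2] by metis
    from this[OF \<rho>] this[OF \<sigma>] show ?thesis unfolding eq by linarith
  qed
  then have "\<bar>(\<integral>p. f p \<partial>\<rho>) - (\<integral>p. f p \<partial>\<sigma>)\<bar> \<le> 0" by (rule field_le_epsilon[of _ 0, simplified])
  then show "(\<integral>p. f p \<partial>\<rho>) = (\<integral>p. f p \<partial>\<sigma>)" by simp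
qed

lemma kingman_phi:
  assumes \<mu>: "\<mu> \<in> path_forest_measures"
  shows "kingman (\<lambda>l. phi \<mu> (path_forest_tree l))"
proof -
  have c: "\<mu> \<in> central_measures" and z: "\<And>t. \<not> path_forest t \<Longrightarrow> phi \<mu> t = 0"
    using \<mu> by (auto simp: path_forest_measures_iff)
  have h: "harmonic (phi \<mu>)" by (rule harmonic_phi[OF c])
  show ?thesis
    unfolding kingman_def
  proof (intro conjI allI impI)
    show "phi \<mu> (path_forest_tree {#}) = 1"
      using h by (simp add: harmonic_def flip: bullet_path_forest_tree(1))
    fix l
    show "0 \<le> phi \<mu> (path_forest_tree l)" using h by (simp add: harmonic_def)
    show "phi \<mu> (path_forest_tree l) \<le> 1" by (rule harmonic_le_1[OF h])
    assume l: "int_partition l"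
    have "phi \<mu> (path_forest_tree l) = (\<Sum>b\<in>#grow (path_forest_tree l). phi \<mu> b)" using h by (simp add: harmonic_def)
    then show "phi \<mu> (path_forest_tree l) = phi \<mu> (path_forest_tree (add_mset 1 l))
        + (\<Sum>j\<in>#l. phi \<mu> (path_forest_tree (add_mset (Suc j) (l - {#j#}))))"
      using sum_grow_path_forest[OF l, of "phi \<mu>"] z by simp
  qed
qed

lemma bary_map_surj:
  assumes \<mu>: "\<mu> \<in> path_forest_measures"
  obtains \<rho> where "\<rho> \<in> prob_measures X_nabla" "bary_map \<rho> = \<mu>"
proof -
  have c: "\<mu> \<in> central_measures" and z: "\<And>t. \<not> path_forest t \<Longrightarrow> phi \<mu> t = 0"
    using \<mu> by (auto simp: path_forest_measures_iff)
  obtain \<rho> where \<rho>: "\<rho> \<in> prob_measures X_nabla"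
    and eq: "\<forall>l. int_partition l \<longrightarrow> phi \<mu> (path_forest_tree l) = (\<integral>p. cval p l \<partial>\<rho>)"
    using kingman_representation[OF kingman_phi[OF \<mu>]] by blast
  have "bary_map \<rho> = \<mu>"
  proof (rule central_eqI[OF bary_map_central[OF \<rho>] c])
    fix t
    show "phi (bary_map \<rho>) t = phi \<mu> t"
    proof (cases "path_forest t")
      case True
      then obtain l where "int_partition l" "t = path_forest_tree l" by (rule path_forest_obtain)
      then show ?thesis using eq integral_cval_phi[OF \<rho>] by simp
    next
      case False
      then show ?thesis using z bary_map(1)[OF \<rho>] by (simp add: path_forest_measures_iff)
    qed
  qed
  with \<rho> show ?thesis by (rule that)
qed

section \<open>The barycentre map as a homeomorphism\<close>

lemma topspace_path_forest_top [simp]: "topspace path_forest_top = path_forest_measures"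
  by (auto simp: path_forest_top_def path_forest_measures_def)

lemma continuous_map_phi_path_forest: "continuous_map path_forest_top euclideanreal (\<lambda>\<mu>. phi \<mu> t)"
  unfolding path_forest_top_def by (rule continuous_map_from_subtopology[OF continuous_map_phi])

lemma continuous_into_path_forest:
  assumes "\<And>z. z \<in> topspace Z \<Longrightarrow> h z \<in> path_forest_measures"
    and "\<And>t. continuous_map Z euclideanreal (\<lambda>z. phi (h z) t)"
  shows "continuous_map Z path_forest_top h"
  unfolding path_forest_top_def
  using assms by (intro continuous_map_into_subtopology continuous_into_central) (auto simp: path_forest_measures_def)

text \<open>Both topologies are controlled by \<open>phi\<close>: values of \<open>phi\<close> at
  barycentres are integrals of continuous functions, and conversely the integral of a continuous
  function against the inverse image is a uniform limit of finite combinations of values of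
  \<open>phi\<close>.\<close>

lemma homeomorphic_bary_map: "homeomorphic_map (weak_topology X_nabla) path_forest_top bary_map"
proof -
  define r where "r = inv_into (prob_measures X_nabla) bary_map"
  have inj: "inj_on bary_map (prob_measures X_nabla)" using bary_map_inj by (auto intro: inj_onI)
  have rl: "r (bary_map \<rho>) = \<rho>" if "\<rho> \<in> prob_measures X_nabla" for \<rho>
    unfolding r_def by (rule inv_into_f_f[OF inj that])
  have r: "r \<mu> \<in> prob_measures X_nabla \<and> bary_map (r \<mu>) = \<mu>" if \<mu>: "\<mu> \<in> path_forest_measures" for \<mu>
  proof -
    obtain \<rho> where "\<rho> \<in> prob_measures X_nabla" "bary_map \<rho> = \<mu>" using bary_map_surj[OF \<mu>] by blast
    then show ?thesis using rl[of \<rho>] by auto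
  qed
  have "continuous_map (weak_topology X_nabla) path_forest_top bary_map"
  proof (rule continuous_into_path_forest)
    show "bary_map \<rho> \<in> path_forest_measures" if "\<rho> \<in> topspace (weak_topology X_nabla)" for \<rho>
      using that bary_map(1) by simp
    fix t
    have "continuous_map (weak_topology X_nabla) euclideanreal (\<lambda>\<rho>. \<integral>p. psi_basis p t \<partial>\<rho>)"
      using continuous_on_psi_basis by (intro continuous_map_weak_integral continuous_nabla_bounded) simp_all
    then show "continuous_map (weak_topology X_nabla) euclideanreal (\<lambda>\<rho>. phi (bary_map \<rho>) t)"
      by (rule continuous_map_eq) (simp add: bary_map(2))
  qed
  moreover have "continuous_map path_forest_top (weak_topology X_nabla) r"
  proof (rule continuous_map_into_weak)
    show "r \<mu> \<in> prob_measures X_nabla" if "\<mu> \<in> topspace path_forest_top" for \<mu> using that r by simp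
    fix f assume "continuous_map X_nabla euclideanreal f"
    then have f: "continuous_on nabla f" by simp
    show "continuous_map path_forest_top euclideanreal (\<lambda>\<mu>. \<integral>p. f p \<partial>r \<mu>)"
    proof (rule continuous_map_approx)
      fix e :: real assume e: "e > 0"
      obtain S c where S: "finite S" "\<And>l. l \<in> S \<Longrightarrow> int_partition l" "\<And>\<rho>. \<rho> \<in> prob_measures X_nabla \<Longrightarrow>
         \<bar>(\<Sum>l\<in>S. c l * phi (bary_map \<rho>) (path_forest_tree l)) - (\<integral>p. f p \<partial>\<rho>)\<bar> \<le> e"
        using integral_nabla_approx[OF f e] by metis
      have "continuous_map path_forest_top euclideanreal (\<lambda>\<mu>. \<Sum>l\<in>S. c l * phi \<mu> (path_forest_tree l))"
        using S(1) by (intro continuous_intros continuous_map_phi_path_forest) auto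
      moreover have "\<bar>(\<Sum>l\<in>S. c l * phi \<mu> (path_forest_tree l)) - (\<integral>p. f p \<partial>r \<mu>)\<bar> \<le> e"
        if "\<mu> \<in> topspace path_forest_top" for \<mu>
        using that r[of \<mu>] S(3)[of "r \<mu>"] by simp
      ultimately show "\<exists>g. continuous_map path_forest_top euclideanreal g \<and>
          (\<forall>\<mu>\<in>topspace path_forest_top. \<bar>g \<mu> - (\<integral>p. f p \<partial>r \<mu>)\<bar> \<le> e)" by blast
    qed
  qed
  ultimately have "homeomorphic_maps (weak_topology X_nabla) path_forest_top bary_map r"
    unfolding homeomorphic_maps_def using rl r by simp
  then show ?thesis unfolding homeomorphic_map_maps by blast
qed

subsection \<open>Extreme points\<close>

lemma singleton_nabla_sets: "p \<in> nabla \<Longrightarrow> {p} \<in> sets (borel_on X_nabla)"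
proof -
  assume p: "p \<in> nabla"
  have "openin X_nabla (nabla - {p})" by (auto simp: openin_open intro!: exI[of _ "- {p}"])
  then have "nabla - {p} \<in> sets (borel_on X_nabla)" by (rule openin_borel_on)
  from sets.compl_sets[OF this] have "nabla - (nabla - {p}) \<in> sets (borel_on X_nabla)" by simp
  moreover have "nabla - (nabla - {p}) = {p}" using p by blast
  ultimately show ?thesis by (simp only:)
qed

lemma bary_map_dirac:
  assumes \<rho>: "\<rho> \<in> prob_measures X_nabla" and p: "p \<in> nabla" and ae: "AE q in \<rho>. q = p"
  shows "bary_map \<rho> = mu p"
proof (rule central_eqI[OF bary_map_central[OF \<rho>] mu_central[OF p]])
  fix t
  interpret prob_space \<rho> using prob_measuresD[OF \<rho>] by simp
  have "(\<integral>q. psi_basis q t \<partial>\<rho>) = (\<integral>q. psi_basis p t \<partial>\<rho>)"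
  proof (rule integral_cong_AE)
    show "(\<lambda>q. psi_basis q t) \<in> borel_measurable \<rho>"
      using integrable_nabla[OF \<rho> continuous_on_psi_basis] by (rule borel_measurable_integrable)
    show "AE q in \<rho>. psi_basis q t = psi_basis p t" using ae by (rule AE_mp) auto
  qed simp
  then show "phi (bary_map \<rho>) t = phi (mu p) t" by (simp add: bary_map(2)[OF \<rho>] phi_mu[OF p] prob_space)
qed

lemma return_prob_measures: "x \<in> topspace X \<Longrightarrow> return (borel_on X) x \<in> prob_measures X"
  using prob_space_return[of x "borel_on X"] by (simp add: prob_measures_def)

lemma bary_map_return:
  assumes p: "p \<in> nabla" shows "bary_map (return (borel_on X_nabla) p) = mu p"
proof (rule bary_map_dirac[OF return_prob_measures p])
  have "{q \<in> space (borel_on X_nabla). q = p} = {p}" using p by auto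
  then have "Measurable.pred (borel_on X_nabla) (\<lambda>q. q = p)"
    using singleton_nabla_sets[OF p] by (simp add: pred_def)
  then show "AE q in return (borel_on X_nabla) p. q = p" using p by (subst AE_return) auto
qed (use p in simp)

text \<open>A decomposition of \<open>mu p\<close> stays in the face, and injectivity of
  \<open>bary_map\<close> turns it into a decomposition of a point mass, whose components both give
  mass 1 to \<open>p\<close>.\<close>

lemma mu_extreme:
  assumes p: "p \<in> nabla" shows "mu p \<in> extreme_points central_measures"
proof -
  have "\<nu> = mu p \<and> \<kappa> = mu p"
    if \<nu>: "\<nu> \<in> central_measures" and \<kappa>: "\<kappa> \<in> central_measures" and a: "a \<in> {0<..<1}" and eq: "mu p = mix a \<nu> \<kappa>" for \<nu> \<kappa> a
  proof -
    have a': "a \<in> {0..1}" using a by simp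
    \<comment> \<open>Where \<open>mu p\<close> vanishes, so do both components, being nonnegative
      and mixed with positive weights.\<close>
    have zero: "phi \<nu> t = 0 \<and> phi \<kappa> t = 0" if "\<not> path_forest t" for t
    proof -
      have "a * phi \<nu> t + (1 - a) * phi \<kappa> t = 0"
      proof -
        have "phi (mu p) t = a * phi \<nu> t + (1 - a) * phi \<kappa> t"
          unfolding eq by (rule mix_central(2)[OF \<nu> \<kappa> a'])
        then show ?thesis using that by (simp add: phi_mu[OF p] psi_basis_not_path_forest)
      qed
      moreover have "0 \<le> a * phi \<nu> t" "0 \<le> (1 - a) * phi \<kappa> t"
        using harmonic_phi[OF \<nu>] harmonic_phi[OF \<kappa>] a by (simp_all add: harmonic_def)
      ultimately have "a * phi \<nu> t = 0" "(1 - a) * phi \<kappa> t = 0" by linarith+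
      then show ?thesis using a by simp
    qed
    have "\<nu> \<in> path_forest_measures" "\<kappa> \<in> path_forest_measures"
      using \<nu> \<kappa> zero by (simp_all add: path_forest_measures_iff)
    then obtain \<sigma> \<tau> where \<sigma>: "\<sigma> \<in> prob_measures X_nabla" "bary_map \<sigma> = \<nu>" and \<tau>: "\<tau> \<in> prob_measures X_nabla" "bary_map \<tau> = \<kappa>"
      using bary_map_surj by metis
    let ?d = "return (borel_on X_nabla) p"
    have d: "?d \<in> prob_measures X_nabla" using p by (intro return_prob_measures) simp
    have "bary_map ?d = bary_map (mix a \<sigma> \<tau>)"
      using affine_bary_map \<sigma> \<tau> a' eq by (simp add: bary_map_return[OF p] affine_map_def)
    then have "?d = mix a \<sigma> \<tau>" by (rule bary_map_inj[OF d mix_prob_measures[OF \<sigma>(1) \<tau>(1) a']])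
    then have "measure ?d {p} = a * measure \<sigma> {p} + (1 - a) * measure \<tau> {p}"
      using measure_mix[OF \<sigma>(1) \<tau>(1) a' singleton_nabla_sets[OF p]] by simp
    moreover have "measure ?d {p} = 1"
      using singleton_nabla_sets[OF p] by (simp add: measure_def)
    ultimately have sum: "a * measure \<sigma> {p} + (1 - a) * measure \<tau> {p} = 1" by simp
    interpret \<sigma>: prob_space \<sigma> using prob_measuresD[OF \<sigma>(1)] by simp
    interpret \<tau>: prob_space \<tau> using prob_measuresD[OF \<tau>(1)] by simp
    have "a * (1 - measure \<sigma> {p}) + (1 - a) * (1 - measure \<tau> {p}) = 0" using sum by (simp add: algebra_simps)
    moreover have "0 \<le> a * (1 - measure \<sigma> {p})" "0 \<le> (1 - a) * (1 - measure \<tau> {p})" using a by simp_all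
    ultimately have "a * (1 - measure \<sigma> {p}) = 0" "(1 - a) * (1 - measure \<tau> {p}) = 0" by linarith+
    then have one: "measure \<sigma> {p} = 1" "measure \<tau> {p} = 1" using a by simp_all
    have "AE q in \<sigma>. q \<in> {p}" "AE q in \<tau>. q \<in> {p}"
      using one singleton_nabla_sets[OF p] prob_measuresD(2)[OF \<sigma>(1)] prob_measuresD(2)[OF \<tau>(1)]
      by (intro \<sigma>.AE_in_set_eq_1[THEN iffD2] \<tau>.AE_in_set_eq_1[THEN iffD2]; simp)+
    then show ?thesis
      using bary_map_dirac[OF \<sigma>(1) p] bary_map_dirac[OF \<tau>(1) p] \<sigma>(2) \<tau>(2) by simp
  qed
  then show ?thesis using mu_central[OF p] unfolding extreme_points_def by blast
qed

text \<open>The law of total probability: conditioning on a set of intermediate mass and on its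
  complement splits a measure.\<close>

lemma mix_uniform_measure:
  assumes \<rho>: "\<rho> \<in> prob_measures X" and A: "A \<in> sets (borel_on X)" and m: "0 < measure \<rho> A" "measure \<rho> A < 1"
  shows "uniform_measure \<rho> A \<in> prob_measures X" "uniform_measure \<rho> (topspace X - A) \<in> prob_measures X"
    "\<rho> = mix (measure \<rho> A) (uniform_measure \<rho> A) (uniform_measure \<rho> (topspace X - A))"
proof -
  interpret prob_space \<rho> using prob_measuresD[OF \<rho>] by simp
  have s: "sets \<rho> = sets (borel_on X)" and sp: "space \<rho> = topspace X" using prob_measuresD[OF \<rho>] by auto
  let ?A' = "topspace X - A"
  have As: "A \<in> sets \<rho>" "?A' \<in> sets \<rho>" using A s sets.compl_sets[of A \<rho>] sp by auto
  have m': "measure \<rho> ?A' = 1 - measure \<rho> A" using prob_compl[OF As(1)] sp by simp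
  have e: "emeasure \<rho> A \<noteq> 0" "emeasure \<rho> ?A' \<noteq> 0" using m m' by (simp_all add: emeasure_eq_measure)
  have e': "emeasure \<rho> A \<noteq> \<infinity>" "emeasure \<rho> ?A' \<noteq> \<infinity>" by simp_all
  show u: "uniform_measure \<rho> A \<in> prob_measures X" "uniform_measure \<rho> ?A' \<in> prob_measures X"
    using prob_space_uniform_measure[OF e(1) e'(1)] prob_space_uniform_measure[OF e(2) e'(2)] s
    by (simp_all add: prob_measures_def)
  have a: "measure \<rho> A \<in> {0..1}" using m by simp
  note mp = mix_prob_measures[OF u a]
  interpret mx: prob_space "mix (measure \<rho> A) (uniform_measure \<rho> A) (uniform_measure \<rho> ?A')"
    using prob_measuresD[OF mp] by simp
  show "\<rho> = mix (measure \<rho> A) (uniform_measure \<rho> A) (uniform_measure \<rho> ?A')"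
  proof (rule measure_eqI)
    show "sets \<rho> = sets (mix (measure \<rho> A) (uniform_measure \<rho> A) (uniform_measure \<rho> ?A'))" by simp
    fix B assume B: "B \<in> sets \<rho>"
    have "measure (mix (measure \<rho> A) (uniform_measure \<rho> A) (uniform_measure \<rho> ?A')) B
        = measure \<rho> (A \<inter> B) + measure \<rho> (?A' \<inter> B)"
      using B s m m' measure_uniform_measure[OF e(1) e'(1) B] measure_uniform_measure[OF e(2) e'(2) B]
      by (subst measure_mix[OF u a]) auto
    also have "\<dots> = measure \<rho> ((A \<inter> B) \<union> (?A' \<inter> B))"
      using As B by (intro finite_measure_Union[symmetric]) auto
    also have "(A \<inter> B) \<union> (?A' \<inter> B) = B" using sets.sets_into_space[OF B] sp by auto
    finally show "emeasure \<rho> B = emeasure (mix (measure \<rho> A) (uniform_measure \<rho> A) (uniform_measure \<rho> ?A')) B"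
      by (simp add: emeasure_eq_measure mx.emeasure_eq_measure)
  qed
qed

text \<open>If every point had a ball of mass zero, finitely many of them would cover the compact
  simplex. So some point has only balls of positive mass, hence of mass 1, and these shrink to the
  point.\<close>

lemma zero_one_dirac:
  assumes \<rho>: "\<rho> \<in> prob_measures X_nabla" and zo: "\<And>A. A \<in> sets (borel_on X_nabla) \<Longrightarrow> measure \<rho> A \<in> {0, 1}"
  obtains p where "p \<in> nabla" "AE q in \<rho>. q = p"
proof -
  interpret prob_space \<rho> using prob_measuresD[OF \<rho>] by simp
  have s: "sets \<rho> = sets (borel_on X_nabla)" and sp: "space \<rho> = nabla" using prob_measuresD[OF \<rho>] by auto
  have bs: "ball p e \<inter> nabla \<in> sets \<rho>" for p e
    unfolding s by (intro openin_borel_on) (auto simp: openin_open)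
  have "\<exists>p\<in>nabla. \<forall>e>0. measure \<rho> (ball p e \<inter> nabla) \<noteq> 0"
  proof (rule ccontr)
    assume "\<not> ?thesis"
    then obtain e where e: "\<And>p. p \<in> nabla \<Longrightarrow> e p > 0 \<and> measure \<rho> (ball p (e p) \<inter> nabla) = 0" by metis
    have "nabla \<subseteq> (\<Union>p\<in>nabla. ball p (e p))" using e by force
    then obtain D where D: "D \<subseteq> nabla" "finite D" "nabla \<subseteq> (\<Union>p\<in>D. ball p (e p))"
      using compactE_image[OF compact_nabla, of nabla "\<lambda>p. ball p (e p)"] by auto
    have "measure \<rho> nabla \<le> measure \<rho> (\<Union>p\<in>D. ball p (e p) \<inter> nabla)"
      using D(2,3) bs by (intro finite_measure_mono sets.finite_UN) auto
    also have "\<dots> \<le> (\<Sum>p\<in>D. measure \<rho> (ball p (e p) \<inter> nabla))"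
      using D(2) bs by (intro finite_measure_subadditive_finite) auto
    also have "\<dots> = 0" using D(1) e by (intro sum.neutral) auto
    finally show False using prob_space sp by simp
  qed
  then obtain p where p: "p \<in> nabla" "\<And>e. e > 0 \<Longrightarrow> measure \<rho> (ball p e \<inter> nabla) \<noteq> 0" by blast
  have "AE q in \<rho>. q \<in> ball p (1 / real (Suc n)) \<inter> nabla" for n
  proof -
    have "measure \<rho> (ball p (1 / real (Suc n)) \<inter> nabla) = 1"
      using zo[OF bs[unfolded s], of p "1 / real (Suc n)"] p(2)[of "1 / real (Suc n)"] by auto
    then show ?thesis using bs by (subst AE_in_set_eq_1) auto
  qed
  then have "AE q in \<rho>. \<forall>n. q \<in> ball p (1 / real (Suc n)) \<inter> nabla" by (simp add: AE_all_countable)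
  then have "AE q in \<rho>. q = p"
  proof (rule AE_mp, intro AE_I2 impI)
    fix q assume q: "\<forall>n. q \<in> ball p (1 / real (Suc n)) \<inter> nabla"
    show "q = p"
    proof (rule ccontr)
      assume "q \<noteq> p"
      then obtain n where "inverse (real (Suc n)) < dist p q" using reals_Archimedean[of "dist p q"] by auto
      moreover have "dist p q < 1 / real (Suc n)" using q by simp
      ultimately show False by (simp add: inverse_eq_divide)
    qed
  qed
  with p(1) show ?thesis by (rule that)
qed

text \<open>Extremality forbids conditioning the representing measure on a set of intermediate mass,
  so that measure takes only the values 0 and 1.\<close>

lemma extreme_points_path_forest: "extreme_points path_forest_measures = mu ` nabla"
proof (intro equalityI subsetI)
  fix \<mu> assume ex: "\<mu> \<in> extreme_points path_forest_measures"
  then have "\<mu> \<in> path_forest_measures" by (simp add: extreme_points_def)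
  then obtain \<rho> where \<rho>: "\<rho> \<in> prob_measures X_nabla" "bary_map \<rho> = \<mu>" by (rule bary_map_surj)
  interpret prob_space \<rho> using prob_measuresD[OF \<rho>(1)] by simp
  have "measure \<rho> A \<in> {0, 1}" if A: "A \<in> sets (borel_on X_nabla)" for A
  proof (rule ccontr)
    assume "measure \<rho> A \<notin> {0, 1}"
    then have m: "0 < measure \<rho> A" "measure \<rho> A < 1"
      using prob_le_1[of A] measure_nonneg[of \<rho> A] by (simp_all add: less_le)
    let ?\<sigma> = "uniform_measure \<rho> A" and ?\<tau> = "uniform_measure \<rho> (topspace X_nabla - A)"
    note u = mix_uniform_measure[OF \<rho>(1) A m]
    have "\<mu> = bary_map (mix (measure \<rho> A) ?\<sigma> ?\<tau>)" using u(3) \<rho>(2) by simp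
    also have "\<dots> = mix (measure \<rho> A) (bary_map ?\<sigma>) (bary_map ?\<tau>)"
      using affine_bary_map u(1,2) m unfolding affine_map_def by (auto simp del: topspace_euclidean_subtopology)
    finally have "\<mu> = mix (measure \<rho> A) (bary_map ?\<sigma>) (bary_map ?\<tau>)" .
    moreover have "measure \<rho> A \<in> {0<..<1}" using m by simp
    ultimately have "bary_map ?\<sigma> = \<mu>"
      using ex bary_map(1)[OF u(1)] bary_map(1)[OF u(2)] unfolding extreme_points_def by blast
    then have "?\<sigma> = \<rho>" using \<rho> u(1) by (intro bary_map_inj) auto
    moreover have "measure ?\<sigma> A = 1"
      using A m prob_measuresD(2)[OF \<rho>(1)] by (subst measure_uniform_measure) (auto simp: emeasure_eq_measure)
    ultimately show False using m by simp
  qed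
  then obtain p where "p \<in> nabla" "AE q in \<rho>. q = p" using zero_one_dirac[OF \<rho>(1)] by blast
  then show "\<mu> \<in> mu ` nabla" using bary_map_dirac[OF \<rho>(1)] \<rho>(2) by blast
next
  fix \<mu> assume "\<mu> \<in> mu ` nabla"
  then obtain p where p: "p \<in> nabla" "\<mu> = mu p" by blast
  have "path_forest_measures \<subseteq> central_measures" by (auto simp: path_forest_measures_def)
  then show "\<mu> \<in> extreme_points path_forest_measures"
    using mu_extreme[OF p(1)] mu_path_forest[OF p(1)] unfolding p(2) extreme_points_def by blast
qed

subsection \<open>Barycentres\<close>

text \<open>The weak topology is given by a subbasis, so convergence of integrals is carried through
  finite intersections and unions by induction on the generation of open sets.\<close>

lemma limitin_weak:
  assumes \<rho>: "\<rho> \<in> prob_measures X" and \<rho>n: "\<And>n. \<rho>n n \<in> prob_measures X"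
    and lim: "\<And>f. continuous_map X euclideanreal f \<Longrightarrow> bounded (f ` topspace X) \<Longrightarrow>
       (\<lambda>n. \<integral>x. f x \<partial>\<rho>n n) \<longlonglongrightarrow> (\<integral>x. f x \<partial>\<rho>)"
  shows "limitin (weak_topology X) \<rho>n \<rho> sequentially"
  unfolding limitin_def
proof (intro conjI allI impI)
  show "\<rho> \<in> topspace (weak_topology X)" using \<rho> by simp
  fix U assume "openin (weak_topology X) U \<and> \<rho> \<in> U"
  then have "generate_topology_on {{\<mu> \<in> prob_measures X. (\<integral>x. f x \<partial>\<mu>) \<in> U} | f U.
        continuous_map X euclideanreal f \<and> bounded (f ` topspace X) \<and> open U} U" "\<rho> \<in> U"
    by (auto simp: weak_topology_def openin_topology_generated_by_iff)
  then show "\<forall>\<^sub>F n in sequentially. \<rho>n n \<in> U"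
  proof (induction rule: generate_topology_on.induct)
    case (Int a b)
    then show ?case by (simp add: eventually_conj)
  next
    case (UN K)
    then obtain k where k: "k \<in> K" "\<rho> \<in> k" by blast
    show ?case by (rule eventually_mono[OF UN.IH[OF k]]) (use k(1) in blast)
  next
    case (Basis s)
    then obtain f V where s: "s = {\<mu> \<in> prob_measures X. (\<integral>x. f x \<partial>\<mu>) \<in> V}"
      and f: "continuous_map X euclideanreal f" "bounded (f ` topspace X)" and V: "open V" by blast
    have "(\<integral>x. f x \<partial>\<rho>) \<in> V" using Basis.prems s by simp
    then show ?case using topological_tendstoD[OF lim[OF f] V] \<rho>n by (simp add: s)
  qed simp
qed

lemma return_eqI:
  assumes \<rho>: "\<rho> \<in> prob_measures X_nabla" and p: "p \<in> nabla" and m: "measure \<rho> {p} = 1"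
  shows "\<rho> = return (borel_on X_nabla) p"
proof (rule bary_map_inj[OF \<rho> return_prob_measures])
  interpret prob_space \<rho> using prob_measuresD[OF \<rho>] by simp
  have "AE q in \<rho>. q \<in> {p}"
    using m singleton_nabla_sets[OF p] prob_measuresD(2)[OF \<rho>] by (intro AE_in_set_eq_1[THEN iffD2]) simp_all
  then show "bary_map \<rho> = bary_map (return (borel_on X_nabla) p)"
    unfolding bary_map_return[OF p] by (intro bary_map_dirac[OF \<rho> p]) simp
qed (use p in simp)

lemma integral_return_nabla:
  fixes f :: "(nat \<Rightarrow> real) \<Rightarrow> real"
  assumes "continuous_on nabla f" "p \<in> nabla"
  shows "(\<integral>q. f q \<partial>return (borel_on X_nabla) p) = f p"
  using assms by (intro integral_return borel_measurable_borel_on) auto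

text \<open>A measure carried by finitely many points is built from point masses by conditioning on
  one point and on its complement, and both sides respect such mixtures.\<close>

lemma affine_integral_finite:
  assumes g: "continuous_on nabla g" and \<Psi>: "affine_functional (prob_measures X_nabla) \<Psi>"
    and eq: "\<And>p. p \<in> nabla \<Longrightarrow> \<Psi> (return (borel_on X_nabla) p) = g p"
    and F: "finite F" "F \<subseteq> nabla" and \<rho>: "\<rho> \<in> prob_measures X_nabla" "measure \<rho> F = 1"
  shows "\<Psi> \<rho> = (\<integral>p. g p \<partial>\<rho>)"
  using F \<rho>
proof (induction F arbitrary: \<rho> rule: finite_induct)
  case (insert p F)
  interpret prob_space \<rho> using prob_measuresD[OF insert.prems(2)] by simp
  have s: "sets \<rho> = sets (borel_on X_nabla)" using prob_measuresD(2)[OF insert.prems(2)] .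
  have p: "p \<in> nabla" and F: "F \<subseteq> nabla" using insert.prems(1) by auto
  have ps: "{p} \<in> sets \<rho>" using singleton_nabla_sets[OF p] s by simp
  have "F = (\<Union>q\<in>F. {q})" by simp
  moreover have "(\<Union>q\<in>F. {q}) \<in> sets \<rho>"
    using insert.hyps(1) F singleton_nabla_sets s by (intro sets.finite_UN) auto
  ultimately have Fs: "F \<in> sets \<rho>" by simp
  have sum: "measure \<rho> {p} + measure \<rho> F = 1"
    using finite_measure_Union[OF ps Fs] insert.hyps(2) insert.prems(3) by simp
  have dirac: "\<Psi> \<sigma> = (\<integral>q. g q \<partial>\<sigma>)" if "\<sigma> \<in> prob_measures X_nabla" "measure \<sigma> {p} = 1" for \<sigma>
    unfolding return_eqI[OF that(1) p that(2)] using eq[OF p] integral_return_nabla[OF g p] by simp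
  \<comment> \<open>Conditioning is impossible if \<open>p\<close> has mass 0 or 1; then the smaller
    support or a point mass settles the claim.\<close>
  consider "measure \<rho> {p} = 1" | "measure \<rho> F = 1" | "0 < measure \<rho> {p}" "measure \<rho> {p} < 1"
    using sum measure_nonneg[of \<rho> "{p}"] measure_nonneg[of \<rho> F] by linarith
  then show ?case
  proof cases
    case 1
    then show ?thesis by (rule dirac[OF insert.prems(2)])
  next
    case 2
    then show ?thesis by (rule insert.IH[OF F insert.prems(2)])
  next
    case 3
    let ?a = "measure \<rho> {p}" and ?\<sigma> = "uniform_measure \<rho> {p}" and ?\<tau> = "uniform_measure \<rho> (topspace X_nabla - {p})"
    note u = mix_uniform_measure[OF insert.prems(2) singleton_nabla_sets[OF p] 3]
    have a: "?a \<in> {0..1}" using 3 by simp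
    have sp: "space \<rho> = topspace X_nabla" using prob_measuresD(3)[OF insert.prems(2)] .
    have compl: "measure \<rho> (topspace X_nabla - {p}) = 1 - ?a" using prob_compl[OF ps] sp by simp
    have "measure ?\<sigma> {p} = 1"
      using ps 3 by (subst measure_uniform_measure) (auto simp: emeasure_eq_measure)
    then have \<sigma>: "\<Psi> ?\<sigma> = (\<integral>q. g q \<partial>?\<sigma>)" by (rule dirac[OF u(1)])
    have "(topspace X_nabla - {p}) \<inter> F = F" using F insert.hyps(2) by auto
    then have "measure ?\<tau> F = 1"
      using Fs 3 compl sum by (subst measure_uniform_measure) (auto simp: emeasure_eq_measure)
    then have \<tau>: "\<Psi> ?\<tau> = (\<integral>q. g q \<partial>?\<tau>)" by (rule insert.IH[OF F u(2)])
    obtain B where B: "\<And>q. q \<in> topspace X_nabla \<Longrightarrow> \<bar>g q\<bar> \<le> B"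
      using continuous_nabla_bounded[OF g] by (auto simp: bounded_iff)
    have gm: "g \<in> borel_measurable (borel_on X_nabla)" using g by (intro borel_measurable_borel_on) simp
    have "\<Psi> (mix ?a ?\<sigma> ?\<tau>) = ?a * \<Psi> ?\<sigma> + (1 - ?a) * \<Psi> ?\<tau>"
      using \<Psi> u(1,2) a unfolding affine_functional_def by blast
    also have "\<dots> = (\<integral>q. g q \<partial>mix ?a ?\<sigma> ?\<tau>)"
      unfolding \<sigma> \<tau> by (rule integral_mix[OF u(1,2) a gm B, symmetric])
    finally show ?thesis unfolding u(3)[symmetric] .
  qed
qed simp

lemma measurable_snap: "snap m \<in> measurable (borel_on X_nabla) (borel_on X_nabla)" if m: "m \<ge> 1"
proof (rule measurable_borel_onI)
  fix p assume "p \<in> space (borel_on X_nabla)"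
  then show "snap m p \<in> topspace X_nabla" using snap_in_nabla[OF m] by simp
next
  fix U assume "openin X_nabla U"
  let ?V = "snap m ` nabla"
  have coord: "(\<lambda>p. p i) \<in> borel_measurable (borel_on X_nabla)" for i
    by (rule borel_measurable_borel_on)
       (simp, rule continuous_on_subset[OF continuous_on_product_coordinates], simp)
  have "{p \<in> space (borel_on X_nabla). \<forall>i. snap m p i = q i} \<in> sets (borel_on X_nabla)" for q
    unfolding snap_def using coord by measurable
  then have "(\<Union>q\<in>?V \<inter> U. {p \<in> space (borel_on X_nabla). \<forall>i. snap m p i = q i}) \<in> sets (borel_on X_nabla)"
    using finite_range_snap[OF m] by (intro sets.finite_UN) auto
  moreover have "snap m -` U \<inter> space (borel_on X_nabla)
      = (\<Union>q\<in>?V \<inter> U. {p \<in> space (borel_on X_nabla). \<forall>i. snap m p i = q i})"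
    by (auto simp flip: fun_eq_iff)
  ultimately show "snap m -` U \<inter> space (borel_on X_nabla) \<in> sets (borel_on X_nabla)" by simp
qed

text \<open>Rounding pushes \<open>\<rho>\<close> to measures with finite support that converge
  weakly to \<open>\<rho>\<close>, and continuity of \<open>\<Psi>\<close> passes to the limit. This
  yields the barycentre property for arbitrary continuous affine functionals.\<close>

lemma affine_integral:
  assumes \<Psi>: "continuous_map (weak_topology X_nabla) euclideanreal \<Psi>" "affine_functional (prob_measures X_nabla) \<Psi>"
    and \<rho>: "\<rho> \<in> prob_measures X_nabla"
  shows "\<Psi> \<rho> = (\<integral>p. \<Psi> (return (borel_on X_nabla) p) \<partial>\<rho>)"
proof -
  define g where "g p = \<Psi> (return (borel_on X_nabla) p)" for p
  have "continuous_map X_nabla (weak_topology X_nabla) (return (borel_on X_nabla))"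
  proof (rule continuous_map_into_weak)
    show "return (borel_on X_nabla) p \<in> prob_measures X_nabla" if "p \<in> topspace X_nabla" for p
      using that by (rule return_prob_measures)
    fix f assume f: "continuous_map X_nabla euclideanreal f"
    show "continuous_map X_nabla euclideanreal (\<lambda>p. \<integral>x. f x \<partial>return (borel_on X_nabla) p)"
      by (rule continuous_map_eq[OF f]) (use f in \<open>simp add: integral_return_nabla\<close>)
  qed
  from continuous_map_compose[OF this \<Psi>(1)] have g: "continuous_on nabla g" by (simp add: g_def o_def)
  interpret prob_space \<rho> using prob_measuresD[OF \<rho>] by simp
  have s: "sets \<rho> = sets (borel_on X_nabla)" and sp: "space \<rho> = nabla" using prob_measuresD[OF \<rho>] by auto
  have sm: "snap (Suc n) \<in> measurable \<rho> (borel_on X_nabla)" for n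
    unfolding measurable_cong_sets[OF s refl] by (rule measurable_snap) simp
  define \<rho>n where "\<rho>n n = distr \<rho> (borel_on X_nabla) (snap (Suc n))" for n
  have \<rho>n: "\<rho>n n \<in> prob_measures X_nabla" for n
    unfolding \<rho>n_def prob_measures_def using prob_space_distr[OF sm] by simp
  have lim: "(\<lambda>n. \<integral>p. f p \<partial>\<rho>n n) \<longlonglongrightarrow> (\<integral>p. f p \<partial>\<rho>)" if f: "continuous_on nabla f" for f :: "(nat \<Rightarrow> real) \<Rightarrow> real"
  proof (rule LIMSEQ_I)
    fix e :: real assume e: "e > 0"
    have e2: "e / 2 > 0" using e by simp
    obtain m0 where m0: "m0 \<ge> 1"
      "\<And>m p q. m \<ge> m0 \<Longrightarrow> p \<in> nabla \<Longrightarrow> q \<in> nabla \<Longrightarrow> \<forall>i. \<bar>q i - p i\<bar> \<le> 1 / real m \<Longrightarrow> \<bar>f q - f p\<bar> < e / 2"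
      by (rule nabla_uniform[OF f e2]) blast
    have fm: "f \<in> borel_measurable (borel_on X_nabla)" using f by (intro borel_measurable_borel_on) simp
    have "norm ((\<integral>p. f p \<partial>\<rho>n n) - (\<integral>p. f p \<partial>\<rho>)) < e" if n: "n \<ge> m0" for n
    proof -
      have d: "(\<integral>p. f p \<partial>\<rho>n n) = (\<integral>p. f (snap (Suc n) p) \<partial>\<rho>)"
        unfolding \<rho>n_def by (rule integral_distr[OF sm fm])
      have i1: "integrable \<rho> (\<lambda>p. f (snap (Suc n) p))"
        using integrable_nabla[OF \<rho>n f, of n] unfolding \<rho>n_def by (rule integrable_distr[OF sm])
      have i2: "integrable \<rho> f" by (rule integrable_nabla[OF \<rho> f])
      have "(\<integral>p. f p \<partial>\<rho>n n) - (\<integral>p. f p \<partial>\<rho>) = (\<integral>p. f (snap (Suc n) p) - f p \<partial>\<rho>)"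
        unfolding d using i1 i2 by (simp add: Bochner_Integration.integral_diff)
      also have "\<bar>\<dots>\<bar> \<le> (\<integral>p. \<bar>f (snap (Suc n) p) - f p\<bar> \<partial>\<rho>)" by (rule integral_abs_bound)
      also have "\<dots> \<le> (\<integral>p. e / 2 \<partial>\<rho>)"
      proof (rule integral_mono)
        fix p assume "p \<in> space \<rho>"
        then have p: "p \<in> nabla" by (simp add: sp)
        have "\<bar>f (snap (Suc n) p) - f p\<bar> < e / 2"
          using n snap_diff[of "Suc n" p] by (intro m0(2)[of "Suc n"] p snap_in_nabla) auto
        then show "\<bar>f (snap (Suc n) p) - f p\<bar> \<le> e / 2" by simp
      qed (use i1 i2 in auto)
      also have "\<dots> < e" using e by (simp add: prob_space)
      finally show ?thesis by simp
    qed
    then show "\<exists>no. \<forall>n\<ge>no. norm ((\<integral>p. f p \<partial>\<rho>n n) - (\<integral>p. f p \<partial>\<rho>)) < e" by blast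
  qed
  have "limitin (weak_topology X_nabla) \<rho>n \<rho> sequentially"
    by (rule limitin_weak[OF \<rho> \<rho>n]) (use lim in simp)
  from continuous_map_limit[OF \<Psi>(1) this] have 1: "(\<lambda>n. \<Psi> (\<rho>n n)) \<longlonglongrightarrow> \<Psi> \<rho>" by (simp add: o_def)
  have "\<Psi> (\<rho>n n) = (\<integral>p. g p \<partial>\<rho>n n)" for n
  proof (rule affine_integral_finite[OF g \<Psi>(2) _ _ _ \<rho>n])
    let ?F = "snap (Suc n) ` nabla"
    show "finite ?F" by (rule finite_range_snap) simp
    then have "?F = (\<Union>q\<in>?F. {q})" by simp
    show F: "?F \<subseteq> nabla" using snap_in_nabla[of "Suc n"] by auto
    have "(\<Union>q\<in>?F. {q}) \<in> sets (borel_on X_nabla)"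
      using \<open>finite ?F\<close> F singleton_nabla_sets by (intro sets.finite_UN) auto
    then have Fs: "?F \<in> sets (borel_on X_nabla)" by simp
    have "measure (\<rho>n n) ?F = measure \<rho> (snap (Suc n) -` ?F \<inter> space \<rho>)"
      unfolding \<rho>n_def by (rule measure_distr[OF sm Fs])
    also have "snap (Suc n) -` ?F \<inter> space \<rho> = space \<rho>" using sp by auto
    finally show "measure (\<rho>n n) ?F = 1" by (simp add: prob_space)
  qed (simp add: g_def)
  then have 2: "(\<lambda>n. \<Psi> (\<rho>n n)) \<longlonglongrightarrow> (\<integral>p. g p \<partial>\<rho>)" using lim[OF g] by simp
  show ?thesis using LIMSEQ_unique[OF 1 2] unfolding g_def .
qed

subsection \<open>The Bauer simplex\<close>

lemma Hausdorff_space_path_forest_top: "Hausdorff_space path_forest_top"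
  unfolding path_forest_top_def using Hausdorff_space_central_top by (rule Hausdorff_space_subtopology)

lemma compact_space_path_forest_top: "compact_space path_forest_top"
proof -
  have "closedin central_top {\<mu> \<in> topspace central_top. phi \<mu> t \<in> {0}}" for t
    by (rule closedin_continuous_map_preimage[OF continuous_map_phi]) simp
  then have "closedin central_top (\<Inter>t\<in>{t. \<not> path_forest t}. {\<mu> \<in> topspace central_top. phi \<mu> t \<in> {0}})"
    using ex_not_path_forest by (intro closedin_INT) auto
  moreover have "(\<Inter>t\<in>{t. \<not> path_forest t}. {\<mu> \<in> topspace central_top. phi \<mu> t \<in> {0}}) = path_forest_measures"
    using ex_not_path_forest by (auto simp: path_forest_measures_iff)
  ultimately have "closedin central_top path_forest_measures" by simp
  then have "compactin central_top path_forest_measures"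
    by (rule closedin_compact_space[OF compact_space_central_top])
  then show ?thesis unfolding path_forest_top_def by (rule compact_space_subtopology)
qed

definition mu_top :: "(nat \<Rightarrow> edge) measure topology" where
  "mu_top = subtopology path_forest_top (mu ` nabla)"

lemma topspace_mu_top [simp]: "topspace mu_top = mu ` nabla"
  using mu_path_forest by (auto simp: mu_top_def)

lemma continuous_map_mu: "continuous_map X_nabla path_forest_top mu"
proof (rule continuous_into_path_forest)
  show "mu p \<in> path_forest_measures" if "p \<in> topspace X_nabla" for p using that mu_path_forest by simp
  fix t
  have "continuous_map X_nabla euclideanreal (\<lambda>p. psi_basis p t)" using continuous_on_psi_basis by simp
  then show "continuous_map X_nabla euclideanreal (\<lambda>p. phi (mu p) t)"
    by (rule continuous_map_eq) (simp add: phi_mu)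
qed

text \<open>Injectivity is that of \<open>bary_map\<close> on point masses; a continuous injection
  from a compact space into a Hausdorff space does the rest.\<close>

lemma homeomorphic_map_mu: "homeomorphic_map X_nabla mu_top mu"
proof (rule continuous_imp_homeomorphic_map)
  show "continuous_map X_nabla mu_top mu"
    unfolding mu_top_def by (rule continuous_map_into_subtopology[OF continuous_map_mu]) auto
  show "compact_space X_nabla" using compact_nabla by (simp add: compact_space_subtopology compactin_euclidean_iff)
  show "Hausdorff_space mu_top"
    unfolding mu_top_def using Hausdorff_space_path_forest_top by (rule Hausdorff_space_subtopology)
  show "mu ` topspace X_nabla = topspace mu_top" by simp
  show "inj_on mu (topspace X_nabla)"
  proof (rule inj_onI)
    fix p q assume "p \<in> topspace X_nabla" "q \<in> topspace X_nabla" and eq: "mu p = mu q"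
    then have p: "p \<in> nabla" and q: "q \<in> nabla" by simp_all
    let ?r = "return (borel_on X_nabla)"
    have "?r p = ?r q"
      using p q eq by (intro bary_map_inj return_prob_measures) (simp_all add: bary_map_return)
    then have "measure (?r p) {p} = measure (?r q) {p}" by simp
    then show "p = q" using singleton_nabla_sets[OF p] by (auto simp: measure_return indicator_def split: if_splits)
  qed
qed

lemma closedin_mu: "closedin path_forest_top (mu ` nabla)"
proof -
  have "compactin X_nabla nabla" using compact_nabla by (simp add: compactin_subtopology compactin_euclidean_iff)
  then have "compactin path_forest_top (mu ` nabla)" using continuous_map_mu by (rule image_compactin)
  then show ?thesis by (rule compactin_imp_closedin[OF Hausdorff_space_path_forest_top])
qed

lemma measurable_continuous_map:
  assumes f: "continuous_map X Y f" shows "f \<in> measurable (borel_on X) (borel_on Y)"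
proof (rule measurable_borel_onI)
  show "f x \<in> topspace Y" if "x \<in> space (borel_on X)" for x
    using continuous_map_image_subset_topspace[OF f] that by auto
  fix U assume "openin Y U"
  then have "openin X {x \<in> topspace X. f x \<in> U}" using f by (simp add: continuous_map_def)
  moreover have "f -` U \<inter> space (borel_on X) = {x \<in> topspace X. f x \<in> U}" by auto
  ultimately show "f -` U \<inter> space (borel_on X) \<in> sets (borel_on X)" by (simp add: openin_borel_on)
qed

lemma distr_prob_measures:
  assumes f: "continuous_map X Y f" and \<rho>: "\<rho> \<in> prob_measures X"
  shows "distr \<rho> (borel_on Y) f \<in> prob_measures Y" "f \<in> measurable \<rho> (borel_on Y)"
proof -
  interpret prob_space \<rho> using prob_measuresD[OF \<rho>] by simp
  show m: "f \<in> measurable \<rho> (borel_on Y)"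
    using measurable_continuous_map[OF f] measurable_cong_sets[OF prob_measuresD(2)[OF \<rho>] refl] by blast
  show "distr \<rho> (borel_on Y) f \<in> prob_measures Y"
    using prob_space_distr[OF m] by (simp add: prob_measures_def)
qed

lemma cont_affine_phi: "cont_affine path_forest_top (\<lambda>\<mu>. phi \<mu> t)"
  using continuous_map_phi_path_forest mix_central(2)
  by (auto simp: cont_affine_def affine_functional_def path_forest_measures_def)

text \<open>Composed with \<open>bary_map\<close>, a continuous affine functional becomes one on the
  measures on the simplex, where it integrates its values at point masses.\<close>

lemma barycentre_bary_map:
  assumes \<rho>: "\<rho> \<in> prob_measures X_nabla"
  shows "barycentre_of path_forest_top (distr \<rho> (borel_on mu_top) mu) (bary_map \<rho>)"
  unfolding barycentre_of_def
proof (intro conjI allI impI)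
  show "bary_map \<rho> \<in> topspace path_forest_top" using bary_map(1)[OF \<rho>] by simp
  fix \<Phi> assume \<Phi>: "cont_affine path_forest_top \<Phi>"
  then have c: "continuous_map path_forest_top euclideanreal \<Phi>" and a: "affine_functional path_forest_measures \<Phi>"
    by (simp_all add: cont_affine_def)
  have "continuous_map (weak_topology X_nabla) euclideanreal (\<Phi> \<circ> bary_map)"
    using homeomorphic_imp_continuous_map[OF homeomorphic_bary_map] c by (rule continuous_map_compose)
  moreover have "affine_functional (prob_measures X_nabla) (\<Phi> \<circ> bary_map)"
    using a affine_bary_map bary_map(1) by (simp add: affine_functional_def affine_map_def)
  ultimately have "(\<Phi> \<circ> bary_map) \<rho> = (\<integral>p. (\<Phi> \<circ> bary_map) (return (borel_on X_nabla) p) \<partial>\<rho>)"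
    by (rule affine_integral[OF _ _ \<rho>])
  also have "\<dots> = (\<integral>p. \<Phi> (mu p) \<partial>\<rho>)"
    using prob_measuresD(3)[OF \<rho>] by (intro Bochner_Integration.integral_cong) (simp_all add: bary_map_return)
  also have "\<dots> = (\<integral>\<nu>. \<Phi> \<nu> \<partial>distr \<rho> (borel_on mu_top) mu)"
  proof (rule integral_distr[symmetric])
    show "mu \<in> measurable \<rho> (borel_on mu_top)"
      using homeomorphic_imp_continuous_map[OF homeomorphic_map_mu] \<rho> by (rule distr_prob_measures(2))
    show "\<Phi> \<in> borel_measurable (borel_on mu_top)"
      unfolding mu_top_def by (intro borel_measurable_borel_on continuous_map_from_subtopology c)
  qed
  finally show "\<Phi> (bary_map \<rho>) = (\<integral>\<nu>. \<Phi> \<nu> \<partial>distr \<rho> (borel_on mu_top) mu)" by simp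
qed

text \<open>The evaluations \<open>phi\<close> are continuous and affine, so a representing measure,
  pulled back to the simplex, has the same moments as \<open>\<rho>\<close>.\<close>

lemma barycentre_unique:
  assumes m: "m \<in> prob_measures mu_top" and \<rho>: "\<rho> \<in> prob_measures X_nabla"
    and b: "barycentre_of path_forest_top m (bary_map \<rho>)"
  shows "m = distr \<rho> (borel_on mu_top) mu"
proof -
  obtain r where r: "homeomorphic_maps X_nabla mu_top mu r"
    using homeomorphic_map_mu unfolding homeomorphic_map_maps by blast
  then have rc: "continuous_map mu_top X_nabla r" and mc: "continuous_map X_nabla mu_top mu"
    and mr: "\<And>\<nu>. \<nu> \<in> mu ` nabla \<Longrightarrow> mu (r \<nu>) = \<nu>"
    by (auto simp: homeomorphic_maps_def)
  have rn: "r \<nu> \<in> nabla" if "\<nu> \<in> mu ` nabla" for \<nu>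
    using continuous_map_image_subset_topspace[OF rc] that by auto
  let ?\<sigma> = "distr m (borel_on X_nabla) r"
  have \<sigma>: "?\<sigma> \<in> prob_measures X_nabla" and rm: "r \<in> measurable m (borel_on X_nabla)"
    by (rule distr_prob_measures[OF rc m])+
  have sp: "space m = mu ` nabla" using prob_measuresD(3)[OF m] by simp
  have "bary_map ?\<sigma> = bary_map \<rho>"
  proof (rule central_eqI[OF bary_map_central[OF \<sigma>] bary_map_central[OF \<rho>]])
    fix t
    have "phi (bary_map ?\<sigma>) t = (\<integral>p. psi_basis p t \<partial>?\<sigma>)" by (rule bary_map(2)[OF \<sigma>])
    also have "\<dots> = (\<integral>\<nu>. psi_basis (r \<nu>) t \<partial>m)"
      using continuous_on_psi_basis by (intro integral_distr[OF rm] borel_measurable_borel_on) simp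
    also have "\<dots> = (\<integral>\<nu>. phi \<nu> t \<partial>m)"
      using sp rn mr by (intro Bochner_Integration.integral_cong) (auto simp flip: phi_mu)
    also have "\<dots> = phi (bary_map \<rho>) t"
      using b cont_affine_phi[of t] unfolding barycentre_of_def by metis
    finally show "phi (bary_map ?\<sigma>) t = phi (bary_map \<rho>) t" .
  qed
  then have eq: "?\<sigma> = \<rho>" by (rule bary_map_inj[OF \<sigma> \<rho>])
  have mm: "mu \<in> measurable (borel_on X_nabla) (borel_on mu_top)" by (rule measurable_continuous_map[OF mc])
  have "distr \<rho> (borel_on mu_top) mu = distr m (borel_on mu_top) (mu \<circ> r)"
    unfolding eq[symmetric] by (rule distr_distr[OF mm rm])
  also have "\<dots> = distr m m (\<lambda>\<nu>. \<nu>)"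
    using prob_measuresD(2)[OF m] sp mr by (intro distr_cong) auto
  also have "\<dots> = m" by (rule distr_id)
  finally show ?thesis by simp
qed

lemma bauer_simplex_path_forest: "bauer_simplex path_forest_top"
  unfolding bauer_simplex_def topspace_path_forest_top extreme_points_path_forest compact_convex_def
proof (intro conjI ballI compact_space_path_forest_top convex_path_forest closedin_mu)
  fix \<mu> assume "\<mu> \<in> path_forest_measures"
  then obtain \<rho> where \<rho>: "\<rho> \<in> prob_measures X_nabla" and \<mu>: "bary_map \<rho> = \<mu>" by (rule bary_map_surj)
  show "\<exists>!m. m \<in> prob_measures (subtopology path_forest_top (mu ` nabla)) \<and> barycentre_of path_forest_top m \<mu>"
    unfolding mu_top_def[symmetric]
  proof (rule ex1I)
    show "distr \<rho> (borel_on mu_top) mu \<in> prob_measures mu_top \<and>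
        barycentre_of path_forest_top (distr \<rho> (borel_on mu_top) mu) \<mu>"
      using distr_prob_measures(1)[OF homeomorphic_imp_continuous_map[OF homeomorphic_map_mu] \<rho>]
        barycentre_bary_map[OF \<rho>] \<mu> by simp
    fix m assume "m \<in> prob_measures mu_top \<and> barycentre_of path_forest_top m \<mu>"
    then show "m = distr \<rho> (borel_on mu_top) mu" using barycentre_unique[OF _ \<rho>] \<mu> by blast
  qed
qed

theorem theorem5p2:
  shows "exposed_face_by central_top path_forest_measures face_functional
    \<and> path_forest_measures \<noteq> {} \<and> path_forest_measures \<subset> central_measures
    \<and> homeomorphic_map (weak_topology (top_of_set nabla)) path_forest_top bary_map
    \<and> affine_map (prob_measures (top_of_set nabla)) bary_map
    \<and> bauer_simplex path_forest_top
    \<and> extreme_points path_forest_measures = mu ` nabla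
    \<and> mu ` nabla \<subseteq> extreme_points central_measures"
proof (intro conjI exposed_face_path_forest path_forest_measures_nonempty homeomorphic_bary_map
    affine_bary_map bauer_simplex_path_forest extreme_points_path_forest)
  show "path_forest_measures \<subset> central_measures"
    using ex_central_not_path_forest by (auto simp: path_forest_measures_def)
  show "mu ` nabla \<subseteq> extreme_points central_measures" using mu_extreme by blast
qed



end
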